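(* Let $D$ be the Drinfeld double of $\mathcal{FK}_3\#\Bbbk\mathbb{S}_3$. (i) Let $E$ be an extension of $L(\varepsilon)$ by $L(\sigma,-)$, i.e. there is a short exact sequence of $D$-modules $0\to L(\sigma,-)\to E\to L(\varepsilon)\to0$. Then $E\simeq E(\varepsilon)_{s,t,u}$ for some $s,t,u\in\Bbbk$. Moreover, it is a graded extension if and only if it is isomorphic (up to shifts) to either $E(\varepsilon)_{1,0,0}$, $E(\varepsilon)_{0,1,0}$, $E(\varepsilon)_{0,0,1}$ or $E(\varepsilon)_{0,0,0}$. (ii) Let $E$ be an extension of $L(\sigma,-)$ by $L(\varepsilon)$, i.e. there is a short exact sequence of $D$-modules $0\to L(\varepsilon)\to E\to L(\sigma,-)\to0$. Then $E\simeq E(\varepsilon)_{s,t,u}^*$ for some $s,t,u\in\Bbbk$. Moreover, it is a graded extension if and only if it is isomorphic (up to shifts) to either $E(\varepsilon)_{1,0,0}^*$, $E(\varepsilon)_{0,1,0}^*$, $E(\varepsilon)_{0,0,1}^*$ or $E(\varepsilon)_{0,0,0}$.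
   Context: Let $\Bbbk$ be an algebraically closed field of characteristic zero and $\zeta\in\Bbbk$ a primitive cube root of unity. All modules are finite-dimensional left modules. The algebra. $D(\mathbb{S}_3)$ is the Drinfeld double of the group algebra $\Bbbk\mathbb{S}_3$: it is generated by $g\in\mathbb{S}_3$ and the dual basis elements $\delta_g$ of $\Bbbk^{\mathbb{S}_3}$, with $g\delta_hg^{-1}=\delta_{ghg^{-1}}$. A $D(\mathbb{S}_3)$-module is an $\mathbb{S}_3$-module with a compatible $\mathbb{S}_3$-grading, $\delta_g$ being the projection to the component of $\mathbb{S}_3$-degree $g$. Let $V=\Bbbk\{x_{(12)},x_{(13)},x_{(23)}\}$ be the simple $D(\mathbb{S}_3)$-module with $g\cdot x_{(ij)}=\mathrm{sgn}(g)x_{g(ij)g^{-1}}$ and $\delta_g\cdot x_{(ij)}=\delta_{g,(ij)}x_{(ij)}$; let $\overline V=\Bbbk\{y_{(12)},y_{(13)},y_{(23)}\}$ be its dual, isomorphic to $V$ via $y_{(ij)}\mapsto x_{(ij)}$. The Nichols algebra $\mathfrak{B}(V)=\mathcal{FK}_3$ is the quotient of $T(V)$ by $x_{(ij)}^2$, $x_{(12)}x_{(13)}+x_{(23)}x_{(12)}+x_{(13)}x_{(23)}$, $x_{(13)}x_{(12)}+x_{(12)}x_{(23)}+x_{(23)}x_{(13)}$ (dimension 12); $\mathfrak{B}(\overline V)$ is the same algebra in the $y$'s. $D$ is the Drinfeld double of the bosonization $\mathcal{FK}_3\#\Bbbk\mathbb{S}_3$. It is generated by $D(\mathbb{S}_3)$,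 $V$, $\overline V$; multiplication gives a linear isomorphism $\mathfrak{B}(V)\otimes D(\mathbb{S}_3)\otimes\mathfrak{B}(\overline V)\to D$. Its Hopf subalgebras $D^{\le0}=\mathfrak{B}(V)\#D(\mathbb{S}_3)$ and $D^{\ge0}=\mathfrak{B}(\overline V)\#D(\mathbb{S}_3)$ are bosonizations, so $gx_{(ij)}g^{-1}=\mathrm{sgn}(g)x_{g(ij)g^{-1}}$, $\delta_gx_{(ij)}=x_{(ij)}\delta_{(ij)g}$ and likewise for the $y$'s; the cross relations are $y_sx_r=-x_ry_{rsr}+\delta_{s,r}1+r(\delta_s-\delta_{sr})$ for transpositions $s,r$. Comultiplication: $\Delta(g)=g\otimes g$, $\Delta(\delta_g)=\sum_h\delta_h\otimes\delta_{h^{-1}g}$, $\Delta(x_{(ij)})=x_{(ij)}\otimes1+(ij)\otimes x_{(ij)}$, $\Delta(y_{(ij)})=y_{(ij)}\otimes1+\sum_{g}\mathrm{sgn}(g)\delta_g\otimes y_{g^{-1}(ij)g}$. $D$ is $\mathbb{Z}$-graded with $\deg V=-1$, $\deg D(\mathbb{S}_3)=0$, $\deg\overline V=1$. For a graded module $N$, $N[1](i)=N(i-1)$. $N^*$ is the dual module (via the antipode). Weights. The weights are the simple $D(\mathbb{S}_3)$-modules, indexed by $\Lambda=\{\varepsilon=(e,+),(e,-),(e,\rho),(\sigma,+),(\sigma,-),(\tau,0),(\tau,1),(\tau,2)\}$. Here $(e,+),(e,-),(e,\rho)$ have $\mathbb{S}_3$-degree $e$ and carry the trivial, sign and 2-dimensional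 irreducible representation; $(\sigma,\pm)$ has basis $|12\rangle,|13\rangle,|23\rangle$ with $|ij\rangle=|ji\rangle$ of degree $(ij)$, $g|ij\rangle=|g(i)g(j)\rangle$ for $(\sigma,+)$ and $g|ij\rangle=\mathrm{sgn}(g)|g(i)g(j)\rangle$ for $(\sigma,-)$; $(\tau,\ell)$ has basis $|123\rangle_\ell,|132\rangle_\ell$ of degrees $(123),(132)$, where $(12)$ swaps the two basis vectors and $(123)$ acts by $\zeta^\ell$ on $|123\rangle_\ell$ and by $\zeta^{-\ell}$ on $|132\rangle_\ell$. Modules. $M(\lambda)=D\otimes_{D^{\ge0}}\lambda$ ($\overline V$ acting by zero on $\lambda$) is the Verma module and $W(\lambda)=D\otimes_{D^{\le0}}\lambda$ ($V$ acting by zero on $\lambda$) the co-Verma module; both are graded with $1\otimes\lambda$ in degree $0$. $L(\lambda)$ is the simple head of $M(\lambda)$, the unique simple module of highest weight $\lambda$, graded with $\lambda$ in degree $0$; $L(\varepsilon)$ is the trivial module. Basis of $L(\sigma,-)$. It has a homogeneous basis $c_1,\dots,c_{10}$ with, as $D(\mathbb{S}_3)$-modules (matching ordered bases): $\langle c_1,c_2,c_3\rangle\simeq(\sigma,-)$ with ordered basis $|12\rangle,|23\rangle,|13\rangle$, degree $-2$; $\langle c_4,c_5\rangle\simeq(\tau,1)$ with ordered basis $|123\rangle_1,|132\rangle_1$, degree $-1$; $\langle c_6,c_7\rangle\simeq(\tau,2)$ with ordered basis $|123\rangle_2,|132\rangle_2$, degree $-1$; $\langle c_8,c_9,c_{10}\rangle\simeq(\sigma,-)$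 with ordered basis $|12\rangle,|23\rangle,|13\rangle$, degree $0$. The action of $x_{(12)}$: $c_1,c_2,c_3,c_8\mapsto0$, $c_4\mapsto\zeta c_2$, $c_5\mapsto\zeta c_3$, $c_6\mapsto\zeta^2c_2$, $c_7\mapsto\zeta^2c_3$, $c_9\mapsto\frac{1}{1-\zeta}(c_6-\zeta c_4)$, $c_{10}\mapsto\frac{1}{1-\zeta}(c_7-\zeta c_5)$. The action of $y_{(12)}$: $c_1,c_8,c_9,c_{10}\mapsto0$, $c_2\mapsto\frac{\zeta^2}{1-\zeta}(c_4-c_6)$, $c_3\mapsto\frac{\zeta^2}{1-\zeta}(c_5-c_7)$, $c_4,c_6\mapsto c_9$, $c_5,c_7\mapsto c_{10}$. The other $x_{(ij)},y_{(ij)}$ act by conjugation with $\mathbb{S}_3$. The module $T_{0,1}$. It is the graded $D$-module which as graded $D(\mathbb{S}_3)$-module is $L(\sigma,-)[1]\oplus\varepsilon$, with $L(\sigma,-)[1]$ a graded $D$-submodule with basis $c_1,\dots,c_{10}$, where, as $D(\mathbb{S}_3)$-modules (matching ordered bases), $\langle c_1,c_2,c_3\rangle\simeq(\sigma,-)$ with ordered basis $|12\rangle,|23\rangle,|13\rangle$, now in degree $-1$; $\langle c_4,c_5\rangle\simeq(\tau,1)$ with ordered basis $|123\rangle_1,|132\rangle_1$ and $\langle c_6,c_7\rangle\simeq(\tau,2)$ with ordered basis $|123\rangle_2,|132\rangle_2$, now in degree $0$; $\langle c_8,c_9,c_{10}\rangle\simeq(\sigma,-)$ with ordered basis $|12\rangle,|23\rangle,|13\rangle$,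 now in degree $1$; on which $x_{(12)}$ acts by $c_1,c_2,c_3,c_8\mapsto0$, $c_4\mapsto\zeta c_2$, $c_5\mapsto\zeta c_3$, $c_6\mapsto\zeta^2c_2$, $c_7\mapsto\zeta^2c_3$, $c_9\mapsto\frac{1}{1-\zeta}(c_6-\zeta c_4)$, $c_{10}\mapsto\frac{1}{1-\zeta}(c_7-\zeta c_5)$ and $y_{(12)}$ acts by $c_1,c_8,c_9,c_{10}\mapsto0$, $c_2\mapsto\frac{\zeta^2}{1-\zeta}(c_4-c_6)$, $c_3\mapsto\frac{\zeta^2}{1-\zeta}(c_5-c_7)$, $c_4,c_6\mapsto c_9$, $c_5,c_7\mapsto c_{10}$; and with $\varepsilon$ in degree $0$ spanned by $\mathsf{t}_{0,1}$, where $x_{(12)}\cdot\mathsf{t}_{0,1}=c_1$ and $y_{(12)}\cdot\mathsf{t}_{0,1}=c_8$. It is an extension of $L(\varepsilon)$ by $L(\sigma,-)$. The extensions $E(\varepsilon)_{s,t,u}$. There are extensions $$0\to L(\sigma,-)[-1]\to M(\varepsilon)/\mathrm{soc}\,M(\varepsilon)\to L(\varepsilon)\to0,\qquad 0\to L(\sigma,-)[3]\to W(\varepsilon)/\mathrm{soc}\,W(\varepsilon)\to L(\varepsilon)[2]\to0$$ (the shift on the last quotient being immaterial for what follows). Forgetting gradings, for $s,t,u\in\Bbbk$ not all zero, $E(\varepsilon)_{s,t,u}$ is the middle term of the linear combination (Baer sum) $s\,(M(\varepsilon)/\mathrm{soc}\,M(\varepsilon))+t\,(W(\varepsilon)/\mathrm{soc}\,W(\varepsilon))+u\,T_{0,1}$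 in $\mathrm{Ext}^1_D(L(\varepsilon),L(\sigma,-))$, and $E(\varepsilon)_{0,0,0}=L(\sigma,-)\oplus L(\varepsilon)$. An extension of $L(\lambda)$ by $L(\mu)$ is called graded if it arises from a short exact sequence of graded modules and degree-preserving maps $0\to L(\mu)[\ell]\to E\to L(\lambda)[\ell']\to0$ for some integers $\ell,\ell'$. *)

theory Defs
  imports
    "HOL-Combinatorics.Perm"
    "HOL-Combinatorics.Permutations"
    "HOL-Library.Numeral_Type"
    "HOL-Library.Poly_Mapping"
    "HOL-Computational_Algebra.Polynomial"
    "HOL-Algebra.Algebra"
    "HOL-Algebra.Algebraic_Closure_Type"
begin

section \<open>Left modules over a not necessarily commutative ring\<close>

text \<open>
  The axioms are those of the library locale \<^locale>\<open>module\<close>, with its \<open>cring\<close> weakened to \<open>ring\<close>.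
  As there, the fields \<open>mult\<close> and \<open>one\<close> of the record are irrelevant for a module.
\<close>

locale left_module = R?: ring R + M?: abelian_group M
  for R :: "('r, 'q) ring_scheme" (structure) and M :: "('r, 'v, 'w) module_scheme" (structure) +
  assumes smult_closed:
      "\<lbrakk>a \<in> carrier R; x \<in> carrier M\<rbrakk> \<Longrightarrow> a \<odot>\<^bsub>M\<^esub> x \<in> carrier M"
    and smult_l_distr:
      "\<lbrakk>a \<in> carrier R; b \<in> carrier R; x \<in> carrier M\<rbrakk> \<Longrightarrow>
       (a \<oplus>\<^bsub>R\<^esub> b) \<odot>\<^bsub>M\<^esub> x = a \<odot>\<^bsub>M\<^esub> x \<oplus>\<^bsub>M\<^esub> b \<odot>\<^bsub>M\<^esub> x"
    and smult_r_distr: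
      "\<lbrakk>a \<in> carrier R; x \<in> carrier M; y \<in> carrier M\<rbrakk> \<Longrightarrow>
       a \<odot>\<^bsub>M\<^esub> (x \<oplus>\<^bsub>M\<^esub> y) = a \<odot>\<^bsub>M\<^esub> x \<oplus>\<^bsub>M\<^esub> a \<odot>\<^bsub>M\<^esub> y"
    and smult_assoc1:
      "\<lbrakk>a \<in> carrier R; b \<in> carrier R; x \<in> carrier M\<rbrakk> \<Longrightarrow>
       (a \<otimes>\<^bsub>R\<^esub> b) \<odot>\<^bsub>M\<^esub> x = a \<odot>\<^bsub>M\<^esub> (b \<odot>\<^bsub>M\<^esub> x)"
    and smult_one:
      "x \<in> carrier M \<Longrightarrow> \<one>\<^bsub>R\<^esub> \<odot>\<^bsub>M\<^esub> x = x"

definition mod_hom ::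
  "('r, 'q) ring_scheme \<Rightarrow> ('r, 'a) module \<Rightarrow> ('r, 'b) module \<Rightarrow> ('a \<Rightarrow> 'b) set" where
  "mod_hom R M N = {f. f \<in> carrier M \<rightarrow> carrier N \<and>
     (\<forall>x\<in>carrier M. \<forall>y\<in>carrier M. f (x \<oplus>\<^bsub>M\<^esub> y) = f x \<oplus>\<^bsub>N\<^esub> f y) \<and>
     (\<forall>r\<in>carrier R. \<forall>x\<in>carrier M. f (r \<odot>\<^bsub>M\<^esub> x) = r \<odot>\<^bsub>N\<^esub> f x)}"

definition mod_iso ::
  "('r, 'q) ring_scheme \<Rightarrow> ('r, 'a) module \<Rightarrow> ('r, 'b) module \<Rightarrow> bool" where
  "mod_iso R M N \<longleftrightarrow> (\<exists>f\<in>mod_hom R M N. bij_betw f (carrier M) (carrier N))"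

definition quot_module :: "('r, 'a) module \<Rightarrow> 'a set \<Rightarrow> ('r, 'a set) module" where
  "quot_module M N =
     \<lparr>carrier = a_rcosets\<^bsub>M\<^esub> N, monoid.mult = undefined, one = undefined,
      ring.zero = N, add = set_add M,
      module.smult = (\<lambda>r C. \<Union>v\<in>C. N +>\<^bsub>M\<^esub> (r \<odot>\<^bsub>M\<^esub> v))\<rparr>"

definition dsum_module ::
  "('r, 'a) module \<Rightarrow> ('r, 'b) module \<Rightarrow> ('r, 'a \<times> 'b) module" where
  "dsum_module M N =
     \<lparr>carrier = carrier M \<times> carrier N, monoid.mult = undefined, one = undefined,
      ring.zero = (\<zero>\<^bsub>M\<^esub>, \<zero>\<^bsub>N\<^esub>),
      add = (\<lambda>(x, y) (x', y'). (x \<oplus>\<^bsub>M\<^esub> x', y \<oplus>\<^bsub>N\<^esub> y')),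
      module.smult = (\<lambda>r (x, y). (r \<odot>\<^bsub>M\<^esub> x, r \<odot>\<^bsub>N\<^esub> y))\<rparr>"

definition gen_submodule :: "('r, 'q) ring_scheme \<Rightarrow> ('r, 'a) module \<Rightarrow> 'a set \<Rightarrow> 'a set" where
  "gen_submodule R M S = \<Inter>{N. submodule N R M \<and> S \<subseteq> N}"

definition simple_submodule :: "('r, 'q) ring_scheme \<Rightarrow> ('r, 'a) module \<Rightarrow> 'a set \<Rightarrow> bool" where
  "simple_submodule R M S \<longleftrightarrow> submodule S R M \<and> S \<noteq> {\<zero>\<^bsub>M\<^esub>} \<and>
     (\<forall>N. submodule N R M \<and> N \<subseteq> S \<longrightarrow> N = {\<zero>\<^bsub>M\<^esub>} \<or> N = S)"

definition maximal_submodule :: "('r, 'q) ring_scheme \<Rightarrow> ('r, 'a) module \<Rightarrow> 'a set \<Rightarrow> bool" where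
  "maximal_submodule R M S \<longleftrightarrow> submodule S R M \<and> S \<noteq> carrier M \<and>
     (\<forall>N. submodule N R M \<and> S \<subseteq> N \<longrightarrow> N = S \<or> N = carrier M)"

definition socle :: "('r, 'q) ring_scheme \<Rightarrow> ('r, 'a) module \<Rightarrow> 'a set" where
  "socle R M = gen_submodule R M (\<Union>{S. simple_submodule R M S})"

definition mod_radical :: "('r, 'q) ring_scheme \<Rightarrow> ('r, 'a) module \<Rightarrow> 'a set" where
  "mod_radical R M = carrier M \<inter> \<Inter>{S. maximal_submodule R M S}"

definition mod_head :: "('r, 'q) ring_scheme \<Rightarrow> ('r, 'a) module \<Rightarrow> ('r, 'a set) module" where
  "mod_head R M = quot_module M (mod_radical R M)"


section \<open>Extensions and the linear structure of \<open>Ext\<close>\<close>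

type_synonym ('r, 'a, 'e, 'b) extension = "('a \<Rightarrow> 'e) \<times> ('r, 'e) module \<times> ('e \<Rightarrow> 'b)"

text \<open>An extension of \<open>B\<close> by \<open>A\<close> is written \<open>(i, E, p)\<close>, with \<open>i : A \<rightarrow> E\<close> and \<open>p : E \<rightarrow> B\<close>.\<close>

definition short_exact ::
  "('r, 'q) ring_scheme \<Rightarrow> ('r, 'a) module \<Rightarrow> ('r, 'a, 'e, 'b) extension \<Rightarrow> ('r, 'b) module \<Rightarrow> bool"
  where
  "short_exact R A \<xi> B \<longleftrightarrow> (case \<xi> of (i, E, p) \<Rightarrow>
     left_module R A \<and> left_module R E \<and> left_module R B \<and>
     i \<in> mod_hom R A E \<and> p \<in> mod_hom R E B \<and>
     inj_on i (carrier A) \<and> p ` carrier E = carrier B \<and>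
     i ` carrier A = {x \<in> carrier E. p x = \<zero>\<^bsub>B\<^esub>})"

text \<open>
  Scalar multiplication in \<open>Ext\<close> is the pushout along multiplication by \<open>c\<close> on \<open>A\<close> (\<open>c\<close> is meant to
  be central); the Baer sum is the pullback over \<open>B\<close> modulo the antidiagonal copy of \<open>A\<close>.  The
  projections do not depend on the representative chosen.
\<close>

definition scale_ext ::
  "('r, 'a) module \<Rightarrow> 'r \<Rightarrow> ('r, 'a, 'e, 'b) extension \<Rightarrow> ('r, 'a, ('e \<times> 'a) set, 'b) extension"
  where
  "scale_ext A c \<xi> = (case \<xi> of (i, E, p) \<Rightarrow>
     let P = dsum_module E A;
         N = {(i a, \<ominus>\<^bsub>A\<^esub> (c \<odot>\<^bsub>A\<^esub> a)) | a. a \<in> carrier A}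
     in (\<lambda>a. N +>\<^bsub>P\<^esub> (\<zero>\<^bsub>E\<^esub>, a), quot_module P N, \<lambda>C. p (fst (SOME w. w \<in> C))))"

definition baer_sum ::
  "('r, 'a) module \<Rightarrow> ('r, 'a, 'e, 'b) extension \<Rightarrow> ('r, 'a, 'f, 'b) extension
   \<Rightarrow> ('r, 'a, ('e \<times> 'f) set, 'b) extension" where
  "baer_sum A \<xi> \<xi>' = (case (\<xi>, \<xi>') of ((i, E, p), (i', E', p')) \<Rightarrow>
     let P = (dsum_module E E')
               \<lparr>carrier := {(x, y). x \<in> carrier E \<and> y \<in> carrier E' \<and> p x = p' y}\<rparr>;
         N = {(i a, \<ominus>\<^bsub>E'\<^esub> (i' a)) | a. a \<in> carrier A}
     in (\<lambda>a. N +>\<^bsub>P\<^esub> (i a, \<zero>\<^bsub>E'\<^esub>), quot_module P N, \<lambda>C. p (fst (SOME w. w \<in> C))))"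

definition middle :: "('r, 'a, 'e, 'b) extension \<Rightarrow> ('r, 'e) module" where
  "middle \<xi> = fst (snd \<xi>)"


section \<open>The symmetric group on three letters\<close>

unbundle permutation_syntax

text \<open>
  The letters are the elements \<open>1\<close>, \<open>2\<close>, \<open>3\<close> of the three-element type \<open>3\<close> (where \<open>3 = 0\<close>).
  The product of permutations is composition, the right factor being applied first.
\<close>

type_synonym S3 = "3 perm"

definition t12 :: S3 where "t12 = \<langle>1 \<leftrightarrow> 2\<rangle>"
definition t13 :: S3 where "t13 = \<langle>1 \<leftrightarrow> 3\<rangle>"
definition t23 :: S3 where "t23 = \<langle>2 \<leftrightarrow> 3\<rangle>"
definition c123 :: S3 where "c123 = \<langle>[1, 2, 3]\<rangle>"
definition c132 :: S3 where "c132 = \<langle>[1, 3, 2]\<rangle>"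

definition transps :: "S3 set" where "transps = {t12, t13, t23}"

definition conj3 :: "S3 \<Rightarrow> S3 \<Rightarrow> S3" where "conj3 g h = g * h * inverse g"

definition sgn3 :: "S3 \<Rightarrow> 'k::field" where "sgn3 g = of_int (sign (Perm.apply g))"


section \<open>The free algebra and the algebra \<open>D\<close>\<close>

datatype gen = GGrp S3 | GDelta S3 | GX S3 | GY S3

datatype word = Word (letters: "gen list")

instantiation word :: monoid_add
begin
definition zero_word :: word where "zero_word = Word []"
definition plus_word :: "word \<Rightarrow> word \<Rightarrow> word" where
  "plus_word v w = Word (letters v @ letters w)"
instance by standard (auto simp: zero_word_def plus_word_def)
end

text \<open>The free algebra: formal linear combinations of words with the convolution product.\<close>

type_synonym 'k free = "word \<Rightarrow>\<^sub>0 'k"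

definition scal :: "'k::field \<Rightarrow> 'k free" where "scal c = Poly_Mapping.single 0 c"
definition var :: "gen \<Rightarrow> 'k::field free" where "var a = Poly_Mapping.single (Word [a]) 1"

abbreviation grp :: "S3 \<Rightarrow> 'k::field free" where "grp g \<equiv> var (GGrp g)"
abbreviation dlt :: "S3 \<Rightarrow> 'k::field free" where "dlt g \<equiv> var (GDelta g)"
abbreviation xx :: "S3 \<Rightarrow> 'k::field free" where "xx s \<equiv> var (GX s)"
abbreviation yy :: "S3 \<Rightarrow> 'k::field free" where "yy s \<equiv> var (GY s)"

text \<open>
  \<open>D\<close> is the quotient of the free algebra by its defining relations.  The letters \<open>xx s\<close>, \<open>yy s\<close>
  exist for all \<open>s\<close> in the group; those for which \<open>s\<close> is not a transposition are relations, hence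
  zero in \<open>D\<close>.  The relations present \<open>D\<close>: by them \<open>D\<close> is spanned by
  \<open>B(V) D(S\<^sub>3) B(V')\<close>, where \<open>V'\<close> is the dual of \<open>V\<close>, and in the Drinfeld double the
  multiplication map of these three factors is bijective.
\<close>

definition double_S3_relations :: "'k::field free set" where
  "double_S3_relations =
     {grp 1 - 1} \<union> {grp g * grp h - grp (g * h) | g h. True} \<union>
     {(\<Sum>g\<in>UNIV. dlt g) - 1} \<union>
     {dlt g * dlt h - (if g = h then dlt g else 0) | g h. True} \<union>
     {grp g * dlt h - dlt (conj3 g h) * grp g | g h. True}"

definition boson_relations :: "(S3 \<Rightarrow> 'k::field free) \<Rightarrow> 'k free set" where
  "boson_relations z =
     {z s | s. s \<notin> transps} \<union>
     {z s * z s | s. s \<in> transps} \<union>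
     {z t12 * z t13 + z t23 * z t12 + z t13 * z t23,
      z t13 * z t12 + z t12 * z t23 + z t23 * z t13} \<union>
     {grp g * z s - scal (sgn3 g) * z (conj3 g s) * grp g | g s. s \<in> transps} \<union>
     {dlt g * z s - z s * dlt (s * g) | g s. s \<in> transps}"

definition cross_relations :: "'k::field free set" where
  "cross_relations =
     {yy s * xx r - (- (xx r * yy (r * s * r)) + (if s = r then 1 else 0)
        + grp r * (dlt s - dlt (s * r))) | s r. s \<in> transps \<and> r \<in> transps}"

definition D_ideal :: "'k::field free set" where
  "D_ideal = Idl\<^bsub>ring_of_type_algebra\<^esub>
     (double_S3_relations \<union> boson_relations xx \<union> boson_relations yy \<union> cross_relations)"

definition DD :: "'k::field free set ring" where
  "DD = ring_of_type_algebra Quot D_ideal"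

definition cls :: "'k::field free \<Rightarrow> 'k free set" where
  "cls p = D_ideal +>\<^bsub>ring_of_type_algebra\<^esub> p"

definition gen_degree :: "gen \<Rightarrow> int" where
  "gen_degree a = (case a of GX s \<Rightarrow> - 1 | GY s \<Rightarrow> 1 | _ \<Rightarrow> 0)"

definition DD_deg :: "int \<Rightarrow> 'k::field free set set" where
  "DD_deg n = {cls p | p. \<forall>w\<in>Poly_Mapping.keys p. sum_list (map gen_degree (letters w)) = n}"

text \<open>
  The antipode on generators, obtained from the comultiplication by solving
  \<open>S(a\<^sub>1) a\<^sub>2 = \<epsilon>(a)\<close>; it is extended as an algebra antihomomorphism.
\<close>

definition gen_antipode :: "gen \<Rightarrow> 'k::field free" where
  "gen_antipode a = (case a of
     GGrp g \<Rightarrow> grp (inverse g)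
   | GDelta g \<Rightarrow> dlt (inverse g)
   | GX s \<Rightarrow> - (grp (inverse s) * xx s)
   | GY s \<Rightarrow> - (\<Sum>g\<in>UNIV. scal (sgn3 g) * dlt (inverse g) * yy (conj3 (inverse g) s)))"

definition free_antipode :: "'k::field free \<Rightarrow> 'k free" where
  "free_antipode p = (\<Sum>w\<in>Poly_Mapping.keys p.
     scal (Poly_Mapping.lookup p w) * prod_list (map gen_antipode (rev (letters w))))"

definition antipode :: "'k::field free set \<Rightarrow> 'k free set" where
  "antipode d = (\<Union>p\<in>d. cls (free_antipode p))"

definition dual_module :: "('k::field free set, 'v) module \<Rightarrow> ('k free set, 'v \<Rightarrow> 'k) module" where
  "dual_module M =
     \<lparr>carrier = {f. (\<forall>v. v \<notin> carrier M \<longrightarrow> f v = 0) \<and>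
        (\<forall>u\<in>carrier M. \<forall>v\<in>carrier M. f (u \<oplus>\<^bsub>M\<^esub> v) = f u + f v) \<and>
        (\<forall>c. \<forall>v\<in>carrier M. f (cls (scal c) \<odot>\<^bsub>M\<^esub> v) = c * f v)},
      monoid.mult = undefined, one = undefined,
      ring.zero = (\<lambda>v. 0),
      add = (\<lambda>f f' v. f v + f' v),
      module.smult = (\<lambda>d f v. if v \<in> carrier M then f (antipode d \<odot>\<^bsub>M\<^esub> v) else 0)\<rparr>"


section \<open>Graded modules\<close>

definition graded_module ::
  "('k::field free set, 'v) module \<Rightarrow> (int \<Rightarrow> 'v set) \<Rightarrow> bool" where
  "graded_module M Mg \<longleftrightarrow> left_module DD M \<and>
     (\<forall>n. subgroup (Mg n) (add_monoid M)) \<and>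
     (\<forall>m n. \<forall>d\<in>DD_deg m. \<forall>v\<in>Mg n. d \<odot>\<^bsub>M\<^esub> v \<in> Mg (m + n)) \<and>
     (\<forall>v\<in>carrier M. \<exists>!f. (\<forall>n. f n \<in> Mg n) \<and> finite {n. f n \<noteq> \<zero>\<^bsub>M\<^esub>} \<and>
        v = finsum M f {n. f n \<noteq> \<zero>\<^bsub>M\<^esub>})"

definition shift :: "(int \<Rightarrow> 'v set) \<Rightarrow> int \<Rightarrow> int \<Rightarrow> 'v set" where
  "shift Mg l = (\<lambda>n. Mg (n - l))"

definition degree_preserving ::
  "('v \<Rightarrow> 'w) \<Rightarrow> (int \<Rightarrow> 'v set) \<Rightarrow> (int \<Rightarrow> 'w set) \<Rightarrow> bool" where
  "degree_preserving f Mg Ng \<longleftrightarrow> (\<forall>n. f ` Mg n \<subseteq> Ng n)"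

text \<open>
  Here \<open>E\<close> is an ungraded module: the grading is part of what has to exist.
\<close>

definition graded_extension ::
  "('k::field free set, 'a) module \<Rightarrow> (int \<Rightarrow> 'a set)
   \<Rightarrow> ('k free set, 'e) module
   \<Rightarrow> ('k free set, 'b) module \<Rightarrow> (int \<Rightarrow> 'b set) \<Rightarrow> bool" where
  "graded_extension A Ag E B Bg \<longleftrightarrow>
     (\<exists>Eg l l' i p. graded_module E Eg \<and> short_exact DD A (i, E, p) B \<and>
        degree_preserving i (shift Ag l) Eg \<and> degree_preserving p Eg (shift Bg l'))"


section \<open>Modules given by a basis and the action of the generators\<close>

text \<open>
  A pair \<open>(B, \<rho>)\<close> consists of a finite set \<open>B\<close> indexing a basis and, for a generator \<open>a\<close> and
  \<open>b \<in> B\<close>, the coordinate vector \<open>\<rho> a b\<close> of the image of the basis vector \<open>b\<close> under \<open>a\<close>.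
\<close>

definition ket :: "'b \<Rightarrow> 'b \<Rightarrow> 'k::field" where
  "ket b = (\<lambda>c. if c = b then 1 else 0)"

definition vecs :: "'b set \<Rightarrow> ('b \<Rightarrow> 'k::field) set" where
  "vecs B = {v. \<forall>b. b \<notin> B \<longrightarrow> v b = 0}"

definition lin :: "'b set \<Rightarrow> ('b \<Rightarrow> 'b \<Rightarrow> 'k::field) \<Rightarrow> ('b \<Rightarrow> 'k) \<Rightarrow> 'b \<Rightarrow> 'k" where
  "lin B m v = (\<lambda>c. \<Sum>b\<in>B. v b * m b c)"

definition free_act ::
  "'b set \<Rightarrow> (gen \<Rightarrow> 'b \<Rightarrow> 'b \<Rightarrow> 'k::field) \<Rightarrow> 'k free \<Rightarrow> ('b \<Rightarrow> 'k) \<Rightarrow> 'b \<Rightarrow> 'k" where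
  "free_act B \<rho> p v = (\<lambda>c. \<Sum>w\<in>Poly_Mapping.keys p.
     Poly_Mapping.lookup p w * foldr (\<lambda>a. lin B (\<rho> a)) (letters w) v c)"

text \<open>
  When \<open>\<rho>\<close> satisfies the relations of \<open>D\<close>, the choice of the
  representative of \<open>d\<close> is irrelevant.
\<close>

definition rep_module ::
  "'b set \<Rightarrow> (gen \<Rightarrow> 'b \<Rightarrow> 'b \<Rightarrow> 'k::field) \<Rightarrow> ('k free set, 'b \<Rightarrow> 'k) module" where
  "rep_module B \<rho> =
     \<lparr>carrier = vecs B, monoid.mult = undefined, one = undefined,
      ring.zero = (\<lambda>b. 0), add = (\<lambda>u v b. u b + v b),
      module.smult = (\<lambda>d v. free_act B \<rho> (SOME p. p \<in> d) v)\<rparr>"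


section \<open>Verma and co-Verma modules\<close>

text \<open>
  For the subalgebra generated by a set \<open>S\<close> of generators and its module \<open>\<lambda>\<close> given by \<open>(B, \<rho>)\<close>,
  the \<open>k\<close>-space \<open>D \<otimes> \<lambda>\<close> is the space of functions \<open>B \<rightarrow> D\<close>, with \<open>d \<otimes> v\<close> corresponding to
  \<open>b \<mapsto> d \<cdot> v b\<close>; the tensor product over the subalgebra is its quotient by the elements
  \<open>d p \<otimes> v - d \<otimes> p v\<close>, where \<open>p\<close> ranges over the subalgebra.
\<close>

definition tensor_k :: "'b set \<Rightarrow> ('k::field free set, 'b \<Rightarrow> 'k free set) module" where
  "tensor_k B =
     \<lparr>carrier = {f. \<forall>b. if b \<in> B then f b \<in> carrier DD else f b = \<zero>\<^bsub>DD\<^esub>},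
      monoid.mult = undefined, one = undefined,
      ring.zero = (\<lambda>b. \<zero>\<^bsub>DD\<^esub>), add = (\<lambda>f f' b. f b \<oplus>\<^bsub>DD\<^esub> f' b),
      module.smult = (\<lambda>d f b. d \<otimes>\<^bsub>DD\<^esub> f b)\<rparr>"

definition pure_tensor :: "'b set \<Rightarrow> 'k::field free set \<Rightarrow> ('b \<Rightarrow> 'k) \<Rightarrow> 'b \<Rightarrow> 'k free set" where
  "pure_tensor B d v = (\<lambda>b. if b \<in> B then d \<otimes>\<^bsub>DD\<^esub> cls (scal (v b)) else \<zero>\<^bsub>DD\<^esub>)"

definition balancing ::
  "gen set \<Rightarrow> 'b set \<Rightarrow> (gen \<Rightarrow> 'b \<Rightarrow> 'b \<Rightarrow> 'k::field) \<Rightarrow> ('b \<Rightarrow> 'k free set) set" where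
  "balancing S B \<rho> = gen_submodule DD (tensor_k B)
     {pure_tensor B (d \<otimes>\<^bsub>DD\<^esub> cls p) v \<ominus>\<^bsub>tensor_k B\<^esub> pure_tensor B d (free_act B \<rho> p v) | d p v.
        d \<in> carrier DD \<and> (\<forall>w\<in>Poly_Mapping.keys p. set (letters w) \<subseteq> S) \<and> v \<in> vecs B}"

definition induced ::
  "gen set \<Rightarrow> 'b set \<Rightarrow> (gen \<Rightarrow> 'b \<Rightarrow> 'b \<Rightarrow> 'k::field)
   \<Rightarrow> ('k free set, ('b \<Rightarrow> 'k free set) set) module" where
  "induced S B \<rho> = quot_module (tensor_k B) (balancing S B \<rho>)"

definition induced_deg ::
  "gen set \<Rightarrow> 'b set \<Rightarrow> (gen \<Rightarrow> 'b \<Rightarrow> 'b \<Rightarrow> 'k::field) \<Rightarrow> int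
   \<Rightarrow> ('b \<Rightarrow> 'k free set) set set" where
  "induced_deg S B \<rho> n =
     {balancing S B \<rho> +>\<^bsub>tensor_k B\<^esub> f | f.
        f \<in> carrier (tensor_k B) \<and> (\<forall>b\<in>B. f b \<in> DD_deg n)}"

definition gens_ge0 :: "gen set" where
  "gens_ge0 = range GGrp \<union> range GDelta \<union> range GY"

definition gens_le0 :: "gen set" where
  "gens_le0 = range GGrp \<union> range GDelta \<union> range GX"

abbreviation "verma \<equiv> induced gens_ge0"
abbreviation "coverma \<equiv> induced gens_le0"

text \<open>\<open>L(\<lambda>)\<close> is the head of \<open>M(\<lambda>)\<close>, with the grading induced from \<open>M(\<lambda>)\<close>.\<close>

definition simple_L ::
  "'b set \<Rightarrow> (gen \<Rightarrow> 'b \<Rightarrow> 'b \<Rightarrow> 'k::field)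
   \<Rightarrow> ('k free set, ('b \<Rightarrow> 'k free set) set set) module" where
  "simple_L B \<rho> = mod_head DD (verma B \<rho>)"

definition simple_L_deg ::
  "'b set \<Rightarrow> (gen \<Rightarrow> 'b \<Rightarrow> 'b \<Rightarrow> 'k::field) \<Rightarrow> int
   \<Rightarrow> ('b \<Rightarrow> 'k free set) set set set" where
  "simple_L_deg B \<rho> n =
     {mod_radical DD (verma B \<rho>) +>\<^bsub>verma B \<rho>\<^esub> x | x. x \<in> induced_deg gens_ge0 B \<rho> n}"


section \<open>The weights and modules of the statement\<close>

text \<open>
  The weights are modules over the double of the group algebra on which all \<open>x\<close> and \<open>y\<close> act by zero.
  For \<open>\<epsilon>\<close> the basis vector has degree \<open>1\<close>; for \<open>(\<sigma>,-)\<close> the vector \<open>|ij\<rangle>\<close> is indexed by its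
  degree \<open>(ij)\<close>.
\<close>

definition eps_rep :: "gen \<Rightarrow> S3 \<Rightarrow> S3 \<Rightarrow> 'k::field" where
  "eps_rep a b = (case a of
     GGrp g \<Rightarrow> ket b
   | GDelta h \<Rightarrow> if h = b then ket b else (\<lambda>c. 0)
   | _ \<Rightarrow> (\<lambda>c. 0))"

definition sigma_minus_rep :: "gen \<Rightarrow> S3 \<Rightarrow> S3 \<Rightarrow> 'k::field" where
  "sigma_minus_rep a b = (case a of
     GGrp g \<Rightarrow> (\<lambda>c. sgn3 g * ket (conj3 g b) c)
   | GDelta h \<Rightarrow> if h = b then ket b else (\<lambda>c. 0)
   | _ \<Rightarrow> (\<lambda>c. 0))"

abbreviation "M_eps \<equiv> verma {1} eps_rep"
abbreviation "W_eps \<equiv> coverma {1} eps_rep"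
abbreviation "L_eps \<equiv> simple_L {1} eps_rep"
abbreviation "L_eps_deg \<equiv> simple_L_deg {1} eps_rep"
abbreviation "L_sigma \<equiv> simple_L transps sigma_minus_rep"
abbreviation "L_sigma_deg \<equiv> simple_L_deg transps sigma_minus_rep"

text \<open>
  The basis of \<open>T\<^sub>0\<^sub>,\<^sub>1\<close>, each vector carrying its degree in the group:
  \<open>c\<^sub>1, c\<^sub>2, c\<^sub>3\<close> are \<open>Low t12, Low t23, Low t13\<close>; \<open>c\<^sub>4, c\<^sub>5\<close> are \<open>Tau1 c123, Tau1 c132\<close>;
  \<open>c\<^sub>6, c\<^sub>7\<close> are \<open>Tau2 c123, Tau2 c132\<close>; \<open>c\<^sub>8, c\<^sub>9, c\<^sub>1\<^sub>0\<close> are \<open>High t12, High t23, High t13\<close>;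
  \<open>TT\<close> is the vector spanning \<open>\<epsilon>\<close>.
\<close>

datatype T_index = Low S3 | Tau1 S3 | Tau2 S3 | High S3 | TT

definition T_basis :: "T_index set" where
  "T_basis = Low ` transps \<union> Tau1 ` {c123, c132} \<union> Tau2 ` {c123, c132} \<union> High ` transps \<union> {TT}"

text \<open>
  The action of \<open>g\<close> on \<open>(\<tau>,l)\<close>: every \<open>g\<close> is \<open>(123)\<^sup>k\<close> or \<open>(123)\<^sup>k (12)\<close> with \<open>k = rot_exp g\<close>; the
  factor \<open>(12)\<close> permutes the two basis vectors, and \<open>(123)\<^sup>k\<close> then multiplies the result by
  \<open>\<zeta>\<^sup>l\<^sup>k\<close> or \<open>\<zeta>\<^sup>-\<^sup>l\<^sup>k\<close> according to its degree.
\<close>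

definition rot_exp :: "S3 \<Rightarrow> nat" where
  "rot_exp g = (if g \<in> {1, t12} then 0 else if g \<in> {c123, c123 * t12} then 1 else 2)"

definition tau_coeff :: "'k::field \<Rightarrow> nat \<Rightarrow> S3 \<Rightarrow> S3 \<Rightarrow> 'k" where
  "tau_coeff \<zeta> l g b =
     (if conj3 g b = c123 then \<zeta> ^ (l * rot_exp g) else inverse \<zeta> ^ (l * rot_exp g))"

definition T_grp :: "'k::field \<Rightarrow> S3 \<Rightarrow> T_index \<Rightarrow> T_index \<Rightarrow> 'k" where
  "T_grp \<zeta> g b = (case b of
     Low s \<Rightarrow> (\<lambda>c. sgn3 g * ket (Low (conj3 g s)) c)
   | Tau1 h \<Rightarrow> (\<lambda>c. tau_coeff \<zeta> 1 g h * ket (Tau1 (conj3 g h)) c)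
   | Tau2 h \<Rightarrow> (\<lambda>c. tau_coeff \<zeta> 2 g h * ket (Tau2 (conj3 g h)) c)
   | High s \<Rightarrow> (\<lambda>c. sgn3 g * ket (High (conj3 g s)) c)
   | TT \<Rightarrow> ket TT)"

definition T_S3_degree :: "T_index \<Rightarrow> S3" where
  "T_S3_degree b = (case b of Low s \<Rightarrow> s | Tau1 h \<Rightarrow> h | Tau2 h \<Rightarrow> h | High s \<Rightarrow> s | TT \<Rightarrow> 1)"

definition T_x12 :: "'k::field \<Rightarrow> T_index \<Rightarrow> T_index \<Rightarrow> 'k" where
  "T_x12 \<zeta> b =
    (if b = Tau1 c123 then (\<lambda>c. \<zeta> * ket (Low t23) c)
     else if b = Tau1 c132 then (\<lambda>c. \<zeta> * ket (Low t13) c)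
     else if b = Tau2 c123 then (\<lambda>c. \<zeta>\<^sup>2 * ket (Low t23) c)
     else if b = Tau2 c132 then (\<lambda>c. \<zeta>\<^sup>2 * ket (Low t13) c)
     else if b = High t23 then (\<lambda>c. 1 / (1 - \<zeta>) * (ket (Tau2 c123) c - \<zeta> * ket (Tau1 c123) c))
     else if b = High t13 then (\<lambda>c. 1 / (1 - \<zeta>) * (ket (Tau2 c132) c - \<zeta> * ket (Tau1 c132) c))
     else if b = TT then ket (Low t12)
     else (\<lambda>c. 0))"

definition T_y12 :: "'k::field \<Rightarrow> T_index \<Rightarrow> T_index \<Rightarrow> 'k" where
  "T_y12 \<zeta> b =
    (if b = Low t23 then (\<lambda>c. \<zeta>\<^sup>2 / (1 - \<zeta>) * (ket (Tau1 c123) c - ket (Tau2 c123) c))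
     else if b = Low t13 then (\<lambda>c. \<zeta>\<^sup>2 / (1 - \<zeta>) * (ket (Tau1 c132) c - ket (Tau2 c132) c))
     else if b \<in> {Tau1 c123, Tau2 c123} then ket (High t23)
     else if b \<in> {Tau1 c132, Tau2 c132} then ket (High t13)
     else if b = TT then ket (High t12)
     else (\<lambda>c. 0))"

text \<open>\<open>to_transp s\<close> is an element \<open>g\<close> with \<open>g (12) g\<^sup>-\<^sup>1 = s\<close>; then \<open>x\<^sub>s = sgn(g) g x\<^sub>1\<^sub>2 g\<^sup>-\<^sup>1\<close>, and likewise for \<open>y\<^sub>s\<close>.\<close>

definition to_transp :: "S3 \<Rightarrow> S3" where
  "to_transp s = (if s = t13 then t23 else if s = t23 then t13 else 1)"

definition T_conj ::
  "'k::field \<Rightarrow> (T_index \<Rightarrow> T_index \<Rightarrow> 'k) \<Rightarrow> S3 \<Rightarrow> T_index \<Rightarrow> T_index \<Rightarrow> 'k" where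
  "T_conj \<zeta> m s b =
     (if s \<in> transps then
        (let g = to_transp s in
         (\<lambda>c. sgn3 g * lin T_basis (T_grp \<zeta> g)
            (lin T_basis m (lin T_basis (T_grp \<zeta> (inverse g)) (ket b))) c))
      else (\<lambda>c. 0))"

definition T_rep :: "'k::field \<Rightarrow> gen \<Rightarrow> T_index \<Rightarrow> T_index \<Rightarrow> 'k" where
  "T_rep \<zeta> a b = (case a of
     GGrp g \<Rightarrow> T_grp \<zeta> g b
   | GDelta h \<Rightarrow> if h = T_S3_degree b then ket b else (\<lambda>c. 0)
   | GX s \<Rightarrow> T_conj \<zeta> (T_x12 \<zeta>) s b
   | GY s \<Rightarrow> T_conj \<zeta> (T_y12 \<zeta>) s b)"

abbreviation "T01 \<zeta> \<equiv> rep_module T_basis (T_rep \<zeta>)"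

text \<open>
  The middle term of \<open>s \<xi>\<^sub>M + t \<xi>\<^sub>W + u \<xi>\<^sub>T\<close> in the space of extensions of \<open>L(\<epsilon>)\<close> by \<open>L(\<sigma>,-)\<close>.
  For \<open>s = t = u = 0\<close> the module \<open>E(\<epsilon>)\<close> is the direct sum, which lives on another type; therefore
  \<open>E(\<epsilon>)\<close> enters through the predicates \<open>iso_E\<close> and \<open>iso_E_dual\<close> on the module \<open>N\<close>.
\<close>

definition lin_comb_ext where
  "lin_comb_ext \<xi>M \<xi>W \<xi>T s t u =
     baer_sum L_sigma
       (baer_sum L_sigma
          (scale_ext L_sigma (cls (scal s)) \<xi>M) (scale_ext L_sigma (cls (scal t)) \<xi>W))
       (scale_ext L_sigma (cls (scal u)) \<xi>T)"

definition iso_E where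
  "iso_E \<xi>M \<xi>W \<xi>T s t u N \<longleftrightarrow>
     (if s = 0 \<and> t = 0 \<and> u = 0 then mod_iso DD N (dsum_module L_sigma L_eps)
      else mod_iso DD N (middle (lin_comb_ext \<xi>M \<xi>W \<xi>T s t u)))"

definition iso_E_dual where
  "iso_E_dual \<xi>M \<xi>W \<xi>T s t u N \<longleftrightarrow>
     (if s = 0 \<and> t = 0 \<and> u = 0 then mod_iso DD N (dual_module (dsum_module L_sigma L_eps))
      else mod_iso DD N (dual_module (middle (lin_comb_ext \<xi>M \<xi>W \<xi>T s t u))))"

end

theory Submission
  imports Defs
begin

text \<open>
  An extension \<open>0 \<rightarrow> L(\<sigma>,-) \<rightarrow> E \<rightarrow> L(\<epsilon>) \<rightarrow> 0\<close> is controlled by three scalars.  The idempotent \<open>\<delta>\<^sub>1\<close>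
  kills \<open>L(\<sigma>,-)\<close>, which has no vector of group degree \<open>1\<close>, and is the identity on \<open>L(\<epsilon>)\<close>.
  Hence the generator of \<open>L(\<epsilon>)\<close> has exactly one lift \<open>t\<close> with \<open>\<delta>\<^sub>1 t = t\<close>, and uniqueness makes \<open>t\<close>
  invariant under the group.  The vectors \<open>x\<^sub>1\<^sub>2 t\<close> and \<open>y\<^sub>1\<^sub>2 t\<close> have group degree \<open>(12)\<close> and lie in
  \<open>L(\<sigma>,-)\<close>, so they are combinations of \<open>c\<^sub>1\<close> and \<open>c\<^sub>8\<close>:
  \<open>x\<^sub>1\<^sub>2 t = \<alpha> c\<^sub>1 + \<beta> c\<^sub>8\<close> and \<open>y\<^sub>1\<^sub>2 t = \<gamma> c\<^sub>1 + \<delta> c\<^sub>8\<close>.  The cross relation between \<open>y\<^sub>1\<^sub>2\<close> and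
  \<open>x\<^sub>2\<^sub>3\<close> forces \<open>\<delta> = \<alpha>\<close> (\<open>column_cross_relation\<close>).  So \<open>E\<close> is, up to isomorphism, the space with basis
  \<open>c\<^sub>1, \<dots>, c\<^sub>1\<^sub>0, t\<close> with \<open>x\<^sub>1\<^sub>2\<close>, \<open>y\<^sub>1\<^sub>2\<close> acting through \<open>(\<alpha>, \<beta>, \<gamma>)\<close> (\<open>has_params_realizes\<close>); this is
  the predicate \<open>realizes_col\<close>.

  The triple is additive under Baer sums and linear under multiples.  It is \<open>(1, 0, 0)\<close> for
  \<open>T\<^sub>0\<^sub>,\<^sub>1\<close>.  The quotient \<open>M(\<epsilon>) / soc M(\<epsilon>)\<close> is generated by a vector of group degree \<open>1\<close>
  killed by \<open>y\<^sub>1\<^sub>2\<close>, hence \<open>\<alpha> = \<gamma> = 0\<close>; a direct sum would not be generated by such a vector, hence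
  \<open>\<beta> \<noteq> 0\<close> (\<open>verma_params\<close>).  Likewise \<open>W(\<epsilon>) / soc W(\<epsilon>)\<close> has the triple \<open>(0, 0, \<gamma>)\<close> with
  \<open>\<gamma> \<noteq> 0\<close> (\<open>coverma_params\<close>).  Thus every triple belongs to exactly one linear combination.

  In a grading compatible with the extension the vector \<open>t\<close> is homogeneous, \<open>c\<^sub>8\<close> lies two degrees above \<open>c\<^sub>1\<close>,
  \<open>x\<^sub>1\<^sub>2\<close> lowers and \<open>y\<^sub>1\<^sub>2\<close> raises degrees by one; if \<open>c\<^sub>8\<close> has degree \<open>0\<close>, then
  \<open>\<alpha> \<noteq> 0\<close>, \<open>\<beta> \<noteq> 0\<close> and \<open>\<gamma> \<noteq> 0\<close> put \<open>t\<close> in degree \<open>-1\<close>, \<open>1\<close> and \<open>-3\<close>.  So an extension is graded if and only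
  if at most one of the three scalars is nonzero, and rescaling \<open>t\<close> then normalizes that scalar.
  Which scalars vanish depends on the module \<open>E\<close> alone and not on the maps of the
  extension, since \<open>\<alpha>\<close>, \<open>\<beta>\<close>, \<open>\<gamma>\<close> vanish precisely when \<open>y\<^sub>1\<^sub>3 x\<^sub>1\<^sub>2 \<delta>\<^sub>1\<close>, \<open>x\<^sub>1\<^sub>3 x\<^sub>1\<^sub>2 \<delta>\<^sub>1\<close>, \<open>y\<^sub>1\<^sub>3 y\<^sub>1\<^sub>2 \<delta>\<^sub>1\<close> act
  by zero (\<open>realizes_col_pattern\<close>).

  For \<open>0 \<rightarrow> L(\<epsilon>) \<rightarrow> E \<rightarrow> L(\<sigma>,-) \<rightarrow> 0\<close> the same argument runs with the complementary idempotent
  \<open>1 - \<delta>\<^sub>1\<close>, which splits \<open>E\<close> over the double of the group algebra; now the scalars are the coefficients with which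
  \<open>x\<^sub>1\<^sub>2\<close>, \<open>y\<^sub>1\<^sub>2\<close> map \<open>c\<^sub>1\<close> and \<open>c\<^sub>8\<close> to the invariant vector (\<open>realizes_row\<close>).  An explicit bilinear form
  on the eleven-dimensional space, for which every generator is adjoint to its antipode,
  identifies the dual of the module with triple \<open>(\<alpha>, \<beta>, \<gamma>)\<close> with the module of the second kind with the
  same triple (\<open>dual_realizes_row\<close>).  For the dual to be a module the antipode has to respect the
  relations of \<open>D\<close>; this is checked relation by relation (\<open>antipode_dd_ideal\<close>).

  The simple modules, defined as heads of Verma modules, enter through \<open>T\<^sub>0\<^sub>,\<^sub>1\<close> only: an exact
  sequence with middle term \<open>T\<^sub>0\<^sub>,\<^sub>1\<close> identifies \<open>L(\<sigma>,-)\<close> with the span of \<open>c\<^sub>1, \<dots>, c\<^sub>1\<^sub>0\<close> and \<open>L(\<epsilon>)\<close>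
  with the quotient by it (\<open>iT_L10\<close>, \<open>L10_image\<close>, \<open>L_eps_carrier\<close>).
\<close>

section \<open>The symmetric group on three letters, concretely\<close>

lemma three_letters: "(x::3) = 1 \<or> x = 2 \<or> x = 3"
proof (induct x)
  case (of_int z)
  hence "z = 0 \<or> z = 1 \<or> z = 2" by fastforce
  thus ?case by auto
qed

text \<open>
  The type of letters has three elements, in which the numeral \<open>3\<close> denotes \<open>0\<close>.
\<close>

lemma three_letters_distinct [simp]:
  "(1::3) \<noteq> 2" "(2::3) \<noteq> 1" "(1::3) \<noteq> 3" "(3::3) \<noteq> 1" "(2::3) \<noteq> 3" "(3::3) \<noteq> 2"
  by simp_all

lemma S3_eq_iff:
  fixes g h :: S3
  shows "g = h \<longleftrightarrow> g \<langle>$\<rangle> 1 = h \<langle>$\<rangle> 1 \<and> g \<langle>$\<rangle> 2 = h \<langle>$\<rangle> 2 \<and> g \<langle>$\<rangle> 3 = h \<langle>$\<rangle> 3"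
  unfolding perm_eq_iff by (metis three_letters)

lemma S3_cycles_as_products: "c123 = t12 * t23" "c132 = t23 * t12"
  by (simp_all add: c123_def c132_def t12_def t23_def S3_eq_iff apply_times)

lemma S3_apply:
  "t12 \<langle>$\<rangle> 1 = 2" "t12 \<langle>$\<rangle> 2 = 1" "t12 \<langle>$\<rangle> 3 = 3"
  "t13 \<langle>$\<rangle> 1 = 3" "t13 \<langle>$\<rangle> 2 = 2" "t13 \<langle>$\<rangle> 3 = 1"
  "t23 \<langle>$\<rangle> 1 = 1" "t23 \<langle>$\<rangle> 2 = 3" "t23 \<langle>$\<rangle> 3 = 2"
  "c123 \<langle>$\<rangle> 1 = 2" "c123 \<langle>$\<rangle> 2 = 3" "c123 \<langle>$\<rangle> 3 = 1"
  "c132 \<langle>$\<rangle> 1 = 3" "c132 \<langle>$\<rangle> 2 = 1" "c132 \<langle>$\<rangle> 3 = 2"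
  by (simp_all add: t12_def t13_def t23_def S3_cycles_as_products apply_times)

lemma S3_distinct [simp]:
  "t12 \<noteq> 1" "t13 \<noteq> 1" "t23 \<noteq> 1" "c123 \<noteq> 1" "c132 \<noteq> 1"
  "1 \<noteq> t12" "1 \<noteq> t13" "1 \<noteq> t23" "1 \<noteq> c123" "1 \<noteq> c132"
  "t12 \<noteq> t13" "t12 \<noteq> t23" "t12 \<noteq> c123" "t12 \<noteq> c132"
  "t13 \<noteq> t12" "t13 \<noteq> t23" "t13 \<noteq> c123" "t13 \<noteq> c132"
  "t23 \<noteq> t12" "t23 \<noteq> t13" "t23 \<noteq> c123" "t23 \<noteq> c132"
  "c123 \<noteq> t12" "c123 \<noteq> t13" "c123 \<noteq> t23" "c123 \<noteq> c132"
  "c132 \<noteq> t12" "c132 \<noteq> t13" "c132 \<noteq> t23" "c132 \<noteq> c123"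
  by (simp_all add: S3_eq_iff S3_apply)

lemma S3_cases: "(g::S3) = 1 \<or> g = t12 \<or> g = t13 \<or> g = t23 \<or> g = c123 \<or> g = c132"
proof -
  have inj: "g \<langle>$\<rangle> 1 \<noteq> g \<langle>$\<rangle> 2" "g \<langle>$\<rangle> 1 \<noteq> g \<langle>$\<rangle> 3" "g \<langle>$\<rangle> 2 \<noteq> g \<langle>$\<rangle> 3"
    by (simp_all only: apply_inj three_letters_distinct not_False_eq_True)
  show ?thesis
    using three_letters[of "g \<langle>$\<rangle> 1"] three_letters[of "g \<langle>$\<rangle> 2"] three_letters[of "g \<langle>$\<rangle> 3"] inj
    by (elim disjE) (simp_all add: S3_eq_iff S3_apply)
qed

lemma S3_UNIV: "(UNIV :: S3 set) = {1, t12, t13, t23, c123, c132}"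
  using S3_cases by blast

lemma S3_mult [simp]:
  "t12 * t12 = 1" "t13 * t13 = 1" "t23 * t23 = 1"
  "t12 * t13 = c132" "t13 * t12 = c123" "t12 * t23 = c123" "t23 * t12 = c132"
  "t13 * t23 = c132" "t23 * t13 = c123"
  "t12 * c123 = t23" "t12 * c132 = t13" "t13 * c123 = t12" "t13 * c132 = t23"
  "t23 * c123 = t13" "t23 * c132 = t12"
  "c123 * t12 = t13" "c132 * t12 = t23" "c123 * t13 = t23" "c132 * t13 = t12"
  "c123 * t23 = t12" "c132 * t23 = t13"
  "c123 * c123 = c132" "c132 * c132 = c123" "c123 * c132 = 1" "c132 * c123 = 1"
  by (simp_all add: S3_eq_iff S3_apply apply_times)

lemma S3_inverse [simp]:
  "inverse t12 = t12" "inverse t13 = t13" "inverse t23 = t23" "inverse c123 = c132" "inverse c132 = c123"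
proof -
  have "inverse g = h" if "g * h = 1" for g h :: S3
    using that by (rule perm.inverse_unique)
  then show "inverse t12 = t12" "inverse t13 = t13" "inverse t23 = t23" "inverse c123 = c132" "inverse c132 = c123"
    by simp_all
qed

lemma S3_inverse_one: "inverse (1::S3) = 1"
  by simp

lemma S3_sum: "(\<Sum>g\<in>(UNIV::S3 set). f g) = f 1 + (f t12 + (f t13 + (f t23 + (f c123 + f c132))))"
  by (simp add: S3_UNIV)

lemma sgn3_mult: "sgn3 (g * h) = (sgn3 g * sgn3 h :: 'k::field)"
proof -
  have "apply (g * h) = apply g \<circ> apply h"
    by (rule ext) (simp add: apply_times)
  moreover have "permutation (apply (g::S3))" for g
    by (simp add: permutation)
  ultimately show ?thesis
    by (simp add: sgn3_def sign_compose)
qed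

lemma sgn3_simps [simp]:
  "sgn3 1 = 1" "sgn3 t12 = -1" "sgn3 t13 = -1" "sgn3 t23 = -1" "sgn3 c123 = 1" "sgn3 c132 = 1"
proof -
  have "apply \<langle>a \<leftrightarrow> b\<rangle> = transpose a b" for a b :: 3
    by (rule ext) (auto simp: transpose_def swap.rep_eq)
  then show *: "sgn3 t12 = -1" "sgn3 t13 = -1" "sgn3 t23 = -1"
    by (simp_all add: sgn3_def t12_def t13_def t23_def sign_swap_id)
  have "apply (1::S3) = id" by (rule ext) simp
  then show "sgn3 1 = 1" by (simp add: sgn3_def)
  show "sgn3 c123 = 1" "sgn3 c132 = 1"
    by (simp_all only: S3_cycles_as_products sgn3_mult *) simp_all
qed

lemma conj3_simps [simp]:
  "conj3 1 h = h" "conj3 g 1 = 1"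
  "conj3 t12 t12 = t12" "conj3 t12 t13 = t23" "conj3 t12 t23 = t13" "conj3 t12 c123 = c132" "conj3 t12 c132 = c123"
  "conj3 t13 t12 = t23" "conj3 t13 t13 = t13" "conj3 t13 t23 = t12" "conj3 t13 c123 = c132" "conj3 t13 c132 = c123"
  "conj3 t23 t12 = t13" "conj3 t23 t13 = t12" "conj3 t23 t23 = t23" "conj3 t23 c123 = c132" "conj3 t23 c132 = c123"
  "conj3 c123 t12 = t23" "conj3 c123 t13 = t12" "conj3 c123 t23 = t13" "conj3 c123 c123 = c123" "conj3 c123 c132 = c132"
  "conj3 c132 t12 = t13" "conj3 c132 t13 = t23" "conj3 c132 t23 = t12" "conj3 c132 c123 = c123" "conj3 c132 c132 = c132"
  by (simp_all add: conj3_def)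

lemma transps_simps [simp]:
  "t12 \<in> transps" "t13 \<in> transps" "t23 \<in> transps" "1 \<notin> transps" "c123 \<notin> transps" "c132 \<notin> transps"
  by (simp_all add: transps_def)

lemma finite_transps [simp]: "finite transps"
  by (simp add: transps_def)

lemma conj3_mult: "conj3 (g * h) k = conj3 g (conj3 h k)"
  by (simp add: conj3_def perm.inverse_distrib_swap mult.assoc)

lemma conj3_transps [simp]: "conj3 g s \<in> transps \<longleftrightarrow> s \<in> transps"
  using S3_cases[of g] S3_cases[of s] by (elim disjE) simp_all

section \<open>The free algebra\<close>

lemma scal_hom:
  "scal (0::'k::field) = 0" "scal (1::'k) = 1"
  "scal (a + b) = (scal a + scal b :: 'k free)" "scal (a * b) = (scal a * scal b :: 'k free)"
  "scal (- a) = (- scal a :: 'k free)"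
  by (simp_all add: scal_def single_add mult_single single_uminus)

lemma free_induct [case_names single add]:
  fixes p :: "'k::field free"
  assumes "\<And>w c. P (Poly_Mapping.single w c)" and "\<And>p q. P p \<Longrightarrow> P q \<Longrightarrow> P (p + q)"
  shows "P p"
proof (induct p rule: update_induct)
  case const
  show ?case using assms(1)[of _ 0] by simp
next
  case (update f a b)
  have "Poly_Mapping.update a b f = f + Poly_Mapping.single a b"
    using update(1)
    by (auto intro!: poly_mapping_eqI simp: lookup_update lookup_add lookup_single when_def in_keys_iff)
  then show ?case using assms update by simp
qed

lemma scal_central: "scal c * p = p * (scal c :: 'k::field free)"
  by (induct p rule: free_induct) (simp_all add: scal_def mult_single algebra_simps)

lemma single_eq_prod:
  "Poly_Mapping.single w (c::'k::field) = scal c * prod_list (map var (letters w))"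
proof -
  have "prod_list (map var l) = Poly_Mapping.single (Word l) (1::'k)" for l
    by (induct l) (simp_all add: var_def mult_single plus_word_def flip: zero_word_def)
  then show ?thesis by (simp add: scal_def mult_single)
qed

text \<open>
  The free algebra is spanned by products of generators.
\<close>

lemma free_induct_generators [case_names scal var add mult]:
  fixes p :: "'k::field free"
  assumes scal: "\<And>c. P (scal c)" and var: "\<And>a. P (var a)"
    and add: "\<And>p q. P p \<Longrightarrow> P q \<Longrightarrow> P (p + q)"
    and mult: "\<And>p q. P p \<Longrightarrow> P q \<Longrightarrow> P (p * q)"
  shows "P p"
proof (induct p rule: free_induct)
  case (single w c)
  have "P (prod_list (map var l))" for l
    by (induct l) (use scal[of 1] in \<open>auto simp: scal_hom intro: var mult\<close>)
  then show ?case unfolding single_eq_prod by (intro mult scal)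
qed (rule add)

text \<open>
  Linear extensions of functions on words are sums over the support, which changes under addition of
  elements; a common finite superset of the supports makes such sums comparable.
\<close>

lemma sum_keys_superset:
  assumes "finite A" "Poly_Mapping.keys p \<subseteq> A" "\<And>w. f w 0 = 0"
  shows "(\<Sum>w\<in>Poly_Mapping.keys p. f w (Poly_Mapping.lookup p w)) = (\<Sum>w\<in>A. f w (Poly_Mapping.lookup p w))"
  by (rule sum.mono_neutral_left) (use assms in \<open>auto simp: in_keys_iff\<close>)

lemma sum_keys_add:
  assumes "\<And>w. f w 0 = 0" "\<And>w a b. f w (a + b) = f w a + f w b"
  shows "(\<Sum>w\<in>Poly_Mapping.keys (p + q). f w (Poly_Mapping.lookup (p + q) w)) =
    (\<Sum>w\<in>Poly_Mapping.keys p. f w (Poly_Mapping.lookup p w)) +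
    (\<Sum>w\<in>Poly_Mapping.keys q. f w (Poly_Mapping.lookup q w))"
proof -
  let ?A = "Poly_Mapping.keys p \<union> Poly_Mapping.keys q"
  have "Poly_Mapping.keys (p + q) \<subseteq> ?A" by (rule keys_add)
  then show ?thesis
    using sum_keys_superset[of ?A "p + q" f] sum_keys_superset[of ?A p f] sum_keys_superset[of ?A q f] assms
    by (simp add: lookup_add sum.distrib)
qed

section \<open>The algebra \<open>D\<close> as a quotient\<close>

abbreviation free_ring :: "'k::field free ring" where
  "free_ring \<equiv> ring_of_type_algebra"

lemma ring_of_type_algebra_simps [simp]:
  "carrier ring_of_type_algebra = UNIV" "a \<otimes>\<^bsub>ring_of_type_algebra\<^esub> b = a * b"
  "\<one>\<^bsub>ring_of_type_algebra\<^esub> = 1" "\<zero>\<^bsub>ring_of_type_algebra\<^esub> = 0" "a \<oplus>\<^bsub>ring_of_type_algebra\<^esub> b = a + b"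
  by (simp_all add: ring_of_type_algebra_def)

lemma ring_free_ring: "ring (free_ring :: 'k::field free ring)"
proof -
  have "\<exists>y. x + y = 0" for x :: "'k free" by (rule exI[of _ "- x"]) simp
  then show ?thesis
    by unfold_locales (auto simp: algebra_simps Units_def, (metis add.commute)?)
qed

lemma free_ring_minus: "\<ominus>\<^bsub>free_ring\<^esub> p = - (p :: 'k::field free)"
  using ring.ring_simprules(9)[OF ring_free_ring, of p] by (simp add: eq_neg_iff_add_eq_0)

definition D_relations :: "'k::field free set" where
  "D_relations = double_S3_relations \<union> boson_relations xx \<union> boson_relations yy \<union> cross_relations"

lemma D_ideal_ideal: "ideal D_ideal (free_ring :: 'k::field free ring)"
  unfolding D_ideal_def by (rule ring.genideal_ideal[OF ring_free_ring]) simp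

lemma D_ideal_closed:
  "(0 :: 'k::field free) \<in> D_ideal"
  "p \<in> D_ideal \<Longrightarrow> q \<in> D_ideal \<Longrightarrow> p + q \<in> (D_ideal :: 'k::field free set)"
  "p \<in> D_ideal \<Longrightarrow> - p \<in> (D_ideal :: 'k::field free set)"
  "p \<in> D_ideal \<Longrightarrow> p - q \<in> D_ideal \<longleftrightarrow> q \<in> (D_ideal :: 'k::field free set)"
  "p \<in> D_ideal \<Longrightarrow> r * p \<in> (D_ideal :: 'k::field free set)"
  "p \<in> D_ideal \<Longrightarrow> p * r \<in> (D_ideal :: 'k::field free set)"
proof -
  interpret ideal D_ideal "free_ring :: 'k free ring" by (rule D_ideal_ideal)
  show 0: "(0 :: 'k free) \<in> D_ideal" using additive_subgroup.zero_closed[OF additive_subgroup_axioms] by simp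
  show add: "p + q \<in> (D_ideal :: 'k free set)" if "p \<in> D_ideal" "q \<in> D_ideal" for p q
    using additive_subgroup.a_closed[OF additive_subgroup_axioms that] by simp
  show um: "- p \<in> (D_ideal :: 'k free set)" if "p \<in> D_ideal" for p
    using additive_subgroup.a_inv_closed[OF additive_subgroup_axioms that] by (simp add: free_ring_minus)
  show "p - q \<in> D_ideal \<longleftrightarrow> q \<in> (D_ideal :: 'k free set)" if "p \<in> D_ideal" for p q
    using add[OF that um] add[OF um that, of "p - q"] um[of "q - p"]  um[of "- q"] by auto
  show "r * p \<in> (D_ideal :: 'k free set)" if "p \<in> D_ideal" for p r
    using I_l_closed[OF that, of r] by simp
  show "p * r \<in> (D_ideal :: 'k free set)" if "p \<in> D_ideal" for p r
    using I_r_closed[OF that, of r] by simp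
qed

lemma D_relations_in_ideal: "p \<in> D_relations \<Longrightarrow> (p :: 'k::field free) \<in> D_ideal"
  using ring.genideal_self[OF ring_free_ring, of D_relations] unfolding D_ideal_def D_relations_def by auto

text \<open>
  To see that a map out of the free algebra factors over \<open>D\<close>, one shows that its kernel is a
  two-sided ideal containing the relations.
\<close>

lemma D_ideal_least:
  fixes J :: "'k::field free set"
  assumes rel: "D_relations \<subseteq> J" and zero: "0 \<in> J"
    and diff: "\<And>p q. p \<in> J \<Longrightarrow> q \<in> J \<Longrightarrow> p - q \<in> J"
    and left: "\<And>p r. p \<in> J \<Longrightarrow> r * p \<in> J" and right: "\<And>p r. p \<in> J \<Longrightarrow> p * r \<in> J"
  shows "D_ideal \<subseteq> J"
proof -
  have um: "- p \<in> J" if "p \<in> J" for p using diff[OF zero that] by simp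
  have add: "p + q \<in> J" if "p \<in> J" "q \<in> J" for p q using diff[OF that(1) um[OF that(2)]] by simp
  have "ideal J (free_ring :: 'k free ring)"
  proof (rule idealI[OF ring_free_ring])
    show "subgroup J (add_monoid free_ring)"
    proof (rule subgroup.intro)
      show "inv\<^bsub>add_monoid free_ring\<^esub> x \<in> J" if "x \<in> J" for x
        using um[OF that] by (simp only: free_ring_minus flip: a_inv_def)
    qed (use assms(2) add in auto)
  qed (auto intro: left right)
  then show ?thesis
    unfolding D_ideal_def using rel unfolding D_relations_def by (rule ring.genideal_minimal[OF ring_free_ring])
qed

lemma cls_def': "cls p = {q. q - p \<in> (D_ideal :: 'k::field free set)}"
  unfolding cls_def a_r_coset_def'
  by (auto simp: image_iff algebra_simps)

lemma cls_eq_iff: "cls p = cls q \<longleftrightarrow> p - q \<in> (D_ideal :: 'k::field free set)"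
proof
  assume "cls p = cls q"
  moreover have "p \<in> cls p" by (simp add: cls_def' D_ideal_closed)
  ultimately show "p - q \<in> D_ideal" by (simp add: cls_def')
next
  assume *: "p - q \<in> D_ideal"
  have "r - p \<in> D_ideal \<longleftrightarrow> r - q \<in> D_ideal" for r
    using D_ideal_closed(2)[OF *, of "r - p"] D_ideal_closed(2)[OF D_ideal_closed(3)[OF *], of "r - q"]
    by (auto simp: algebra_simps)
  then show "cls p = cls q" by (simp add: cls_def')
qed

lemma cls_self: "p \<in> cls (p :: 'k::field free)"
  by (simp add: cls_def' D_ideal_closed)

lemma carrier_DD: "carrier (DD :: 'k::field free set ring) = range cls"
  unfolding DD_def FactRing_def A_RCOSETS_def' cls_def by auto

lemma cls_in_DD [simp, intro]: "cls p \<in> carrier (DD :: 'k::field free set ring)"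
  by (simp add: carrier_DD)

lemma DD_carrierE:
  assumes "d \<in> carrier (DD :: 'k::field free set ring)"
  obtains p where "d = cls p"
  using assms by (auto simp: carrier_DD)

lemma ring_DD: "ring (DD :: 'k::field free set ring)"
  unfolding DD_def by (rule ideal.quotient_is_ring[OF D_ideal_ideal])

lemma DD_simps:
  "\<zero>\<^bsub>DD\<^esub> = (cls 0 :: 'k::field free set)" "\<one>\<^bsub>DD\<^esub> = (cls 1 :: 'k::field free set)"
  "cls p \<oplus>\<^bsub>DD\<^esub> cls q = (cls (p + q) :: 'k::field free set)"
  "cls p \<otimes>\<^bsub>DD\<^esub> cls q = (cls (p * q) :: 'k::field free set)"
proof -
  interpret ideal D_ideal "free_ring :: 'k free ring" by (rule D_ideal_ideal)
  show "\<zero>\<^bsub>DD\<^esub> = (cls 0 :: 'k free set)"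
    by (auto simp: DD_def FactRing_def cls_def')
  show "\<one>\<^bsub>DD\<^esub> = (cls 1 :: 'k free set)" by (simp add: DD_def FactRing_def cls_def)
  show "cls p \<oplus>\<^bsub>DD\<^esub> cls q = (cls (p + q) :: 'k free set)"
    using a_rcos_sum[of p q] by (simp add: DD_def FactRing_def cls_def)
  show "cls p \<otimes>\<^bsub>DD\<^esub> cls q = (cls (p * q) :: 'k free set)"
    using rcoset_mult_add[of p q] by (simp add: DD_def FactRing_def cls_def)
qed

lemma DD_minus: "\<ominus>\<^bsub>DD\<^esub> cls p = (cls (- p) :: 'k::field free set)"
proof -
  interpret ring "DD :: 'k free set ring" by (rule ring_DD)
  show ?thesis by (rule minus_equality) (simp_all add: DD_simps)
qed

lemma cls_cong:
  assumes "cls p = cls p'" "cls q = cls (q' :: 'k::field free)"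
  shows "cls (p + q) = cls (p' + q')" "cls (p * q) = cls (p' * q')" "cls (- p) = cls (- p')"
    "cls (p - q) = cls (p' - q')"
  using assms by (metis DD_simps DD_minus diff_conv_add_uminus)+

lemma cls_rel: "p - q \<in> D_relations \<Longrightarrow> cls p = cls (q :: 'k::field free)"
  by (simp add: cls_eq_iff D_relations_in_ideal)

section \<open>Left modules, submodules and quotients\<close>

lemma (in abelian_group) a_inv_zero [simp]: "\<ominus> \<zero> = \<zero>"
  using add.inv_one by (simp add: a_inv_def)

lemma (in abelian_group) a_minus_eq_zeroD: "\<lbrakk>x \<ominus> y = \<zero>; x \<in> carrier G; y \<in> carrier G\<rbrakk> \<Longrightarrow> x = y"
  by (metis a_inv_closed minus_eq minus_equality minus_minus)

lemma left_moduleI: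
  assumes "ring R"
    and "\<zero>\<^bsub>M\<^esub> \<in> carrier M" "\<And>x y. \<lbrakk>x \<in> carrier M; y \<in> carrier M\<rbrakk> \<Longrightarrow> x \<oplus>\<^bsub>M\<^esub> y \<in> carrier M"
    and "\<And>x y z. \<lbrakk>x \<in> carrier M; y \<in> carrier M; z \<in> carrier M\<rbrakk> \<Longrightarrow> (x \<oplus>\<^bsub>M\<^esub> y) \<oplus>\<^bsub>M\<^esub> z = x \<oplus>\<^bsub>M\<^esub> (y \<oplus>\<^bsub>M\<^esub> z)"
    and "\<And>x y. \<lbrakk>x \<in> carrier M; y \<in> carrier M\<rbrakk> \<Longrightarrow> x \<oplus>\<^bsub>M\<^esub> y = y \<oplus>\<^bsub>M\<^esub> x"
    and "\<And>x. x \<in> carrier M \<Longrightarrow> \<zero>\<^bsub>M\<^esub> \<oplus>\<^bsub>M\<^esub> x = x"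
    and "\<And>x. x \<in> carrier M \<Longrightarrow> \<exists>y\<in>carrier M. y \<oplus>\<^bsub>M\<^esub> x = \<zero>\<^bsub>M\<^esub>"
    and "\<And>a x. \<lbrakk>a \<in> carrier R; x \<in> carrier M\<rbrakk> \<Longrightarrow> a \<odot>\<^bsub>M\<^esub> x \<in> carrier M"
    and "\<And>a b x. \<lbrakk>a \<in> carrier R; b \<in> carrier R; x \<in> carrier M\<rbrakk> \<Longrightarrow>
       (a \<oplus>\<^bsub>R\<^esub> b) \<odot>\<^bsub>M\<^esub> x = a \<odot>\<^bsub>M\<^esub> x \<oplus>\<^bsub>M\<^esub> b \<odot>\<^bsub>M\<^esub> x"
    and "\<And>a x y. \<lbrakk>a \<in> carrier R; x \<in> carrier M; y \<in> carrier M\<rbrakk> \<Longrightarrow>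
       a \<odot>\<^bsub>M\<^esub> (x \<oplus>\<^bsub>M\<^esub> y) = a \<odot>\<^bsub>M\<^esub> x \<oplus>\<^bsub>M\<^esub> a \<odot>\<^bsub>M\<^esub> y"
    and "\<And>a b x. \<lbrakk>a \<in> carrier R; b \<in> carrier R; x \<in> carrier M\<rbrakk> \<Longrightarrow>
       (a \<otimes>\<^bsub>R\<^esub> b) \<odot>\<^bsub>M\<^esub> x = a \<odot>\<^bsub>M\<^esub> (b \<odot>\<^bsub>M\<^esub> x)"
    and "\<And>x. x \<in> carrier M \<Longrightarrow> \<one>\<^bsub>R\<^esub> \<odot>\<^bsub>M\<^esub> x = x"
  shows "left_module R M"
proof -
  have "abelian_group M" by (rule abelian_groupI) (fact assms)+
  then show ?thesis
    using assms by (auto intro!: left_module.intro left_module_axioms.intro)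
qed

context left_module
begin

lemma smult_zero_left: "x \<in> carrier M \<Longrightarrow> \<zero> \<odot>\<^bsub>M\<^esub> x = \<zero>\<^bsub>M\<^esub>"
  using smult_l_distr[of \<zero> \<zero> x] smult_closed[of \<zero> x]
  by (metis M.add.l_cancel_one R.l_zero R.zero_closed)

lemma smult_zero_right: "a \<in> carrier R \<Longrightarrow> a \<odot>\<^bsub>M\<^esub> \<zero>\<^bsub>M\<^esub> = \<zero>\<^bsub>M\<^esub>"
  using smult_r_distr[of a "\<zero>\<^bsub>M\<^esub>" "\<zero>\<^bsub>M\<^esub>"] smult_closed[of a "\<zero>\<^bsub>M\<^esub>"]
  by (metis M.add.l_cancel_one M.l_zero M.zero_closed)

lemma smult_minus_left: "\<lbrakk>a \<in> carrier R; x \<in> carrier M\<rbrakk> \<Longrightarrow> (\<ominus> a) \<odot>\<^bsub>M\<^esub> x = \<ominus>\<^bsub>M\<^esub> (a \<odot>\<^bsub>M\<^esub> x)"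
  using smult_l_distr[of "\<ominus> a" a x] smult_closed[of a x] smult_closed[of "\<ominus> a" x]
  by (metis M.minus_equality R.a_inv_closed R.l_neg smult_zero_left)

lemma smult_minus_right: "\<lbrakk>a \<in> carrier R; x \<in> carrier M\<rbrakk> \<Longrightarrow> a \<odot>\<^bsub>M\<^esub> (\<ominus>\<^bsub>M\<^esub> x) = \<ominus>\<^bsub>M\<^esub> (a \<odot>\<^bsub>M\<^esub> x)"
  using smult_r_distr[of a "\<ominus>\<^bsub>M\<^esub> x" x] smult_closed[of a x] smult_closed[of a "\<ominus>\<^bsub>M\<^esub> x"]
  by (metis M.minus_equality M.a_inv_closed M.l_neg smult_zero_right)

lemma submoduleI:
  assumes "N \<subseteq> carrier M" "\<zero>\<^bsub>M\<^esub> \<in> N" "\<And>x y. \<lbrakk>x \<in> N; y \<in> N\<rbrakk> \<Longrightarrow> x \<oplus>\<^bsub>M\<^esub> y \<in> N"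
    "\<And>a x. \<lbrakk>a \<in> carrier R; x \<in> N\<rbrakk> \<Longrightarrow> a \<odot>\<^bsub>M\<^esub> x \<in> N"
  shows "submodule N R M"
proof (intro submodule.intro submodule_axioms.intro subgroup.intro)
  fix x assume "x \<in> N"
  then have "\<ominus>\<^bsub>M\<^esub> x = (\<ominus> \<one>) \<odot>\<^bsub>M\<^esub> x"
    using smult_minus_left[of \<one> x] smult_one[of x] assms(1) by auto
  then show "inv\<^bsub>add_monoid M\<^esub> x \<in> N"
    using assms(4)[OF _ \<open>x \<in> N\<close>] by (simp flip: a_inv_def)
qed (use assms in auto)

lemma submoduleD:
  assumes "submodule N R M"
  shows "N \<subseteq> carrier M" "\<zero>\<^bsub>M\<^esub> \<in> N" "\<And>x y. \<lbrakk>x \<in> N; y \<in> N\<rbrakk> \<Longrightarrow> x \<oplus>\<^bsub>M\<^esub> y \<in> N"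
    "\<And>a x. \<lbrakk>a \<in> carrier R; x \<in> N\<rbrakk> \<Longrightarrow> a \<odot>\<^bsub>M\<^esub> x \<in> N" "\<And>x. x \<in> N \<Longrightarrow> \<ominus>\<^bsub>M\<^esub> x \<in> N"
proof -
  have sg: "subgroup N (add_monoid M)" using assms by (rule submodule.axioms)
  show "N \<subseteq> carrier M" "\<zero>\<^bsub>M\<^esub> \<in> N" "\<And>x y. \<lbrakk>x \<in> N; y \<in> N\<rbrakk> \<Longrightarrow> x \<oplus>\<^bsub>M\<^esub> y \<in> N"
    using subgroup.subset[OF sg] subgroup.one_closed[OF sg] subgroup.m_closed[OF sg] by auto
  show "\<And>x. x \<in> N \<Longrightarrow> \<ominus>\<^bsub>M\<^esub> x \<in> N" using subgroup.m_inv_closed[OF sg] by (simp add: a_inv_def)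
  show "\<And>a x. \<lbrakk>a \<in> carrier R; x \<in> N\<rbrakk> \<Longrightarrow> a \<odot>\<^bsub>M\<^esub> x \<in> N"
    using submodule.smult_closed[OF assms] by auto
qed

lemma carrier_submodule: "submodule (carrier M) R M"
  by (rule submoduleI) (auto intro: smult_closed)

lemma submodule_Inter:
  assumes "\<F> \<noteq> {}" "\<And>N. N \<in> \<F> \<Longrightarrow> submodule N R M"
  shows "submodule (\<Inter>\<F>) R M"
proof (rule submoduleI)
  show "\<Inter>\<F> \<subseteq> carrier M" using assms submoduleD(1) by blast
qed (use assms submoduleD(2-4) in blast)+

lemma submodule_abelian_subgroup:
  assumes "submodule N R M" shows "abelian_subgroup N M"
  using assms submodule.axioms(1)
  by (intro abelian_subgroupI3 additive_subgroupI) (auto intro: M.abelian_group_axioms)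

lemma left_module_restrict:
  assumes "submodule N R M"
  shows "left_module R (M\<lparr>carrier := N\<rparr>)"
proof (rule left_moduleI)
  note N = submoduleD[OF assms]
  note in_M = subsetD[OF N(1)]
  show "\<exists>y\<in>carrier (M\<lparr>carrier := N\<rparr>). y \<oplus>\<^bsub>M\<lparr>carrier := N\<rparr>\<^esub> x = \<zero>\<^bsub>M\<lparr>carrier := N\<rparr>\<^esub>"
    if "x \<in> carrier (M\<lparr>carrier := N\<rparr>)" for x
    using that N(5)[of x] in_M[of x] by (auto intro!: bexI[of _ "\<ominus>\<^bsub>M\<^esub> x"] simp: M.l_neg)
qed (use submoduleD[OF assms] R.ring_axioms in
    \<open>auto simp: M.add.m_assoc M.add.m_comm M.add.m_lcomm subset_iff smult_l_distr smult_r_distr smult_assoc1 smult_one\<close>)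

end

context
  fixes R :: "('r, 'q) ring_scheme" and M :: "('r, 'v) module"
  assumes RM: "left_module R M"
begin

interpretation left_module R M by (rule RM)

lemma gen_submodule_submodule:
  assumes "S \<subseteq> carrier M"
  shows "submodule (gen_submodule R M S) R M"
  unfolding gen_submodule_def using assms carrier_submodule by (intro submodule_Inter) auto

lemma gen_submodule_superset: "S \<subseteq> gen_submodule R M S"
  unfolding gen_submodule_def by auto

lemma submodule_socle: "submodule (socle R M) R M"
  unfolding socle_def by (rule gen_submodule_submodule) (use submoduleD(1) simple_submodule_def in blast)

lemma submodule_mod_radical: "submodule (mod_radical R M) R M"
proof -
  have "mod_radical R M = \<Inter>(insert (carrier M) {S. maximal_submodule R M S})"
    by (auto simp: mod_radical_def)
  then show ?thesis
    using carrier_submodule by (simp only:) (rule submodule_Inter, auto simp: maximal_submodule_def)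
qed

end

text \<open>
  The quotient by a submodule is described through representatives: the operations of the
  quotient are given on cosets \<open>N + x\<close>, and \<open>coset_eq_iff\<close> decides equality.
\<close>

locale module_with_submodule = left_module R M for R :: "('r, 'q) ring_scheme" (structure)
    and M :: "('r, 'v) module" (structure) +
  fixes N :: "'v set"
  assumes N: "submodule N R M"
begin

lemmas N_simps = submoduleD[OF N]

lemma in_N_carrier: "x \<in> N \<Longrightarrow> x \<in> carrier M" using N_simps(1) by auto

interpretation S: abelian_subgroup N M by (rule submodule_abelian_subgroup[OF N])

lemma coset_eq_iff: "\<lbrakk>x \<in> carrier M; y \<in> carrier M\<rbrakk> \<Longrightarrow> N +>\<^bsub>M\<^esub> x = N +>\<^bsub>M\<^esub> y \<longleftrightarrow> x \<ominus>\<^bsub>M\<^esub> y \<in> N"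
proof -
  assume xy: "x \<in> carrier M" "y \<in> carrier M"
  have "N +>\<^bsub>M\<^esub> x = N +>\<^bsub>M\<^esub> y \<longleftrightarrow> x \<in> N +>\<^bsub>M\<^esub> y"
    using S.a_rcos_self[OF xy(1)] S.a_repr_independence'[of x y] xy by auto
  also have "\<dots> \<longleftrightarrow> x \<ominus>\<^bsub>M\<^esub> y \<in> N"
    using S.a_rcos_module[OF xy(2,1)] by (simp add: M.minus_eq)
  finally show ?thesis .
qed

lemma coset_eq_zero_iff: "x \<in> carrier M \<Longrightarrow> N +>\<^bsub>M\<^esub> x = N \<longleftrightarrow> x \<in> N"
  using coset_eq_iff[of x "\<zero>\<^bsub>M\<^esub>"] by (simp add: M.minus_eq N_simps a_inv_def)

lemma coset_self: "x \<in> carrier M \<Longrightarrow> x \<in> N +>\<^bsub>M\<^esub> x"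
  by (rule S.a_rcos_self)

lemma coset_mem: "\<lbrakk>x \<in> carrier M; y \<in> N +>\<^bsub>M\<^esub> x\<rbrakk> \<Longrightarrow> y \<in> carrier M \<and> N +>\<^bsub>M\<^esub> y = N +>\<^bsub>M\<^esub> x"
  using S.a_repr_independence'[of y x] S.a_elemrcos_carrier[of x y] by auto

lemma quot_carrier: "carrier (quot_module M N) = {N +>\<^bsub>M\<^esub> x | x. x \<in> carrier M}"
  by (auto simp: quot_module_def A_RCOSETS_def')

lemma quot_zero: "\<zero>\<^bsub>quot_module M N\<^esub> = N"
  by (simp add: quot_module_def)

lemma quot_add:
  "\<lbrakk>x \<in> carrier M; y \<in> carrier M\<rbrakk> \<Longrightarrow> (N +>\<^bsub>M\<^esub> x) \<oplus>\<^bsub>quot_module M N\<^esub> (N +>\<^bsub>M\<^esub> y) = N +>\<^bsub>M\<^esub> (x \<oplus>\<^bsub>M\<^esub> y)"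
  using S.a_rcos_sum by (simp add: quot_module_def)

lemma quot_smult:
  assumes "r \<in> carrier R" "x \<in> carrier M"
  shows "r \<odot>\<^bsub>quot_module M N\<^esub> (N +>\<^bsub>M\<^esub> x) = N +>\<^bsub>M\<^esub> (r \<odot>\<^bsub>M\<^esub> x)"
proof -
  have "N +>\<^bsub>M\<^esub> (r \<odot>\<^bsub>M\<^esub> y) = N +>\<^bsub>M\<^esub> (r \<odot>\<^bsub>M\<^esub> x)" if "y \<in> N +>\<^bsub>M\<^esub> x" for y
  proof -
    have y: "y \<in> carrier M" "y \<ominus>\<^bsub>M\<^esub> x \<in> N"
      using coset_mem[OF assms(2) that] coset_eq_iff assms(2) by auto
    have "r \<odot>\<^bsub>M\<^esub> y \<ominus>\<^bsub>M\<^esub> r \<odot>\<^bsub>M\<^esub> x = r \<odot>\<^bsub>M\<^esub> (y \<ominus>\<^bsub>M\<^esub> x)"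
      using assms y by (simp add: M.minus_eq smult_r_distr smult_minus_right)
    then show ?thesis
      using assms y by (subst coset_eq_iff) (auto simp: smult_closed N_simps)
  qed
  then have "(\<Union>v\<in>N +>\<^bsub>M\<^esub> x. N +>\<^bsub>M\<^esub> (r \<odot>\<^bsub>M\<^esub> v)) = (\<Union>v\<in>N +>\<^bsub>M\<^esub> x. N +>\<^bsub>M\<^esub> (r \<odot>\<^bsub>M\<^esub> x))"
    by (intro SUP_cong refl)
  also have "\<dots> = N +>\<^bsub>M\<^esub> (r \<odot>\<^bsub>M\<^esub> x)"
    using coset_self[OF assms(2)] by blast
  finally show ?thesis by (simp only: quot_module_def module.simps)
qed

lemma left_module_quot: "left_module R (quot_module M N)"
proof (rule left_moduleI)
  show "\<zero>\<^bsub>quot_module M N\<^esub> \<in> carrier (quot_module M N)"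
    unfolding quot_carrier quot_zero using coset_eq_zero_iff[of "\<zero>\<^bsub>M\<^esub>"] N_simps(2) M.zero_closed by blast
  show "\<zero>\<^bsub>quot_module M N\<^esub> \<oplus>\<^bsub>quot_module M N\<^esub> C = C" if "C \<in> carrier (quot_module M N)" for C
  proof -
    have z: "N = N +>\<^bsub>M\<^esub> \<zero>\<^bsub>M\<^esub>" using coset_eq_zero_iff[of "\<zero>\<^bsub>M\<^esub>"] N_simps(2) by simp
    obtain x where x: "x \<in> carrier M" "C = N +>\<^bsub>M\<^esub> x" using \<open>C \<in> _\<close> unfolding quot_carrier by auto
    show ?thesis using quot_add[of "\<zero>\<^bsub>M\<^esub>" x] x(1) z[symmetric] by (simp add: x(2) quot_zero)
  qed
  show "\<exists>C1\<in>carrier (quot_module M N). C1 \<oplus>\<^bsub>quot_module M N\<^esub> C = \<zero>\<^bsub>quot_module M N\<^esub>"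
    if "C \<in> carrier (quot_module M N)" for C
  proof -
    have z: "N +>\<^bsub>M\<^esub> \<zero>\<^bsub>M\<^esub> = N" using coset_eq_zero_iff[of "\<zero>\<^bsub>M\<^esub>"] N_simps(2) by simp
    obtain x where x: "x \<in> carrier M" "C = N +>\<^bsub>M\<^esub> x" using \<open>C \<in> _\<close> unfolding quot_carrier by auto
    have "N +>\<^bsub>M\<^esub> (\<ominus>\<^bsub>M\<^esub> x) \<in> carrier (quot_module M N)" using x by (auto simp: quot_carrier)
    moreover have "(N +>\<^bsub>M\<^esub> (\<ominus>\<^bsub>M\<^esub> x)) \<oplus>\<^bsub>quot_module M N\<^esub> C = \<zero>\<^bsub>quot_module M N\<^esub>"
      using x z by (simp add: quot_add quot_zero M.l_neg)
    ultimately show ?thesis by blast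
  qed
  fix C C1 C2 a b
  assume c: "C \<in> carrier (quot_module M N)"
  then obtain x where x: "x \<in> carrier M" "C = N +>\<^bsub>M\<^esub> x" unfolding quot_carrier by auto
  show "a \<odot>\<^bsub>quot_module M N\<^esub> C \<in> carrier (quot_module M N)" if "a \<in> carrier R"
    using that x by (auto simp: quot_smult quot_carrier smult_closed)
  show "\<one> \<odot>\<^bsub>quot_module M N\<^esub> C = C" using x by (simp add: quot_smult smult_one)
  show "(a \<oplus> b) \<odot>\<^bsub>quot_module M N\<^esub> C = a \<odot>\<^bsub>quot_module M N\<^esub> C \<oplus>\<^bsub>quot_module M N\<^esub> b \<odot>\<^bsub>quot_module M N\<^esub> C"
    "(a \<otimes> b) \<odot>\<^bsub>quot_module M N\<^esub> C = a \<odot>\<^bsub>quot_module M N\<^esub> (b \<odot>\<^bsub>quot_module M N\<^esub> C)"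
    if "a \<in> carrier R" "b \<in> carrier R"
    using that x by (auto simp: quot_smult quot_add smult_l_distr smult_assoc1 smult_closed)
  assume "C1 \<in> carrier (quot_module M N)"
  then obtain y where y: "y \<in> carrier M" "C1 = N +>\<^bsub>M\<^esub> y" unfolding quot_carrier by auto
  show "C \<oplus>\<^bsub>quot_module M N\<^esub> C1 \<in> carrier (quot_module M N)" using x y by (auto simp: quot_add quot_carrier)
  show "C \<oplus>\<^bsub>quot_module M N\<^esub> C1 = C1 \<oplus>\<^bsub>quot_module M N\<^esub> C" using x y by (simp add: quot_add M.a_comm)
  show "a \<odot>\<^bsub>quot_module M N\<^esub> (C \<oplus>\<^bsub>quot_module M N\<^esub> C1) =
      a \<odot>\<^bsub>quot_module M N\<^esub> C \<oplus>\<^bsub>quot_module M N\<^esub> a \<odot>\<^bsub>quot_module M N\<^esub> C1" if "a \<in> carrier R"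
    using that x y by (simp add: quot_smult quot_add smult_r_distr smult_closed)
  assume "C2 \<in> carrier (quot_module M N)"
  then obtain z where z: "z \<in> carrier M" "C2 = N +>\<^bsub>M\<^esub> z" unfolding quot_carrier by auto
  show "C \<oplus>\<^bsub>quot_module M N\<^esub> C1 \<oplus>\<^bsub>quot_module M N\<^esub> C2 = C \<oplus>\<^bsub>quot_module M N\<^esub> (C1 \<oplus>\<^bsub>quot_module M N\<^esub> C2)"
    using x y z by (simp add: quot_add M.a_assoc)
qed (rule R.ring_axioms)

end

lemma module_with_submoduleI:
  "left_module R M \<Longrightarrow> submodule N R M \<Longrightarrow> module_with_submodule R M N"
  by (simp add: module_with_submodule_def module_with_submodule_axioms_def)

section \<open>Homomorphisms and direct sums\<close>

lemma mod_homD: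
  assumes "f \<in> mod_hom R M N"
  shows "x \<in> carrier M \<Longrightarrow> f x \<in> carrier N"
    "\<lbrakk>x \<in> carrier M; y \<in> carrier M\<rbrakk> \<Longrightarrow> f (x \<oplus>\<^bsub>M\<^esub> y) = f x \<oplus>\<^bsub>N\<^esub> f y"
    "\<lbrakk>r \<in> carrier R; x \<in> carrier M\<rbrakk> \<Longrightarrow> f (r \<odot>\<^bsub>M\<^esub> x) = r \<odot>\<^bsub>N\<^esub> f x"
  using assms by (auto simp: mod_hom_def)

lemma mod_hom_zero:
  assumes "f \<in> mod_hom R M N" "left_module R M" "left_module R N"
  shows "f \<zero>\<^bsub>M\<^esub> = \<zero>\<^bsub>N\<^esub>"
proof -
  interpret M: left_module R M by fact
  interpret N: left_module R N by fact
  have "f (\<zero>\<^bsub>R\<^esub> \<odot>\<^bsub>M\<^esub> \<zero>\<^bsub>M\<^esub>) = \<zero>\<^bsub>R\<^esub> \<odot>\<^bsub>N\<^esub> f \<zero>\<^bsub>M\<^esub>" using mod_homD[OF assms(1)] by simp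
  then show ?thesis using mod_homD[OF assms(1)] by (simp add: M.smult_zero_left N.smult_zero_left)
qed

lemma mod_hom_minus:
  assumes "f \<in> mod_hom R M N" "left_module R M" "left_module R N" "x \<in> carrier M"
  shows "f (\<ominus>\<^bsub>M\<^esub> x) = \<ominus>\<^bsub>N\<^esub> f x"
proof -
  interpret M: left_module R M by fact
  interpret N: left_module R N by fact
  have "f (\<ominus>\<^bsub>M\<^esub> x) \<oplus>\<^bsub>N\<^esub> f x = \<zero>\<^bsub>N\<^esub>"
    using mod_homD(2)[OF assms(1), of "\<ominus>\<^bsub>M\<^esub> x" x] assms mod_hom_zero[OF assms(1-3)]
    by (simp add: M.M.l_neg)
  then show ?thesis using mod_homD(1)[OF assms(1)] assms(4) by (metis N.M.minus_equality M.M.a_inv_closed)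
qed

lemma mod_hom_diff:
  assumes "f \<in> mod_hom R M N" "left_module R M" "left_module R N" "x \<in> carrier M" "y \<in> carrier M"
  shows "f (x \<ominus>\<^bsub>M\<^esub> y) = f x \<ominus>\<^bsub>N\<^esub> f y"
proof -
  interpret M: left_module R M by fact
  interpret N: left_module R N by fact
  show ?thesis
    using assms mod_hom_minus[OF assms(1-3), of y] mod_homD(2)[OF assms(1)]
    by (simp add: M.M.minus_eq N.M.minus_eq)
qed

lemma mod_iso_sym:
  assumes "mod_iso R M N" "left_module R M"
  shows "mod_iso R N M"
proof -
  interpret M: left_module R M by fact
  obtain f where f: "f \<in> mod_hom R M N" "bij_betw f (carrier M) (carrier N)"
    using assms unfolding mod_iso_def by auto
  note h = mod_homD[OF f(1)]
  let ?g = "inv_into (carrier M) f"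
  have g: "?g y \<in> carrier M" "f (?g y) = y" if "y \<in> carrier N" for y
    using that f(2) by (auto simp: bij_betw_def inv_into_into f_inv_into_f)
  have eqI: "x = y" if "f x = f y" "x \<in> carrier M" "y \<in> carrier M" for x y
    using that f(2) by (auto simp: bij_betw_def inj_on_def)
  have cl: "x \<oplus>\<^bsub>N\<^esub> y \<in> carrier N" if "x \<in> carrier N" "y \<in> carrier N" for x y
    using that h(1)[of "?g x \<oplus>\<^bsub>M\<^esub> ?g y"] h(2)[of "?g x" "?g y"] g by simp
  have cl2: "r \<odot>\<^bsub>N\<^esub> y \<in> carrier N" if "r \<in> carrier R" "y \<in> carrier N" for r y
    using that h(1)[of "r \<odot>\<^bsub>M\<^esub> ?g y"] h(3)[of r "?g y"] g by (simp add: M.smult_closed)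
  have "?g \<in> mod_hom R N M"
    unfolding mod_hom_def using g cl cl2 by (auto intro!: eqI simp: h M.smult_closed)
  moreover have "bij_betw ?g (carrier N) (carrier M)" using f(2) by (rule bij_betw_inv_into)
  ultimately show ?thesis unfolding mod_iso_def by blast
qed

lemma dsum_simps [simp]:
  "carrier (dsum_module M N) = carrier M \<times> carrier N" "\<zero>\<^bsub>dsum_module M N\<^esub> = (\<zero>\<^bsub>M\<^esub>, \<zero>\<^bsub>N\<^esub>)"
  "(x, y) \<oplus>\<^bsub>dsum_module M N\<^esub> (x', y') = (x \<oplus>\<^bsub>M\<^esub> x', y \<oplus>\<^bsub>N\<^esub> y')"
  "r \<odot>\<^bsub>dsum_module M N\<^esub> (x, y) = (r \<odot>\<^bsub>M\<^esub> x, r \<odot>\<^bsub>N\<^esub> y)"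
  by (simp_all add: dsum_module_def)

lemma left_module_dsum:
  assumes "left_module R M" "left_module R N"
  shows "left_module R (dsum_module M N)"
proof -
  interpret M: left_module R M by fact
  interpret N: left_module R N by fact
  show ?thesis
  proof (rule left_moduleI)
    show "\<exists>y\<in>carrier (dsum_module M N). y \<oplus>\<^bsub>dsum_module M N\<^esub> x = \<zero>\<^bsub>dsum_module M N\<^esub>"
      if "x \<in> carrier (dsum_module M N)" for x
      using that by (cases x) (auto intro!: bexI[of _ "(\<ominus>\<^bsub>M\<^esub> fst x, \<ominus>\<^bsub>N\<^esub> snd x)"] simp: M.M.l_neg N.M.l_neg)
  qed (auto simp: M.M.add.m_ac N.M.add.m_ac M.smult_closed N.smult_closed M.smult_l_distr
      N.smult_l_distr M.smult_r_distr N.smult_r_distr M.smult_assoc1 N.smult_assoc1 M.smult_one N.smult_one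
      M.R.ring_axioms)
qed

lemma dsum_minus:
  assumes "left_module R M" "left_module R N" "x \<in> carrier M" "y \<in> carrier N"
  shows "\<ominus>\<^bsub>dsum_module M N\<^esub> (x, y) = (\<ominus>\<^bsub>M\<^esub> x, \<ominus>\<^bsub>N\<^esub> y)"
proof -
  interpret M: left_module R M by fact
  interpret N: left_module R N by fact
  interpret S: left_module R "dsum_module M N" by (rule left_module_dsum) fact+
  show ?thesis using assms(3,4) by (intro S.M.minus_equality) (auto simp: M.M.l_neg N.M.l_neg)
qed

section \<open>Extensions: multiples and Baer sums\<close>

lemma short_exactD:
  assumes "short_exact R A (i, E, p) B"
  shows "left_module R A" "left_module R E" "left_module R B" "i \<in> mod_hom R A E" "p \<in> mod_hom R E B"
    "\<And>a b. \<lbrakk>i a = i b; a \<in> carrier A; b \<in> carrier A\<rbrakk> \<Longrightarrow> a = b"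
    "\<And>b. b \<in> carrier B \<Longrightarrow> \<exists>x\<in>carrier E. p x = b"
    "\<And>a. a \<in> carrier A \<Longrightarrow> p (i a) = \<zero>\<^bsub>B\<^esub>"
    "\<And>x. \<lbrakk>x \<in> carrier E; p x = \<zero>\<^bsub>B\<^esub>\<rbrakk> \<Longrightarrow> \<exists>a\<in>carrier A. x = i a"
proof -
  note d = assms[unfolded short_exact_def prod.case]
  show "left_module R A" "left_module R E" "left_module R B" "i \<in> mod_hom R A E" "p \<in> mod_hom R E B"
    "\<And>a b. \<lbrakk>i a = i b; a \<in> carrier A; b \<in> carrier A\<rbrakk> \<Longrightarrow> a = b"
    using d by (auto simp: inj_on_def)
  have ker: "i ` carrier A = {x \<in> carrier E. p x = \<zero>\<^bsub>B\<^esub>}" and im: "p ` carrier E = carrier B" using d by auto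
  show "\<exists>x\<in>carrier E. p x = b" if "b \<in> carrier B" for b
    using that unfolding im[symmetric] by auto
  show "p (i a) = \<zero>\<^bsub>B\<^esub>" if "a \<in> carrier A" for a
    using imageI[OF that, of i] unfolding ker by simp
  show "\<exists>a\<in>carrier A. x = i a" if "x \<in> carrier E" "p x = \<zero>\<^bsub>B\<^esub>" for x
  proof -
    have "x \<in> i ` carrier A" unfolding ker using that by simp
    then show ?thesis by auto
  qed
qed

lemma short_exactI:
  assumes "left_module R A" "left_module R E" "left_module R B" "i \<in> mod_hom R A E" "p \<in> mod_hom R E B"
    and ker: "\<And>a. \<lbrakk>a \<in> carrier A; i a = \<zero>\<^bsub>E\<^esub>\<rbrakk> \<Longrightarrow> a = \<zero>\<^bsub>A\<^esub>"
    and surj: "\<And>b. b \<in> carrier B \<Longrightarrow> \<exists>x\<in>carrier E. p x = b"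
    and comp: "\<And>a. a \<in> carrier A \<Longrightarrow> p (i a) = \<zero>\<^bsub>B\<^esub>"
    and exact: "\<And>x. \<lbrakk>x \<in> carrier E; p x = \<zero>\<^bsub>B\<^esub>\<rbrakk> \<Longrightarrow> \<exists>a\<in>carrier A. x = i a"
  shows "short_exact R A (i, E, p) B"
proof -
  interpret A: left_module R A by fact
  interpret E: left_module R E by fact
  have "inj_on i (carrier A)"
  proof (rule inj_onI)
    fix a b assume ab: "a \<in> carrier A" "b \<in> carrier A" "i a = i b"
    then have "i (a \<ominus>\<^bsub>A\<^esub> b) = \<zero>\<^bsub>E\<^esub>"
      using mod_hom_diff[OF assms(4,1,2)] mod_homD(1)[OF assms(4)] by (simp add: E.M.minus_eq E.M.r_neg)
    then show "a = b" using ker[of "a \<ominus>\<^bsub>A\<^esub> b"] ab by (auto intro: A.M.a_minus_eq_zeroD)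
  qed
  moreover have "p ` carrier E = carrier B" using surj mod_homD(1)[OF assms(5)] by auto
  moreover have "i ` carrier A = {x \<in> carrier E. p x = \<zero>\<^bsub>B\<^esub>}"
    using comp exact mod_homD(1)[OF assms(4)] by auto
  ultimately show ?thesis unfolding short_exact_def using assms(1-5) by auto
qed

text \<open>
  The pushout along multiplication by a central element.  The map \<open>h : E \<rightarrow> E'\<close> covers the identity
  on \<open>B\<close> and multiplication by \<open>c\<close> on \<open>A\<close>; through it a lift in \<open>E\<close> of an element of \<open>B\<close>
  becomes a lift in \<open>E'\<close>.
\<close>

lemma scale_ext_exact:
  assumes se: "short_exact R A (i, E, p) B"
    and c: "c \<in> carrier R" "\<And>r. r \<in> carrier R \<Longrightarrow> c \<otimes>\<^bsub>R\<^esub> r = r \<otimes>\<^bsub>R\<^esub> c"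
  obtains i' E' p' h where "scale_ext A c (i, E, p) = (i', E', p')" "short_exact R A (i', E', p') B"
    "h \<in> mod_hom R E E'" "\<And>x. x \<in> carrier E \<Longrightarrow> p' (h x) = p x"
    "\<And>a. a \<in> carrier A \<Longrightarrow> h (i a) = i' (c \<odot>\<^bsub>A\<^esub> a)"
proof -
  note d = short_exactD[OF se]
  interpret A: left_module R A by (rule d)
  interpret E: left_module R E by (rule d)
  interpret B: left_module R B by (rule d)
  let ?P = "dsum_module E A"
  let ?N = "{(i a, \<ominus>\<^bsub>A\<^esub> (c \<odot>\<^bsub>A\<^esub> a)) | a. a \<in> carrier A}"
  interpret P: left_module R ?P by (rule left_module_dsum) (rule d)+
  note ih = mod_homD[OF d(4)] and ph = mod_homD[OF d(5)]
  have "submodule ?N R ?P"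
  proof (rule P.submoduleI)
    show "\<zero>\<^bsub>?P\<^esub> \<in> ?N"
      using c by (auto intro!: exI[of _ "\<zero>\<^bsub>A\<^esub>"] simp: mod_hom_zero[OF d(4,1,2)] A.smult_zero_right)
    fix x y assume "x \<in> ?N" "y \<in> ?N"
    then obtain a b where "a \<in> carrier A" "b \<in> carrier A" "x = (i a, \<ominus>\<^bsub>A\<^esub> (c \<odot>\<^bsub>A\<^esub> a))" "y = (i b, \<ominus>\<^bsub>A\<^esub> (c \<odot>\<^bsub>A\<^esub> b))"
      by auto
    then show "x \<oplus>\<^bsub>?P\<^esub> y \<in> ?N"
      using c by (auto intro!: exI[of _ "a \<oplus>\<^bsub>A\<^esub> b"] simp: ih A.smult_r_distr A.smult_closed A.M.minus_add)
  next
    fix r x assume r: "r \<in> carrier R" and "x \<in> ?N"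
    then obtain a where a: "a \<in> carrier A" "x = (i a, \<ominus>\<^bsub>A\<^esub> (c \<odot>\<^bsub>A\<^esub> a))" by auto
    have "r \<odot>\<^bsub>A\<^esub> (c \<odot>\<^bsub>A\<^esub> a) = c \<odot>\<^bsub>A\<^esub> (r \<odot>\<^bsub>A\<^esub> a)"
      using c r a A.smult_assoc1[of c r a] A.smult_assoc1[of r c a] by simp
    then show "r \<odot>\<^bsub>?P\<^esub> x \<in> ?N"
      using a r c by (auto intro!: exI[of _ "r \<odot>\<^bsub>A\<^esub> a"] simp: ih A.smult_minus_right A.smult_closed)
  qed (use c in \<open>auto simp: ih A.smult_closed\<close>)
  then interpret Q: module_with_submodule R ?P ?N by (intro module_with_submoduleI left_module_dsum d)
  let ?i = "\<lambda>a. ?N +>\<^bsub>?P\<^esub> (\<zero>\<^bsub>E\<^esub>, a)" and ?Q = "quot_module ?P ?N"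
    and ?p = "\<lambda>D. p (fst (SOME w. w \<in> D))" and ?h = "\<lambda>x. ?N +>\<^bsub>?P\<^esub> (x, \<zero>\<^bsub>A\<^esub>)"
  have p: "?p (?N +>\<^bsub>?P\<^esub> (x, a)) = p x" if xa: "x \<in> carrier E" "a \<in> carrier A" for x a
  proof -
    have "(SOME w. w \<in> ?N +>\<^bsub>?P\<^esub> (x, a)) \<in> ?N +>\<^bsub>?P\<^esub> (x, a)"
      by (rule someI, rule Q.coset_self) (use xa in simp)
    then obtain b where b: "b \<in> carrier A"
      "(SOME w. w \<in> ?N +>\<^bsub>?P\<^esub> (x, a)) = (i b, \<ominus>\<^bsub>A\<^esub> (c \<odot>\<^bsub>A\<^esub> b)) \<oplus>\<^bsub>?P\<^esub> (x, a)"
      by (auto simp: a_r_coset_def')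
    then show ?thesis using xa by (simp add: ph ih d(8))
  qed
  have Qelt: "\<exists>x a. C = ?N +>\<^bsub>?P\<^esub> (x, a) \<and> x \<in> carrier E \<and> a \<in> carrier A" if "C \<in> carrier ?Q" for C
    using that by (auto simp: Q.quot_carrier)
  have hi: "?h (i a) = ?i (c \<odot>\<^bsub>A\<^esub> a)" if "a \<in> carrier A" for a
    using that c
    by (subst Q.coset_eq_iff)
       (auto intro!: exI[of _ a] simp: ih A.smult_closed P.M.minus_eq dsum_minus[OF d(2,1)] simp del: dsum_simps(3)
         simp: dsum_simps(3)[where M=E and N=A])
  have "short_exact R A (?i, ?Q, ?p) B"
  proof (rule short_exactI)
    show "?i \<in> mod_hom R A ?Q"
      by (auto simp: mod_hom_def Q.quot_carrier Q.quot_add Q.quot_smult E.smult_zero_right)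
    show "?p \<in> mod_hom R ?Q B"
    proof -
      have "?p (C \<oplus>\<^bsub>?Q\<^esub> C1) = ?p C \<oplus>\<^bsub>B\<^esub> ?p C1" if "C \<in> carrier ?Q" "C1 \<in> carrier ?Q" for C C1
        using Qelt[OF that(1)] Qelt[OF that(2)] by (auto simp: Q.quot_add p ph)
      moreover have "?p (r \<odot>\<^bsub>?Q\<^esub> C) = r \<odot>\<^bsub>B\<^esub> ?p C" if "C \<in> carrier ?Q" "r \<in> carrier R" for r C
        using Qelt[OF that(1)] that(2) by (auto simp: Q.quot_smult p ph E.smult_closed A.smult_closed)
      moreover have "?p C \<in> carrier B" if "C \<in> carrier ?Q" for C
        using Qelt[OF that] by (auto simp: p ph)
      ultimately show ?thesis by (simp add: mod_hom_def)
    qed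
    show "a = \<zero>\<^bsub>A\<^esub>" if "a \<in> carrier A" "?i a = \<zero>\<^bsub>?Q\<^esub>" for a
    proof -
      have "(\<zero>\<^bsub>E\<^esub>, a) \<in> ?N" using that Q.coset_eq_zero_iff[of "(\<zero>\<^bsub>E\<^esub>, a)"] by (simp add: Q.quot_zero)
      then obtain b where "b \<in> carrier A" "i b = \<zero>\<^bsub>E\<^esub>" "a = \<ominus>\<^bsub>A\<^esub> (c \<odot>\<^bsub>A\<^esub> b)" by auto
      moreover have "b = \<zero>\<^bsub>A\<^esub>" using d(6)[of b "\<zero>\<^bsub>A\<^esub>"] calculation by (simp add: mod_hom_zero[OF d(4,1,2)])
      ultimately show ?thesis using c by (simp add: A.smult_zero_right)
    qed
    show "\<exists>C\<in>carrier ?Q. ?p C = b" if b: "b \<in> carrier B" for b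
    proof -
      obtain x where x: "x \<in> carrier E" "p x = b" using d(7)[OF b] by auto
      then show ?thesis
        by (intro bexI[of _ "?h x"]) (auto simp only: p Q.quot_carrier A.M.zero_closed, auto)
    qed
    show "?p (?i a) = \<zero>\<^bsub>B\<^esub>" if "a \<in> carrier A" for a
      using that by (subst p) (auto simp: mod_hom_zero[OF d(5,2,3)])
    show "\<exists>a\<in>carrier A. C = ?i a" if C: "C \<in> carrier ?Q" "?p C = \<zero>\<^bsub>B\<^esub>" for C
    proof -
      obtain x a where x: "C = ?N +>\<^bsub>?P\<^esub> (x, a)" "x \<in> carrier E" "a \<in> carrier A" using Qelt[OF C(1)] by auto
      then obtain b where b: "b \<in> carrier A" "x = i b" using d(9)[of x] C(2) p[of x a] by auto
      have "C = ?h x \<oplus>\<^bsub>?Q\<^esub> ?i a" using x by (simp add: Q.quot_add)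
      also have "\<dots> = ?i (c \<odot>\<^bsub>A\<^esub> b \<oplus>\<^bsub>A\<^esub> a)" using x b c by (simp add: hi Q.quot_add A.smult_closed)
      finally show ?thesis using b x c by (auto simp: A.smult_closed)
    qed
  qed (rule d Q.left_module_quot)+
  moreover have "scale_ext A c (i, E, p) = (?i, ?Q, ?p)" by (simp add: scale_ext_def Let_def)
  moreover have "?h \<in> mod_hom R E ?Q"
    by (auto simp: mod_hom_def Q.quot_carrier Q.quot_add Q.quot_smult A.smult_zero_right)
  ultimately show ?thesis using p hi by (intro that[of ?i ?Q ?p ?h]) auto
qed

text \<open>
  The map \<open>h\<close> sends a pair of lifts of the same element of \<open>B\<close> to its class, again a lift; on
  pairs from \<open>A\<close> it is the addition of \<open>A\<close>.  This is why data read off from lifts are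
  additive.
\<close>

lemma baer_sum_exact:
  assumes se: "short_exact R A (i, E, p) B" and se': "short_exact R A (i', E', p') B"
  obtains j F q h where "baer_sum A (i, E, p) (i', E', p') = (j, F, q)" "short_exact R A (j, F, q) B"
    "\<And>x y. \<lbrakk>x \<in> carrier E; y \<in> carrier E'; p x = p' y\<rbrakk> \<Longrightarrow> h (x, y) \<in> carrier F \<and> q (h (x, y)) = p x"
    "\<And>r x y. \<lbrakk>r \<in> carrier R; x \<in> carrier E; y \<in> carrier E'; p x = p' y\<rbrakk> \<Longrightarrow>
        r \<odot>\<^bsub>F\<^esub> h (x, y) = h (r \<odot>\<^bsub>E\<^esub> x, r \<odot>\<^bsub>E'\<^esub> y)"
    "\<And>a b. \<lbrakk>a \<in> carrier A; b \<in> carrier A\<rbrakk> \<Longrightarrow> h (i a, i' b) = j (a \<oplus>\<^bsub>A\<^esub> b)"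
proof -
  note d = short_exactD[OF se] and d' = short_exactD[OF se']
  interpret A: left_module R A by (rule d)
  interpret E: left_module R E by (rule d)
  interpret E': left_module R E' by (rule d')
  interpret B: left_module R B by (rule d)
  note ih = mod_homD[OF d(4)] and ph = mod_homD[OF d(5)] and ih' = mod_homD[OF d'(4)] and ph' = mod_homD[OF d'(5)]
  let ?U = "{(x, y). x \<in> carrier E \<and> y \<in> carrier E' \<and> p x = p' y}"
  let ?S = "dsum_module E E'"
  let ?P = "?S\<lparr>carrier := ?U\<rparr>"
  let ?N = "{(i a, \<ominus>\<^bsub>E'\<^esub> (i' a)) | a. a \<in> carrier A}"
  interpret S: left_module R ?S by (rule left_module_dsum) (rule d d')+
  have U: "submodule ?U R ?S"
    by (rule S.submoduleI)
       (auto simp: ph ph' mod_hom_zero[OF d(5,2,3)] mod_hom_zero[OF d'(5,2,3)] E.smult_closed E'.smult_closed)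
  interpret P: left_module R ?P by (rule S.left_module_restrict[OF U])
  have "submodule ?N R ?P"
  proof (rule P.submoduleI)
    show "?N \<subseteq> carrier ?P"
      using mod_hom_minus[OF d'(5,2,3)] by (auto simp: ih ih' d(8) d'(8))
    show "\<zero>\<^bsub>?P\<^esub> \<in> ?N"
      by (auto intro!: exI[of _ "\<zero>\<^bsub>A\<^esub>"] simp: mod_hom_zero[OF d(4,1,2)] mod_hom_zero[OF d'(4,1,2)])
    fix x y assume "x \<in> ?N" "y \<in> ?N"
    then obtain a b where "a \<in> carrier A" "b \<in> carrier A" "x = (i a, \<ominus>\<^bsub>E'\<^esub> (i' a))" "y = (i b, \<ominus>\<^bsub>E'\<^esub> (i' b))"
      by auto
    then show "x \<oplus>\<^bsub>?P\<^esub> y \<in> ?N"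
      by (auto intro!: exI[of _ "a \<oplus>\<^bsub>A\<^esub> b"] simp: ih ih' E'.M.minus_add)
  next
    fix r x assume r: "r \<in> carrier R" and "x \<in> ?N"
    then obtain a where a: "a \<in> carrier A" "x = (i a, \<ominus>\<^bsub>E'\<^esub> (i' a))" by auto
    then show "r \<odot>\<^bsub>?P\<^esub> x \<in> ?N"
      using r by (auto intro!: exI[of _ "r \<odot>\<^bsub>A\<^esub> a"] simp: ih ih' E'.smult_minus_right A.smult_closed)
  qed
  then interpret Q: module_with_submodule R ?P ?N by (intro module_with_submoduleI S.left_module_restrict U)
  let ?j = "\<lambda>a. ?N +>\<^bsub>?P\<^esub> (i a, \<zero>\<^bsub>E'\<^esub>)" and ?Q = "quot_module ?P ?N"
    and ?p = "\<lambda>D. p (fst (SOME w. w \<in> D))" and ?h = "\<lambda>w. ?N +>\<^bsub>?P\<^esub> w"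
  have p: "?p (?N +>\<^bsub>?P\<^esub> (x, y)) = p x" if xy: "(x, y) \<in> ?U" for x y
  proof -
    have "(SOME w. w \<in> ?N +>\<^bsub>?P\<^esub> (x, y)) \<in> ?N +>\<^bsub>?P\<^esub> (x, y)"
      by (rule someI, rule Q.coset_self) (use xy in simp)
    then obtain b where b: "b \<in> carrier A"
      "(SOME w. w \<in> ?N +>\<^bsub>?P\<^esub> (x, y)) = (i b, \<ominus>\<^bsub>E'\<^esub> (i' b)) \<oplus>\<^bsub>?P\<^esub> (x, y)"
      by (auto simp: a_r_coset_def')
    then show ?thesis using xy by (simp add: ph ph' ih d(8))
  qed
  have Qelt: "\<exists>x y. C = ?N +>\<^bsub>?P\<^esub> (x, y) \<and> (x, y) \<in> ?U" if "C \<in> carrier ?Q" for C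
    using that by (auto simp: Q.quot_carrier)
  have inQ: "?h w \<in> carrier ?Q" if "w \<in> ?U" for w
    unfolding Q.quot_carrier by (rule CollectI, rule exI[of _ w]) (use that in simp)
  have inU: "(i a, i' b) \<in> ?U" if "a \<in> carrier A" "b \<in> carrier A" for a b
    using that by (simp add: ih ih' d(8) d'(8))
  have hj: "?h (i a, i' b) = ?j (a \<oplus>\<^bsub>A\<^esub> b)" if ab: "a \<in> carrier A" "b \<in> carrier A" for a b
  proof -
    have n: "(i b, \<ominus>\<^bsub>E'\<^esub> (i' b)) \<in> ?N" using ab by auto
    have U2: "(i (a \<oplus>\<^bsub>A\<^esub> b), \<zero>\<^bsub>E'\<^esub>) \<in> ?U"
      using inU[of "a \<oplus>\<^bsub>A\<^esub> b" "\<zero>\<^bsub>A\<^esub>"] ab by (simp add: mod_hom_zero[OF d'(4,1,2)])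
    have "(i (a \<oplus>\<^bsub>A\<^esub> b), \<zero>\<^bsub>E'\<^esub>) = (i b, \<ominus>\<^bsub>E'\<^esub> (i' b)) \<oplus>\<^bsub>?P\<^esub> (i a, i' b)"
      using ab by (simp add: ih ih' E'.M.l_neg A.M.a_comm[of a b] E.M.a_comm)
    then have "(i (a \<oplus>\<^bsub>A\<^esub> b), \<zero>\<^bsub>E'\<^esub>) \<in> ?N +>\<^bsub>?P\<^esub> (i a, i' b)"
      using n by (auto simp: a_r_coset_def')
    then show ?thesis using Q.coset_mem[of "(i a, i' b)" "(i (a \<oplus>\<^bsub>A\<^esub> b), \<zero>\<^bsub>E'\<^esub>)"] inU[OF ab] by simp
  qed
  have jU: "(i a, \<zero>\<^bsub>E'\<^esub>) \<in> ?U" if "a \<in> carrier A" for a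
    using inU[of a "\<zero>\<^bsub>A\<^esub>"] that by (simp add: mod_hom_zero[OF d'(4,1,2)])
  have "short_exact R A (?j, ?Q, ?p) B"
  proof (rule short_exactI)
    show "?j \<in> mod_hom R A ?Q"
    proof -
      have "?j a \<in> carrier ?Q" if "a \<in> carrier A" for a
        using jU[OF that] unfolding Q.quot_carrier by auto
      then show ?thesis
        unfolding mod_hom_def using jU
        by (auto simp: Q.quot_add Q.quot_smult E'.smult_zero_right ih)
    qed
    show "?p \<in> mod_hom R ?Q B"
    proof -
      have "?p (C \<oplus>\<^bsub>?Q\<^esub> C1) = ?p C \<oplus>\<^bsub>B\<^esub> ?p C1" if th: "C \<in> carrier ?Q" "C1 \<in> carrier ?Q" for C C1
      proof -
        obtain x y x' y' where xy: "C = ?h (x, y)" "C1 = ?h (x', y')" "(x, y) \<in> ?U" "(x', y') \<in> ?U"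
          using Qelt[OF th(1)] Qelt[OF th(2)] by blast
        then have "(x \<oplus>\<^bsub>E\<^esub> x', y \<oplus>\<^bsub>E'\<^esub> y') \<in> ?U" by (simp add: ph ph')
        then have "?p (?h (x \<oplus>\<^bsub>E\<^esub> x', y \<oplus>\<^bsub>E'\<^esub> y')) = p (x \<oplus>\<^bsub>E\<^esub> x')" by (rule p)
        moreover have "C \<oplus>\<^bsub>?Q\<^esub> C1 = ?h (x \<oplus>\<^bsub>E\<^esub> x', y \<oplus>\<^bsub>E'\<^esub> y')" using xy by (simp add: Q.quot_add)
        ultimately show ?thesis using xy p[OF xy(3)] p[OF xy(4)] by (simp only:) (simp add: ph)
      qed
      moreover have "?p (r \<odot>\<^bsub>?Q\<^esub> C) = r \<odot>\<^bsub>B\<^esub> ?p C" if th: "C \<in> carrier ?Q" "r \<in> carrier R" for r C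
      proof -
        obtain x y where xy: "C = ?h (x, y)" "(x, y) \<in> ?U" using Qelt[OF th(1)] by blast
        then have "(r \<odot>\<^bsub>E\<^esub> x, r \<odot>\<^bsub>E'\<^esub> y) \<in> ?U" using th by (simp add: ph ph' E.smult_closed E'.smult_closed)
        then have "?p (?h (r \<odot>\<^bsub>E\<^esub> x, r \<odot>\<^bsub>E'\<^esub> y)) = p (r \<odot>\<^bsub>E\<^esub> x)" by (rule p)
        moreover have "r \<odot>\<^bsub>?Q\<^esub> C = ?h (r \<odot>\<^bsub>E\<^esub> x, r \<odot>\<^bsub>E'\<^esub> y)" using xy th by (simp add: Q.quot_smult)
        ultimately show ?thesis using xy th p[OF xy(2)] by (simp only:) (simp add: ph)
      qed
      moreover have "?p C \<in> carrier B" if th: "C \<in> carrier ?Q" for C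
      proof -
        obtain x y where xy: "C = ?h (x, y)" "(x, y) \<in> ?U" using Qelt[OF th(1)] by blast
        then show ?thesis using p[OF xy(2)] by (simp only:) (simp add: ph ph')
      qed
      ultimately show ?thesis by (simp add: mod_hom_def)
    qed
    show "a = \<zero>\<^bsub>A\<^esub>" if "a \<in> carrier A" "?j a = \<zero>\<^bsub>?Q\<^esub>" for a
    proof -
      have "(i a, \<zero>\<^bsub>E'\<^esub>) \<in> ?N" using that Q.coset_eq_zero_iff[of "(i a, \<zero>\<^bsub>E'\<^esub>)"] jU[of a] by (simp add: Q.quot_zero)
      then obtain b where b: "b \<in> carrier A" "i a = i b" "\<zero>\<^bsub>E'\<^esub> = \<ominus>\<^bsub>E'\<^esub> (i' b)" by auto
      then have "i' b = \<zero>\<^bsub>E'\<^esub>" using ih'(1)[of b] by (metis E'.M.minus_minus E'.M.a_inv_zero)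
      then have "b = \<zero>\<^bsub>A\<^esub>" using d'(6)[of b "\<zero>\<^bsub>A\<^esub>"] b by (simp add: mod_hom_zero[OF d'(4,1,2)])
      then show ?thesis using b d(6)[of a b] that by simp
    qed
    show "\<exists>C\<in>carrier ?Q. ?p C = b" if b: "b \<in> carrier B" for b
    proof -
      obtain x y where xy: "x \<in> carrier E" "p x = b" "y \<in> carrier E'" "p' y = b"
        using d(7)[OF b] d'(7)[OF b] by auto
      have "?p (?h (x, y)) = b" using p[of x y] xy by simp
      moreover have "?h (x, y) \<in> carrier ?Q" by (rule inQ) (use xy in simp)
      ultimately show ?thesis by blast
    qed
    show "?p (?j a) = \<zero>\<^bsub>B\<^esub>" if "a \<in> carrier A" for a
      using that p[OF jU[OF that]] d(8)[OF that] by simp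
    show "\<exists>a\<in>carrier A. C = ?j a" if C: "C \<in> carrier ?Q" "?p C = \<zero>\<^bsub>B\<^esub>" for C
    proof -
      obtain x y where xy: "C = ?h (x, y)" "(x, y) \<in> ?U" using Qelt[OF C(1)] by blast
      have "p x = \<zero>\<^bsub>B\<^esub>" using C(2) xy p[OF xy(2)] by simp
      moreover have "p' y = \<zero>\<^bsub>B\<^esub>" using calculation xy by simp
      ultimately obtain a b where "a \<in> carrier A" "x = i a" "b \<in> carrier A" "y = i' b"
        using d(9)[of x] d'(9)[of y] xy by auto
      then show ?thesis using xy hj[of a b] by auto
    qed
  qed (rule d Q.left_module_quot)+
  moreover have "baer_sum A (i, E, p) (i', E', p') = (?j, ?Q, ?p)" by (simp add: baer_sum_def Let_def)
  moreover have "?h (x, y) \<in> carrier ?Q \<and> ?p (?h (x, y)) = p x"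
    if "x \<in> carrier E" "y \<in> carrier E'" "p x = p' y" for x y
    using that p[of x y] inQ[of "(x, y)"] by simp
  moreover have "r \<odot>\<^bsub>?Q\<^esub> ?h (x, y) = ?h (r \<odot>\<^bsub>E\<^esub> x, r \<odot>\<^bsub>E'\<^esub> y)"
    if "r \<in> carrier R" "x \<in> carrier E" "y \<in> carrier E'" "p x = p' y" for r x y
    using that by (simp add: Q.quot_smult)
  ultimately show ?thesis using hj by (intro that[of ?j ?Q ?p ?h]) auto
qed

section \<open>Generators of \<open>D\<close> and their relations\<close>

lemma sgn3_square [simp]: "sgn3 g * sgn3 g = (1::'k::field)"
  using S3_cases[of g] by (elim disjE) simp_all

lemma scal_sgn3_square: "scal (sgn3 g) * (scal (sgn3 g) * p) = (p :: 'k::field free)"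
  by (simp flip: mult.assoc scal_hom(4)) (simp add: scal_hom)

lemma cls_mult_left: "cls p = cls q \<Longrightarrow> cls (r * p) = (cls (r * q) :: 'k::field free set)"
  by (rule cls_cong(2)) simp_all

lemma cls_mult_right: "cls p = cls q \<Longrightarrow> cls (p * r) = (cls (q * r) :: 'k::field free set)"
  by (rule cls_cong(2)) simp_all

lemma cls_grp_one: "cls (grp 1) = (cls 1 :: 'k::field free set)"
  by (rule cls_rel) (simp add: D_relations_def double_S3_relations_def)

lemma cls_grp_mult: "cls (grp g * grp h) = (cls (grp (g * h)) :: 'k::field free set)"
  by (rule cls_rel) (auto simp: D_relations_def double_S3_relations_def)

lemma cls_dlt_sum: "cls (\<Sum>g\<in>UNIV. dlt g) = (cls 1 :: 'k::field free set)"
  by (rule cls_rel) (simp add: D_relations_def double_S3_relations_def)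

lemma cls_dlt_mult: "cls (dlt g * dlt h) = (cls (if g = h then dlt g else 0) :: 'k::field free set)"
  by (rule cls_rel) (auto simp: D_relations_def double_S3_relations_def)

lemma cls_grp_dlt: "cls (grp g * dlt h) = (cls (dlt (conj3 g h) * grp g) :: 'k::field free set)"
  by (rule cls_rel) (auto simp: D_relations_def double_S3_relations_def)

lemma cls_boson:
  assumes "boson_relations z \<subseteq> (D_relations :: 'k::field free set)"
  shows "s \<notin> transps \<Longrightarrow> cls (z s) = cls 0"
    "s \<in> transps \<Longrightarrow> cls (z s * z s) = cls 0"
    "cls (z t12 * z t13 + z t23 * z t12 + z t13 * z t23) = cls 0"
    "cls (z t13 * z t12 + z t12 * z t23 + z t23 * z t13) = cls 0"
    "s \<in> transps \<Longrightarrow> cls (grp g * z s) = cls (scal (sgn3 g) * z (conj3 g s) * grp g)"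
    "s \<in> transps \<Longrightarrow> cls (dlt g * z s) = cls (z s * dlt (s * g))"
proof -
  have rel: "cls p = cls q" if "p - q \<in> boson_relations z" for p q :: "'k free"
    using that assms by (intro cls_rel) auto
  show "s \<notin> transps \<Longrightarrow> cls (z s) = cls 0" "s \<in> transps \<Longrightarrow> cls (z s * z s) = cls 0"
    "cls (z t12 * z t13 + z t23 * z t12 + z t13 * z t23) = cls 0"
    "cls (z t13 * z t12 + z t12 * z t23 + z t23 * z t13) = cls 0"
    by (rule rel; simp add: boson_relations_def; blast)+
  show "s \<in> transps \<Longrightarrow> cls (grp g * z s) = cls (scal (sgn3 g) * z (conj3 g s) * grp g)"
    "s \<in> transps \<Longrightarrow> cls (dlt g * z s) = cls (z s * dlt (s * g))"
    by (rule rel; unfold boson_relations_def; blast)+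
qed

lemma boson_in_D: "boson_relations xx \<subseteq> (D_relations :: 'k::field free set)"
  "boson_relations yy \<subseteq> (D_relations :: 'k::field free set)"
  by (auto simp: D_relations_def)

lemma cls_cross:
  assumes "s \<in> transps" "r \<in> transps"
  shows "cls (yy s * xx r) = (cls (- (xx r * yy (r * s * r)) + (if s = r then 1 else 0)
        + grp r * (dlt s - dlt (s * r))) :: 'k::field free set)"
  using assms by (intro cls_rel) (auto simp: D_relations_def cross_relations_def)

lemma to_transp_simps [simp]: "to_transp t12 = 1" "to_transp t13 = t23" "to_transp t23 = t13"
  by (simp_all add: to_transp_def)

text \<open>
  The three transpositions are conjugate, so \<open>x\<^sub>1\<^sub>2\<close> and \<open>y\<^sub>1\<^sub>2\<close> generate together with the
  group and its dual.
\<close>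

lemma cls_boson_conj:
  assumes z: "boson_relations z \<subseteq> (D_relations :: 'k::field free set)" and s: "s \<in> transps"
  shows "cls (z s) = cls (scal (sgn3 (to_transp s)) * grp (to_transp s) * z t12 * grp (inverse (to_transp s)))"
proof -
  let ?g = "to_transp s"
  have c: "conj3 ?g t12 = s" using s by (auto simp: transps_def)
  have "cls (scal (sgn3 ?g) * (grp ?g * z t12 * grp (inverse ?g)))
      = cls (scal (sgn3 ?g) * ((scal (sgn3 ?g) * z s * grp ?g) * grp (inverse ?g)))"
    using cls_boson(5)[OF z, of t12 ?g] by (intro cls_mult_left cls_mult_right) (simp add: c)
  also have "\<dots> = cls (z s * (grp ?g * grp (inverse ?g)))"
    by (simp add: mult.assoc scal_sgn3_square)
  also have "\<dots> = cls (z s * 1)"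
    by (rule cls_mult_left) (simp add: cls_grp_mult cls_grp_one)
  finally show ?thesis by (simp add: mult.assoc)
qed

lemma free_eq_sum_keys:
  "(p :: 'k::field free) = (\<Sum>w\<in>Poly_Mapping.keys p. Poly_Mapping.single w (Poly_Mapping.lookup p w))"
  by (rule poly_mapping_eqI) (auto simp: lookup_sum lookup_single when_def in_keys_iff)

text \<open>
  Homogeneous elements of \<open>D\<close> are obtained from the listed generators by homogeneous sums and
  products.  The case \<open>cls\<close> permits replacing a representative in the free algebra by an
  equivalent one, which is what allows the induction to mention \<open>x\<^sub>1\<^sub>2\<close> and \<open>y\<^sub>1\<^sub>2\<close> only.
\<close>

lemma DD_deg_induct [consumes 1, case_names cls zero add mult scal grp dlt xx yy]:
  fixes p :: "'k::field free"
  assumes hom: "\<forall>w\<in>Poly_Mapping.keys p. sum_list (map gen_degree (letters w)) = n"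
    and cls: "\<And>n p q. cls p = cls q \<Longrightarrow> Q n p \<Longrightarrow> Q n q"
    and zero: "\<And>n. Q n 0"
    and add: "\<And>n p q. Q n p \<Longrightarrow> Q n q \<Longrightarrow> Q n (p + q)"
    and mult: "\<And>m n p q. Q m p \<Longrightarrow> Q n q \<Longrightarrow> Q (m + n) (p * q)"
    and gens: "\<And>c. Q 0 (scal c)" "\<And>g. Q 0 (grp g)" "\<And>g. Q 0 (dlt g)" "Q (-1) (xx t12)" "Q 1 (yy t12)"
  shows "Q n p"
proof -
  have conj: "Q (gen_degree (GX s)) (xx s)" "Q (gen_degree (GY s)) (yy s)" for s
  proof -
    have "Q n (z s)" if z: "boson_relations z \<subseteq> (D_relations :: 'k free set)" and t: "Q n (z t12)" for z n
    proof (cases "s \<in> transps")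
      case True
      let ?g = "to_transp s"
      have "Q (0 + 0 + n + 0) (scal (sgn3 ?g) * grp ?g * z t12 * grp (inverse ?g))"
        by (intro mult gens t)
      then show ?thesis using cls[OF cls_boson_conj[OF z True, symmetric]] by simp
    next
      case False
      then show ?thesis using cls[OF cls_boson(1)[OF z False, symmetric]] zero by simp
    qed
    from this[OF boson_in_D(1)] this[OF boson_in_D(2)]
    show "Q (gen_degree (GX s)) (xx s)" "Q (gen_degree (GY s)) (yy s)"
      using gens by (simp_all add: gen_degree_def)
  qed
  have var: "Q (gen_degree a) (var a)" for a
    by (cases a) (use gens conj in \<open>simp_all add: gen_degree_def\<close>)
  have "Q (sum_list (map gen_degree l)) (prod_list (map var l))" for l
    by (induct l) (use gens(1)[of 1] in \<open>auto simp: scal_hom intro: mult var\<close>)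
  from mult[OF gens(1) this] have word: "Q (sum_list (map gen_degree (letters w))) (Poly_Mapping.single w c)" for w c
    by (simp add: single_eq_prod)
  have "Q n (\<Sum>w\<in>A. Poly_Mapping.single w (Poly_Mapping.lookup p w))" if "finite A" "A \<subseteq> Poly_Mapping.keys p" for A
    using that
  proof (induct A)
    case (insert w A)
    then have "sum_list (map gen_degree (letters w)) = n" using hom by auto
    with insert show ?case using word[of w] by (auto intro: add)
  qed (simp add: zero)
  then show ?thesis by (subst free_eq_sum_keys) auto
qed

lemma DD_induct [case_names cls add mult scal grp dlt xx yy]:
  fixes p :: "'k::field free"
  assumes cls: "\<And>p q. cls p = cls q \<Longrightarrow> Q p \<Longrightarrow> Q q"
    and add: "\<And>p q. Q p \<Longrightarrow> Q q \<Longrightarrow> Q (p + q)"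
    and mult: "\<And>p q. Q p \<Longrightarrow> Q q \<Longrightarrow> Q (p * q)"
    and gens: "\<And>c. Q (scal c)" "\<And>g. Q (grp g)" "\<And>g. Q (dlt g)" "Q (xx t12)" "Q (yy t12)"
  shows "Q p"
proof (induct p rule: free_induct)
  case (single w c)
  have "\<forall>v\<in>Poly_Mapping.keys (Poly_Mapping.single w c). sum_list (map gen_degree (letters v)) =
      sum_list (map gen_degree (letters w))"
    by (auto split: if_splits)
  then show ?case
  proof (rule DD_deg_induct[where Q = "\<lambda>_. Q"])
    show "Q 0" using gens(1)[of 0] by (simp add: scal_hom)
  qed (fact cls add mult gens)+
qed (rule add)

section \<open>Modules over \<open>D\<close>\<close>

text \<open>
  Naming the elements of \<open>D\<close> by representatives lets calculations in the free algebra rewrite the action.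
\<close>

definition act :: "('k::field free set, 'v) module \<Rightarrow> 'k free \<Rightarrow> 'v \<Rightarrow> 'v" where
  "act M p v = cls p \<odot>\<^bsub>M\<^esub> v"

lemma act_cong: "cls p = cls q \<Longrightarrow> act M p v = act M q v"
  by (simp add: act_def)

locale D_module = left_module DD M for M :: "('k::field free set, 'v) module"
begin

lemma act_closed [simp, intro]: "v \<in> carrier M \<Longrightarrow> act M p v \<in> carrier M"
  by (simp add: act_def smult_closed)

lemma act_mult: "v \<in> carrier M \<Longrightarrow> act M (p * q) v = act M p (act M q v)"
  using smult_assoc1[of "cls p" "cls q" v] by (simp add: act_def DD_simps)

lemma act_add: "v \<in> carrier M \<Longrightarrow> act M (p + q) v = act M p v \<oplus>\<^bsub>M\<^esub> act M q v"
  using smult_l_distr[of "cls p" "cls q" v] by (simp add: act_def DD_simps)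

lemma act_one [simp]: "v \<in> carrier M \<Longrightarrow> act M 1 v = v"
  using smult_one[of v] by (simp add: act_def DD_simps)

lemma act_zero [simp]: "v \<in> carrier M \<Longrightarrow> act M 0 v = \<zero>\<^bsub>M\<^esub>"
  using smult_zero_left[of v] by (simp add: act_def DD_simps)

lemma act_minus: "v \<in> carrier M \<Longrightarrow> act M (- p) v = \<ominus>\<^bsub>M\<^esub> act M p v"
  using smult_minus_left[of "cls p" v] by (simp add: act_def DD_minus)

lemma act_add_right: "\<lbrakk>u \<in> carrier M; v \<in> carrier M\<rbrakk> \<Longrightarrow> act M p (u \<oplus>\<^bsub>M\<^esub> v) = act M p u \<oplus>\<^bsub>M\<^esub> act M p v"
  by (simp add: act_def smult_r_distr)

lemma act_zero_right [simp]: "act M p \<zero>\<^bsub>M\<^esub> = \<zero>\<^bsub>M\<^esub>"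
  by (simp add: act_def smult_zero_right)

lemma act_minus_right: "v \<in> carrier M \<Longrightarrow> act M p (\<ominus>\<^bsub>M\<^esub> v) = \<ominus>\<^bsub>M\<^esub> act M p v"
  by (simp add: act_def smult_minus_right)

lemma act_scal_one [simp]: "v \<in> carrier M \<Longrightarrow> act M (scal 1) v = v"
  by (simp add: scal_hom)

lemma act_scal_zero [simp]: "v \<in> carrier M \<Longrightarrow> act M (scal 0) v = \<zero>\<^bsub>M\<^esub>"
  by (simp add: scal_hom)

lemma act_scal_mult: "v \<in> carrier M \<Longrightarrow> act M (scal (a * b)) v = act M (scal a) (act M (scal b) v)"
  by (simp add: scal_hom act_mult)

lemma act_scal_commute: "v \<in> carrier M \<Longrightarrow> act M p (act M (scal c) v) = act M (scal c) (act M p v)"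
  by (simp add: scal_central flip: act_mult)

lemma act_scal_eq_zero: "\<lbrakk>v \<in> carrier M; act M (scal c) v = \<zero>\<^bsub>M\<^esub>; c \<noteq> 0\<rbrakk> \<Longrightarrow> v = \<zero>\<^bsub>M\<^esub>"
  using act_scal_mult[of v "inverse c" c] by simp

lemma act_grp_one [simp]: "v \<in> carrier M \<Longrightarrow> act M (grp 1) v = v"
  by (simp add: act_cong[OF cls_grp_one])

lemma act_dlt_dlt:
  "v \<in> carrier M \<Longrightarrow> act M (dlt g) (act M (dlt h) v) = (if g = h then act M (dlt g) v else \<zero>\<^bsub>M\<^esub>)"
  by (simp add: act_cong[OF cls_dlt_mult] flip: act_mult)

lemma act_grp_dlt: "v \<in> carrier M \<Longrightarrow> act M (grp g) (act M (dlt h) v) = act M (dlt (conj3 g h)) (act M (grp g) v)"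
  by (simp add: act_cong[OF cls_grp_dlt] flip: act_mult)

lemma act_dlt_xx: "\<lbrakk>v \<in> carrier M; s \<in> transps\<rbrakk> \<Longrightarrow> act M (dlt g) (act M (xx s) v) = act M (xx s) (act M (dlt (s * g)) v)"
  by (simp add: act_cong[OF cls_boson(6)[OF boson_in_D(1)]] flip: act_mult)

lemma act_dlt_yy: "\<lbrakk>v \<in> carrier M; s \<in> transps\<rbrakk> \<Longrightarrow> act M (dlt g) (act M (yy s) v) = act M (yy s) (act M (dlt (s * g)) v)"
  by (simp add: act_cong[OF cls_boson(6)[OF boson_in_D(2)]] flip: act_mult)

lemma act_xx_conj: "\<lbrakk>v \<in> carrier M; s \<in> transps\<rbrakk> \<Longrightarrow> act M (xx s) v =
    act M (scal (sgn3 (to_transp s))) (act M (grp (to_transp s)) (act M (xx t12) (act M (grp (inverse (to_transp s))) v)))"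
  using act_cong[OF cls_boson_conj[OF boson_in_D(1)], of s M v] by (simp add: act_mult)

lemma act_yy_conj: "\<lbrakk>v \<in> carrier M; s \<in> transps\<rbrakk> \<Longrightarrow> act M (yy s) v =
    act M (scal (sgn3 (to_transp s))) (act M (grp (to_transp s)) (act M (yy t12) (act M (grp (inverse (to_transp s))) v)))"
  using act_cong[OF cls_boson_conj[OF boson_in_D(2)], of s M v] by (simp add: act_mult)

lemma act_preserves:
  assumes P: "P \<subseteq> carrier M" and v: "v \<in> P"
    and add: "\<And>u v. u \<in> P \<Longrightarrow> v \<in> P \<Longrightarrow> u \<oplus>\<^bsub>M\<^esub> v \<in> P"
    and gens: "\<And>c v. v \<in> P \<Longrightarrow> act M (scal c) v \<in> P" "\<And>g v. v \<in> P \<Longrightarrow> act M (grp g) v \<in> P"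
      "\<And>g v. v \<in> P \<Longrightarrow> act M (dlt g) v \<in> P" "\<And>v. v \<in> P \<Longrightarrow> act M (xx t12) v \<in> P"
      "\<And>v. v \<in> P \<Longrightarrow> act M (yy t12) v \<in> P"
  shows "act M p v \<in> P"
proof -
  have "\<forall>v\<in>P. act M p v \<in> P"
  proof (induct p rule: DD_induct)
    case (cls p q)
    then show ?case using act_cong[OF cls(1), of M] by simp
  qed (use P in \<open>auto simp: act_mult act_add add gens subset_iff\<close>)
  then show ?thesis using v by blast
qed

text \<open>
  A family of subspaces is a grading of the action as soon as the generators of \<open>D\<close> shift it
  correctly.
\<close>

lemma act_homogeneous:
  assumes P: "\<And>n. P n \<subseteq> carrier M" and zero: "\<And>n. \<zero>\<^bsub>M\<^esub> \<in> P n"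
    and add: "\<And>n u v. u \<in> P n \<Longrightarrow> v \<in> P n \<Longrightarrow> u \<oplus>\<^bsub>M\<^esub> v \<in> P n"
    and gens: "\<And>n c v. v \<in> P n \<Longrightarrow> act M (scal c) v \<in> P n" "\<And>n g v. v \<in> P n \<Longrightarrow> act M (grp g) v \<in> P n"
      "\<And>n g v. v \<in> P n \<Longrightarrow> act M (dlt g) v \<in> P n" "\<And>n v. v \<in> P n \<Longrightarrow> act M (xx t12) v \<in> P (n - 1)"
      "\<And>n v. v \<in> P n \<Longrightarrow> act M (yy t12) v \<in> P (n + 1)"
    and d: "d \<in> DD_deg m" and v: "v \<in> P n"
  shows "d \<odot>\<^bsub>M\<^esub> v \<in> P (m + n)"
proof -
  have carr: "v \<in> carrier M" if "v \<in> P n" for n v using P that by blast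
  obtain p where p: "d = cls p" "\<forall>w\<in>Poly_Mapping.keys p. sum_list (map gen_degree (letters w)) = m"
    using d unfolding DD_deg_def by auto
  from p(2) have "\<forall>n. \<forall>v\<in>P n. act M p v \<in> P (m + n)"
  proof (induct rule: DD_deg_induct)
    case (cls n p q)
    then show ?case using act_cong[OF cls(1), of M] by simp
  next
    case (mult m n p q)
    then show ?case by (auto simp: act_mult carr add.assoc)
  next
    case xx
    then show ?case using gens(4) by (simp add: algebra_simps)
  next
    case yy
    then show ?case using gens(5) by (simp add: algebra_simps)
  qed (auto simp: act_add carr zero add gens)
  then show ?thesis using v p(1) by (simp add: act_def)
qed

end

lemma D_moduleI: "left_module DD M \<Longrightarrow> D_module M"
  by (simp add: D_module_def)

lemma mod_hom_act: "\<lbrakk>f \<in> mod_hom DD M N; v \<in> carrier M\<rbrakk> \<Longrightarrow> f (act M p v) = act N p (f v)"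
  by (simp add: act_def mod_homD(3))

text \<open>
  Every element of \<open>D\<close> is a polynomial in the scalars, the group elements, the \<open>\<delta>\<^sub>g\<close> and the two
  elements \<open>x\<^sub>1\<^sub>2\<close>, \<open>y\<^sub>1\<^sub>2\<close>, the other \<open>x\<close> and \<open>y\<close> being conjugate to these.
\<close>

lemma mod_homI_generators:
  assumes "left_module DD M" "left_module DD (N :: ('k::field free set, 'w) module)"
    and f: "f \<in> carrier M \<rightarrow> carrier N"
    and add: "\<And>u v. \<lbrakk>u \<in> carrier M; v \<in> carrier M\<rbrakk> \<Longrightarrow> f (u \<oplus>\<^bsub>M\<^esub> v) = f u \<oplus>\<^bsub>N\<^esub> f v"
    and gens: "\<And>c v. v \<in> carrier M \<Longrightarrow> f (act M (scal c) v) = act N (scal c) (f v)"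
      "\<And>g v. v \<in> carrier M \<Longrightarrow> f (act M (grp g) v) = act N (grp g) (f v)"
      "\<And>g v. v \<in> carrier M \<Longrightarrow> f (act M (dlt g) v) = act N (dlt g) (f v)"
      "\<And>v. v \<in> carrier M \<Longrightarrow> f (act M (xx t12) v) = act N (xx t12) (f v)"
      "\<And>v. v \<in> carrier M \<Longrightarrow> f (act M (yy t12) v) = act N (yy t12) (f v)"
  shows "f \<in> mod_hom DD M N"
proof -
  interpret M: D_module M by (rule D_moduleI) fact
  interpret N: D_module N by (rule D_moduleI) fact
  have fc: "f v \<in> carrier N" if "v \<in> carrier M" for v using f that by auto
  have "\<forall>v\<in>carrier M. f (act M p v) = act N p (f v)" for p
  proof (induct p rule: DD_induct)
    case (cls p q)
    then show ?case using act_cong[OF cls(1), of M] act_cong[OF cls(1), of N] by auto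
  qed (auto simp: M.act_mult N.act_mult M.act_add N.act_add add fc gens)
  then show ?thesis unfolding mod_hom_def using f add by (auto simp: act_def elim!: DD_carrierE)
qed

lemma cls_scal_central:
  "r \<in> carrier DD \<Longrightarrow> cls (scal c) \<otimes>\<^bsub>DD\<^esub> r = r \<otimes>\<^bsub>DD\<^esub> (cls (scal c) :: 'k::field free set)"
  by (auto elim!: DD_carrierE simp: DD_simps scal_central)

section \<open>The free algebra acting through matrices\<close>

lemma lin_scale: "lin B m (\<lambda>b. k * v b) = (\<lambda>c. k * lin B m v c)"
  by (simp add: lin_def sum_distrib_left mult.assoc)

lemma lin_add: "lin B m (\<lambda>b. u b + v b) = (\<lambda>c. lin B m u c + lin B m v c)"
  by (simp add: lin_def distrib_right sum.distrib)

lemma foldr_lin_linear: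
  "foldr (\<lambda>a. lin B (\<rho> a)) l (\<lambda>b. k * v b) = (\<lambda>c. k * foldr (\<lambda>a. lin B (\<rho> a)) l v c)"
  "foldr (\<lambda>a. lin B (\<rho> a)) l (\<lambda>b. u b + v b) =
    (\<lambda>c. foldr (\<lambda>a. lin B (\<rho> a)) l u c + foldr (\<lambda>a. lin B (\<rho> a)) l v c)"
  by (induct l) (simp_all add: lin_scale lin_add)

lemma free_act_single:
  "free_act B \<rho> (Poly_Mapping.single w k) v = (\<lambda>c. k * foldr (\<lambda>a. lin B (\<rho> a)) (letters w) v c)"
  by (simp add: free_act_def)

lemma free_act_add: "free_act B \<rho> (p + q) v = (\<lambda>c. free_act B \<rho> p v c + free_act B \<rho> q v c)"
  unfolding free_act_def
  by (rule ext) (rule sum_keys_add[where f = "\<lambda>w a. a * foldr (\<lambda>a. lin B (\<rho> a)) (letters w) v _"],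
      simp_all add: distrib_right)

lemma free_act_linear:
  "free_act B \<rho> p (\<lambda>b. k * v b) = (\<lambda>c. k * free_act B \<rho> p v c)"
  "free_act B \<rho> p (\<lambda>b. u b + v b) = (\<lambda>c. free_act B \<rho> p u c + free_act B \<rho> p v c)"
  by (induct p rule: free_induct)
     (simp_all add: free_act_single free_act_add foldr_lin_linear algebra_simps)

lemma free_act_mult: "free_act B \<rho> (p * q) v = free_act B \<rho> p (free_act B \<rho> q v)"
proof (induct p rule: free_induct)
  case p: (single w k)
  show ?case
  proof (induct q rule: free_induct)
    case (single w' k')
    show ?case by (simp add: mult_single free_act_single plus_word_def foldr_lin_linear mult.assoc)
  next
    case (add p q)
    then show ?case by (simp add: distrib_left free_act_add free_act_linear)
  qed
next
  case (add p q)
  then show ?case by (simp add: distrib_right free_act_add)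
qed

lemma free_act_scal: "free_act B \<rho> (scal k) v = (\<lambda>c. k * v c)"
  by (simp add: scal_def free_act_single zero_word_def)

lemma free_act_zero: "free_act B \<rho> 0 v = (\<lambda>c. 0)"
  by (simp add: free_act_def)

lemma free_act_one: "free_act B \<rho> 1 v = v"
  using free_act_scal[of B \<rho> 1 v] by (simp add: scal_hom)

lemma free_act_var: "free_act B \<rho> (var a) v = lin B (\<rho> a) v"
  by (simp add: var_def free_act_single)

lemma free_act_uminus: "free_act B \<rho> (- p) v = (\<lambda>c. - free_act B \<rho> p v c)"
proof -
  have m: "scal (- 1) * p = - p" by (simp add: scal_hom)
  show ?thesis using free_act_mult[of B \<rho> "scal (- 1)" p v] unfolding m free_act_scal by simp
qed

lemma free_act_diff: "free_act B \<rho> (p - q) v = (\<lambda>c. free_act B \<rho> p v c - free_act B \<rho> q v c)"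
  using free_act_add[of B \<rho> p "- q" v] by (simp add: free_act_uminus)

lemmas free_act_simps = free_act_add free_act_mult free_act_scal free_act_zero free_act_one free_act_var
  free_act_uminus free_act_diff

lemma lin_vecs: "(\<And>b. b \<in> B \<Longrightarrow> m b \<in> vecs B) \<Longrightarrow> lin B m v \<in> vecs B"
  by (auto simp: vecs_def lin_def)

lemma free_act_vecs:
  assumes "\<And>a b. b \<in> B \<Longrightarrow> \<rho> a b \<in> vecs B" "v \<in> vecs B"
  shows "free_act B \<rho> p v \<in> vecs B"
  using assms(2)
proof (induct p arbitrary: v rule: free_induct_generators)
  case (var a)
  then show ?case by (simp add: free_act_var lin_vecs assms(1))
qed (auto simp: free_act_simps vecs_def)

text \<open>
  The definition of the action on \<open>rep_module\<close> chooses a representative of a class.  If the matrices satisfy the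
  relations, then the elements that act by zero form an ideal containing the relations, so the
  choice does not matter.
\<close>

lemma act_rep_module:
  assumes stable: "\<And>a b. b \<in> B \<Longrightarrow> \<rho> a b \<in> vecs B"
    and rel: "\<And>p v. \<lbrakk>p \<in> D_relations; v \<in> vecs B\<rbrakk> \<Longrightarrow> free_act B \<rho> p v = (\<lambda>c. 0)"
    and v: "v \<in> vecs B"
  shows "act (rep_module B \<rho>) p v = free_act B \<rho> p v"
proof -
  let ?J = "{p. \<forall>v\<in>vecs B. free_act B \<rho> p v = (\<lambda>c. 0)}"
  have "free_act B \<rho> q (\<lambda>c. 0) = (\<lambda>c. 0)" for q
    using free_act_linear(1)[of B \<rho> q 0 "\<lambda>c. 0"] by simp
  then have "D_ideal \<subseteq> ?J"
    by (intro D_ideal_least) (auto simp: rel free_act_simps free_act_vecs[OF stable])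
  moreover have "(SOME q. q \<in> cls p) - p \<in> D_ideal"
    using someI[of "\<lambda>q. q \<in> cls p", OF cls_self] by (simp add: cls_def')
  ultimately have "free_act B \<rho> ((SOME q. q \<in> cls p) - p) v = (\<lambda>c. 0)"
    using v by auto
  then show ?thesis by (auto simp: act_def rep_module_def free_act_diff fun_eq_iff)
qed

lemma rep_module_simps [simp]:
  "carrier (rep_module B \<rho>) = vecs B" "\<zero>\<^bsub>rep_module B \<rho>\<^esub> = (\<lambda>b. 0)"
  "u \<oplus>\<^bsub>rep_module B \<rho>\<^esub> v = (\<lambda>b. u b + v b)"
  by (simp_all add: rep_module_def)

section \<open>Operators on the space with basis \<open>c\<^sub>1, \<dots>, c\<^sub>1\<^sub>0, t\<close>\<close>

abbreviation G_op :: "'k::field \<Rightarrow> S3 \<Rightarrow> (T_index \<Rightarrow> 'k) \<Rightarrow> T_index \<Rightarrow> 'k" where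
  "G_op \<zeta> g \<equiv> lin T_basis (T_grp \<zeta> g)"

definition dlt_op :: "S3 \<Rightarrow> (T_index \<Rightarrow> 'k::field) \<Rightarrow> T_index \<Rightarrow> 'k" where
  "dlt_op h v = (\<lambda>c. if c \<in> T_basis \<and> T_S3_degree c = h then v c else 0)"

text \<open>
  The action of \<open>x\<^sub>1\<^sub>2\<close> that extends the given one on \<open>c\<^sub>1, \<dots>, c\<^sub>1\<^sub>0\<close>: the scalars \<open>a\<close>, \<open>b\<close> are the coefficients
  of \<open>c\<^sub>1\<close>, \<open>c\<^sub>8\<close> in the image of \<open>t\<close>, and \<open>a'\<close>, \<open>b'\<close> those of \<open>t\<close> in the images of \<open>c\<^sub>1\<close>, \<open>c\<^sub>8\<close>.  The
  constants are those of \<open>T\<^sub>0\<^sub>,\<^sub>1\<close> written as polynomials in \<open>\<zeta>\<close> with rational coefficients, for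
  instance \<open>1 / (1 - \<zeta>) = (2 + \<zeta>) / 3\<close>; identities between operators then reduce to
  arithmetic modulo \<open>\<zeta>\<^sup>2 = - 1 - \<zeta>\<close>.
\<close>

definition X_op :: "'k::field_char_0 \<Rightarrow> 'k \<Rightarrow> 'k \<Rightarrow> 'k \<Rightarrow> 'k \<Rightarrow> (T_index \<Rightarrow> 'k) \<Rightarrow> T_index \<Rightarrow> 'k" where
  "X_op \<zeta> a b a' b' v = (\<lambda>c.
     if c = Low t12 then a * v TT
     else if c = Low t23 then \<zeta> * v (Tau1 c123) + (- 1 - \<zeta>) * v (Tau2 c123)
     else if c = Low t13 then \<zeta> * v (Tau1 c132) + (- 1 - \<zeta>) * v (Tau2 c132)
     else if c = Tau1 c123 then (1 - \<zeta>) / 3 * v (High t23)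
     else if c = Tau1 c132 then (1 - \<zeta>) / 3 * v (High t13)
     else if c = Tau2 c123 then (2 + \<zeta>) / 3 * v (High t23)
     else if c = Tau2 c132 then (2 + \<zeta>) / 3 * v (High t13)
     else if c = High t12 then b * v TT
     else if c = TT then a' * v (Low t12) + b' * v (High t12)
     else 0)"

definition Y_op :: "'k::field_char_0 \<Rightarrow> 'k \<Rightarrow> 'k \<Rightarrow> 'k \<Rightarrow> 'k \<Rightarrow> (T_index \<Rightarrow> 'k) \<Rightarrow> T_index \<Rightarrow> 'k" where
  "Y_op \<zeta> a b a' b' v = (\<lambda>c.
     if c = Low t12 then a * v TT
     else if c = Tau1 c123 then (- 1 - 2 * \<zeta>) / 3 * v (Low t23)
     else if c = Tau1 c132 then (- 1 - 2 * \<zeta>) / 3 * v (Low t13)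
     else if c = Tau2 c123 then (1 + 2 * \<zeta>) / 3 * v (Low t23)
     else if c = Tau2 c132 then (1 + 2 * \<zeta>) / 3 * v (Low t13)
     else if c = High t12 then b * v TT
     else if c = High t23 then v (Tau1 c123) + v (Tau2 c123)
     else if c = High t13 then v (Tau1 c132) + v (Tau2 c132)
     else if c = TT then a' * v (Low t12) + b' * v (High t12)
     else 0)"

lemma T_basis_eq: "T_basis = {Low t12, Low t13, Low t23, Tau1 c123, Tau1 c132, Tau2 c123, Tau2 c132,
    High t12, High t13, High t23, TT}"
  by (auto simp: T_basis_def transps_def)

lemma T_basis_in [simp]: "Low s \<in> T_basis \<longleftrightarrow> s \<in> transps" "High s \<in> T_basis \<longleftrightarrow> s \<in> transps"
  "Tau1 h \<in> T_basis \<longleftrightarrow> h \<in> {c123, c132}" "Tau2 h \<in> T_basis \<longleftrightarrow> h \<in> {c123, c132}" "TT \<in> T_basis"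
  by (auto simp: T_basis_def)

lemma finite_T_basis [simp]: "finite T_basis"
  by (simp add: T_basis_eq)

text \<open>
  Vectors are compared coordinate by coordinate; this turns each identity between operators into
  eleven scalar identities.
\<close>

lemma T_ext:
  assumes "u \<in> vecs T_basis" "v \<in> vecs T_basis"
    "u (Low t12) = v (Low t12)" "u (Low t13) = v (Low t13)" "u (Low t23) = v (Low t23)"
    "u (Tau1 c123) = v (Tau1 c123)" "u (Tau1 c132) = v (Tau1 c132)"
    "u (Tau2 c123) = v (Tau2 c123)" "u (Tau2 c132) = v (Tau2 c132)"
    "u (High t12) = v (High t12)" "u (High t13) = v (High t13)" "u (High t23) = v (High t23)" "u TT = v TT"
  shows "u = v"
proof (rule ext)
  fix c show "u c = v c"
  proof (cases "c \<in> T_basis")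
    case True
    then show ?thesis using assms(3-) by (auto simp: T_basis_eq)
  next
    case False
    then show ?thesis using assms(1,2) by (simp add: vecs_def)
  qed
qed

lemma op_vecs [simp, intro]:
  "X_op \<zeta> a b a' b' v \<in> vecs T_basis" "Y_op \<zeta> a b a' b' v \<in> vecs T_basis"
  "dlt_op h v \<in> vecs T_basis"
  by (auto simp: vecs_def X_op_def Y_op_def dlt_op_def)

lemma conj3_three_cycles [simp]: "conj3 g h \<in> {c123, c132} \<longleftrightarrow> h \<in> {c123, c132}"
  "conj3 g h = c123 \<or> conj3 g h = c132 \<longleftrightarrow> h = c123 \<or> h = c132"
  using S3_cases[of g] S3_cases[of h] by (elim disjE; simp)+

lemma T_grp_vecs: "b \<in> T_basis \<Longrightarrow> T_grp \<zeta> g b \<in> vecs T_basis"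
  by (cases b) (auto simp: T_grp_def vecs_def ket_def)

lemma G_op_vecs [simp, intro]: "G_op \<zeta> g v \<in> vecs T_basis"
  by (rule lin_vecs) (rule T_grp_vecs)

lemma lin_T_basis: "lin T_basis m v c = v (Low t12) * m (Low t12) c + (v (Low t13) * m (Low t13) c +
   (v (Low t23) * m (Low t23) c + (v (Tau1 c123) * m (Tau1 c123) c + (v (Tau1 c132) * m (Tau1 c132) c +
   (v (Tau2 c123) * m (Tau2 c123) c + (v (Tau2 c132) * m (Tau2 c132) c + (v (High t12) * m (High t12) c +
   (v (High t13) * m (High t13) c + (v (High t23) * m (High t23) c + v TT * m TT c)))))))))"
  by (simp add: lin_def T_basis_eq)

lemma rot_exp_simps [simp]: "rot_exp 1 = 0" "rot_exp t12 = 0" "rot_exp t13 = 1" "rot_exp t23 = 2"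
  "rot_exp c123 = 1" "rot_exp c132 = 2"
  by (simp_all add: rot_exp_def)

locale primitive_cube_root =
  fixes \<zeta> :: "'k::field_char_0"
  assumes cube: "\<zeta> ^ 3 = 1" and nontrivial: "\<zeta> \<noteq> 1"
begin

lemma zeta_square: "\<zeta> * \<zeta> = - 1 - \<zeta>"
proof -
  have "(\<zeta> - 1) * (\<zeta> * \<zeta> + \<zeta> + 1) = 0" using cube by (simp add: algebra_simps power3_eq_cube mult.assoc)
  then have "\<zeta> * \<zeta> + \<zeta> + 1 = 0" using nontrivial by simp
  then have "\<zeta> * \<zeta> = - (\<zeta> + 1)" by (metis add.assoc eq_neg_iff_add_eq_0)
  then show ?thesis by simp
qed

lemma zeta_square': "\<zeta> * (\<zeta> * u) = - u - \<zeta> * u"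
  using zeta_square by (simp flip: mult.assoc) (simp add: algebra_simps)

lemma zeta_power: "\<zeta>\<^sup>2 = - 1 - \<zeta>" "\<zeta> ^ 4 = \<zeta>" "inverse \<zeta> = - 1 - \<zeta>" "inverse \<zeta> ^ 4 = - 1 - \<zeta>"
proof -
  show 2: "\<zeta>\<^sup>2 = - 1 - \<zeta>" by (simp add: power2_eq_square zeta_square)
  have "\<zeta> ^ 4 = \<zeta> ^ 3 * \<zeta>" by (simp add: eval_nat_numeral)
  then show 4: "\<zeta> ^ 4 = \<zeta>" by (simp add: cube)
  have "\<zeta> * \<zeta>\<^sup>2 = 1" using cube by (simp add: power3_eq_cube power2_eq_square mult.assoc)
  then show i: "inverse \<zeta> = - 1 - \<zeta>" using inverse_unique 2 by metis
  show "inverse \<zeta> ^ 4 = - 1 - \<zeta>" by (metis 4 i power_inverse)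
qed

lemma zeta_fractions: "1 / (1 - \<zeta>) = (2 + \<zeta>) / 3" "\<zeta> / (1 - \<zeta>) = - ((1 - \<zeta>) / 3)"
  "\<zeta>\<^sup>2 / (1 - \<zeta>) = (- 1 - 2 * \<zeta>) / 3"
  using nontrivial by (simp_all add: field_simps zeta_power zeta_square zeta_square')

lemma zeta_not: "\<zeta> \<noteq> 0" "\<zeta> \<noteq> 1" "1 - \<zeta> \<noteq> 0" "1 + 2 * \<zeta> \<noteq> 0" "2 + \<zeta> \<noteq> 0" "1 + \<zeta> \<noteq> 0" "- 1 - \<zeta> \<noteq> 0"
proof -
  show 0: "\<zeta> \<noteq> 0" "\<zeta> \<noteq> 1" "1 - \<zeta> \<noteq> 0" using cube nontrivial by auto
  have "(1 + 2 * \<zeta>) * (1 + 2 * \<zeta>) = - 3" "(2 + \<zeta>) * (1 - \<zeta>) = 3" by (simp_all add: algebra_simps zeta_square zeta_square')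
  then show "1 + 2 * \<zeta> \<noteq> 0" "2 + \<zeta> \<noteq> 0" by auto
  show 1: "- 1 - \<zeta> \<noteq> 0" using zeta_square 0 by auto
  then show "1 + \<zeta> \<noteq> 0" by (metis add_eq_0_iff diff_minus_eq_add minus_diff_eq neg_equal_0_iff_equal add.commute)
qed

lemma G_op_simps [simp]:
  "s \<in> transps \<Longrightarrow> G_op \<zeta> g v (Low s) = sgn3 g * v (Low (conj3 (inverse g) s))"
  "s \<in> transps \<Longrightarrow> G_op \<zeta> g v (High s) = sgn3 g * v (High (conj3 (inverse g) s))"
  "G_op \<zeta> g v (Tau1 c123) = \<zeta> ^ rot_exp g * v (Tau1 (conj3 (inverse g) c123))"
  "G_op \<zeta> g v (Tau1 c132) = (- 1 - \<zeta>) ^ rot_exp g * v (Tau1 (conj3 (inverse g) c132))"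
  "G_op \<zeta> g v (Tau2 c123) = (- 1 - \<zeta>) ^ rot_exp g * v (Tau2 (conj3 (inverse g) c123))"
  "G_op \<zeta> g v (Tau2 c132) = \<zeta> ^ rot_exp g * v (Tau2 (conj3 (inverse g) c132))"
  "G_op \<zeta> g v TT = v TT"
proof -
  note d = lin_T_basis T_grp_def ket_def tau_coeff_def power_mult zeta_power
  have 4: "(- 1 - \<zeta>) ^ 2 = \<zeta>" "(- 1 - \<zeta>) * (- 1 - \<zeta>) = \<zeta>" "(- 1 - \<zeta>) ^ 4 = - 1 - \<zeta>"
    using zeta_power(4) by (simp_all add: power2_eq_square algebra_simps zeta_square zeta_power)
  note dd = d 4
  show "G_op \<zeta> g v (Low s) = sgn3 g * v (Low (conj3 (inverse g) s))"
    "G_op \<zeta> g v (High s) = sgn3 g * v (High (conj3 (inverse g) s))" if "s \<in> transps"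
    using S3_cases[of g] that unfolding transps_def by (auto simp: dd)
  show "G_op \<zeta> g v (Tau1 c123) = \<zeta> ^ rot_exp g * v (Tau1 (conj3 (inverse g) c123))"
    "G_op \<zeta> g v (Tau1 c132) = (- 1 - \<zeta>) ^ rot_exp g * v (Tau1 (conj3 (inverse g) c132))"
    "G_op \<zeta> g v (Tau2 c123) = (- 1 - \<zeta>) ^ rot_exp g * v (Tau2 (conj3 (inverse g) c123))"
    "G_op \<zeta> g v (Tau2 c132) = \<zeta> ^ rot_exp g * v (Tau2 (conj3 (inverse g) c132))"
    "G_op \<zeta> g v TT = v TT"
    using S3_cases[of g] by (elim disjE; simp add: dd; fail)+
qed

end

lemma lin_ket: "\<lbrakk>finite B; b \<in> B\<rbrakk> \<Longrightarrow> lin B m (ket b) = m b"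
  by (rule ext) (simp add: lin_def ket_def if_distrib[where f = "\<lambda>x. x * _"] cong: if_cong)

lemma lin_lin: "lin B m (lin B m' v) = lin B (\<lambda>b. lin B m (m' b)) v"
  unfolding lin_def sum_distrib_left sum_distrib_right
  by (rule ext, subst sum.swap) (simp add: mult.assoc)

lemma lin_cong: "(\<And>b. b \<in> B \<Longrightarrow> m b = m' b) \<Longrightarrow> lin B m = lin B m'"
  by (simp add: lin_def fun_eq_iff)

text \<open>
  If \<open>F\<close> is the action of \<open>x\<^sub>1\<^sub>2\<close>, this is the action of \<open>x\<^sub>s\<close>, and likewise for the \<open>y\<^sub>s\<close>.
\<close>

definition conj_op :: "'k::field \<Rightarrow> ((T_index \<Rightarrow> 'k) \<Rightarrow> T_index \<Rightarrow> 'k) \<Rightarrow> S3 \<Rightarrow> (T_index \<Rightarrow> 'k) \<Rightarrow> T_index \<Rightarrow> 'k" where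
  "conj_op \<zeta> F s v = (\<lambda>c. sgn3 (to_transp s) * G_op \<zeta> (to_transp s) (F (G_op \<zeta> (inverse (to_transp s)) v)) c)"

lemma lin_T_conj:
  assumes "s \<in> transps"
  shows "lin T_basis (T_conj \<zeta> m s) v = conj_op \<zeta> (lin T_basis m) s v"
proof -
  let ?g = "to_transp s"
  have "lin T_basis (T_conj \<zeta> m s) v =
      (\<lambda>c. sgn3 ?g * lin T_basis (\<lambda>b. lin T_basis (T_grp \<zeta> ?g) (lin T_basis m (T_grp \<zeta> (inverse ?g) b))) v c)"
    using assms by (simp add: T_conj_def Let_def lin_ket lin_def[of T_basis _ v] sum_distrib_left mult.left_commute)
  then show ?thesis by (simp add: conj_op_def lin_lin)
qed

lemma conj_op_vecs [simp, intro]: "conj_op \<zeta> F s v \<in> vecs T_basis"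
  using G_op_vecs[of \<zeta> "to_transp s"] unfolding conj_op_def vecs_def by simp

lemma dlt_op_simps [simp]:
  "s \<in> transps \<Longrightarrow> dlt_op h v (Low s) = (if s = h then v (Low s) else 0)"
  "s \<in> transps \<Longrightarrow> dlt_op h v (High s) = (if s = h then v (High s) else 0)"
  "k \<in> {c123, c132} \<Longrightarrow> dlt_op h v (Tau1 k) = (if k = h then v (Tau1 k) else 0)"
  "k \<in> {c123, c132} \<Longrightarrow> dlt_op h v (Tau2 k) = (if k = h then v (Tau2 k) else 0)"
  "dlt_op h v TT = (if 1 = h then v TT else 0)"
  by (simp_all add: dlt_op_def T_S3_degree_def)

lemma X_op_simps [simp]:
  "X_op \<zeta> a b a' b' v (Low t12) = a * v TT"
  "X_op \<zeta> a b a' b' v (Low t23) = \<zeta> * v (Tau1 c123) + (- 1 - \<zeta>) * v (Tau2 c123)"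
  "X_op \<zeta> a b a' b' v (Low t13) = \<zeta> * v (Tau1 c132) + (- 1 - \<zeta>) * v (Tau2 c132)"
  "X_op \<zeta> a b a' b' v (Tau1 c123) = (1 - \<zeta>) / 3 * v (High t23)"
  "X_op \<zeta> a b a' b' v (Tau1 c132) = (1 - \<zeta>) / 3 * v (High t13)"
  "X_op \<zeta> a b a' b' v (Tau2 c123) = (2 + \<zeta>) / 3 * v (High t23)"
  "X_op \<zeta> a b a' b' v (Tau2 c132) = (2 + \<zeta>) / 3 * v (High t13)"
  "X_op \<zeta> a b a' b' v (High t12) = b * v TT"
  "X_op \<zeta> a b a' b' v (High t13) = 0" "X_op \<zeta> a b a' b' v (High t23) = 0"
  "X_op \<zeta> a b a' b' v TT = a' * v (Low t12) + b' * v (High t12)"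
  by (simp_all add: X_op_def)

lemma Y_op_simps [simp]:
  "Y_op \<zeta> a b a' b' v (Low t12) = a * v TT"
  "Y_op \<zeta> a b a' b' v (Low t13) = 0" "Y_op \<zeta> a b a' b' v (Low t23) = 0"
  "Y_op \<zeta> a b a' b' v (Tau1 c123) = (- 1 - 2 * \<zeta>) / 3 * v (Low t23)"
  "Y_op \<zeta> a b a' b' v (Tau1 c132) = (- 1 - 2 * \<zeta>) / 3 * v (Low t13)"
  "Y_op \<zeta> a b a' b' v (Tau2 c123) = (1 + 2 * \<zeta>) / 3 * v (Low t23)"
  "Y_op \<zeta> a b a' b' v (Tau2 c132) = (1 + 2 * \<zeta>) / 3 * v (Low t13)"
  "Y_op \<zeta> a b a' b' v (High t12) = b * v TT"
  "Y_op \<zeta> a b a' b' v (High t23) = v (Tau1 c123) + v (Tau2 c123)"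
  "Y_op \<zeta> a b a' b' v (High t13) = v (Tau1 c132) + v (Tau2 c132)"
  "Y_op \<zeta> a b a' b' v TT = a' * v (Low t12) + b' * v (High t12)"
  by (simp_all add: Y_op_def)

lemma vecs_closed [simp, intro]: "\<lbrakk>u \<in> vecs B; v \<in> vecs B\<rbrakk> \<Longrightarrow> (\<lambda>c. u c + v c) \<in> vecs B"
  "(\<lambda>c. 0) \<in> vecs B" "v \<in> vecs B \<Longrightarrow> (\<lambda>c. k * v c) \<in> vecs B"
  "\<lbrakk>u \<in> vecs B; v \<in> vecs B\<rbrakk> \<Longrightarrow> (\<lambda>c. u c - v c) \<in> vecs B" "v \<in> vecs B \<Longrightarrow> (\<lambda>c. - v c) \<in> vecs B"
  by (simp_all add: vecs_def)

context primitive_cube_root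
begin

lemma zeta_cofactor: "(- 1 - \<zeta>)\<^sup>2 = \<zeta>"
  by (simp add: power2_eq_square algebra_simps zeta_square)

lemma lin_T_x12: "lin T_basis (T_x12 \<zeta>) = X_op \<zeta> 1 0 0 0"
proof (rule ext)
  fix v
  have "T_x12 \<zeta> b \<in> vecs T_basis" for b by (auto simp: T_x12_def vecs_def ket_def)
  then have "lin T_basis (T_x12 \<zeta>) v \<in> vecs T_basis" by (rule lin_vecs)
  then show "lin T_basis (T_x12 \<zeta>) v = X_op \<zeta> 1 0 0 0 v"
    by (rule T_ext) (use zeta_not in \<open>simp_all add: lin_T_basis T_x12_def ket_def zeta_fractions zeta_power field_simps zeta_square zeta_square'\<close>)
qed

lemma lin_T_y12: "lin T_basis (T_y12 \<zeta>) = Y_op \<zeta> 0 1 0 0"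
proof (rule ext)
  fix v
  have "T_y12 \<zeta> b \<in> vecs T_basis" for b by (auto simp: T_y12_def vecs_def ket_def)
  then have "lin T_basis (T_y12 \<zeta>) v \<in> vecs T_basis" by (rule lin_vecs)
  then show "lin T_basis (T_y12 \<zeta>) v = Y_op \<zeta> 0 1 0 0 v"
    by (rule T_ext) (use zeta_not in \<open>simp_all add: lin_T_basis T_y12_def ket_def zeta_fractions zeta_power field_simps zeta_square zeta_square'\<close>)
qed

lemma lin_T_rep:
  "lin T_basis (T_rep \<zeta> (GGrp g)) = G_op \<zeta> g"
  "lin T_basis (T_rep \<zeta> (GDelta g)) = dlt_op g"
  "s \<in> transps \<Longrightarrow> lin T_basis (T_rep \<zeta> (GX s)) = conj_op \<zeta> (X_op \<zeta> 1 0 0 0) s"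
  "s \<in> transps \<Longrightarrow> lin T_basis (T_rep \<zeta> (GY s)) = conj_op \<zeta> (Y_op \<zeta> 0 1 0 0) s"
  "s \<notin> transps \<Longrightarrow> lin T_basis (T_rep \<zeta> (GX s)) v = (\<lambda>c. 0)"
  "s \<notin> transps \<Longrightarrow> lin T_basis (T_rep \<zeta> (GY s)) v = (\<lambda>c. 0)"
proof -
  show "lin T_basis (T_rep \<zeta> (GGrp g)) = G_op \<zeta> g"
    by (rule lin_cong) (simp add: T_rep_def)
  show "lin T_basis (T_rep \<zeta> (GDelta g)) = dlt_op g"
  proof (intro ext)
    fix v c
    have "lin T_basis (T_rep \<zeta> (GDelta g)) v c =
        (\<Sum>b\<in>T_basis. if c = b then if T_S3_degree c = g then v c else 0 else 0)"
      unfolding lin_def by (rule sum.cong) (auto simp: T_rep_def ket_def)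
    then show "lin T_basis (T_rep \<zeta> (GDelta g)) v c = dlt_op g v c" by (simp add: dlt_op_def)
  qed
  show "lin T_basis (T_rep \<zeta> (GX s)) = conj_op \<zeta> (X_op \<zeta> 1 0 0 0) s" if "s \<in> transps"
    using lin_T_conj[OF that, of \<zeta> "T_x12 \<zeta>"] by (intro ext) (simp add: T_rep_def[abs_def] lin_T_x12)
  show "lin T_basis (T_rep \<zeta> (GY s)) = conj_op \<zeta> (Y_op \<zeta> 0 1 0 0) s" if "s \<in> transps"
    using lin_T_conj[OF that, of \<zeta> "T_y12 \<zeta>"] by (intro ext) (simp add: T_rep_def[abs_def] lin_T_y12)
qed (simp_all add: lin_def T_rep_def T_conj_def)

lemma G_op_one: "v \<in> vecs T_basis \<Longrightarrow> G_op \<zeta> 1 v = v"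
  by (rule T_ext) simp_all

text \<open>
  The scalars by which the group acts on the vectors \<open>c\<^sub>4, \<dots>, c\<^sub>7\<close> form a cocycle.  The inverse of
  \<open>\<zeta>\<close> is \<open>- 1 - \<zeta>\<close>; a transposition on the left exchanges \<open>\<zeta>\<close> and its inverse.
\<close>

lemma phase_mult:
  "g \<in> {1, c123, c132} \<Longrightarrow> \<zeta> ^ rot_exp g * (\<zeta> ^ rot_exp h * u) = \<zeta> ^ rot_exp (g * h) * u"
  "g \<in> {1, c123, c132} \<Longrightarrow>
    (- 1 - \<zeta>) ^ rot_exp g * ((- 1 - \<zeta>) ^ rot_exp h * u) = (- 1 - \<zeta>) ^ rot_exp (g * h) * u"
  "g \<in> transps \<Longrightarrow> \<zeta> ^ rot_exp g * ((- 1 - \<zeta>) ^ rot_exp h * u) = \<zeta> ^ rot_exp (g * h) * u"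
  "g \<in> transps \<Longrightarrow> (- 1 - \<zeta>) ^ rot_exp g * (\<zeta> ^ rot_exp h * u) = (- 1 - \<zeta>) ^ rot_exp (g * h) * u"
  unfolding transps_def using S3_cases[of h]
  by (simp_all only: insert_iff empty_iff, elim disjE;
      simp add: zeta_power zeta_cofactor; simp add: algebra_simps zeta_square zeta_square')+

lemma G_op_mult: "G_op \<zeta> g (G_op \<zeta> h v) = G_op \<zeta> (g * h) v"
proof -
  have lh: "G_op \<zeta> g (G_op \<zeta> h v) (Low s) = G_op \<zeta> (g * h) v (Low s)"
      "G_op \<zeta> g (G_op \<zeta> h v) (High s) = G_op \<zeta> (g * h) v (High s)" if "s \<in> transps" for s
    using that by (simp_all add: sgn3_mult conj3_mult mult.assoc)
  have "g \<in> {1, c123, c132} \<and> conj3 (inverse g) c123 = c123 \<and> conj3 (inverse g) c132 = c132 \<or>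
      g \<in> transps \<and> conj3 (inverse g) c123 = c132 \<and> conj3 (inverse g) c132 = c123"
    using S3_cases[of g] by (elim disjE) simp_all
  then show ?thesis
    by (elim disjE conjE; intro T_ext G_op_vecs lh)
       (simp_all add: phase_mult conj3_mult del: insert_iff singleton_iff)
qed

lemma conj3_inverse_eq_iff: "conj3 (inverse g) s = h \<longleftrightarrow> s = conj3 g h"
  by (auto simp: conj3_mult[symmetric])

lemma G_op_dlt_op: "G_op \<zeta> g (dlt_op h v) = dlt_op (conj3 g h) (G_op \<zeta> g v)"
proof -
  have 1: "1 = h \<longleftrightarrow> 1 = conj3 g h" using conj3_inverse_eq_iff[of g 1 h] by auto
  have m: "conj3 (inverse g) c123 \<in> {c123, c132}" "conj3 (inverse g) c132 \<in> {c123, c132}"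
    by (subst conj3_three_cycles, simp)+
  show ?thesis
    by (intro T_ext G_op_vecs op_vecs)
       (simp_all add: conj3_inverse_eq_iff 1 dlt_op_simps(3,4)[OF m(1)] dlt_op_simps(3,4)[OF m(2)])
qed

lemma G_op_scale: "G_op \<zeta> g (\<lambda>c. k * v c) = (\<lambda>c. k * G_op \<zeta> g v c)"
  by (rule lin_scale)

lemma X_op_scale: "X_op \<zeta> a b a' b' (\<lambda>c. k * v c) = (\<lambda>c. k * X_op \<zeta> a b a' b' v c)"
  by (auto simp: X_op_def fun_eq_iff algebra_simps)

lemma Y_op_scale: "Y_op \<zeta> a b a' b' (\<lambda>c. k * v c) = (\<lambda>c. k * Y_op \<zeta> a b a' b' v c)"
  by (auto simp: Y_op_def fun_eq_iff algebra_simps)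

lemma G_op_t12: "G_op \<zeta> t12 (X_op \<zeta> a b a' b' v) = (\<lambda>c. - 1 * X_op \<zeta> a b a' b' (G_op \<zeta> t12 v) c)"
  "G_op \<zeta> t12 (Y_op \<zeta> a b a' b' v) = (\<lambda>c. - 1 * Y_op \<zeta> a b a' b' (G_op \<zeta> t12 v) c)"
  by (intro T_ext vecs_closed(3) G_op_vecs op_vecs; simp add: algebra_simps)+

lemma dlt_op_t12:
  "dlt_op g (X_op \<zeta> a b a' b' v) = X_op \<zeta> a b a' b' (dlt_op (t12 * g) v)"
  "dlt_op g (Y_op \<zeta> a b a' b' v) = Y_op \<zeta> a b a' b' (dlt_op (t12 * g) v)"
  using S3_cases[of g] by (elim disjE; intro T_ext op_vecs; simp)+

text \<open>
  The stabilizer of \<open>(12)\<close> under conjugation is generated by \<open>(12)\<close> itself, so compatibility of \<open>F\<close> with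
  that one element gives the relation between \<open>g\<close> and \<open>z\<^sub>s\<close> for all \<open>g\<close> and \<open>s\<close>.
\<close>

lemma G_op_conj_op:
  assumes F: "\<And>v. F v \<in> vecs T_basis" "\<And>v. G_op \<zeta> t12 (F v) = (\<lambda>c. - 1 * F (G_op \<zeta> t12 v) c)"
    and s: "s \<in> transps"
  shows "G_op \<zeta> g (conj_op \<zeta> F s v) = (\<lambda>c. sgn3 g * conj_op \<zeta> F (conj3 g s) (G_op \<zeta> g v) c)"
proof -
  let ?h = "to_transp s" and ?h' = "to_transp (conj3 g s)"
  define c where "c = inverse ?h' * g * ?h"
  have c12: "c = 1 \<or> c = t12" "sgn3 g * sgn3 ?h' = (sgn3 ?h * sgn3 c :: 'k)"
    using S3_cases[of g] s unfolding transps_def c_def by auto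
  have gh: "g * ?h = ?h' * c" "c * inverse ?h = inverse ?h' * g"
    by (simp add: c_def flip: mult.assoc) (simp add: c_def mult.assoc)
  have Fc: "G_op \<zeta> c (F (G_op \<zeta> k v)) = (\<lambda>b. sgn3 c * F (G_op \<zeta> (c * k) v) b)" for k
    using c12(1)
  proof
    assume "c = 1"
    then show ?thesis by (simp add: G_op_one F)
  next
    assume "c = t12"
    then show ?thesis using F(2) by (simp add: G_op_mult)
  qed
  have "G_op \<zeta> g (conj_op \<zeta> F s v) = (\<lambda>b. sgn3 ?h * G_op \<zeta> ?h' (G_op \<zeta> c (F (G_op \<zeta> (inverse ?h) v))) b)"
    by (simp add: conj_op_def G_op_scale G_op_mult gh)
  also have "\<dots> = (\<lambda>b. sgn3 ?h * sgn3 c * G_op \<zeta> ?h' (F (G_op \<zeta> (inverse ?h' * g) v)) b)"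
    by (simp add: Fc G_op_scale gh mult.assoc)
  finally show ?thesis by (simp add: conj_op_def G_op_mult mult.assoc flip: c12(2))
qed

lemma dlt_op_conj_op:
  assumes F: "\<And>g v. dlt_op g (F v) = F (dlt_op (t12 * g) v)" and s: "s \<in> transps"
  shows "dlt_op g (conj_op \<zeta> F s v) = conj_op \<zeta> F s (dlt_op (s * g) v)"
proof -
  let ?h = "to_transp s"
  have sc: "dlt_op g (\<lambda>c. k * v c) = (\<lambda>c. k * dlt_op g v c)" for g v and k :: 'k
    by (simp add: dlt_op_def fun_eq_iff)
  have "conj3 ?h t12 = s" using s unfolding transps_def by auto
  moreover have "conj3 ?h (t12 * conj3 (inverse ?h) g) = conj3 ?h t12 * g"
    unfolding conj3_def by (simp add: mult.assoc)
  ultimately have "t12 * conj3 (inverse ?h) g = conj3 (inverse ?h) (s * g)"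
    using conj3_inverse_eq_iff[of ?h "s * g"] by metis
  moreover have comm: "dlt_op g (G_op \<zeta> ?h w) = G_op \<zeta> ?h (dlt_op (conj3 (inverse ?h) g) w)" for w
    using G_op_dlt_op[of ?h "conj3 (inverse ?h) g" w] by (simp flip: conj3_mult)
  ultimately show ?thesis
    by (simp add: conj_op_def sc F G_op_dlt_op[of "inverse ?h" "s * g"] comm)
qed

lemma conj_op_square:
  assumes F: "\<And>v. F (F v) = (\<lambda>c. 0)" "\<And>k v. F (\<lambda>c. k * v c) = (\<lambda>c. k * F v c)" "\<And>v. F v \<in> vecs T_basis"
  shows "conj_op \<zeta> F s (conj_op \<zeta> F s v) = (\<lambda>c. 0)"
proof -
  have "G_op \<zeta> g (\<lambda>c. 0) = (\<lambda>c. 0)" for g by (simp add: lin_def)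
  then show ?thesis by (simp add: conj_op_def G_op_scale F G_op_mult G_op_one)
qed

lemma X_op_conj [simp]:
  fixes v :: "T_index \<Rightarrow> 'k" and a b a' b' :: 'k
  defines "X13 \<equiv> conj_op \<zeta> (X_op \<zeta> a b a' b') t13 v" and "X23 \<equiv> conj_op \<zeta> (X_op \<zeta> a b a' b') t23 v"
  shows
  "X13 (Low t12) = (- 1 - \<zeta>) * v (Tau1 c123) + \<zeta> * v (Tau2 c123)"
  "X13 (Low t13) = a * v TT"
  "X13 (Low t23) = v (Tau1 c132) + v (Tau2 c132)"
  "X13 (Tau1 c123) = (- 2 - \<zeta>) / 3 * v (High t12)"
  "X13 (Tau1 c132) = (1 + 2 * \<zeta>) / 3 * v (High t23)"
  "X13 (Tau2 c123) = (- 1 + \<zeta>) / 3 * v (High t12)"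
  "X13 (Tau2 c132) = (- 1 - 2 * \<zeta>) / 3 * v (High t23)"
  "X13 (High t12) = 0" "X13 (High t13) = b * v TT" "X13 (High t23) = 0"
  "X13 TT = a' * v (Low t13) + b' * v (High t13)"
  "X23 (Low t12) = (- 1 - \<zeta>) * v (Tau1 c132) + \<zeta> * v (Tau2 c132)"
  "X23 (Low t13) = v (Tau1 c123) + v (Tau2 c123)"
  "X23 (Low t23) = a * v TT"
  "X23 (Tau1 c123) = (1 + 2 * \<zeta>) / 3 * v (High t13)"
  "X23 (Tau1 c132) = (- 2 - \<zeta>) / 3 * v (High t12)"
  "X23 (Tau2 c123) = (- 1 - 2 * \<zeta>) / 3 * v (High t13)"
  "X23 (Tau2 c132) = (- 1 + \<zeta>) / 3 * v (High t12)"
  "X23 (High t12) = 0" "X23 (High t13) = 0" "X23 (High t23) = b * v TT"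
  "X23 TT = a' * v (Low t23) + b' * v (High t23)"
  unfolding X13_def X23_def conj_op_def
  by (simp add: zeta_cofactor zeta_power field_simps zeta_square zeta_square'; fail)+

lemma Y_op_conj [simp]:
  fixes v :: "T_index \<Rightarrow> 'k" and a b a' b' :: 'k
  defines "Y13 \<equiv> conj_op \<zeta> (Y_op \<zeta> a b a' b') t13 v" and "Y23 \<equiv> conj_op \<zeta> (Y_op \<zeta> a b a' b') t23 v"
  shows
  "Y13 (Low t12) = 0" "Y13 (Low t13) = a * v TT" "Y13 (Low t23) = 0"
  "Y13 (Tau1 c123) = (- 1 + \<zeta>) / 3 * v (Low t12)"
  "Y13 (Tau1 c132) = (2 + \<zeta>) / 3 * v (Low t23)"
  "Y13 (Tau2 c123) = (- 2 - \<zeta>) / 3 * v (Low t12)"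
  "Y13 (Tau2 c132) = (1 - \<zeta>) / 3 * v (Low t23)"
  "Y13 (High t12) = \<zeta> * v (Tau1 c123) + (- 1 - \<zeta>) * v (Tau2 c123)"
  "Y13 (High t13) = b * v TT"
  "Y13 (High t23) = (- 1 - \<zeta>) * v (Tau1 c132) + \<zeta> * v (Tau2 c132)"
  "Y13 TT = a' * v (Low t13) + b' * v (High t13)"
  "Y23 (Low t12) = 0" "Y23 (Low t13) = 0" "Y23 (Low t23) = a * v TT"
  "Y23 (Tau1 c123) = (2 + \<zeta>) / 3 * v (Low t13)"
  "Y23 (Tau1 c132) = (- 1 + \<zeta>) / 3 * v (Low t12)"
  "Y23 (Tau2 c123) = (1 - \<zeta>) / 3 * v (Low t13)"
  "Y23 (Tau2 c132) = (- 2 - \<zeta>) / 3 * v (Low t12)"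
  "Y23 (High t12) = \<zeta> * v (Tau1 c132) + (- 1 - \<zeta>) * v (Tau2 c132)"
  "Y23 (High t13) = (- 1 - \<zeta>) * v (Tau1 c123) + \<zeta> * v (Tau2 c123)"
  "Y23 (High t23) = b * v TT"
  "Y23 TT = a' * v (Low t23) + b' * v (High t23)"
  unfolding Y13_def Y23_def conj_op_def
  by (simp add: zeta_cofactor zeta_power field_simps zeta_square zeta_square'; fail)+

lemma conj_op_t12: "v \<in> vecs T_basis \<Longrightarrow> conj_op \<zeta> (X_op \<zeta> a b a' b') t12 v = X_op \<zeta> a b a' b' v"
  "v \<in> vecs T_basis \<Longrightarrow> conj_op \<zeta> (Y_op \<zeta> a b a' b') t12 v = Y_op \<zeta> a b a' b' v"
  by (simp_all add: conj_op_def G_op_one)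

lemma X_op_square: "X_op \<zeta> a b 0 0 (X_op \<zeta> a b 0 0 v) = (\<lambda>c. 0)"
  by (intro T_ext op_vecs vecs_closed; simp add: field_simps zeta_square zeta_square')

lemma Y_op_square: "Y_op \<zeta> a b 0 0 (Y_op \<zeta> a b 0 0 v) = (\<lambda>c. 0)"
  by (intro T_ext op_vecs vecs_closed; simp add: field_simps zeta_square zeta_square')

lemma quadratic_relations:
  fixes v :: "T_index \<Rightarrow> 'k"
  assumes v: "v \<in> vecs T_basis" and F: "F = X_op \<zeta> a b 0 0 \<or> F = Y_op \<zeta> a b 0 0"
  shows "(\<lambda>c. conj_op \<zeta> F t12 (conj_op \<zeta> F t13 v) c + conj_op \<zeta> F t23 (conj_op \<zeta> F t12 v) c
      + conj_op \<zeta> F t13 (conj_op \<zeta> F t23 v) c) = (\<lambda>c. 0)"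
    "(\<lambda>c. conj_op \<zeta> F t13 (conj_op \<zeta> F t12 v) c + conj_op \<zeta> F t12 (conj_op \<zeta> F t23 v) c
      + conj_op \<zeta> F t23 (conj_op \<zeta> F t13 v) c) = (\<lambda>c. 0)"
  using F
  by (elim disjE; intro T_ext vecs_closed conj_op_vecs;
      simp add: conj_op_t12 v field_simps zeta_square zeta_square')+

text \<open>
  The two entries \<open>1\<close> of the operators are linked: with \<open>X_op \<zeta> a b 0 0\<close> and \<open>Y_op \<zeta> c d 0 0\<close> the
  relation holds only for \<open>a = d\<close>, see \<open>column_cross_relation\<close>.
\<close>

lemma cross_relations_T:
  fixes v :: "T_index \<Rightarrow> 'k"
  assumes v: "v \<in> vecs T_basis" and s: "s \<in> transps" and r: "r \<in> transps"
  defines "xc \<equiv> conj_op \<zeta> (X_op \<zeta> 1 0 0 0)" and "yc \<equiv> conj_op \<zeta> (Y_op \<zeta> 0 1 0 0)"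
  shows "yc s (xc r v) = (\<lambda>c. - xc r (yc (r * s * r) v) c + (if s = r then v c else 0)
      + G_op \<zeta> r (\<lambda>c. dlt_op s v c - dlt_op (s * r) v c) c)"
proof -
  have c: "(\<lambda>c. - xc r (yc (r * s * r) v) c + (if s = r then v c else 0)
      + G_op \<zeta> r (\<lambda>c. dlt_op s v c - dlt_op (s * r) v c) c) \<in> vecs T_basis"
    unfolding xc_def using v by (cases "s = r") (auto intro!: vecs_closed)
  have "(s = t12 \<or> s = t13 \<or> s = t23) \<and> (r = t12 \<or> r = t13 \<or> r = t23)"
    using s r by (auto simp: transps_def)
  then show ?thesis
    by (elim conjE disjE; intro T_ext c; (unfold yc_def, rule conj_op_vecs)?)
       (simp_all add: xc_def yc_def conj_op_t12 v zeta_power zeta_cofactor field_simps zeta_square zeta_square')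
qed

lemma T_rep_relations:
  assumes p: "p \<in> D_relations" and v: "v \<in> vecs T_basis"
  shows "free_act T_basis (T_rep \<zeta>) p v = (\<lambda>c. 0)"
proof -
  note sim = free_act_simps lin_T_rep v
  consider "p \<in> double_S3_relations" | "p \<in> boson_relations xx" | "p \<in> boson_relations yy" | "p \<in> cross_relations"
    using p by (auto simp: D_relations_def)
  then show ?thesis
  proof cases
    case 1
    have "(\<lambda>c. dlt_op 1 v c + (dlt_op t12 v c + (dlt_op t13 v c + (dlt_op t23 v c + (dlt_op c123 v c + dlt_op c132 v c))))) = v"
      by (intro T_ext vecs_closed op_vecs v) simp_all
    then have sum: "free_act T_basis (T_rep \<zeta>) (\<Sum>g\<in>UNIV. dlt g) v = v"
      by (simp add: S3_sum sim)
    have dd: "dlt_op g (dlt_op h v) = (\<lambda>c. if g = h then dlt_op g v c else 0)" for g h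
      by (auto simp: dlt_op_def fun_eq_iff)
    show ?thesis using 1 unfolding double_S3_relations_def
      by (auto simp: sim sum G_op_one G_op_mult G_op_dlt_op dd split: if_splits)
  next
    case 2
    have X: "conj_op \<zeta> (X_op \<zeta> 1 0 0 0) s (conj_op \<zeta> (X_op \<zeta> 1 0 0 0) s v) = (\<lambda>c. 0)" for s
      by (rule conj_op_square) (simp_all add: X_op_square X_op_scale)
    show ?thesis
      using 2 unfolding boson_relations_def
      by (elim UnE CollectE exE conjE insertE emptyE)
        (simp_all add: sim X quadratic_relations[OF v disjI1[OF refl]]
          G_op_conj_op G_op_t12 dlt_op_conj_op dlt_op_t12)
  next
    case 3
    have Y: "conj_op \<zeta> (Y_op \<zeta> 0 1 0 0) s (conj_op \<zeta> (Y_op \<zeta> 0 1 0 0) s v) = (\<lambda>c. 0)" for s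
      by (rule conj_op_square) (simp_all add: Y_op_square Y_op_scale)
    show ?thesis
      using 3 unfolding boson_relations_def
      by (elim UnE CollectE exE conjE insertE emptyE)
        (simp_all add: sim Y quadratic_relations[OF v disjI2[OF refl]]
          G_op_conj_op G_op_t12 dlt_op_conj_op dlt_op_t12)
  next
    case 4
    then obtain s r where sr: "s \<in> transps" "r \<in> transps" "p = yy s * xx r - (- (xx r * yy (r * s * r)) +
        (if s = r then 1 else 0) + grp r * (dlt s - dlt (s * r)))"
      unfolding cross_relations_def by auto
    have t: "r * s * r \<in> transps" using conj3_transps[of r s] sr(1,2) by (auto simp: transps_def)
    show ?thesis
      using cross_relations_T[OF v sr(1,2)] sr t by (auto simp: sim fun_eq_iff)
  qed
qed

lemma T_rep_stable: "b \<in> T_basis \<Longrightarrow> T_rep \<zeta> a b \<in> vecs T_basis"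
proof -
  assume b: "b \<in> T_basis"
  then have "T_rep \<zeta> a b = lin T_basis (T_rep \<zeta> a) (ket b)" by (simp add: lin_ket)
  also have "\<dots> \<in> vecs T_basis"
  proof (cases a)
    case (GX s)
    then show ?thesis using lin_T_rep(3,5)[of s] by (cases "s \<in> transps") auto
  next
    case (GY s)
    then show ?thesis using lin_T_rep(4,6)[of s] by (cases "s \<in> transps") auto
  qed (simp_all add: lin_T_rep)
  finally show ?thesis .
qed

lemma act_T01:
  assumes "v \<in> vecs T_basis"
  shows "act (T01 \<zeta>) p v = free_act T_basis (T_rep \<zeta>) p v"
  using T_rep_stable T_rep_relations assms by (rule act_rep_module)

lemma act_T01_generators:
  assumes v: "v \<in> vecs T_basis"
  shows "act (T01 \<zeta>) (scal k) v = (\<lambda>c. k * v c)" "act (T01 \<zeta>) (grp g) v = G_op \<zeta> g v"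
    "act (T01 \<zeta>) (dlt h) v = dlt_op h v"
    "act (T01 \<zeta>) (xx t12) v = X_op \<zeta> 1 0 0 0 v" "act (T01 \<zeta>) (yy t12) v = Y_op \<zeta> 0 1 0 0 v"
  using v by (simp_all add: act_T01 free_act_simps lin_T_rep conj_op_t12)

end

section \<open>Induced modules and their quotients\<close>

lemma tensor_k_simps [simp]:
  "carrier (tensor_k B) = {f. \<forall>b. if b \<in> B then f b \<in> carrier DD else f b = \<zero>\<^bsub>DD\<^esub>}"
  "\<zero>\<^bsub>tensor_k B\<^esub> = (\<lambda>b. \<zero>\<^bsub>DD\<^esub>)" "f \<oplus>\<^bsub>tensor_k B\<^esub> f' = (\<lambda>b. f b \<oplus>\<^bsub>DD\<^esub> f' b)"
  "d \<odot>\<^bsub>tensor_k B\<^esub> f = (\<lambda>b. d \<otimes>\<^bsub>DD\<^esub> f b)"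
  by (simp_all add: tensor_k_def)

lemma left_module_tensor_k: "left_module DD (tensor_k B :: ('k::field free set, 'b \<Rightarrow> 'k free set) module)"
proof -
  interpret R: ring "DD :: 'k free set ring" by (rule ring_DD)
  have c: "f b \<in> carrier DD" if "f \<in> carrier (tensor_k B)" for f :: "'b \<Rightarrow> 'k free set" and b
    using that by (cases "b \<in> B") (auto dest: spec[of _ b])
  show ?thesis
  proof (rule left_moduleI[OF ring_DD])
    show "\<exists>y\<in>carrier (tensor_k B). y \<oplus>\<^bsub>tensor_k B\<^esub> x = \<zero>\<^bsub>tensor_k B\<^esub>"
      if x: "x \<in> carrier (tensor_k B)" for x :: "'b \<Rightarrow> 'k free set"
    proof (rule bexI[of _ "\<lambda>b. \<ominus>\<^bsub>DD\<^esub> x b"])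
      show "(\<lambda>b. \<ominus>\<^bsub>DD\<^esub> x b) \<oplus>\<^bsub>tensor_k B\<^esub> x = \<zero>\<^bsub>tensor_k B\<^esub>"
        using c[OF x] by (simp add: R.l_neg)
      show "(\<lambda>b. \<ominus>\<^bsub>DD\<^esub> x b) \<in> carrier (tensor_k B)" using x c[OF x] by auto
    qed
    fix f g h :: "'b \<Rightarrow> 'k free set" and a d :: "'k free set"
    assume f: "f \<in> carrier (tensor_k B)"
    show "\<zero>\<^bsub>tensor_k B\<^esub> \<oplus>\<^bsub>tensor_k B\<^esub> f = f" "\<one>\<^bsub>DD\<^esub> \<odot>\<^bsub>tensor_k B\<^esub> f = f" using c[OF f] by simp_all
    show "a \<odot>\<^bsub>tensor_k B\<^esub> f \<in> carrier (tensor_k B)" if "a \<in> carrier DD" using f c[OF f] that by auto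
    show "(a \<oplus>\<^bsub>DD\<^esub> d) \<odot>\<^bsub>tensor_k B\<^esub> f = a \<odot>\<^bsub>tensor_k B\<^esub> f \<oplus>\<^bsub>tensor_k B\<^esub> d \<odot>\<^bsub>tensor_k B\<^esub> f"
      "(a \<otimes>\<^bsub>DD\<^esub> d) \<odot>\<^bsub>tensor_k B\<^esub> f = a \<odot>\<^bsub>tensor_k B\<^esub> (d \<odot>\<^bsub>tensor_k B\<^esub> f)"
      if "a \<in> carrier DD" "d \<in> carrier DD" using that c[OF f] by (simp_all add: R.l_distr R.m_assoc)
    assume g: "g \<in> carrier (tensor_k B)"
    show "f \<oplus>\<^bsub>tensor_k B\<^esub> g \<in> carrier (tensor_k B)" using f g c[OF f] c[OF g] by auto
    show "f \<oplus>\<^bsub>tensor_k B\<^esub> g = g \<oplus>\<^bsub>tensor_k B\<^esub> f" using c[OF f] c[OF g] by (simp add: R.a_comm)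
    show "a \<odot>\<^bsub>tensor_k B\<^esub> (f \<oplus>\<^bsub>tensor_k B\<^esub> g) = a \<odot>\<^bsub>tensor_k B\<^esub> f \<oplus>\<^bsub>tensor_k B\<^esub> a \<odot>\<^bsub>tensor_k B\<^esub> g"
      if "a \<in> carrier DD" using that c[OF f] c[OF g] by (simp add: R.r_distr)
    assume h: "h \<in> carrier (tensor_k B)"
    show "f \<oplus>\<^bsub>tensor_k B\<^esub> g \<oplus>\<^bsub>tensor_k B\<^esub> h = f \<oplus>\<^bsub>tensor_k B\<^esub> (g \<oplus>\<^bsub>tensor_k B\<^esub> h)"
      using c[OF f] c[OF g] c[OF h] by (simp add: R.a_assoc)
  qed simp
qed

text \<open>
  The element \<open>1 \<otimes> b\<close>.
\<close>

definition tensor_unit :: "'b \<Rightarrow> 'b \<Rightarrow> 'k::field free set" where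
  "tensor_unit b = (\<lambda>c. if c = b then \<one>\<^bsub>DD\<^esub> else \<zero>\<^bsub>DD\<^esub>)"

lemma tensor_unit_carrier: "b \<in> B \<Longrightarrow> tensor_unit b \<in> carrier (tensor_k B)"
  by (auto simp: tensor_unit_def DD_simps)

lemma submodule_balancing:
  fixes \<rho> :: "gen \<Rightarrow> 'b \<Rightarrow> 'b \<Rightarrow> 'k::field"
  shows "submodule (balancing S B \<rho>) DD (tensor_k B)"
proof -
  interpret left_module DD "tensor_k B :: ('k free set, 'b \<Rightarrow> 'k free set) module"
    by (rule left_module_tensor_k)
  have pt: "pure_tensor B d v \<in> carrier (tensor_k B)" if "d \<in> carrier DD" for d and v :: "'b \<Rightarrow> 'k"
    using that R.m_closed by (auto simp: pure_tensor_def)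
  show ?thesis
    unfolding balancing_def
  proof (rule gen_submodule_submodule[OF left_module_tensor_k], safe)
    fix d :: "'k free set" and p :: "'k free" and v :: "'b \<Rightarrow> 'k"
    assume "d \<in> carrier DD"
    then have "pure_tensor B (d \<otimes>\<^bsub>DD\<^esub> cls p) v \<ominus>\<^bsub>tensor_k B\<^esub> pure_tensor B d (free_act B \<rho> p v)
        \<in> carrier (tensor_k B)"
      by (intro M.minus_closed pt R.m_closed) auto
    then show "pure_tensor B (d \<otimes>\<^bsub>DD\<^esub> cls p) v \<ominus>\<^bsub>tensor_k B\<^esub> pure_tensor B d (free_act B \<rho> p v)
        \<in> carrier (tensor_k B)" .
  qed
qed

lemma left_module_induced:
  fixes \<rho> :: "gen \<Rightarrow> 'b \<Rightarrow> 'b \<Rightarrow> 'k::field"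
  shows "left_module DD (induced S B \<rho>)"
  unfolding induced_def
  by (intro module_with_submodule.left_module_quot module_with_submoduleI left_module_tensor_k submodule_balancing)

text \<open>
  Quotients of induced modules.  Verma and co-Verma modules modulo their socles and the simple modules are
  of this form.  They are generated by the images
  of \<open>1 \<otimes> b\<close>, on which the inducing subalgebra acts as prescribed.
\<close>

locale induced_quotient =
  fixes S :: "gen set" and B :: "'b set" and \<rho> :: "gen \<Rightarrow> 'b \<Rightarrow> 'b \<Rightarrow> 'k::field"
    and N :: "('b \<Rightarrow> 'k free set) set set"
  assumes finite_B: "finite B" and stable: "\<And>a b. b \<in> B \<Longrightarrow> \<rho> a b \<in> vecs B"
    and N: "submodule N DD (induced S B \<rho>)"
begin

abbreviation "bal \<equiv> balancing S B \<rho>"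
abbreviation "tens \<equiv> (tensor_k B :: ('k free set, 'b \<Rightarrow> 'k free set) module)"
abbreviation "ind \<equiv> induced S B \<rho>"
abbreviation "quo \<equiv> quot_module ind N"

sublocale Te: module_with_submodule DD tens bal
  by (intro module_with_submoduleI left_module_tensor_k submodule_balancing)

sublocale In: module_with_submodule DD ind N
  by (intro module_with_submoduleI left_module_induced N)

sublocale Q: D_module quo
  by (intro D_moduleI In.left_module_quot)

definition proj :: "('b \<Rightarrow> 'k free set) \<Rightarrow> ('b \<Rightarrow> 'k free set) set set" where
  "proj f = N +>\<^bsub>ind\<^esub> (bal +>\<^bsub>tens\<^esub> f)"

definition gene :: "'b \<Rightarrow> ('b \<Rightarrow> 'k free set) set set" where
  "gene b = proj (tensor_unit b)"

lemma coset_in_ind: "f \<in> carrier tens \<Longrightarrow> bal +>\<^bsub>tens\<^esub> f \<in> carrier ind"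
  unfolding induced_def Te.quot_carrier by blast

lemma carrier_quo: "carrier quo = proj ` carrier tens"
  unfolding In.quot_carrier proj_def by (auto simp: induced_def Te.quot_carrier)

lemma proj_carrier: "f \<in> carrier tens \<Longrightarrow> proj f \<in> carrier quo"
  by (simp add: carrier_quo)

lemma proj_add: "\<lbrakk>f \<in> carrier tens; g \<in> carrier tens\<rbrakk> \<Longrightarrow> proj (f \<oplus>\<^bsub>tens\<^esub> g) = proj f \<oplus>\<^bsub>quo\<^esub> proj g"
  unfolding proj_def using coset_in_ind
  by (simp only: In.quot_add) (simp only: induced_def Te.quot_add)

lemma proj_smult: "\<lbrakk>f \<in> carrier tens; d \<in> carrier DD\<rbrakk> \<Longrightarrow> proj (d \<odot>\<^bsub>tens\<^esub> f) = d \<odot>\<^bsub>quo\<^esub> proj f"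
  unfolding proj_def using coset_in_ind
  by (simp only: In.quot_smult) (simp only: induced_def Te.quot_smult)

lemma proj_balanced: "f \<in> bal \<Longrightarrow> proj f = \<zero>\<^bsub>quo\<^esub>"
  unfolding proj_def In.quot_zero
proof -
  assume f: "f \<in> bal"
  then have "bal +>\<^bsub>tens\<^esub> f = \<zero>\<^bsub>ind\<^esub>"
    using Te.coset_eq_zero_iff[OF Te.in_N_carrier[OF f]] by (simp add: induced_def Te.quot_zero)
  then show "N +>\<^bsub>ind\<^esub> (bal +>\<^bsub>tens\<^esub> f) = N"
    using In.coset_eq_zero_iff[OF In.M.zero_closed] In.N_simps(2) by simp
qed

lemma gene_carrier [simp, intro]: "b \<in> B \<Longrightarrow> gene b \<in> carrier quo"
  unfolding gene_def by (intro proj_carrier tensor_unit_carrier)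

text \<open>
  An element of the tensor product with coefficients in \<open>K\<close> is a sum of elements \<open>d \<otimes> b\<close>, \<open>d \<in> K\<close>.  With
  \<open>K\<close> a homogeneous component of \<open>D\<close> this describes the homogeneous components of the quotient.
\<close>

lemma proj_span:
  assumes f: "f \<in> carrier tens" "\<And>b. b \<in> B \<Longrightarrow> f b \<in> K"
    and K: "K \<subseteq> carrier DD"
    and zero: "\<zero>\<^bsub>quo\<^esub> \<in> P" and add: "\<And>u v. \<lbrakk>u \<in> P; v \<in> P\<rbrakk> \<Longrightarrow> u \<oplus>\<^bsub>quo\<^esub> v \<in> P"
    and gen: "\<And>b p. \<lbrakk>b \<in> B; cls p \<in> K\<rbrakk> \<Longrightarrow> act quo p (gene b) \<in> P"
  shows "proj f \<in> P"
proof -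
  have "proj (\<lambda>b. if b \<in> A then f b else \<zero>\<^bsub>DD\<^esub>) \<in> P" if "finite A" "A \<subseteq> B" for A
    using that
  proof (induct A)
    case empty
    have "(\<lambda>b. \<zero>\<^bsub>DD\<^esub>) \<in> bal" using Te.N_simps(2) by simp
    then show ?case using proj_balanced zero by simp
  next
    case (insert a A)
    let ?f = "\<lambda>b. if b \<in> A then f b else \<zero>\<^bsub>DD\<^esub>"
    have a: "a \<in> B" "f a \<in> K" and fa: "f a \<in> carrier DD" using insert f K by auto
    from fa obtain p where p: "f a = cls p" by (rule DD_carrierE)
    have fc: "f b \<in> carrier DD" if "b \<in> A" for b using insert f K that by auto
    have fA: "?f \<in> carrier tens" using insert fc by auto
    have "(\<lambda>b. if b \<in> insert a A then f b else \<zero>\<^bsub>DD\<^esub>) = (f a \<odot>\<^bsub>tens\<^esub> tensor_unit a) \<oplus>\<^bsub>tens\<^esub> ?f"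
      using insert(2) fa fc Te.R.ring_axioms by (auto simp: tensor_unit_def fun_eq_iff)
    then have "proj (\<lambda>b. if b \<in> insert a A then f b else \<zero>\<^bsub>DD\<^esub>) = act quo p (gene a) \<oplus>\<^bsub>quo\<^esub> proj ?f"
      using proj_add[OF Te.smult_closed[OF fa tensor_unit_carrier[OF a(1)]] fA]
        proj_smult[OF tensor_unit_carrier[OF a(1)] fa] by (simp only: act_def gene_def p)
    then show ?case using add gen[of a p] a p insert by auto
  qed
  from this[OF finite_B] have "proj (\<lambda>b. if b \<in> B then f b else \<zero>\<^bsub>DD\<^esub>) \<in> P" by simp
  moreover have "(\<lambda>b. if b \<in> B then f b else \<zero>\<^bsub>DD\<^esub>) = f" using f(1) by (auto simp: fun_eq_iff split: if_splits)
  ultimately show ?thesis by simp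
qed

lemma quo_span:
  assumes "u \<in> carrier quo"
    and "\<zero>\<^bsub>quo\<^esub> \<in> P" "\<And>u v. \<lbrakk>u \<in> P; v \<in> P\<rbrakk> \<Longrightarrow> u \<oplus>\<^bsub>quo\<^esub> v \<in> P"
    and "\<And>b p. b \<in> B \<Longrightarrow> act quo p (gene b) \<in> P"
  shows "u \<in> P"
proof -
  obtain f where "f \<in> carrier tens" "u = proj f" using assms(1) by (auto simp: carrier_quo)
  then show ?thesis using proj_span[of f "carrier DD" P] assms by auto
qed

lemma act_gene:
  assumes a: "a \<in> S" and b: "b \<in> B" "b' \<in> B" and \<rho>: "\<rho> a b = (\<lambda>c. k * ket b' c)"
  shows "act quo (var a) (gene b) = act quo (scal k) (gene b')"
proof -
  interpret R: ring "DD :: 'k free set ring" by (rule ring_DD)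
  have pt: "pure_tensor B d (\<lambda>c. k * ket b c) = (d \<otimes>\<^bsub>DD\<^esub> cls (scal k)) \<odot>\<^bsub>tens\<^esub> tensor_unit b"
    if "d \<in> carrier DD" "b \<in> B" for d k b
    using that by (auto simp: pure_tensor_def tensor_unit_def ket_def fun_eq_iff DD_simps(1)[symmetric]
        scal_hom)
  have "free_act B \<rho> (var a) (ket b) = (\<lambda>c. k * ket b' c)"
    using \<rho> b finite_B by (simp add: free_act_var lin_ket)
  moreover have "ket b \<in> vecs B" using b by (auto simp: vecs_def ket_def)
  moreover have "\<forall>w\<in>Poly_Mapping.keys (var a :: 'k free). set (letters w) \<subseteq> S" using a by (simp add: var_def)
  ultimately have "pure_tensor B (\<one>\<^bsub>DD\<^esub> \<otimes>\<^bsub>DD\<^esub> cls (var a)) (ket b) \<ominus>\<^bsub>tens\<^esub> pure_tensor B \<one>\<^bsub>DD\<^esub> (\<lambda>c. k * ket b' c) \<in> bal"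
    unfolding balancing_def
    by (intro subsetD[OF gen_submodule_superset[OF left_module_tensor_k]] CollectI exI[of _ "\<one>\<^bsub>DD\<^esub>"]
        exI[of _ "var a"] exI[of _ "ket b"]) (simp add: ring.ring_simprules(6)[OF ring_DD])
  moreover have "pure_tensor B (\<one>\<^bsub>DD\<^esub> \<otimes>\<^bsub>DD\<^esub> cls (var a)) (ket b) = cls (var a) \<odot>\<^bsub>tens\<^esub> tensor_unit b"
    using pt[of "\<one>\<^bsub>DD\<^esub> \<otimes>\<^bsub>DD\<^esub> cls (var a)" b 1] b(1) by (simp add: DD_simps scal_hom)
  moreover have "pure_tensor B \<one>\<^bsub>DD\<^esub> (\<lambda>c. k * ket b' c) = cls (scal k) \<odot>\<^bsub>tens\<^esub> tensor_unit b'"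
    using pt[of "\<one>\<^bsub>DD\<^esub>" b' k] b(2) by (simp add: DD_simps)
  ultimately have d: "cls (var a) \<odot>\<^bsub>tens\<^esub> tensor_unit b \<ominus>\<^bsub>tens\<^esub> cls (scal k) \<odot>\<^bsub>tens\<^esub> tensor_unit b' \<in> bal" by simp
  have c: "cls (var a) \<odot>\<^bsub>tens\<^esub> tensor_unit b \<in> carrier tens" "cls (scal k) \<odot>\<^bsub>tens\<^esub> tensor_unit b' \<in> carrier tens"
    using tensor_unit_carrier b by (auto intro!: Te.smult_closed simp del: tensor_k_simps)
  have "bal +>\<^bsub>tens\<^esub> (cls (var a) \<odot>\<^bsub>tens\<^esub> tensor_unit b) = bal +>\<^bsub>tens\<^esub> (cls (scal k) \<odot>\<^bsub>tens\<^esub> tensor_unit b')"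
    using Te.coset_eq_iff[OF c] d by simp
  then have "proj (cls (var a) \<odot>\<^bsub>tens\<^esub> tensor_unit b) = proj (cls (scal k) \<odot>\<^bsub>tens\<^esub> tensor_unit b')"
    by (simp only: proj_def)
  then show ?thesis
    using b by (simp only: proj_smult tensor_unit_carrier cls_in_DD) (simp add: act_def gene_def)
qed

end

lemma eps_rep_stable: "b \<in> {1} \<Longrightarrow> eps_rep a b \<in> vecs {1}"
  by (auto simp: eps_rep_def vecs_def ket_def split: gen.splits)

lemma sigma_minus_rep_stable: "b \<in> transps \<Longrightarrow> sigma_minus_rep a b \<in> vecs transps"
  by (auto simp: sigma_minus_rep_def vecs_def ket_def split: gen.splits)

section \<open>The two simple modules inside \<open>T\<^sub>0\<^sub>,\<^sub>1\<close>\<close>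

text \<open>
  The degrees of \<open>c\<^sub>1, \<dots>, c\<^sub>1\<^sub>0\<close> normalized as in \<open>L(\<sigma>,-)\<close>, with highest degree \<open>0\<close>; the degree \<open>n\<close> of \<open>t\<close> is left
  open, since it depends on the extension.
\<close>

definition T_deg :: "int \<Rightarrow> T_index \<Rightarrow> int" where
  "T_deg n b = (case b of Low s \<Rightarrow> - 2 | Tau1 h \<Rightarrow> - 1 | Tau2 h \<Rightarrow> - 1 | High s \<Rightarrow> 0 | TT \<Rightarrow> n)"

lemma T_deg_simps [simp]: "T_deg n (Low s) = - 2" "T_deg n (Tau1 h) = - 1" "T_deg n (Tau2 h) = - 1"
  "T_deg n (High s) = 0" "T_deg n TT = n"
  by (simp_all add: T_deg_def)

definition T_homog :: "int \<Rightarrow> int \<Rightarrow> (T_index \<Rightarrow> 'k::field) set" where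
  "T_homog m n = {v \<in> vecs T_basis. \<forall>b. v b \<noteq> 0 \<longrightarrow> T_deg m b = n}"

definition L10 :: "(T_index \<Rightarrow> 'k::field) set" where
  "L10 = {v \<in> vecs T_basis. v TT = 0}"

lemma L10_vecs: "v \<in> L10 \<Longrightarrow> v \<in> vecs T_basis"
  by (simp add: L10_def)

lemma ket_vecs [simp]: "ket b \<in> vecs B \<longleftrightarrow> b \<in> B"
  by (auto simp: vecs_def ket_def)

lemma ket_simps [simp]: "ket b b = 1" "c \<noteq> b \<Longrightarrow> ket b c = 0"
  by (simp_all add: ket_def)

lemma vecs_span:
  assumes v: "v \<in> vecs B" "finite B" and zero: "(\<lambda>b. 0) \<in> P"
    and add: "\<And>u v. \<lbrakk>u \<in> P; v \<in> P\<rbrakk> \<Longrightarrow> (\<lambda>b. u b + v b) \<in> P"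
    and scale: "\<And>k v. v \<in> P \<Longrightarrow> (\<lambda>b. k * v b) \<in> P"
    and ket: "\<And>b. \<lbrakk>b \<in> B; v b \<noteq> 0\<rbrakk> \<Longrightarrow> ket b \<in> P"
  shows "v \<in> P"
proof -
  have "(\<lambda>c. if c \<in> A then v c else 0) \<in> P" if "finite A" "A \<subseteq> B" for A
    using that
  proof (induct A)
    case (insert a A)
    have "(\<lambda>c. v a * ket a c) \<in> P"
      using insert ket[of a] scale[of "ket a" "v a"] zero by (cases "v a = 0") auto
    moreover have "(\<lambda>c. if c \<in> insert a A then v c else 0) = (\<lambda>c. v a * ket a c + (if c \<in> A then v c else 0))"
      using insert(2) by (auto simp: ket_def)
    ultimately show ?case using insert add by simp
  qed (use zero in simp)
  from this[OF v(2)] have "(\<lambda>c. if c \<in> B then v c else 0) \<in> P" by simp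
  moreover have "(\<lambda>c. if c \<in> B then v c else 0) = v" using v(1) by (auto simp: vecs_def)
  ultimately show ?thesis by simp
qed

context primitive_cube_root
begin

text \<open>
  The vector \<open>c\<^sub>8\<close> generates \<open>c\<^sub>1, \<dots>, c\<^sub>1\<^sub>0\<close> under the group and \<open>x\<^sub>1\<^sub>2\<close>: the group moves it to
  \<open>c\<^sub>9\<close>, whose image under \<open>x\<^sub>1\<^sub>2\<close> has components in both \<open>(\<tau>,1)\<close> and \<open>(\<tau>,2)\<close>; the
  three-cycle separates them, having different eigenvalues there, and \<open>x\<^sub>1\<^sub>2\<close> leads on to \<open>c\<^sub>2\<close>.  The
  index of \<open>P\<close> records the degrees, so that the statement serves for spans and for gradings.
\<close>

lemma L10_generated:
  fixes P :: "int \<Rightarrow> (T_index \<Rightarrow> 'k) set"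
  assumes add: "\<And>n u v. \<lbrakk>u \<in> P n; v \<in> P n\<rbrakk> \<Longrightarrow> (\<lambda>b. u b + v b) \<in> P n"
    and scale: "\<And>n k v. v \<in> P n \<Longrightarrow> (\<lambda>b. k * v b) \<in> P n"
    and G: "\<And>n g v. v \<in> P n \<Longrightarrow> G_op \<zeta> g v \<in> P n"
    and X: "\<And>n v. v \<in> P n \<Longrightarrow> X_op \<zeta> 1 0 0 0 v \<in> P (n - 1)"
    and high: "ket (High t12) \<in> P 0"
    and b: "b \<in> T_basis" "b \<noteq> TT"
  shows "ket b \<in> P (T_deg m b)"
proof -
  have 1: "ket (High t23) = (\<lambda>c. - 1 * G_op \<zeta> t13 (ket (High t12)) c)"
    "ket (High t13) = (\<lambda>c. - 1 * G_op \<zeta> t23 (ket (High t12)) c)"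
    by (intro T_ext vecs_closed(3) G_op_vecs; simp)+
  then have h: "ket (High t23) \<in> P 0" "ket (High t13) \<in> P 0"
    using scale[OF G[OF high], of "- 1"] by simp_all
  \<comment> \<open>\<open>u\<close> is a combination of eigenvectors of the three-cycle with eigenvalues \<open>\<zeta>\<close> and \<open>\<zeta>\<^sup>-\<^sup>1\<close>.\<close>
  define u where "u = X_op \<zeta> 1 0 0 0 (ket (High t23))"
  have u: "u \<in> P (- 1)" using X[OF h(1)] by (simp add: u_def)
  have 2: "ket (Tau1 c123) = (\<lambda>c. - \<zeta> * (G_op \<zeta> c123 u c + (1 + \<zeta>) * u c))"
    "ket (Tau2 c123) = (\<lambda>c. (1 + \<zeta>) * (G_op \<zeta> c123 u c + - \<zeta> * u c))"
    unfolding u_def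
    by (intro T_ext vecs_closed(3) vecs_closed G_op_vecs op_vecs;
        simp add: zeta_not field_simps zeta_square zeta_square')+
  have t: "ket (Tau1 c123) \<in> P (- 1)" "ket (Tau2 c123) \<in> P (- 1)"
    unfolding 2 by (intro scale add G u)+
  have 3: "ket (Tau1 c132) = G_op \<zeta> t12 (ket (Tau1 c123))" "ket (Tau2 c132) = G_op \<zeta> t12 (ket (Tau2 c123))"
    by (intro T_ext G_op_vecs; simp)+
  have t': "ket (Tau1 c132) \<in> P (- 1)" "ket (Tau2 c132) \<in> P (- 1)"
    unfolding 3 by (intro G t)+
  have 4: "ket (Low t23) = (\<lambda>c. inverse \<zeta> * X_op \<zeta> 1 0 0 0 (ket (Tau1 c123)) c)"
    by (intro T_ext vecs_closed(3) op_vecs; simp add: zeta_not)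
  have l: "ket (Low t23) \<in> P (- 2)"
    unfolding 4 using X[OF t(1)] by (intro scale) simp
  have 5: "ket (Low t12) = (\<lambda>c. - 1 * G_op \<zeta> t13 (ket (Low t23)) c)"
    "ket (Low t13) = (\<lambda>c. - 1 * G_op \<zeta> t12 (ket (Low t23)) c)"
    by (intro T_ext vecs_closed(3) G_op_vecs; simp)+
  have l': "ket (Low t12) \<in> P (- 2)" "ket (Low t13) \<in> P (- 2)"
    unfolding 5 by (intro scale G l)+
  show ?thesis using b high h t t' l l' by (auto simp: T_basis_eq)
qed

lemma L10_closed:
  "v \<in> L10 \<Longrightarrow> G_op \<zeta> g v \<in> L10" "v \<in> L10 \<Longrightarrow> dlt_op h v \<in> L10"
  "v \<in> L10 \<Longrightarrow> X_op \<zeta> a b 0 0 v \<in> L10" "v \<in> L10 \<Longrightarrow> Y_op \<zeta> a b 0 0 v \<in> L10"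
  "u \<in> L10 \<Longrightarrow> v \<in> L10 \<Longrightarrow> (\<lambda>c. u c + v c) \<in> L10" "v \<in> L10 \<Longrightarrow> (\<lambda>c. k * v c) \<in> L10" "(\<lambda>c. 0) \<in> L10"
  by (auto simp: L10_def)

lemma T_homog_closed:
  "v \<in> T_homog m n \<Longrightarrow> G_op \<zeta> g v \<in> T_homog m n" "v \<in> T_homog m n \<Longrightarrow> dlt_op h v \<in> T_homog m n"
  "u \<in> T_homog m n \<Longrightarrow> v \<in> T_homog m n \<Longrightarrow> (\<lambda>c. u c + v c) \<in> T_homog m n"
  "v \<in> T_homog m n \<Longrightarrow> (\<lambda>c. k * v c) \<in> T_homog m n" "(\<lambda>c. 0) \<in> T_homog m n"
proof -
  show "G_op \<zeta> g v \<in> T_homog m n" if v: "v \<in> T_homog m n"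
  proof -
    have "T_deg m b = n" if "G_op \<zeta> g v b \<noteq> 0" for b
    proof -
      have "\<exists>b'\<in>T_basis. v b' * T_grp \<zeta> g b' b \<noteq> 0"
        using that unfolding lin_def by (rule contrapos_np) (auto intro: sum.neutral)
      then obtain b' where b': "v b' \<noteq> 0" "T_grp \<zeta> g b' b \<noteq> 0" by auto
      then have "T_deg m b = T_deg m b'"
        by (cases b') (auto simp: T_grp_def ket_def split: if_splits)
      then show ?thesis using v b' by (auto simp: T_homog_def)
    qed
    then show ?thesis by (simp add: T_homog_def)
  qed
  show "dlt_op h v \<in> T_homog m n" if "v \<in> T_homog m n"
    using that op_vecs(3)[of h v] by (auto simp: T_homog_def dlt_op_def split: if_splits)
  show "(\<lambda>c. u c + v c) \<in> T_homog m n" if uv: "u \<in> T_homog m n" "v \<in> T_homog m n"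
  proof -
    have "T_deg m b = n" if "u b + v b \<noteq> 0" for b
      using that uv by (cases "u b = 0") (auto simp: T_homog_def)
    then show ?thesis using uv by (simp add: T_homog_def)
  qed
qed (auto simp: T_homog_def)

text \<open>
  The side conditions give the only degree of \<open>t\<close> for which each extra entry is homogeneous, for
  example \<open>1\<close> if \<open>x\<^sub>1\<^sub>2 t\<close> is to involve \<open>c\<^sub>8\<close>, which has degree \<open>0\<close>.
\<close>

lemma X_op_homog:
  assumes v: "v \<in> T_homog m n" and "a = 0 \<or> m = - 1" "b = 0 \<or> m = 1" "a' = 0 \<or> m = - 3" "b' = 0 \<or> m = - 1"
  shows "X_op \<zeta> a b a' b' v \<in> T_homog m (n - 1)"
proof -
  have z: "v c = 0" if "T_deg m c \<noteq> n" for c using v that by (auto simp: T_homog_def)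
  have zs: "n \<noteq> - 2 \<Longrightarrow> v (Low s) = 0" "n \<noteq> - 1 \<Longrightarrow> v (Tau1 s) = 0" "n \<noteq> - 1 \<Longrightarrow> v (Tau2 s) = 0"
    "n \<noteq> 0 \<Longrightarrow> v (High s) = 0" "n \<noteq> m \<Longrightarrow> v TT = 0" for s
    by (rule z, simp)+
  have "T_deg m c = n - 1" if "X_op \<zeta> a b a' b' v c \<noteq> 0" for c
  proof (rule ccontr)
    assume c: "T_deg m c \<noteq> n - 1"
    have "X_op \<zeta> a b a' b' v c = 0"
      using assms(2-) c unfolding X_op_def by (auto simp: zs)
    then show False using that by simp
  qed
  then show ?thesis by (simp add: T_homog_def)
qed

lemma Y_op_homog:
  assumes v: "v \<in> T_homog m n" and "a = 0 \<or> m = - 3" "b = 0 \<or> m = - 1" "a' = 0 \<or> m = - 1" "b' = 0 \<or> m = 1"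
  shows "Y_op \<zeta> a b a' b' v \<in> T_homog m (n + 1)"
proof -
  have z: "v c = 0" if "T_deg m c \<noteq> n" for c using v that by (auto simp: T_homog_def)
  have zs: "n \<noteq> - 2 \<Longrightarrow> v (Low s) = 0" "n \<noteq> - 1 \<Longrightarrow> v (Tau1 s) = 0" "n \<noteq> - 1 \<Longrightarrow> v (Tau2 s) = 0"
    "n \<noteq> 0 \<Longrightarrow> v (High s) = 0" "n \<noteq> m \<Longrightarrow> v TT = 0" for s
    by (rule z, simp)+
  have "T_deg m c = n + 1" if "Y_op \<zeta> a b a' b' v c \<noteq> 0" for c
  proof (rule ccontr)
    assume c: "T_deg m c \<noteq> n + 1"
    have "Y_op \<zeta> a b a' b' v c = 0"
      using assms(2-) c unfolding Y_op_def by (auto simp: zs)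
    then show False using that by simp
  qed
  then show ?thesis by (simp add: T_homog_def)
qed

end

abbreviation verma_radical :: "'b set \<Rightarrow> (gen \<Rightarrow> 'b \<Rightarrow> 'b \<Rightarrow> 'k::field) \<Rightarrow> ('b \<Rightarrow> 'k free set) set set" where
  "verma_radical B \<rho> \<equiv> mod_radical DD (verma B \<rho>)"

lemma simple_L_eq: "simple_L B \<rho> = quot_module (verma B \<rho>) (verma_radical B \<rho>)"
  by (simp add: simple_L_def mod_head_def)

interpretation sig: induced_quotient gens_ge0 transps sigma_minus_rep
    "verma_radical transps (sigma_minus_rep :: gen \<Rightarrow> S3 \<Rightarrow> S3 \<Rightarrow> 'k::field)"
  by (rule induced_quotient.intro) (simp_all add: sigma_minus_rep_stable submodule_mod_radical left_module_induced)

interpretation eps: induced_quotient gens_ge0 "{1}" eps_rep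
    "verma_radical {1} (eps_rep :: gen \<Rightarrow> S3 \<Rightarrow> S3 \<Rightarrow> 'k::field)"
  by (rule induced_quotient.intro) (auto simp: submodule_mod_radical left_module_induced intro: eps_rep_stable)

abbreviation "sig_gen \<equiv> sig.gene"
abbreviation "eps_gen \<equiv> eps.gene 1"

lemma sig_gen_act:
  assumes "s \<in> transps"
  shows "act L_sigma (grp g) (sig_gen s) = act L_sigma (scal (sgn3 g)) (sig_gen (conj3 g s))"
    "act L_sigma (dlt h) (sig_gen s) = act L_sigma (scal (if h = s then 1 else 0)) (sig_gen s)"
    "act L_sigma (yy r) (sig_gen s) = act L_sigma (scal 0) (sig_gen s)"
  unfolding simple_L_eq
  by (rule sig.act_gene; use assms in \<open>auto simp: gens_ge0_def sigma_minus_rep_def\<close>)+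

lemma eps_gen_act:
  "act L_eps (dlt 1) eps_gen = act L_eps (scal 1) eps_gen" "act L_eps (yy r) eps_gen = act L_eps (scal 0) eps_gen"
  unfolding simple_L_eq
  by (rule eps.act_gene; auto simp: gens_ge0_def eps_rep_def)+

lemmas sig_span = sig.quo_span[folded simple_L_eq]
lemmas eps_span = eps.quo_span[folded simple_L_eq]
lemmas sig_gen_carrier = sig.gene_carrier[folded simple_L_eq]

lemma eps_gen_carrier: "eps_gen \<in> carrier (L_eps :: ('k::field free set, _) module)"
  unfolding simple_L_eq by (rule eps.gene_carrier) simp

lemma simple_L_deg_eq:
  "simple_L_deg transps sigma_minus_rep n = {sig.proj f | f. f \<in> carrier (tensor_k transps) \<and> (\<forall>b\<in>transps. f b \<in> DD_deg n)}"
  "simple_L_deg {1} eps_rep n = {eps.proj f | f. f \<in> carrier (tensor_k {1}) \<and> (\<forall>b\<in>{1}. f b \<in> DD_deg n)}"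
  unfolding simple_L_deg_def induced_deg_def sig.proj_def eps.proj_def by blast+

lemma DD_deg_carrier: "DD_deg n \<subseteq> carrier DD"
  by (auto simp: DD_deg_def)

lemma DD_deg_closed:
  "cls 0 \<in> DD_deg n" "\<lbrakk>c \<in> DD_deg n; d \<in> DD_deg n\<rbrakk> \<Longrightarrow> c \<oplus>\<^bsub>DD\<^esub> d \<in> DD_deg n"
  "\<lbrakk>c \<in> DD_deg m; d \<in> DD_deg n\<rbrakk> \<Longrightarrow> c \<otimes>\<^bsub>DD\<^esub> d \<in> DD_deg (m + n)"
  "cls (scal k) \<in> DD_deg 0" "cls (var a) \<in> DD_deg (gen_degree a)"
proof -
  show "cls 0 \<in> DD_deg n" unfolding DD_deg_def by (intro CollectI exI[of _ 0]) simp
  show "c \<oplus>\<^bsub>DD\<^esub> d \<in> DD_deg n" if "c \<in> DD_deg n" "d \<in> DD_deg n"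
  proof -
    obtain p q where "c = cls p" "d = cls q"
      "\<forall>w\<in>Poly_Mapping.keys p. sum_list (map gen_degree (letters w)) = n"
      "\<forall>w\<in>Poly_Mapping.keys q. sum_list (map gen_degree (letters w)) = n"
      using \<open>c \<in> _\<close> \<open>d \<in> _\<close> unfolding DD_deg_def by auto
    then show ?thesis unfolding DD_deg_def using keys_add[of p q]
      by (intro CollectI exI[of _ "p + q"]) (auto simp: DD_simps)
  qed
  show "c \<otimes>\<^bsub>DD\<^esub> d \<in> DD_deg (m + n)" if "c \<in> DD_deg m" "d \<in> DD_deg n"
  proof -
    obtain p q where "c = cls p" "d = cls q"
      "\<forall>w\<in>Poly_Mapping.keys p. sum_list (map gen_degree (letters w)) = m"
      "\<forall>w\<in>Poly_Mapping.keys q. sum_list (map gen_degree (letters w)) = n"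
      using \<open>c \<in> _\<close> \<open>d \<in> _\<close> unfolding DD_deg_def by auto
    then show ?thesis unfolding DD_deg_def using keys_mult[of p q]
      by (intro CollectI exI[of _ "p * q"]) (fastforce simp: DD_simps plus_word_def)
  qed
  show "cls (scal k) \<in> DD_deg 0" unfolding DD_deg_def
    by (intro CollectI exI[of _ "scal k"]) (auto simp: scal_def zero_word_def split: if_splits)
  show "cls (var a) \<in> DD_deg (gen_degree a)" unfolding DD_deg_def
    by (intro CollectI exI[of _ "var a"]) (auto simp: var_def)
qed

text \<open>
  The exact sequence with middle term \<open>T\<^sub>0\<^sub>,\<^sub>1\<close> serves as the definition of coordinates on
  \<open>L(\<sigma>,-)\<close> and \<open>L(\<epsilon>)\<close>.
\<close>

locale extension_T = primitive_cube_root \<zeta> for \<zeta> :: "'k::field_char_0" +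
  fixes iT pT
  assumes T_exact: "short_exact DD L_sigma (iT, T01 \<zeta>, pT) L_eps"
begin

lemmas T_exactD = short_exactD[OF T_exact]

sublocale Ls: D_module "L_sigma :: ('k free set, _) module" by (rule D_moduleI) (rule T_exactD)
sublocale Le: D_module "L_eps :: ('k free set, _) module" by (rule D_moduleI) (rule T_exactD)
sublocale T: D_module "T01 \<zeta>" by (rule D_moduleI) (rule T_exactD)

lemma iT_closed: "u \<in> carrier L_sigma \<Longrightarrow> iT u \<in> vecs T_basis"
  using mod_homD(1)[OF T_exactD(4)] by simp

lemma pT_closed: "v \<in> vecs T_basis \<Longrightarrow> pT v \<in> carrier L_eps"
  using mod_homD(1)[OF T_exactD(5)] by simp

lemma iT_act: "u \<in> carrier L_sigma \<Longrightarrow> iT (act L_sigma p u) = act (T01 \<zeta>) p (iT u)"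
  by (rule mod_hom_act[OF T_exactD(4)])

lemma pT_act: "v \<in> vecs T_basis \<Longrightarrow> pT (act (T01 \<zeta>) p v) = act L_eps p (pT v)"
  by (rule mod_hom_act[OF T_exactD(5)]) simp

lemma iT_add: "\<lbrakk>u \<in> carrier L_sigma; v \<in> carrier L_sigma\<rbrakk> \<Longrightarrow> iT (u \<oplus>\<^bsub>L_sigma\<^esub> v) = (\<lambda>c. iT u c + iT v c)"
  using mod_homD(2)[OF T_exactD(4)] by simp

lemma pT_add: "\<lbrakk>u \<in> vecs T_basis; v \<in> vecs T_basis\<rbrakk> \<Longrightarrow> pT (\<lambda>c. u c + v c) = pT u \<oplus>\<^bsub>L_eps\<^esub> pT v"
  using mod_homD(2)[OF T_exactD(5), of u v] by simp

lemma iT_zero: "iT \<zero>\<^bsub>L_sigma\<^esub> = (\<lambda>c. 0)" and pT_zero: "pT (\<lambda>c. 0) = \<zero>\<^bsub>L_eps\<^esub>"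
  using mod_hom_zero[OF T_exactD(4,1,2)] mod_hom_zero[OF T_exactD(5,2,3)] by simp_all

lemma iT_scal: "u \<in> carrier L_sigma \<Longrightarrow> iT (act L_sigma (scal k) u) = (\<lambda>c. k * iT u c)"
  by (simp add: iT_act act_T01_generators iT_closed)

text \<open>
  The generators of \<open>L(\<sigma>,-)\<close> are killed by all \<open>y\<^sub>s\<close> and span a copy of \<open>(\<sigma>,-)\<close>.  In group degree \<open>(12)\<close> the space
  \<open>T\<^sub>0\<^sub>,\<^sub>1\<close> is spanned by \<open>c\<^sub>1\<close> and \<open>c\<^sub>8\<close>, and \<open>y\<^sub>1\<^sub>3\<close> does not kill \<open>c\<^sub>1\<close>.
\<close>

lemma sig_gen_image: "\<exists>\<beta>. \<forall>s\<in>transps. iT (sig_gen s) = (\<lambda>c. \<beta> * ket (High s) c)"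
proof -
  define v where "v = iT (sig_gen t12)"
  have v: "v \<in> vecs T_basis" unfolding v_def by (intro iT_closed sig_gen_carrier) simp
  note a = sig_gen_act[of t12, simplified, THEN arg_cong[of _ _ iT], unfolded iT_act[OF sig_gen_carrier[OF transps_simps(1)]]
      iT_scal[OF sig_gen_carrier[OF transps_simps(1)]], folded v_def]
  have d: "v = dlt_op t12 v" using a(2)[of t12] v by (simp add: act_T01_generators)
  \<comment> \<open>\<open>y\<^sub>1\<^sub>3\<close> excludes \<open>c\<^sub>1\<close>, and having group degree \<open>(12)\<close> excludes everything else but \<open>c\<^sub>8\<close>.\<close>
  have "conj_op \<zeta> (Y_op \<zeta> 0 1 0 0) t13 v = (\<lambda>c. 0)"
    using a(3)[of t13] v by (simp add: act_T01 free_act_var free_act_scal lin_T_rep)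
  then have "conj_op \<zeta> (Y_op \<zeta> 0 1 0 0) t13 v (Tau1 c123) = 0" by simp
  then have low: "v (Low t12) = 0" using zeta_not by simp
  have v': "v = (\<lambda>c. v (High t12) * ket (High t12) c)"
    by (subst d, intro T_ext op_vecs vecs_closed(3)) (simp_all add: low)
  have "iT (sig_gen s) = (\<lambda>c. v (High t12) * ket (High s) c)" if s: "s \<in> transps" for s
  proof -
    let ?g = "to_transp s"
    have c: "conj3 ?g t12 = s" using s unfolding transps_def by auto
    have "(\<lambda>c. sgn3 ?g * iT (sig_gen s) c) = G_op \<zeta> ?g v"
      using sig_gen_act(1)[of t12 ?g, THEN arg_cong[of _ _ iT]] s v
      by (simp add: c iT_act[where p = "grp ?g"] iT_scal sig_gen_carrier act_T01_generators flip: v_def)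
    then have "(\<lambda>c. sgn3 ?g * (sgn3 ?g * iT (sig_gen s) c)) = (\<lambda>c. sgn3 ?g * G_op \<zeta> ?g v c)"
      by (simp add: fun_eq_iff)
    then have "iT (sig_gen s) = (\<lambda>c. sgn3 ?g * G_op \<zeta> ?g v c)" by (simp flip: mult.assoc)
    also have "\<dots> = (\<lambda>c. v (High t12) * ket (High s) c)"
      using s unfolding transps_def
    proof -
      have "(\<lambda>c. sgn3 ?g * G_op \<zeta> ?g (ket (High t12)) c) = ket (High s)"
        using s unfolding transps_def
        by (simp only: insert_iff empty_iff, elim disjE FalseE; intro T_ext vecs_closed(3) G_op_vecs) simp_all
      then show ?thesis
        by (subst v', simp only: G_op_scale) (simp add: fun_eq_iff mult.left_commute)
    qed
    finally show ?thesis .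
  qed
  then show ?thesis by blast
qed

definition beta :: 'k where "beta = (SOME \<beta>. \<forall>s\<in>transps. iT (sig_gen s) = (\<lambda>c. \<beta> * ket (High s) c))"

lemma iT_sig_gen: "s \<in> transps \<Longrightarrow> iT (sig_gen s) = (\<lambda>c. beta * ket (High s) c)"
  using someI_ex[OF sig_gen_image] unfolding beta_def by blast

lemma L10_act: "v \<in> L10 \<Longrightarrow> act (T01 \<zeta>) p v \<in> L10"
  by (rule T.act_preserves) (auto simp: L10_vecs act_T01_generators intro: L10_closed)

lemma iT_L10: "u \<in> carrier L_sigma \<Longrightarrow> iT u \<in> L10"
proof -
  assume u: "u \<in> carrier L_sigma"
  have "u \<in> {u \<in> carrier L_sigma. iT u \<in> L10}"
  proof (rule sig_span[OF u])
    fix b p assume b: "b \<in> transps"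
    have "iT (sig_gen b) \<in> L10" using b by (auto simp: iT_sig_gen L10_def)
    then show "act L_sigma p (sig_gen b) \<in> {u \<in> carrier L_sigma. iT u \<in> L10}"
      using b by (auto simp: iT_act L10_act sig_gen_carrier)
  qed (auto simp: iT_zero iT_add L10_closed)
  then show ?thesis by simp
qed

text \<open>
  Otherwise the generators, hence all of \<open>L(\<sigma>,-)\<close>, would map to zero and \<open>pT\<close> would be injective.  The generator
  of \<open>L(\<epsilon>)\<close> then comes from a vector of \<open>T\<^sub>0\<^sub>,\<^sub>1\<close> of group degree \<open>1\<close>, that is a multiple of \<open>t\<close>,
  which is killed by \<open>y\<^sub>1\<^sub>2\<close>; but \<open>y\<^sub>1\<^sub>2 t = c\<^sub>8\<close>.  So the generator is zero, and with it \<open>L(\<epsilon>)\<close>, which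
  contradicts injectivity of \<open>pT\<close>.
\<close>

lemma beta_nonzero: "beta \<noteq> 0"
proof
  assume b0: "beta = 0"
  have all0: "iT u = (\<lambda>c. 0)" if u: "u \<in> carrier L_sigma" for u
  proof -
    have "u \<in> {u \<in> carrier L_sigma. iT u = (\<lambda>c. 0)}"
    proof (rule sig_span[OF u])
      fix b p assume b: "b \<in> transps"
      then show "act L_sigma p (sig_gen b) \<in> {u \<in> carrier L_sigma. iT u = (\<lambda>c. 0)}"
        using T.act_zero_right by (auto simp: iT_act iT_sig_gen b0 sig_gen_carrier)
    qed (auto simp: iT_zero iT_add)
    then show ?thesis by simp
  qed
  have ker: "v = (\<lambda>c. 0)" if "v \<in> vecs T_basis" "pT v = \<zero>\<^bsub>L_eps\<^esub>" for v
    using T_exactD(9)[of v] that all0 by auto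
  obtain v where v: "v \<in> vecs T_basis" "pT v = eps_gen"
    using T_exactD(7)[OF eps_gen_carrier] by auto
  have "pT (\<lambda>c. dlt_op 1 v c + - 1 * v c) = pT (dlt_op 1 v) \<oplus>\<^bsub>L_eps\<^esub> pT (\<lambda>c. - 1 * v c)"
    using v by (intro pT_add) auto
  also have "pT (dlt_op 1 v) = eps_gen"
    using pT_act[OF v(1), of "dlt 1"] v
    by (simp add: act_T01_generators eps_gen_act(1) eps_gen_carrier)
  also have "pT (\<lambda>c. - 1 * v c) = \<ominus>\<^bsub>L_eps\<^esub> eps_gen"
  proof -
    have "pT (\<lambda>c. - 1 * v c) = act L_eps (scal (- 1)) eps_gen"
      using pT_act[OF v(1), of "scal (- 1)"] v by (simp only: act_T01_generators)
    then show ?thesis by (simp only: scal_hom(2,5) Le.act_minus Le.act_one eps_gen_carrier)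
  qed
  finally have "pT (\<lambda>c. dlt_op 1 v c + - 1 * v c) = \<zero>\<^bsub>L_eps\<^esub>"
    by (simp add: Le.M.r_neg eps_gen_carrier)
  then have "(\<lambda>c. dlt_op 1 v c + - 1 * v c) = (\<lambda>c. 0)" using v by (intro ker) auto
  then have dv: "dlt_op 1 v = v" by (simp add: fun_eq_iff)
  have "pT (Y_op \<zeta> 0 1 0 0 v) = \<zero>\<^bsub>L_eps\<^esub>"
    using pT_act[OF v(1), of "yy t12"] v by (simp add: act_T01_generators eps_gen_act(2) eps_gen_carrier)
  then have "Y_op \<zeta> 0 1 0 0 v = (\<lambda>c. 0)" by (intro ker) auto
  then have "Y_op \<zeta> 0 1 0 0 v (High t12) = 0" by simp
  then have "v TT = 0" by simp
  then have "v = (\<lambda>c. 0)" by (subst dv[symmetric], intro T_ext op_vecs vecs_closed) simp_all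
  then have e0: "eps_gen = (\<zero>\<^bsub>L_eps\<^esub> :: (S3 \<Rightarrow> 'k free set) set set)" using v pT_zero by simp
  have "u = \<zero>\<^bsub>L_eps\<^esub>" if "u \<in> carrier L_eps" for u :: "(S3 \<Rightarrow> 'k free set) set set"
    using eps_span[OF that, of "{\<zero>\<^bsub>L_eps\<^esub>}"] e0 by auto
  then have "pT (ket TT) = \<zero>\<^bsub>L_eps\<^esub>" using pT_closed[of "ket TT"] by auto
  then have "ket TT = (\<lambda>c. 0 :: 'k)" using ker by auto
  then show False by (metis ket_simps(1) zero_neq_one)
qed

lemma L10_image:
  assumes "v \<in> L10"
  shows "\<exists>u\<in>carrier L_sigma. iT u = v"
proof -
  let ?P = "iT ` carrier L_sigma"
  have cl: "act (T01 \<zeta>) p v \<in> ?P" if "v \<in> ?P" for p v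
    using that by (auto simp flip: iT_act)
  have vec: "v \<in> vecs T_basis" if "v \<in> ?P" for v using that iT_closed by auto
  have add: "(\<lambda>b. u b + v b) \<in> ?P" if "u \<in> ?P" "v \<in> ?P" for u v
    using that by (auto simp flip: iT_add)
  have scale: "(\<lambda>b. k * v b) \<in> ?P" if "v \<in> ?P" for k v
    using cl[OF that, of "scal k"] vec[OF that] by (simp add: act_T01_generators)
  have high: "ket (High t12) \<in> ?P"
  proof -
    have "iT (sig_gen t12) \<in> ?P" by (simp add: sig_gen_carrier)
    from scale[OF this, of "inverse beta"] show ?thesis
      using beta_nonzero by (simp add: iT_sig_gen flip: mult.assoc)
  qed
  have ket: "ket b \<in> ?P" if "b \<in> T_basis" "b \<noteq> TT" for b
  proof (rule L10_generated[where P = "\<lambda>_. ?P" and m = 0])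
    show "G_op \<zeta> g v \<in> ?P" "X_op \<zeta> 1 0 0 0 v \<in> ?P" if "v \<in> ?P" for g v
      using cl[OF that, of "grp g"] cl[OF that, of "xx t12"] by (simp_all add: act_T01_generators vec[OF that])
  qed (fact add scale high that)+
  have "v \<in> ?P"
  proof (rule vecs_span[where B = T_basis])
    show "(\<lambda>b. 0) \<in> ?P" using iT_zero Ls.M.zero_closed by (metis image_eqI)
    show "ket b \<in> ?P" if "b \<in> T_basis" "v b \<noteq> 0" for b
      using that assms by (intro ket) (auto simp: L10_def)
  qed (use add scale assms in \<open>auto simp: L10_vecs\<close>)
  then show ?thesis by auto
qed

definition jT :: "(T_index \<Rightarrow> 'k) \<Rightarrow> (S3 \<Rightarrow> 'k free set) set set" where
  "jT v = (SOME u. u \<in> carrier L_sigma \<and> iT u = v)"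

lemma jT: "v \<in> L10 \<Longrightarrow> jT v \<in> carrier L_sigma" "v \<in> L10 \<Longrightarrow> iT (jT v) = v"
  using someI_ex[of "\<lambda>u. u \<in> carrier L_sigma \<and> iT u = v"] L10_image[of v] unfolding jT_def by blast+

lemma iT_inj: "\<lbrakk>iT u = iT v; u \<in> carrier L_sigma; v \<in> carrier L_sigma\<rbrakk> \<Longrightarrow> u = v"
  by (rule T_exactD(6))

lemma jT_iT: "u \<in> carrier L_sigma \<Longrightarrow> jT (iT u) = u"
  by (intro iT_inj jT iT_L10)

lemma jT_add: "\<lbrakk>u \<in> L10; v \<in> L10\<rbrakk> \<Longrightarrow> jT (\<lambda>c. u c + v c) = jT u \<oplus>\<^bsub>L_sigma\<^esub> jT v"
  by (rule iT_inj) (simp_all add: jT iT_add L10_closed)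

lemma jT_act: "v \<in> L10 \<Longrightarrow> jT (act (T01 \<zeta>) p v) = act L_sigma p (jT v)"
  by (rule iT_inj) (simp_all add: jT iT_act L10_act)

lemma jT_scal: "v \<in> L10 \<Longrightarrow> jT (\<lambda>c. k * v c) = act L_sigma (scal k) (jT v)"
  using jT_act[of v "scal k"] by (simp add: act_T01_generators L10_vecs)

lemma pT_L10: "v \<in> L10 \<Longrightarrow> pT v = \<zero>\<^bsub>L_eps\<^esub>"
  using T_exactD(8)[of "jT v"] jT[of v] by simp

definition e0 :: "(S3 \<Rightarrow> 'k free set) set set" where
  "e0 = pT (ket TT)"

lemma e0_carrier [simp, intro]: "e0 \<in> carrier L_eps"
  unfolding e0_def by (rule pT_closed) simp

lemma pT_eq:
  assumes "v \<in> vecs T_basis"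
  shows "pT v = act L_eps (scal (v TT)) e0"
proof -
  have l: "(\<lambda>c. v c + - v TT * ket TT c) \<in> L10"
    unfolding L10_def using assms vecs_closed(1)[OF assms vecs_closed(3)[of "ket TT" T_basis "- v TT"]] by simp
  have "pT v = pT (\<lambda>c. (v c + - v TT * ket TT c) + v TT * ket TT c)" by simp
  also have "\<dots> = pT (\<lambda>c. v c + - v TT * ket TT c) \<oplus>\<^bsub>L_eps\<^esub> pT (\<lambda>c. v TT * ket TT c)"
    using L10_vecs[OF l] by (intro pT_add) auto
  also have "\<dots> = pT (\<lambda>c. v TT * ket TT c)"
    by (simp only: pT_L10[OF l]) (simp add: pT_closed)
  also have "\<dots> = act L_eps (scal (v TT)) e0"
    using pT_act[of "ket TT" "scal (v TT)"] by (simp add: act_T01_generators e0_def)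
  finally show ?thesis .
qed

lemma L_eps_carrier: "carrier L_eps = range (\<lambda>k. act L_eps (scal k) e0)"
proof
  show "carrier L_eps \<subseteq> range (\<lambda>k. act L_eps (scal k) e0)"
  proof
    fix u :: "(S3 \<Rightarrow> 'k free set) set set" assume "u \<in> carrier L_eps"
    then obtain v where "v \<in> vecs T_basis" "u = pT v" using T_exactD(7)[of u] by auto
    then show "u \<in> range (\<lambda>k. act L_eps (scal k) e0)" using pT_eq by auto
  qed
qed auto

lemma e0_nonzero: "e0 \<noteq> \<zero>\<^bsub>L_eps\<^esub>"
proof
  assume "e0 = \<zero>\<^bsub>L_eps\<^esub>"
  then obtain u where u: "u \<in> carrier L_sigma" "ket TT = iT u"
    using T_exactD(9)[of "ket TT"] unfolding e0_def by auto
  then have "ket TT \<in> (L10 :: (T_index \<Rightarrow> 'k) set)" using iT_L10 by simp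
  then show False by (simp add: L10_def)
qed

lemma L_eps_scal_eq_iff: "act L_eps (scal a) e0 = act L_eps (scal b) e0 \<longleftrightarrow> a = b"
proof
  assume h: "act L_eps (scal a) e0 = act L_eps (scal b) e0"
  have "act L_eps (scal (a + - b)) e0 = \<zero>\<^bsub>L_eps\<^esub>"
    using h by (simp only: scal_hom(3,5) Le.act_add Le.act_minus e0_carrier) (simp add: Le.M.r_neg)
  then show "a = b" using Le.act_scal_eq_zero[OF e0_carrier, of "a + - b"] e0_nonzero by auto
qed simp

lemma e0_act:
  "act L_eps (grp g) e0 = e0" "act L_eps (dlt h) e0 = (if h = 1 then e0 else \<zero>\<^bsub>L_eps\<^esub>)"
  "act L_eps (xx t12) e0 = \<zero>\<^bsub>L_eps\<^esub>" "act L_eps (yy t12) e0 = \<zero>\<^bsub>L_eps\<^esub>"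
proof -
  have a: "act L_eps p e0 = act L_eps (scal (act (T01 \<zeta>) p (ket TT) TT)) e0" for p
    using pT_act[of "ket TT" p] pT_eq[of "act (T01 \<zeta>) p (ket TT)"] T.act_closed[of "ket TT" p]
    by (simp add: e0_def)
  show "act L_eps (grp g) e0 = e0" "act L_eps (dlt h) e0 = (if h = 1 then e0 else \<zero>\<^bsub>L_eps\<^esub>)"
    "act L_eps (xx t12) e0 = \<zero>\<^bsub>L_eps\<^esub>" "act L_eps (yy t12) e0 = \<zero>\<^bsub>L_eps\<^esub>"
    by (subst a, simp add: act_T01_generators)+
qed

text \<open>
  The degree comes from the head of the Verma module.  Every element of nonzero degree of
  \<open>D\<close> kills \<open>L(\<epsilon>)\<close>, since \<open>x\<^sub>1\<^sub>2\<close> and \<open>y\<^sub>1\<^sub>2\<close> do.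
\<close>

lemma L_eps_deg_eq:
  "(L_eps_deg n :: (S3 \<Rightarrow> 'k free set) set set set) = (if n = 0 then carrier L_eps else {\<zero>\<^bsub>L_eps\<^esub>})"
proof -
  have z: "\<zero>\<^bsub>L_eps\<^esub> \<in> (L_eps_deg n :: (S3 \<Rightarrow> 'k free set) set set set)" for n
  proof -
    have "(\<lambda>b. \<zero>\<^bsub>DD\<^esub>) \<in> balancing gens_ge0 {1} (eps_rep :: gen \<Rightarrow> S3 \<Rightarrow> S3 \<Rightarrow> 'k)"
      using eps.Te.N_simps(2) by simp
    from eps.proj_balanced[OF this] show ?thesis
      unfolding simple_L_deg_eq simple_L_eq
      by (intro CollectI exI[of _ "\<lambda>b. \<zero>\<^bsub>DD\<^esub>"]) (auto simp: DD_simps DD_deg_closed)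
  qed
  show ?thesis
  proof (cases "n = 0")
    case False
    let ?P = "\<lambda>m :: int. if m = 0 then carrier L_eps else {\<zero>\<^bsub>L_eps\<^esub>} :: (S3 \<Rightarrow> 'k free set) set set set"
    have xy: "act L_eps (xx t12) u = \<zero>\<^bsub>L_eps\<^esub>" "act L_eps (yy t12) u = \<zero>\<^bsub>L_eps\<^esub>" 
      if "u \<in> carrier L_eps" for u :: "(S3 \<Rightarrow> 'k free set) set set"
      using that unfolding L_eps_carrier by (auto simp: Le.act_scal_commute e0_act)
    have hom: "d \<odot>\<^bsub>L_eps\<^esub> v \<in> ?P (n + 0)" if "d \<in> DD_deg n" "v \<in> carrier L_eps" for d v
      by (rule Le.act_homogeneous[where P = ?P]) (use that xy in \<open>auto split: if_splits\<close>)
    then have act0: "act L_eps p eps_gen = \<zero>\<^bsub>L_eps\<^esub>" if "cls p \<in> DD_deg n" for p :: "'k free"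
      using hom[OF that eps_gen_carrier] False by (simp add: act_def)
    have "eps.proj f \<in> {\<zero>\<^bsub>L_eps\<^esub>}"
      if "f \<in> carrier (tensor_k {1})" "\<forall>b\<in>{1}. f b \<in> DD_deg n" for f :: "S3 \<Rightarrow> 'k free set"
      unfolding simple_L_eq
      by (rule eps.proj_span[where K = "DD_deg n", OF that(1) _ DD_deg_carrier])
        (use that act0 Le.M.l_zero[OF Le.M.zero_closed] in \<open>auto simp: simple_L_eq\<close>)
    then have "(L_eps_deg n :: (S3 \<Rightarrow> 'k free set) set set set) \<subseteq> {\<zero>\<^bsub>L_eps\<^esub>}"
      unfolding simple_L_deg_eq by blast
    then show ?thesis using z[of n] False by auto
  next
    case True
    have "(eps_gen :: (S3 \<Rightarrow> 'k free set) set set) \<in> carrier L_eps" by (rule eps_gen_carrier)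
    then obtain k where k: "eps_gen = act L_eps (scal k) e0" unfolding L_eps_carrier by auto
    have "k \<noteq> 0"
    proof
      assume "k = 0"
      then have "eps_gen = (\<zero>\<^bsub>L_eps\<^esub> :: (S3 \<Rightarrow> 'k free set) set set)" using k by simp
      then have "e0 \<in> {\<zero>\<^bsub>L_eps\<^esub>}" by (intro eps_span[OF e0_carrier]) simp_all
      then show False using e0_nonzero by simp
    qed
    have "u \<in> L_eps_deg 0" if "u \<in> carrier L_eps" for u :: "(S3 \<Rightarrow> 'k free set) set set"
    proof -
      obtain m where m: "u = act L_eps (scal m) e0" using \<open>u \<in> _\<close> unfolding L_eps_carrier by auto
      have "u = act L_eps (scal (m / k)) eps_gen"
        unfolding k m using \<open>k \<noteq> 0\<close> by (simp flip: Le.act_scal_mult)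
      also have "\<dots> = eps.proj (cls (scal (m / k)) \<odot>\<^bsub>tensor_k {1}\<^esub> tensor_unit 1)"
        using eps.proj_smult[OF tensor_unit_carrier, of 1 "cls (scal (m / k))"] by (simp add: act_def simple_L_eq eps.gene_def)
      finally show ?thesis
        unfolding simple_L_deg_eq using DD_deg_closed(4)[of "m / k"]
        by (intro CollectI exI[of _ "cls (scal (m / k)) \<odot>\<^bsub>tensor_k {1}\<^esub> tensor_unit 1"])
           (auto simp: tensor_unit_def DD_simps)
    qed
    moreover have "(L_eps_deg n :: (S3 \<Rightarrow> 'k free set) set set set) \<subseteq> carrier L_eps"
      unfolding simple_L_deg_eq simple_L_eq by (auto intro!: eps.proj_carrier)
    ultimately show ?thesis using True by auto
  qed
qed

lemma T_homog_L10: "v \<in> L10 \<Longrightarrow> v \<in> T_homog m n \<longleftrightarrow> v \<in> T_homog m' n"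
proof -
  assume "v \<in> L10"
  then have "v b \<noteq> 0 \<Longrightarrow> T_deg m b = T_deg m' b" for b by (cases b) (auto simp: L10_def)
  then show ?thesis by (auto simp: T_homog_def)
qed

lemma T_homog_vecs: "v \<in> T_homog m n \<Longrightarrow> v \<in> vecs T_basis"
  by (simp add: T_homog_def)

lemma T01_homogeneous: "d \<in> DD_deg m \<Longrightarrow> v \<in> T_homog (- 1) n \<Longrightarrow> d \<odot>\<^bsub>T01 \<zeta>\<^esub> v \<in> T_homog (- 1) (m + n)"
  by (rule T.act_homogeneous[where P = "T_homog (- 1)"])
    (auto simp: act_T01_generators T_homog_vecs intro: T_homog_closed X_op_homog Y_op_homog)

text \<open>
  The image of \<open>L(\<sigma>,-)\<close> lies in the span of \<open>c\<^sub>1, \<dots>, c\<^sub>1\<^sub>0\<close>, on which the degree chosen for \<open>t\<close> is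
  invisible; this is why \<open>m\<close> is arbitrary.  In the proof \<open>m = - 1\<close>, the value for which \<open>T\<^sub>0\<^sub>,\<^sub>1\<close>
  is graded.
\<close>

lemma L_sigma_degD:
  assumes u: "u \<in> L_sigma_deg n"
  shows "u \<in> carrier L_sigma" "iT u \<in> T_homog m n"
proof -
  obtain f where f: "f \<in> carrier (tensor_k transps)" "\<And>b. b \<in> transps \<Longrightarrow> f b \<in> DD_deg n" "u = sig.proj f"
    using u unfolding simple_L_deg_eq by blast
  have "sig.proj f \<in> {u \<in> carrier L_sigma. iT u \<in> T_homog (- 1) n}"
    unfolding simple_L_eq
  proof (rule sig.proj_span[where K = "DD_deg n", OF f(1,2) DD_deg_carrier], unfold simple_L_eq[symmetric])
    fix b and p :: "'k free" assume b: "b \<in> transps" and p: "cls p \<in> DD_deg n"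
    have "(\<lambda>c. beta * ket (High b) c) \<in> T_homog (- 1) 0"
      using b by (auto simp: T_homog_def ket_def vecs_def)
    from T01_homogeneous[OF p this] have "iT (act L_sigma p (sig_gen b)) \<in> T_homog (- 1) n"
      using b by (simp add: iT_act sig_gen_carrier iT_sig_gen) (simp add: act_def)
    then show "act L_sigma p (sig_gen b) \<in> {u \<in> carrier L_sigma. iT u \<in> T_homog (- 1) n}"
      using b by (simp add: sig_gen_carrier)
  qed (auto simp: iT_zero iT_add T_homog_closed)
  then have "u \<in> carrier L_sigma \<and> iT u \<in> T_homog (- 1) n" using f(3) by simp
  then show "u \<in> carrier L_sigma" "iT u \<in> T_homog m n"
    using T_homog_L10[OF iT_L10, of u m n "- 1"] by auto
qed

lemma L_sigma_deg_closed:
  fixes u v :: "(S3 \<Rightarrow> 'k free set) set set"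
  shows "\<lbrakk>u \<in> L_sigma_deg n; v \<in> L_sigma_deg n\<rbrakk> \<Longrightarrow> u \<oplus>\<^bsub>L_sigma\<^esub> v \<in> L_sigma_deg n"
    "\<lbrakk>u \<in> L_sigma_deg n; cls p \<in> DD_deg m\<rbrakk> \<Longrightarrow> act L_sigma p u \<in> L_sigma_deg (m + n)"
proof -
  assume u: "u \<in> L_sigma_deg n"
  obtain f where f: "f \<in> carrier (tensor_k transps)" "\<And>b. b \<in> transps \<Longrightarrow> f b \<in> DD_deg n" "u = sig.proj f"
    using u unfolding simple_L_deg_eq by blast
  show "act L_sigma p u \<in> L_sigma_deg (m + n)" if p: "cls p \<in> DD_deg m"
  proof -
    have "act L_sigma p u = sig.proj (cls p \<odot>\<^bsub>tensor_k transps\<^esub> f)"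
      by (simp only: sig.proj_smult[OF f(1) cls_in_DD] act_def f(3) simple_L_eq)
    then show ?thesis
      unfolding simple_L_deg_eq using sig.Te.smult_closed[OF cls_in_DD f(1), of p] f(2) p
      by (intro CollectI exI[of _ "cls p \<odot>\<^bsub>tensor_k transps\<^esub> f"]) (simp add: DD_deg_closed)
  qed
  show "u \<oplus>\<^bsub>L_sigma\<^esub> v \<in> L_sigma_deg n" if v: "v \<in> L_sigma_deg n"
  proof -
    obtain g where g: "g \<in> carrier (tensor_k transps)" "\<And>b. b \<in> transps \<Longrightarrow> g b \<in> DD_deg n" "v = sig.proj g"
      using v unfolding simple_L_deg_eq by blast
    have "u \<oplus>\<^bsub>L_sigma\<^esub> v = sig.proj (f \<oplus>\<^bsub>tensor_k transps\<^esub> g)"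
      by (simp only: sig.proj_add[OF f(1) g(1)] f(3) g(3) simple_L_eq)
    then show ?thesis
      unfolding simple_L_deg_eq using sig.Te.M.a_closed[OF f(1) g(1)] f(2) g(2)
      by (intro CollectI exI[of _ "f \<oplus>\<^bsub>tensor_k transps\<^esub> g"]) (simp add: DD_deg_closed)
  qed
qed

lemma sig_gen_deg: "s \<in> transps \<Longrightarrow> (sig_gen s :: (S3 \<Rightarrow> 'k free set) set set) \<in> L_sigma_deg 0"
  unfolding simple_L_deg_eq sig.gene_def using DD_deg_closed(1)[of 0] DD_deg_closed(4)[of 1] tensor_unit_carrier[of s transps]
  by (intro CollectI exI[of _ "tensor_unit s"] conjI) (auto simp: tensor_unit_def DD_simps scal_hom)

lemma jT_deg:
  assumes v: "v \<in> L10" "v \<in> T_homog m n"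
  shows "jT v \<in> L_sigma_deg n"
proof -
  let ?P = "\<lambda>n. {v \<in> L10. jT v \<in> L_sigma_deg n}"
  have act: "act (T01 \<zeta>) p v \<in> ?P (m + n)" if "v \<in> ?P n" "cls p \<in> DD_deg m" for p v m n
    using that L_sigma_deg_closed(2)[of "jT v" n p m] by (simp add: L10_act jT_act)
  have scale: "(\<lambda>b. k * v b) \<in> ?P n" if "v \<in> ?P n" for k v n
    using act[OF that DD_deg_closed(4), of k] that by (simp add: act_T01_generators L10_vecs)
  have add: "(\<lambda>b. u b + v b) \<in> ?P n" if "u \<in> ?P n" "v \<in> ?P n" for u v n
    using that by (simp add: L10_closed jT_add L_sigma_deg_closed(1))
  have high: "ket (High t12) \<in> ?P 0"
  proof -
    have l: "(\<lambda>c. beta * ket (High t12) c) \<in> L10" by (simp add: L10_def)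
    have "jT (\<lambda>c. beta * ket (High t12) c) = sig_gen t12"
      using jT_iT[OF sig_gen_carrier[OF transps_simps(1)]] by (simp add: iT_sig_gen)
    then have "(\<lambda>c. beta * ket (High t12) c) \<in> ?P 0" using sig_gen_deg[of t12] l by simp
    from scale[OF this, of "inverse beta"] show ?thesis using beta_nonzero by (simp flip: mult.assoc)
  qed
  have ket: "ket b \<in> ?P (T_deg m b)" if "b \<in> T_basis" "b \<noteq> TT" for b
  proof (rule L10_generated[where P = ?P])
    show "G_op \<zeta> g v \<in> ?P n" if "v \<in> ?P n" for g v n
      using act[OF that DD_deg_closed(5), of "GGrp g"] that
      by (simp add: act_T01_generators L10_vecs gen_degree_def)
    show "X_op \<zeta> 1 0 0 0 v \<in> ?P (n - 1)" if "v \<in> ?P n" for v n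
      using act[OF that DD_deg_closed(5), of "GX t12"] that
      by (simp add: act_T01_generators L10_vecs gen_degree_def)
  qed (fact add scale high that)+
  have "v \<in> ?P n"
  proof (rule vecs_span[where B = T_basis])
    show "(\<lambda>b. 0) \<in> ?P n"
    proof -
      have "(act L_sigma 0 (sig_gen t12) :: (S3 \<Rightarrow> 'k free set) set set) \<in> L_sigma_deg n"
        using L_sigma_deg_closed(2)[OF sig_gen_deg DD_deg_closed(1), of t12 n] by simp
      moreover have "jT (\<lambda>b. 0) = \<zero>\<^bsub>L_sigma\<^esub>" using jT_iT[OF Ls.M.zero_closed] by (simp add: iT_zero)
      ultimately show ?thesis by (simp add: sig_gen_carrier L10_closed)
    qed
    show "ket b \<in> ?P n" if "b \<in> T_basis" "v b \<noteq> 0" for b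
    proof -
      have "b \<noteq> TT" "T_deg m b = n" using that v by (auto simp: L10_def T_homog_def)
      then show ?thesis using ket[OF that(1)] by simp
    qed
  qed (use v add scale in \<open>auto simp: L10_vecs\<close>)
  then show ?thesis by simp
qed

end

section \<open>Modules realized on the space with basis \<open>c\<^sub>1, \<dots>, c\<^sub>1\<^sub>0, t\<close>\<close>

type_synonym 'k T_vec = "T_index \<Rightarrow> 'k"

text \<open>
  The map \<open>\<Phi>\<close> identifies the eleven-dimensional space with \<open>M\<close> in such a way that the double of the group
  algebra acts as on \<open>T\<^sub>0\<^sub>,\<^sub>1\<close>, while \<open>x\<^sub>1\<^sub>2\<close> and \<open>y\<^sub>1\<^sub>2\<close> act by \<open>xo\<close> and \<open>yo\<close>.  That these
  operators satisfy the relations of \<open>D\<close> is then a consequence of \<open>M\<close> being a module.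
\<close>

definition realizes :: "'k::field_char_0 \<Rightarrow> ('k free set, 'v) module \<Rightarrow> ('k T_vec \<Rightarrow> 'k T_vec) \<Rightarrow>
    ('k T_vec \<Rightarrow> 'k T_vec) \<Rightarrow> ('k T_vec \<Rightarrow> 'v) \<Rightarrow> bool" where
  "realizes \<zeta> M xo yo \<Phi> \<longleftrightarrow> left_module DD M \<and> bij_betw \<Phi> (vecs T_basis) (carrier M) \<and>
     (\<forall>u\<in>vecs T_basis. \<forall>v\<in>vecs T_basis. \<Phi> (\<lambda>c. u c + v c) = \<Phi> u \<oplus>\<^bsub>M\<^esub> \<Phi> v) \<and>
     (\<forall>k. \<forall>v\<in>vecs T_basis. \<Phi> (\<lambda>c. k * v c) = act M (scal k) (\<Phi> v)) \<and>
     (\<forall>g. \<forall>v\<in>vecs T_basis. \<Phi> (G_op \<zeta> g v) = act M (grp g) (\<Phi> v)) \<and>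
     (\<forall>h. \<forall>v\<in>vecs T_basis. \<Phi> (dlt_op h v) = act M (dlt h) (\<Phi> v)) \<and>
     (\<forall>v\<in>vecs T_basis. \<Phi> (xo v) = act M (xx t12) (\<Phi> v)) \<and>
     (\<forall>v\<in>vecs T_basis. \<Phi> (yo v) = act M (yy t12) (\<Phi> v))"

locale realized = D_module M + primitive_cube_root \<zeta>
  for M :: "('k::field_char_0 free set, 'v) module" and \<zeta> :: 'k +
  fixes xo yo :: "'k T_vec \<Rightarrow> 'k T_vec" and \<Phi> :: "'k T_vec \<Rightarrow> 'v"
  assumes realizes: "realizes \<zeta> M xo yo \<Phi>"
    and op_vecs': "\<And>v. xo v \<in> vecs T_basis" "\<And>v. yo v \<in> vecs T_basis"
begin

lemmas rz = realizes[unfolded realizes_def]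

lemma bij_Phi: "bij_betw \<Phi> (vecs T_basis) (carrier M)"
  using rz by (elim conjE)

lemma Phi_carrier [simp, intro]: "v \<in> vecs T_basis \<Longrightarrow> \<Phi> v \<in> carrier M"
  using bij_Phi by (rule bij_betwE[rule_format])

lemma Phi_inj: "\<lbrakk>\<Phi> u = \<Phi> v; u \<in> vecs T_basis; v \<in> vecs T_basis\<rbrakk> \<Longrightarrow> u = v"
  using bij_Phi by (meson bij_betw_imp_inj_on inj_onD)

lemma Phi_surj: "w \<in> carrier M \<Longrightarrow> \<exists>v\<in>vecs T_basis. w = \<Phi> v"
  using bij_Phi by (metis bij_betw_imp_surj_on imageE)

lemma Phi_act:
  assumes v: "v \<in> vecs T_basis"
  shows "act M (scal k) (\<Phi> v) = \<Phi> (\<lambda>c. k * v c)" "act M (grp g) (\<Phi> v) = \<Phi> (G_op \<zeta> g v)"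
    "act M (dlt h) (\<Phi> v) = \<Phi> (dlt_op h v)" "act M (xx t12) (\<Phi> v) = \<Phi> (xo v)" "act M (yy t12) (\<Phi> v) = \<Phi> (yo v)"
  using rz v by simp_all

lemma Phi_add: "\<lbrakk>u \<in> vecs T_basis; v \<in> vecs T_basis\<rbrakk> \<Longrightarrow> \<Phi> u \<oplus>\<^bsub>M\<^esub> \<Phi> v = \<Phi> (\<lambda>c. u c + v c)"
  using rz by (elim conjE) simp

lemma Phi_zero: "\<Phi> (\<lambda>c. 0) = \<zero>\<^bsub>M\<^esub>"
proof -
  have "\<Phi> (\<lambda>c. 0) = act M (scal 0) (\<Phi> (\<lambda>c. 0))" by (subst Phi_act(1)) simp_all
  then show ?thesis by simp
qed

lemma Phi_eq_zero_iff: "v \<in> vecs T_basis \<Longrightarrow> \<Phi> v = \<zero>\<^bsub>M\<^esub> \<longleftrightarrow> v = (\<lambda>c. 0)"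
  using Phi_inj[of v "\<lambda>c. 0"] Phi_zero by auto

lemma Phi_conj:
  assumes "v \<in> vecs T_basis" "s \<in> transps"
  shows "act M (xx s) (\<Phi> v) = \<Phi> (conj_op \<zeta> xo s v)" "act M (yy s) (\<Phi> v) = \<Phi> (conj_op \<zeta> yo s v)"
  using assms
  by (subst act_xx_conj act_yy_conj; simp add: Phi_act op_vecs' conj_op_def)+

end

lemma realizedI:
  assumes "realizes \<zeta> M xo yo \<Phi>" "\<zeta> ^ 3 = 1" "\<zeta> \<noteq> 1" "\<And>v. xo v \<in> vecs T_basis" "\<And>v. yo v \<in> vecs T_basis"
  shows "realized M \<zeta> xo yo \<Phi>"
  using assms by (intro realized.intro D_moduleI realized_axioms.intro primitive_cube_root.intro)
    (auto simp: realizes_def)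

lemma realizes_iso:
  assumes "realizes \<zeta> M xo yo \<Phi>" "realizes \<zeta> N xo yo \<Psi>" "\<zeta> ^ 3 = 1" "\<zeta> \<noteq> 1"
    "\<And>v. xo v \<in> vecs T_basis" "\<And>v. yo v \<in> vecs T_basis"
  shows "mod_iso DD M N"
proof -
  interpret M: realized M \<zeta> xo yo \<Phi> by (rule realizedI) fact+
  interpret N: realized N \<zeta> xo yo \<Psi> by (rule realizedI) fact+
  let ?j = "inv_into (vecs T_basis) \<Phi>"
  have bij: "bij_betw ?j (carrier M) (vecs T_basis)"
    using assms(1) by (intro bij_betw_inv_into) (simp add: realizes_def)
  have j: "?j (\<Phi> v) = v" if "v \<in> vecs T_basis" for v
    using that assms(1) by (auto simp: realizes_def bij_betw_def)
  have "\<Psi> \<circ> ?j \<in> mod_hom DD M N"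
  proof (rule mod_homI_generators[OF M.left_module_axioms N.left_module_axioms])
    show "\<Psi> \<circ> ?j \<in> carrier M \<rightarrow> carrier N" using bij_betwE[OF bij] by auto
  qed (auto dest!: M.Phi_surj simp: j M.Phi_add N.Phi_add M.Phi_act N.Phi_act M.op_vecs')
  moreover have "bij_betw (\<Psi> \<circ> ?j) (carrier M) (carrier N)"
    using bij assms(2) by (auto simp: realizes_def intro: bij_betw_trans)
  ultimately show ?thesis unfolding mod_iso_def by blast
qed

lemma realizes_mod_iso:
  assumes "realizes \<zeta> M xo yo \<Phi>" "mod_iso DD M N" "left_module DD N" "\<zeta> ^ 3 = 1" "\<zeta> \<noteq> 1"
    "\<And>v. xo v \<in> vecs T_basis" "\<And>v. yo v \<in> vecs T_basis"
  shows "\<exists>\<Psi>. realizes \<zeta> N xo yo \<Psi>"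
proof -
  interpret M: realized M \<zeta> xo yo \<Phi> by (rule realizedI) fact+
  obtain f where f: "f \<in> mod_hom DD M N" "bij_betw f (carrier M) (carrier N)"
    using assms(2) unfolding mod_iso_def by auto
  have "realizes \<zeta> N xo yo (f \<circ> \<Phi>)"
    unfolding realizes_def
    using assms(3) f(2) M.rz
    by (auto simp: mod_hom_act[OF f(1), symmetric] mod_homD(2)[OF f(1), symmetric] M.Phi_add M.Phi_act
        intro: bij_betw_trans)
  then show ?thesis by blast
qed

section \<open>Extensions of \<open>L(\<epsilon>)\<close> by \<open>L(\<sigma>,-)\<close>\<close>

text \<open>
  The vectors of group degree \<open>(12)\<close> in the span of \<open>c\<^sub>1, \<dots>, c\<^sub>1\<^sub>0\<close>: combinations of \<open>c\<^sub>1\<close> and \<open>c\<^sub>8\<close>.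
\<close>

definition low_high :: "'k::field \<Rightarrow> 'k \<Rightarrow> T_index \<Rightarrow> 'k" where
  "low_high a b = (\<lambda>c. a * ket (Low t12) c + b * ket (High t12) c)"

lemma low_high_L10 [simp, intro]: "low_high a b \<in> L10"
  by (auto simp: low_high_def L10_def vecs_def ket_def)

lemma low_high_simps: "(\<lambda>c. low_high a b c + low_high a' b' c) = low_high (a + a') (b + b')"
  "(\<lambda>c. k * low_high a b c) = low_high (k * a) (k * b)"
  by (simp_all add: low_high_def fun_eq_iff algebra_simps)

lemma low_high_apply [simp]: "low_high a b (Low t12) = a" "low_high a b (High t12) = b"
  "s \<noteq> t12 \<Longrightarrow> low_high a b (Low s) = 0" "s \<noteq> t12 \<Longrightarrow> low_high a b (High s) = 0"
  "low_high a b (Tau1 h) = 0" "low_high a b (Tau2 h) = 0" "low_high a b TT = 0"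
  by (simp_all add: low_high_def ket_def)

lemma L10_degree_t12:
  fixes v :: "T_index \<Rightarrow> 'k::field_char_0"
  assumes "v \<in> L10" "dlt_op t12 v = v"
  shows "v = low_high (v (Low t12)) (v (High t12))"
proof -
  have "dlt_op t12 v = low_high (v (Low t12)) (v (High t12))"
    by (rule T_ext, rule op_vecs, rule L10_vecs[OF low_high_L10]) simp_all
  then show ?thesis using assms(2) by simp
qed

lemma L10_degree_one:
  fixes v :: "T_index \<Rightarrow> 'k::field_char_0"
  assumes "v \<in> L10"
  shows "dlt_op 1 v = (\<lambda>c. 0)"
  by (rule T_ext[OF op_vecs(3) vecs_closed(2)]) (use assms in \<open>simp_all add: L10_def\<close>)

definition drop_TT :: "(T_index \<Rightarrow> 'k::field) \<Rightarrow> T_index \<Rightarrow> 'k" where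
  "drop_TT v = v(TT := 0)"

lemma drop_TT_apply [simp]: "drop_TT v TT = 0" "b \<noteq> TT \<Longrightarrow> drop_TT v b = v b"
  by (simp_all add: drop_TT_def)

lemma drop_TT_L10 [simp, intro]: "v \<in> vecs T_basis \<Longrightarrow> drop_TT v \<in> L10"
  by (auto simp: drop_TT_def L10_def vecs_def)

lemma drop_TT_vecs [simp, intro]: "v \<in> vecs T_basis \<Longrightarrow> drop_TT v \<in> vecs T_basis"
  by (rule L10_vecs) (rule drop_TT_L10)

lemma drop_TT_id: "v \<in> L10 \<Longrightarrow> drop_TT v = v"
  by (auto simp: drop_TT_def L10_def)

lemma drop_TT_linear: "drop_TT (\<lambda>c. u c + v c) = (\<lambda>c. drop_TT u c + drop_TT v c)"
  "drop_TT (\<lambda>c. k * v c) = (\<lambda>c. k * drop_TT v c)"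
  by (auto simp: drop_TT_def)

lemma drop_TT_ops:
  "drop_TT (X_op \<zeta> a b a' b' v) = (\<lambda>c. X_op \<zeta> 1 0 0 0 (drop_TT v) c + v TT * low_high a b c)"
  "drop_TT (Y_op \<zeta> a b a' b' v) = (\<lambda>c. Y_op \<zeta> 0 1 0 0 (drop_TT v) c + v TT * low_high a b c)"
  "drop_TT (dlt_op h v) = dlt_op h (drop_TT v)"
  by (intro T_ext vecs_closed drop_TT_vecs op_vecs L10_vecs[OF low_high_L10]; simp)+

lemma (in primitive_cube_root) drop_TT_G_op: "drop_TT (G_op \<zeta> g v) = G_op \<zeta> g (drop_TT v)"
  by (intro T_ext drop_TT_vecs G_op_vecs; simp)

context extension_T
begin

lemma jT_zero: "jT (\<lambda>c. 0) = \<zero>\<^bsub>L_sigma\<^esub>"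
  using jT_iT[OF Ls.M.zero_closed] by (simp add: iT_zero)

lemma act_drop_TT:
  assumes "v \<in> vecs T_basis"
  shows "act L_sigma (grp g) (jT (drop_TT v)) = jT (drop_TT (G_op \<zeta> g v))"
    "act L_sigma (dlt h) (jT (drop_TT v)) = jT (drop_TT (dlt_op h v))"
    "act L_sigma (xx t12) (jT (drop_TT v)) = jT (X_op \<zeta> 1 0 0 0 (drop_TT v))"
    "act L_sigma (yy t12) (jT (drop_TT v)) = jT (Y_op \<zeta> 0 1 0 0 (drop_TT v))"
    "act L_sigma (scal k) (jT (drop_TT v)) = jT (drop_TT (\<lambda>c. k * v c))"
  using assms
  by (simp_all add: jT_act[symmetric] act_T01_generators drop_TT_ops drop_TT_G_op drop_TT_linear)

text \<open>
  The extension class in coordinates: \<open>x\<^sub>1\<^sub>2 t = a c\<^sub>1 + b c\<^sub>8\<close> and \<open>y\<^sub>1\<^sub>2 t = c c\<^sub>1 + d c\<^sub>8\<close> for the lift \<open>t\<close> of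
  the generator of \<open>L(\<epsilon>)\<close> that has group degree \<open>1\<close>.
\<close>

definition has_params where
  "has_params i E p a b c d \<longleftrightarrow> (\<exists>t\<in>carrier E. p t = e0 \<and> act E (dlt 1) t = t \<and>
     act E (xx t12) t = i (jT (low_high a b)) \<and> act E (yy t12) t = i (jT (low_high c d)))"

end

locale eps_by_sigma = extension_T \<zeta> iT pT for \<zeta> :: "'k::field_char_0" and iT pT +
  fixes i and E :: "('k free set, 'e) module" and p
  assumes exact: "short_exact DD L_sigma (i, E, p) L_eps"
begin

lemmas exD = short_exactD[OF exact]

sublocale E: D_module E by (rule D_moduleI) (rule exD)

lemma i_closed [simp, intro]: "u \<in> carrier L_sigma \<Longrightarrow> i u \<in> carrier E"
  by (rule mod_homD(1)[OF exD(4)])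

lemma p_closed [simp, intro]: "w \<in> carrier E \<Longrightarrow> p w \<in> carrier L_eps"
  by (rule mod_homD(1)[OF exD(5)])

lemma i_act: "u \<in> carrier L_sigma \<Longrightarrow> i (act L_sigma q u) = act E q (i u)"
  by (rule mod_hom_act[OF exD(4)])

lemma p_act: "w \<in> carrier E \<Longrightarrow> p (act E q w) = act L_eps q (p w)"
  by (rule mod_hom_act[OF exD(5)])

lemma i_add: "\<lbrakk>u \<in> carrier L_sigma; v \<in> carrier L_sigma\<rbrakk> \<Longrightarrow> i (u \<oplus>\<^bsub>L_sigma\<^esub> v) = i u \<oplus>\<^bsub>E\<^esub> i v"
  by (rule mod_homD(2)[OF exD(4)])

lemma p_add: "\<lbrakk>u \<in> carrier E; v \<in> carrier E\<rbrakk> \<Longrightarrow> p (u \<oplus>\<^bsub>E\<^esub> v) = p u \<oplus>\<^bsub>L_eps\<^esub> p v"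
  by (rule mod_homD(2)[OF exD(5)])

lemma i_zero: "i \<zero>\<^bsub>L_sigma\<^esub> = \<zero>\<^bsub>E\<^esub>" and p_zero: "p \<zero>\<^bsub>E\<^esub> = \<zero>\<^bsub>L_eps\<^esub>"
  using mod_hom_zero[OF exD(4,1,2)] mod_hom_zero[OF exD(5,2,3)] by simp_all

text \<open>
  The difference of two such lifts lies in \<open>L(\<sigma>,-)\<close> and has group degree \<open>1\<close>, but \<open>L(\<sigma>,-)\<close> has no
  nonzero vector of that degree.
\<close>

lemma degree_one_unique:
  assumes "w \<in> carrier E" "w' \<in> carrier E" "act E (dlt 1) w = w" "act E (dlt 1) w' = w'" "p w = p w'"
  shows "w = w'"
proof -
  have "p (w \<ominus>\<^bsub>E\<^esub> w') = \<zero>\<^bsub>L_eps\<^esub>"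
    using assms mod_hom_diff[OF exD(5,2,3)] by (simp add: Le.M.minus_eq Le.M.r_neg)
  then obtain u where u: "u \<in> carrier L_sigma" "w \<ominus>\<^bsub>E\<^esub> w' = i u" using exD(9)[of "w \<ominus>\<^bsub>E\<^esub> w'"] assms by auto
  have "act E (dlt 1) (i u) = i u"
    using assms by (simp add: u(2)[symmetric] E.M.minus_eq E.act_add_right E.act_minus_right)
  then have "i (act L_sigma (dlt 1) u) = i u" using u by (simp add: i_act)
  then have "act L_sigma (dlt 1) u = u" using exD(6) u by auto
  then have "iT u = dlt_op 1 (iT u)" using iT_act[OF u(1), of "dlt 1"] by (simp add: act_T01_generators iT_closed u)
  then have "iT u = iT \<zero>\<^bsub>L_sigma\<^esub>" using L10_degree_one[OF iT_L10[OF u(1)]] by (simp add: iT_zero)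
  then have "u = \<zero>\<^bsub>L_sigma\<^esub>" using u by (intro iT_inj) auto
  then show ?thesis using u assms by (auto simp: i_zero intro: E.M.a_minus_eq_zeroD)
qed

lemma degree_t12_kernel:
  assumes "w \<in> carrier E" "act E (dlt t12) w = w" "p w = \<zero>\<^bsub>L_eps\<^esub>"
  shows "\<exists>a b. w = i (jT (low_high a b))"
proof -
  obtain u where u: "u \<in> carrier L_sigma" "w = i u" using exD(9)[of w] assms by auto
  have "i (act L_sigma (dlt t12) u) = i u" using u assms by (simp add: i_act)
  then have "act L_sigma (dlt t12) u = u" using exD(6) u by auto
  then have "dlt_op t12 (iT u) = iT u" using iT_act[OF u(1), of "dlt t12"] by (simp add: act_T01_generators iT_closed u)
  from L10_degree_t12[OF iT_L10[OF u(1)] this] show ?thesis using u jT_iT[OF u(1)] by metis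
qed

text \<open>
  Applying \<open>\<delta>\<^sub>1\<close> to any lift gives one of group degree \<open>1\<close>.
\<close>

lemma has_params_exists: "\<exists>a b c d. has_params i E p a b c d"
proof -
  obtain t0 where t0: "t0 \<in> carrier E" "p t0 = e0" using exD(7)[OF e0_carrier] by auto
  define t where "t = act E (dlt 1) t0"
  have t: "t \<in> carrier E" "p t = e0" "act E (dlt 1) t = t"
    using t0 by (auto simp: t_def p_act e0_act E.act_dlt_dlt)
  have "\<exists>a b. act E (xx t12) t = i (jT (low_high a b))" "\<exists>a b. act E (yy t12) t = i (jT (low_high a b))"
    using t by (intro degree_t12_kernel; simp add: p_act e0_act E.act_dlt_xx E.act_dlt_yy)+
  then show ?thesis unfolding has_params_def using t by blast
qed

text \<open>
  The lift \<open>t\<close> is invariant under the group by \<open>degree_one_unique\<close>, so \<open>L(\<sigma>,-)\<close> and \<open>t\<close> together give a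
  splitting over the double of the group algebra.  The last two properties of \<open>\<Phi>\<close> say that it
  is compatible with the maps of the two extensions \<open>E\<close> and \<open>T\<^sub>0\<^sub>,\<^sub>1\<close>; gradings need them.
\<close>

lemma has_params_realizes:
  assumes "has_params i E p a b c d"
  obtains \<Phi> where "realizes \<zeta> E (X_op \<zeta> a b 0 0) (Y_op \<zeta> c d 0 0) \<Phi>"
    "\<And>u. u \<in> carrier L_sigma \<Longrightarrow> \<Phi> (iT u) = i u"
    "\<And>v. v \<in> vecs T_basis \<Longrightarrow> p (\<Phi> v) = act L_eps (scal (v TT)) e0"
proof -
  obtain t where t: "t \<in> carrier E" "p t = e0" "act E (dlt 1) t = t"
    "act E (xx t12) t = i (jT (low_high a b))" "act E (yy t12) t = i (jT (low_high c d))"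
    using assms unfolding has_params_def by blast
  have tg: "act E (grp g) t = t" for g
  proof (rule degree_one_unique)
    show "act E (dlt 1) (act E (grp g) t) = act E (grp g) t"
      using E.act_grp_dlt[OF t(1), of g 1, symmetric] by (simp add: t(3))
  qed (use t(1-3) in \<open>simp_all add: p_act e0_act\<close>)
  have td: "act E (dlt h) t = (if h = 1 then t else \<zero>\<^bsub>E\<^esub>)" for h
    using E.act_dlt_dlt[OF t(1), of h 1] t(3) by (cases "h = 1") simp_all
  define \<Phi> where "\<Phi> v = i (jT (drop_TT v)) \<oplus>\<^bsub>E\<^esub> act E (scal (v TT)) t" for v
  have c: "i (jT (drop_TT v)) \<in> carrier E" "act E (scal k) t \<in> carrier E" if "v \<in> vecs T_basis" for v k
    using that t by (auto simp: jT)
  have cl: "\<Phi> v \<in> carrier E" if "v \<in> vecs T_basis" for v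
    unfolding \<Phi>_def using c[OF that] by simp
  have p\<Phi>: "p (\<Phi> v) = act L_eps (scal (v TT)) e0" if "v \<in> vecs T_basis" for v
    using c[OF that] that t by (simp add: \<Phi>_def p_add p_act exD(8) jT)
  have \<Phi>i: "\<Phi> (iT u) = i u" if "u \<in> carrier L_sigma" for u
    using iT_L10[OF that] that t by (simp add: \<Phi>_def drop_TT_id jT_iT) (simp add: L10_def that)
  have add: "\<Phi> (\<lambda>c. u c + v c) = \<Phi> u \<oplus>\<^bsub>E\<^esub> \<Phi> v" if uv: "u \<in> vecs T_basis" "v \<in> vecs T_basis" for u v
    using uv c[OF uv(1)] c[OF uv(2)] t
    by (simp add: \<Phi>_def drop_TT_linear jT_add jT i_add scal_hom E.act_add E.M.add.m_ac)
  have scal: "\<Phi> (\<lambda>c. k * v c) = act E (scal k) (\<Phi> v)" if v: "v \<in> vecs T_basis" for k v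
    using v c[OF v] t
    by (simp add: \<Phi>_def E.act_add_right i_act[symmetric] jT act_drop_TT scal_hom E.act_mult)
  have grp: "\<Phi> (G_op \<zeta> g v) = act E (grp g) (\<Phi> v)" if v: "v \<in> vecs T_basis" for g v
    using v c[OF v] t
    by (simp add: \<Phi>_def E.act_add_right i_act[symmetric] jT act_drop_TT E.act_scal_commute tg)
  have dlt: "\<Phi> (dlt_op h v) = act E (dlt h) (\<Phi> v)" if v: "v \<in> vecs T_basis" for h v
    using v c[OF v] t
    by (simp add: \<Phi>_def E.act_add_right i_act[symmetric] jT act_drop_TT E.act_scal_commute td)
  have z: "\<Phi> (w') = act E q (\<Phi> v)"
    if v: "v \<in> vecs T_basis" and zt: "act E q t = i (jT (low_high a b))"
      and zl: "act L_sigma q (jT (drop_TT v)) = jT (w)" "w \<in> L10"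
      and zo: "drop_TT (w') = (\<lambda>c. w c + v TT * low_high a b c)" "w' TT = 0" for q w w' v a b
  proof -
    have s: "act E (scal (v TT)) (act E q t) = i (jT (\<lambda>c. v TT * low_high a b c))"
      by (simp add: zt i_act[symmetric] jT jT_scal)
    have "act E q (\<Phi> v) = i (jT (w)) \<oplus>\<^bsub>E\<^esub> i (jT (\<lambda>c. v TT * low_high a b c))"
      using v c[OF v] t zl by (simp add: \<Phi>_def E.act_add_right E.act_scal_commute s) (simp add: i_act[symmetric] jT)
    also have "\<dots> = \<Phi> (w')"
      using t zl by (simp add: \<Phi>_def zo jT_add jT i_add L10_closed)
    finally show ?thesis ..
  qed
  have inj: "inj_on \<Phi> (vecs T_basis)"
  proof (rule inj_onI)
    fix u v assume uv: "u \<in> vecs T_basis" "v \<in> vecs T_basis" "\<Phi> u = \<Phi> v"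
    then have tt: "u TT = v TT" using p\<Phi> L_eps_scal_eq_iff by metis
    then have "i (jT (drop_TT u)) = i (jT (drop_TT v))"
      using uv c[OF uv(1)] c[OF uv(2)] t unfolding \<Phi>_def by simp
    then have "jT (drop_TT u) = jT (drop_TT v)" using uv by (intro exD(6)) (auto simp: jT)
    then have "drop_TT u = drop_TT v" using uv jT(2)[OF drop_TT_L10] by metis
    then have "drop_TT u b = drop_TT v b" for b by simp
    then show "u = v" using tt by (intro ext) (metis drop_TT_apply(2))
  qed
  have surj: "\<exists>v\<in>vecs T_basis. \<Phi> v = w" if w: "w \<in> carrier E" for w
  proof -
    obtain k where k: "p w = act L_eps (scal k) e0" using p_closed[OF w] unfolding L_eps_carrier by auto
    have "p (w \<ominus>\<^bsub>E\<^esub> act E (scal k) t) = \<zero>\<^bsub>L_eps\<^esub>"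
      using w t k mod_hom_diff[OF exD(5,2,3)] by (simp add: p_act Le.M.minus_eq Le.M.r_neg)
    then obtain u where u: "u \<in> carrier L_sigma" "w \<ominus>\<^bsub>E\<^esub> act E (scal k) t = i u"
      using exD(9)[of "w \<ominus>\<^bsub>E\<^esub> act E (scal k) t"] w t by auto
    \<comment> \<open>\<open>iT u\<close> has coordinate \<open>0\<close> at \<open>t\<close>, so this is \<open>iT u + k t\<close>.\<close>
    define v where "v = (iT u)(TT := k)"
    have v: "v \<in> vecs T_basis" "drop_TT v = iT u" "v TT = k"
      using iT_L10[OF u(1)] by (auto simp: v_def L10_def vecs_def drop_TT_def)
    have "\<Phi> v = w \<ominus>\<^bsub>E\<^esub> act E (scal k) t \<oplus>\<^bsub>E\<^esub> act E (scal k) t" by (simp add: \<Phi>_def v jT_iT u)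
    also have "\<dots> = w" using w t by (simp add: E.M.minus_eq E.M.a_assoc E.M.l_neg)
    finally show ?thesis using v by blast
  qed
  have "bij_betw \<Phi> (vecs T_basis) (carrier E)"
    unfolding bij_betw_def using inj cl surj by blast
  moreover have "\<Phi> (X_op \<zeta> a b 0 0 v) = act E (xx t12) (\<Phi> v)" if "v \<in> vecs T_basis" for v
    by (rule z[OF that t(4) act_drop_TT(3)[OF that]]) (use that in \<open>simp_all add: act_drop_TT drop_TT_ops L10_closed\<close>)
  moreover have "\<Phi> (Y_op \<zeta> c d 0 0 v) = act E (yy t12) (\<Phi> v)" if "v \<in> vecs T_basis" for v
    by (rule z[OF that t(5) act_drop_TT(4)[OF that]]) (use that in \<open>simp_all add: act_drop_TT drop_TT_ops L10_closed\<close>)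
  ultimately have "realizes \<zeta> E (X_op \<zeta> a b 0 0) (Y_op \<zeta> c d 0 0) \<Phi>"
    by (simp add: realizes_def exD(2) add scal grp dlt)
  from that[OF this \<Phi>i p\<Phi>] show ?thesis .
qed

end

text \<open>
  The cross relation between \<open>y\<^sub>1\<^sub>2\<close> and \<open>x\<^sub>2\<^sub>3\<close>, read in coordinates.
\<close>

lemma (in realized) cross_relation_t12_t23:
  assumes v: "v \<in> vecs T_basis"
  shows "yo (conj_op \<zeta> xo t23 v) e + conj_op \<zeta> xo t23 (conj_op \<zeta> yo t13 v) e =
    G_op \<zeta> t23 (dlt_op t12 v) e - G_op \<zeta> t23 (dlt_op c123 v) e"
proof -
  let ?q = "- (xx t23 * yy t13) + 0 + grp t23 * (dlt t12 - dlt c123) :: 'k free"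
  have "cls (yy t12 * xx t23 + xx t23 * yy t13) = cls (?q + xx t23 * yy t13)"
    using cls_cross[of t12 t23] by (intro cls_cong(1)) simp_all
  also have "?q + xx t23 * yy t13 = grp t23 * dlt t12 + scal (- 1) * (grp t23 * dlt c123)"
    by (simp add: scal_hom algebra_simps)
  finally have "act M (yy t12 * xx t23 + xx t23 * yy t13) (\<Phi> v) =
      act M (grp t23 * dlt t12 + scal (- 1) * (grp t23 * dlt c123)) (\<Phi> v)" by (rule act_cong)
  then have "\<Phi> (\<lambda>e. yo (conj_op \<zeta> xo t23 v) e + conj_op \<zeta> xo t23 (conj_op \<zeta> yo t13 v) e) =
      \<Phi> (\<lambda>e. G_op \<zeta> t23 (dlt_op t12 v) e + - 1 * G_op \<zeta> t23 (dlt_op c123 v) e)"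
    by (simp only: act_add act_mult Phi_carrier v act_closed Phi_conj(1)[OF _ transps_simps(3)]
        Phi_conj(2)[OF _ transps_simps(2)] Phi_act conj_op_vecs op_vecs' op_vecs G_op_vecs Phi_add vecs_closed)
  from fun_cong[OF Phi_inj[OF this], of e] show ?thesis by (simp add: op_vecs')
qed

text \<open>
  In the cross relation applied to \<open>t\<close>, the coefficient of \<open>c\<^sub>4\<close> is proportional to \<open>d - a\<close>.
\<close>

lemma column_cross_relation:
  assumes "realizes \<zeta> M (X_op \<zeta> a b 0 0) (Y_op \<zeta> c d 0 0) \<Phi>" "\<zeta> ^ 3 = 1" "\<zeta> \<noteq> 1"
  shows "a = d"
proof -
  interpret realized M \<zeta> "X_op \<zeta> a b 0 0" "Y_op \<zeta> c d 0 0" \<Phi> by (rule realizedI) (use assms in auto)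
  have "3 * ((1 + 2 * \<zeta>) * (d - a)) = 0"
    using cross_relation_t12_t23[of "ket TT" "Tau1 c123"] by (simp add: field_simps)
  then show ?thesis using zeta_not by simp
qed

text \<open>
  In the cross relation applied to \<open>c\<^sub>5\<close>, the coefficient of \<open>t\<close> is proportional to \<open>c + b\<close>.
\<close>

lemma row_cross_relation:
  assumes "realizes \<zeta> M (X_op \<zeta> 0 0 a b) (Y_op \<zeta> 0 0 c d) \<Phi>" "\<zeta> ^ 3 = 1" "\<zeta> \<noteq> 1"
  shows "c = - b"
proof -
  interpret realized M \<zeta> "X_op \<zeta> 0 0 a b" "Y_op \<zeta> 0 0 c d" \<Phi> by (rule realizedI) (use assms in auto)
  have "(- 1 - \<zeta>) * (c + b) = 0"
    using cross_relation_t12_t23[of "ket (Tau1 c132)" TT] by (simp add: algebra_simps)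
  then show ?thesis using zeta_not by (simp add: eq_neg_iff_add_eq_0)
qed

section \<open>Extensions of \<open>L(\<sigma>,-)\<close> by \<open>L(\<epsilon>)\<close>\<close>

locale sigma_by_eps = extension_T \<zeta> iT pT for \<zeta> :: "'k::field_char_0" and iT pT +
  fixes i and E :: "('k free set, 'e) module" and p
  assumes exact: "short_exact DD L_eps (i, E, p) L_sigma"
begin

lemmas exD = short_exactD[OF exact]

sublocale E: D_module E by (rule D_moduleI) (rule exD)

lemma i_closed [simp, intro]: "u \<in> carrier L_eps \<Longrightarrow> i u \<in> carrier E"
  by (rule mod_homD(1)[OF exD(4)])

lemma p_closed [simp, intro]: "w \<in> carrier E \<Longrightarrow> p w \<in> carrier L_sigma"
  by (rule mod_homD(1)[OF exD(5)])

lemma i_act: "u \<in> carrier L_eps \<Longrightarrow> i (act L_eps q u) = act E q (i u)"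
  by (rule mod_hom_act[OF exD(4)])

lemma p_act: "w \<in> carrier E \<Longrightarrow> p (act E q w) = act L_sigma q (p w)"
  by (rule mod_hom_act[OF exD(5)])

lemma p_add: "\<lbrakk>u \<in> carrier E; v \<in> carrier E\<rbrakk> \<Longrightarrow> p (u \<oplus>\<^bsub>E\<^esub> v) = p u \<oplus>\<^bsub>L_sigma\<^esub> p v"
  by (rule mod_homD(2)[OF exD(5)])

lemma i_zero: "i \<zero>\<^bsub>L_eps\<^esub> = \<zero>\<^bsub>E\<^esub>"
  by (rule mod_hom_zero[OF exD(4,1,2)])

lemma kernel_scalar:
  assumes "w \<in> carrier E" "p w = \<zero>\<^bsub>L_sigma\<^esub>"
  shows "\<exists>k. w = act E (scal k) (i e0)"
  using exD(9)[OF assms] unfolding L_eps_carrier by (auto simp: i_act)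

lemma i_e0_act:
  "act E (grp g) (i e0) = i e0" "act E (dlt h) (i e0) = (if h = 1 then i e0 else \<zero>\<^bsub>E\<^esub>)"
  "act E (xx t12) (i e0) = \<zero>\<^bsub>E\<^esub>" "act E (yy t12) (i e0) = \<zero>\<^bsub>E\<^esub>"
  by (simp_all add: i_act[symmetric] e0_act i_zero)

text \<open>
  The kernel of \<open>p\<close> is a copy of \<open>L(\<epsilon>)\<close>, on which \<open>\<delta>\<^sub>1\<close> is the identity.
\<close>

lemma section_unique:
  assumes "w \<in> carrier E" "w' \<in> carrier E" "act E (dlt 1) w = \<zero>\<^bsub>E\<^esub>" "act E (dlt 1) w' = \<zero>\<^bsub>E\<^esub>" "p w = p w'"
  shows "w = w'"
proof -
  have "p (w \<ominus>\<^bsub>E\<^esub> w') = \<zero>\<^bsub>L_sigma\<^esub>"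
    using assms mod_hom_diff[OF exD(5,2,3)] by (simp add: Ls.M.minus_eq Ls.M.r_neg)
  then obtain k where k: "w \<ominus>\<^bsub>E\<^esub> w' = act E (scal k) (i e0)"
    using kernel_scalar[of "w \<ominus>\<^bsub>E\<^esub> w'"] assms by auto
  have "act E (dlt 1) (w \<ominus>\<^bsub>E\<^esub> w') = \<zero>\<^bsub>E\<^esub>"
    using assms by (simp add: E.M.minus_eq E.act_add_right E.act_minus_right)
  then have "act E (scal k) (i e0) = \<zero>\<^bsub>E\<^esub>" unfolding k by (simp add: E.act_scal_commute i_e0_act)
  then show ?thesis using k assms by (auto intro: E.M.a_minus_eq_zeroD)
qed

lemma p_degree_one: "w \<in> carrier E \<Longrightarrow> p (act E (dlt 1) w) = \<zero>\<^bsub>L_sigma\<^esub>"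
  by (rule iT_inj)
    (simp_all add: p_act iT_act act_T01_generators iT_closed L10_degree_one[OF iT_L10] iT_zero)

text \<open>
  The idempotent \<open>1 - \<delta>\<^sub>1\<close> moves any preimage to one that is killed by \<open>\<delta>\<^sub>1\<close>, without changing its
  image, because \<open>\<delta>\<^sub>1\<close> is zero on \<open>L(\<sigma>,-)\<close>.
\<close>

lemma section_exists:
  assumes "v \<in> L10"
  shows "\<exists>w\<in>carrier E. p w = jT v \<and> act E (dlt 1) w = \<zero>\<^bsub>E\<^esub>"
proof -
  obtain w where w: "w \<in> carrier E" "p w = jT v" using exD(7)[of "jT v"] jT(1)[OF assms] by auto
  let ?w = "w \<ominus>\<^bsub>E\<^esub> act E (dlt 1) w"
  have "p ?w = jT v"
    using w mod_hom_diff[OF exD(5,2,3), of w "act E (dlt 1) w"] p_degree_one[OF w(1)] jT(1)[OF assms]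
    by (simp add: Ls.M.minus_eq)
  moreover have "act E (dlt 1) ?w = \<zero>\<^bsub>E\<^esub>"
    using w by (simp add: E.M.minus_eq E.act_add_right E.act_minus_right E.act_dlt_dlt E.M.r_neg)
  ultimately show ?thesis using w by (intro bexI[of _ ?w]) auto
qed

definition sect :: "(T_index \<Rightarrow> 'k) \<Rightarrow> 'e" where
  "sect v = (SOME w. w \<in> carrier E \<and> p w = jT v \<and> act E (dlt 1) w = \<zero>\<^bsub>E\<^esub>)"

lemma sect: assumes "v \<in> L10"
  shows "sect v \<in> carrier E" "p (sect v) = jT v" "act E (dlt 1) (sect v) = \<zero>\<^bsub>E\<^esub>"
  using someI_ex[of "\<lambda>w. w \<in> carrier E \<and> p w = jT v \<and> act E (dlt 1) w = \<zero>\<^bsub>E\<^esub>"] section_exists[OF assms]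
  unfolding sect_def by blast+

lemma sect_eqI: "\<lbrakk>v \<in> L10; w \<in> carrier E; p w = jT v; act E (dlt 1) w = \<zero>\<^bsub>E\<^esub>\<rbrakk> \<Longrightarrow> sect v = w"
  by (rule section_unique) (simp_all add: sect)

lemma sect_add: "\<lbrakk>u \<in> L10; v \<in> L10\<rbrakk> \<Longrightarrow> sect (\<lambda>c. u c + v c) = sect u \<oplus>\<^bsub>E\<^esub> sect v"
  by (rule sect_eqI) (simp_all add: sect L10_closed p_add jT_add E.act_add_right)

lemma sect_scal: "v \<in> L10 \<Longrightarrow> sect (\<lambda>c. k * v c) = act E (scal k) (sect v)"
  by (rule sect_eqI) (simp_all add: sect L10_closed p_act jT_scal E.act_scal_commute)

lemma sect_grp: "v \<in> L10 \<Longrightarrow> sect (G_op \<zeta> g v) = act E (grp g) (sect v)"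
  using E.act_grp_dlt[of "sect v" g 1, symmetric]
  by (intro sect_eqI) (simp_all add: sect L10_closed p_act jT_act[symmetric] act_T01_generators L10_vecs)

lemma sect_dlt: "v \<in> L10 \<Longrightarrow> sect (dlt_op h v) = act E (dlt h) (sect v)"
  by (rule sect_eqI) (simp_all add: sect L10_closed p_act jT_act[symmetric] act_T01_generators L10_vecs E.act_dlt_dlt)

text \<open>
  Here \<open>z\<close> is \<open>x\<^sub>1\<^sub>2\<close> or \<open>y\<^sub>1\<^sub>2\<close>.  The section is not \<open>D\<close>-linear: its defect \<open>\<delta>\<^sub>1 z (sect v)\<close> lies in \<open>L(\<epsilon>)\<close> and
  depends on the component of \<open>v\<close> of group degree \<open>(12)\<close> alone, that is, on the coordinates at \<open>c\<^sub>1\<close> and \<open>c\<^sub>8\<close>.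
\<close>

lemma sect_act:
  assumes deg: "\<And>w. w \<in> carrier E \<Longrightarrow> act E (dlt 1) (act E z w) = act E z (act E (dlt t12) w)"
  obtains a b where "\<And>v. v \<in> L10 \<Longrightarrow>
    act E z (sect v) = sect (act (T01 \<zeta>) z v) \<oplus>\<^bsub>E\<^esub> act E (scal (a * v (Low t12) + b * v (High t12))) (i e0)"
proof -
  have "\<exists>k. act E (dlt 1) (act E z (sect v)) = act E (scal k) (i e0)" if "v \<in> L10" for v
    using that by (intro kernel_scalar) (simp_all add: sect p_degree_one)
  then obtain f where f: "\<And>v. v \<in> L10 \<Longrightarrow> act E (dlt 1) (act E z (sect v)) = act E (scal (f v)) (i e0)"
    by metis
  have main: "act E z (sect v) = sect (act (T01 \<zeta>) z v) \<oplus>\<^bsub>E\<^esub> act E (dlt 1) (act E z (sect v))" if v: "v \<in> L10" for v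
  proof -
    let ?w = "act E z (sect v)"
    have w: "?w \<in> carrier E" "p ?w = jT (act (T01 \<zeta>) z v)" using v by (simp_all add: sect p_act jT_act)
    have "sect (act (T01 \<zeta>) z v) = ?w \<ominus>\<^bsub>E\<^esub> act E (dlt 1) ?w"
    proof (rule sect_eqI[OF L10_act[OF v]])
      show "p (?w \<ominus>\<^bsub>E\<^esub> act E (dlt 1) ?w) = jT (act (T01 \<zeta>) z v)"
        using w mod_hom_diff[OF exD(5,2,3), of ?w "act E (dlt 1) ?w"] p_degree_one[OF w(1)] jT(1)[OF L10_act[OF v]]
        by (simp add: Ls.M.minus_eq)
      show "act E (dlt 1) (?w \<ominus>\<^bsub>E\<^esub> act E (dlt 1) ?w) = \<zero>\<^bsub>E\<^esub>"
        using w by (simp add: E.M.minus_eq E.act_add_right E.act_minus_right E.act_dlt_dlt E.M.r_neg)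
    qed (use w in auto)
    then show ?thesis using w by (simp add: E.M.minus_eq E.M.a_assoc E.M.l_neg)
  qed
  have l: "low_high 1 0 \<in> (L10 :: (T_index \<Rightarrow> 'k) set)" "low_high 0 1 \<in> (L10 :: (T_index \<Rightarrow> 'k) set)" by auto
  have lin: "act E (dlt 1) (act E z (sect v)) =
      act E (scal (f (low_high 1 0) * v (Low t12) + f (low_high 0 1) * v (High t12))) (i e0)" if v: "v \<in> L10" for v
  proof -
    have d: "dlt_op t12 v = (\<lambda>c. v (Low t12) * low_high 1 0 c + v (High t12) * low_high 0 1 c)"
      by (rule T_ext, rule op_vecs, intro vecs_closed L10_vecs[OF low_high_L10]) simp_all
    have "act E (dlt 1) (act E z (sect v)) = act E z (act E (dlt t12) (sect v))" using v by (simp add: sect deg)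
    also have "act E (dlt t12) (sect v) = act E (dlt t12) (sect (dlt_op t12 v))"
      using v by (simp add: sect_dlt sect E.act_dlt_dlt)
    also have "act E z \<dots> = act E (dlt 1) (act E z (sect (dlt_op t12 v)))" using v by (simp add: sect deg L10_closed)
    also have "sect (dlt_op t12 v) = act E (scal (v (Low t12))) (sect (low_high 1 0)) \<oplus>\<^bsub>E\<^esub>
        act E (scal (v (High t12))) (sect (low_high 0 1))"
      unfolding d using l by (simp add: sect_add sect_scal L10_closed)
    also have "act E (dlt 1) (act E z \<dots>) = act E (scal (v (Low t12))) (act E (scal (f (low_high 1 0))) (i e0)) \<oplus>\<^bsub>E\<^esub>
        act E (scal (v (High t12))) (act E (scal (f (low_high 0 1))) (i e0))"
      using l by (simp add: sect E.act_add_right E.act_scal_commute[where p = z]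
          E.act_scal_commute[where p = "dlt 1"] f)
    also have "\<dots> = act E (scal (f (low_high 1 0) * v (Low t12) + f (low_high 0 1) * v (High t12))) (i e0)"
      by (simp add: scal_hom(3) E.act_add flip: E.act_scal_mult) (simp add: mult.commute)
    finally show ?thesis .
  qed
  show ?thesis by (rule that) (use main lin in simp)
qed

lemma row_realizes:
  obtains \<Phi> a b c d where "realizes \<zeta> E (X_op \<zeta> 0 0 a b) (Y_op \<zeta> 0 0 c d) \<Phi>"
    "\<And>k. \<Phi> (\<lambda>e. k * ket TT e) = i (act L_eps (scal k) e0)"
    "\<And>v. v \<in> vecs T_basis \<Longrightarrow> p (\<Phi> v) = jT (drop_TT v)"
proof -
  obtain a b where x: "\<And>v. v \<in> L10 \<Longrightarrow>
      act E (xx t12) (sect v) = sect (act (T01 \<zeta>) (xx t12) v) \<oplus>\<^bsub>E\<^esub> act E (scal (a * v (Low t12) + b * v (High t12))) (i e0)"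
    by (rule sect_act[of "xx t12"]) (auto simp: E.act_dlt_xx)
  obtain c d where y: "\<And>v. v \<in> L10 \<Longrightarrow>
      act E (yy t12) (sect v) = sect (act (T01 \<zeta>) (yy t12) v) \<oplus>\<^bsub>E\<^esub> act E (scal (c * v (Low t12) + d * v (High t12))) (i e0)"
    by (rule sect_act[of "yy t12"]) (auto simp: E.act_dlt_yy)
  define \<Phi> where "\<Phi> v = sect (drop_TT v) \<oplus>\<^bsub>E\<^esub> act E (scal (v TT)) (i e0)" for v
  have cl: "\<Phi> v \<in> carrier E" if "v \<in> vecs T_basis" for v
    using that by (auto simp: \<Phi>_def sect)
  have p\<Phi>: "p (\<Phi> v) = jT (drop_TT v)" if "v \<in> vecs T_basis" for v
    using that by (simp add: \<Phi>_def p_add sect i_act[symmetric] exD(8) jT)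
  have s0: "sect (\<lambda>e. 0) = \<zero>\<^bsub>E\<^esub>"
    by (rule sect_eqI) (simp_all add: L10_closed jT_zero mod_hom_zero[OF exD(5,2,3)])
  have \<Phi>TT: "\<Phi> (\<lambda>e. k * ket TT e) = i (act L_eps (scal k) e0)" for k
  proof -
    have "drop_TT (\<lambda>e. k * ket TT e) = (\<lambda>e. 0)" by (auto simp: drop_TT_def ket_def)
    then show ?thesis by (simp add: \<Phi>_def s0 i_act)
  qed
  have add: "\<Phi> (\<lambda>c. u c + v c) = \<Phi> u \<oplus>\<^bsub>E\<^esub> \<Phi> v" if uv: "u \<in> vecs T_basis" "v \<in> vecs T_basis" for u v
    using uv by (simp add: \<Phi>_def drop_TT_linear sect_add sect scal_hom E.act_add E.M.add.m_ac)
  have scal: "\<Phi> (\<lambda>c. k * v c) = act E (scal k) (\<Phi> v)" if v: "v \<in> vecs T_basis" for k v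
    using v by (simp add: \<Phi>_def drop_TT_linear sect_scal sect E.act_add_right scal_hom E.act_mult)
  have grp: "\<Phi> (G_op \<zeta> g v) = act E (grp g) (\<Phi> v)" if v: "v \<in> vecs T_basis" for g v
    using v by (simp add: \<Phi>_def drop_TT_G_op sect_grp sect E.act_add_right E.act_scal_commute i_e0_act)
  have dlt: "\<Phi> (dlt_op h v) = act E (dlt h) (\<Phi> v)" if v: "v \<in> vecs T_basis" for h v
    using v by (simp add: \<Phi>_def drop_TT_ops sect_dlt sect E.act_add_right E.act_scal_commute i_e0_act)
  have dx: "drop_TT (X_op \<zeta> 0 0 a b v) = act (T01 \<zeta>) (xx t12) (drop_TT v)" if "v \<in> vecs T_basis" for v
    using that by (simp add: act_T01_generators drop_TT_ops low_high_def)
  have dy: "drop_TT (Y_op \<zeta> 0 0 c d v) = act (T01 \<zeta>) (yy t12) (drop_TT v)" if "v \<in> vecs T_basis" for v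
    using that by (simp add: act_T01_generators drop_TT_ops low_high_def)
  have xo: "\<Phi> (X_op \<zeta> 0 0 a b v) = act E (xx t12) (\<Phi> v)" if v: "v \<in> vecs T_basis" for v
    using v by (simp add: \<Phi>_def dx x sect L10_act E.act_add_right E.act_scal_commute i_e0_act)
  have yo: "\<Phi> (Y_op \<zeta> 0 0 c d v) = act E (yy t12) (\<Phi> v)" if v: "v \<in> vecs T_basis" for v
    using v by (simp add: \<Phi>_def dy y sect L10_act E.act_add_right E.act_scal_commute i_e0_act)
  have inj: "inj_on \<Phi> (vecs T_basis)"
  proof (rule inj_onI)
    fix u v assume uv: "u \<in> vecs T_basis" "v \<in> vecs T_basis" "\<Phi> u = \<Phi> v"
    then have "jT (drop_TT u) = jT (drop_TT v)" using p\<Phi> by metis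
    then have dr: "drop_TT u = drop_TT v" using uv jT(2)[OF drop_TT_L10] by metis
    then have "i (act L_eps (scal (u TT)) e0) = i (act L_eps (scal (v TT)) e0)"
      using uv by (simp add: \<Phi>_def sect i_act)
    then have "act L_eps (scal (u TT)) e0 = act L_eps (scal (v TT)) e0" by (intro exD(6)) auto
    then have tt: "u TT = v TT" by (simp only: L_eps_scal_eq_iff)
    have "drop_TT u b = drop_TT v b" for b using dr by simp
    then show "u = v" using tt by (intro ext) (metis drop_TT_apply(2))
  qed
  have surj: "\<exists>v\<in>vecs T_basis. \<Phi> v = w" if w: "w \<in> carrier E" for w
  proof -
    let ?v = "iT (p w)"
    have v: "?v \<in> L10" "jT ?v = p w" using w by (simp_all add: iT_L10 jT_iT)
    have "p (w \<ominus>\<^bsub>E\<^esub> sect ?v) = \<zero>\<^bsub>L_sigma\<^esub>"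
      using w v mod_hom_diff[OF exD(5,2,3), of w "sect ?v"] by (simp add: sect Ls.M.minus_eq Ls.M.r_neg)
    then obtain k where k: "w \<ominus>\<^bsub>E\<^esub> sect ?v = act E (scal k) (i e0)"
      using kernel_scalar[of "w \<ominus>\<^bsub>E\<^esub> sect ?v"] w v by (auto simp: sect)
    let ?u = "?v(TT := k)"
    have u: "?u \<in> vecs T_basis" "drop_TT ?u = ?v" "?u TT = k"
      using v(1) by (auto simp: L10_def vecs_def drop_TT_def)
    have "\<Phi> ?u = sect ?v \<oplus>\<^bsub>E\<^esub> (w \<ominus>\<^bsub>E\<^esub> sect ?v)" by (simp only: \<Phi>_def u k)
    also have "\<dots> = w" using w sect(1)[OF v(1)] by (simp add: E.M.minus_eq E.M.a_lcomm E.M.r_neg)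
    finally show ?thesis using u by blast
  qed
  have "bij_betw \<Phi> (vecs T_basis) (carrier E)"
    unfolding bij_betw_def using inj cl surj by blast
  then have "realizes \<zeta> E (X_op \<zeta> 0 0 a b) (Y_op \<zeta> 0 0 c d) \<Phi>"
    by (simp add: realizes_def exD(2) add scal grp dlt xo yo)
  from that[OF this \<Phi>TT p\<Phi>] show ?thesis .
qed

end

section \<open>Isomorphism types of the extensions\<close>

definition realizes_col :: "'k::field_char_0 \<Rightarrow> ('k free set, 'v) module \<Rightarrow> 'k \<Rightarrow> 'k \<Rightarrow> 'k \<Rightarrow> bool" where
  "realizes_col \<zeta> M \<alpha> \<beta> \<gamma> \<longleftrightarrow> (\<exists>\<Phi>. realizes \<zeta> M (X_op \<zeta> \<alpha> \<beta> 0 0) (Y_op \<zeta> \<gamma> \<alpha> 0 0) \<Phi>)"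

text \<open>
  The signs are chosen so that the dual of a module with the parameters \<open>\<alpha>\<close>, \<open>\<beta>\<close>, \<open>\<gamma>\<close> in the sense of
  \<open>realizes_col\<close> has the same parameters in the present sense.
\<close>

definition realizes_row :: "'k::field_char_0 \<Rightarrow> ('k free set, 'v) module \<Rightarrow> 'k \<Rightarrow> 'k \<Rightarrow> 'k \<Rightarrow> bool" where
  "realizes_row \<zeta> M \<alpha> \<beta> \<gamma> \<longleftrightarrow> (\<exists>\<Phi>. realizes \<zeta> M (X_op \<zeta> 0 0 (- \<beta>) \<alpha>) (Y_op \<zeta> 0 0 (- \<alpha>) \<gamma>) \<Phi>)"

lemma realizes_row_col_zero: "realizes_row \<zeta> M 0 0 0 \<longleftrightarrow> realizes_col \<zeta> M 0 0 0"
  by (simp add: realizes_row_def realizes_col_def)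

definition kills :: "('k::field free set, 'v) module \<Rightarrow> 'k free \<Rightarrow> bool" where
  "kills M q \<longleftrightarrow> (\<forall>w\<in>carrier M. act M q w = \<zero>\<^bsub>M\<^esub>)"

text \<open>
  Replacing \<open>t\<close> by a multiple rescales the parameters, so they are homogeneous coordinates of the
  isomorphism type.
\<close>

definition scale_TT :: "'k::field \<Rightarrow> (T_index \<Rightarrow> 'k) \<Rightarrow> T_index \<Rightarrow> 'k" where
  "scale_TT k v = v(TT := k * v TT)"

lemma scale_TT_apply [simp]: "scale_TT k v TT = k * v TT" "b \<noteq> TT \<Longrightarrow> scale_TT k v b = v b"
  by (simp_all add: scale_TT_def)

lemma scale_TT_vecs [simp, intro]: "v \<in> vecs T_basis \<Longrightarrow> scale_TT k v \<in> vecs T_basis"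
  by (auto simp: scale_TT_def vecs_def)

lemma scale_TT_inverse: "k \<noteq> 0 \<Longrightarrow> scale_TT k (scale_TT (inverse k) v) = v"
  "k \<noteq> 0 \<Longrightarrow> scale_TT (inverse k) (scale_TT k v) = v"
  by (auto simp: scale_TT_def)

lemma bij_scale_TT: "k \<noteq> 0 \<Longrightarrow> bij_betw (scale_TT k) (vecs T_basis) (vecs T_basis)"
  by (rule bij_betw_byWitness[where f' = "scale_TT (inverse k)"]) (auto simp: scale_TT_inverse)

lemma (in primitive_cube_root) realizes_scale_TT:
  assumes r: "realizes \<zeta> M (X_op \<zeta> a b a' b') (Y_op \<zeta> c d c' d') \<Phi>" and k: "k \<noteq> 0"
  shows "realizes \<zeta> M (X_op \<zeta> (k * a) (k * b) (a' / k) (b' / k)) (Y_op \<zeta> (k * c) (k * d) (c' / k) (d' / k)) (\<Phi> \<circ> scale_TT k)"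
proof -
  interpret realized M \<zeta> "X_op \<zeta> a b a' b'" "Y_op \<zeta> c d c' d'" \<Phi>
    by (rule realizedI) (use r cube nontrivial in auto)
  have lin: "scale_TT k (\<lambda>c. u c + v c) = (\<lambda>c. scale_TT k u c + scale_TT k v c)"
    "scale_TT k (\<lambda>c. m * v c) = (\<lambda>c. m * scale_TT k v c)" for u v m
    by (auto simp: scale_TT_def algebra_simps)
  have ops: "scale_TT k (G_op \<zeta> g v) = G_op \<zeta> g (scale_TT k v)" "scale_TT k (dlt_op h v) = dlt_op h (scale_TT k v)"
    "scale_TT k (X_op \<zeta> (k * a) (k * b) (a' / k) (b' / k) v) = X_op \<zeta> a b a' b' (scale_TT k v)"
    "scale_TT k (Y_op \<zeta> (k * c) (k * d) (c' / k) (d' / k) v) = Y_op \<zeta> c d c' d' (scale_TT k v)" for v g h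
    using k by (intro T_ext scale_TT_vecs G_op_vecs op_vecs; simp add: field_simps)+
  show ?thesis
    unfolding realizes_def
    using bij_betw_trans[OF bij_scale_TT[OF k] bij_Phi] left_module_axioms
    by (simp add: lin ops Phi_add Phi_act)
qed

lemma (in primitive_cube_root) realizes_col_scale:
  assumes "realizes_col \<zeta> M \<alpha> \<beta> \<gamma>" "k \<noteq> 0"
  shows "realizes_col \<zeta> M (k * \<alpha>) (k * \<beta>) (k * \<gamma>)"
  using assms realizes_scale_TT[of M \<alpha> \<beta> 0 0 \<gamma> \<alpha> 0 0 _ k] unfolding realizes_col_def by auto

lemma (in primitive_cube_root) realizes_row_scale:
  assumes "realizes_row \<zeta> M \<alpha> \<beta> \<gamma>" "k \<noteq> 0"
  shows "realizes_row \<zeta> M (k * \<alpha>) (k * \<beta>) (k * \<gamma>)"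
  using assms realizes_scale_TT[of M 0 0 "- \<beta>" \<alpha> 0 0 "- \<alpha>" \<gamma> _ "inverse k"]
  unfolding realizes_row_def by (auto simp: divide_inverse mult.commute)

text \<open>
  Starting from \<open>t\<close>, the second factor reads off one of \<open>c\<^sub>1\<close>, \<open>c\<^sub>8\<close> from the image under the first:
  \<open>y\<^sub>1\<^sub>3\<close> kills \<open>c\<^sub>8\<close> and \<open>x\<^sub>1\<^sub>3\<close> kills \<open>c\<^sub>1\<close>.  So the vanishing of each parameter is a property of the
  module.
\<close>

lemma (in primitive_cube_root) realizes_col_pattern:
  assumes "realizes_col \<zeta> M \<alpha> \<beta> \<gamma>"
  shows "kills M (yy t13 * xx t12 * dlt 1) \<longleftrightarrow> \<alpha> = 0" "kills M (xx t13 * xx t12 * dlt 1) \<longleftrightarrow> \<beta> = 0"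
    "kills M (yy t13 * yy t12 * dlt 1) \<longleftrightarrow> \<gamma> = 0"
proof -
  obtain \<Phi> where r: "realizes \<zeta> M (X_op \<zeta> \<alpha> \<beta> 0 0) (Y_op \<zeta> \<gamma> \<alpha> 0 0) \<Phi>" using assms unfolding realizes_col_def by auto
  interpret realized M \<zeta> "X_op \<zeta> \<alpha> \<beta> 0 0" "Y_op \<zeta> \<gamma> \<alpha> 0 0" \<Phi>
    by (rule realizedI) (use r cube nontrivial in auto)
  have *: "kills M q \<longleftrightarrow> k = 0"
    if act: "\<And>v. v \<in> vecs T_basis \<Longrightarrow> act M q (\<Phi> v) = \<Phi> (f v)" and fv: "\<And>v. f v \<in> vecs T_basis"
      and z: "k = 0 \<Longrightarrow> \<forall>v. f v = (\<lambda>c. 0)" and n: "f (ket TT) (Tau1 c123) = l * k" "l \<noteq> 0" for q f k l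
  proof
    assume "kills M q"
    then have "act M q (\<Phi> (ket TT)) = \<zero>\<^bsub>M\<^esub>" unfolding kills_def by simp
    then have "f (ket TT) = (\<lambda>c. 0)" using act[of "ket TT"] Phi_eq_zero_iff[OF fv, of "ket TT"] by simp
    then show "k = 0" using n by simp
  next
    assume "k = 0"
    then show "kills M q" unfolding kills_def using z act Phi_zero by (auto dest!: Phi_surj)
  qed
  have n: "(- 1 + \<zeta>) / 3 \<noteq> 0" "(- 2 - \<zeta>) / 3 \<noteq> 0"
    using zeta_not by (auto simp: algebra_simps)
  show "kills M (yy t13 * xx t12 * dlt 1) \<longleftrightarrow> \<alpha> = 0"
    by (rule *[where f = "\<lambda>v. conj_op \<zeta> (Y_op \<zeta> \<gamma> \<alpha> 0 0) t13 (X_op \<zeta> \<alpha> \<beta> 0 0 (dlt_op 1 v))", OF _ _ _ _ n(1)])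
      (auto simp: act_mult Phi_act Phi_conj conj_op_t12 intro!: T_ext)
  show "kills M (xx t13 * xx t12 * dlt 1) \<longleftrightarrow> \<beta> = 0"
    by (rule *[where f = "\<lambda>v. conj_op \<zeta> (X_op \<zeta> \<alpha> \<beta> 0 0) t13 (X_op \<zeta> \<alpha> \<beta> 0 0 (dlt_op 1 v))", OF _ _ _ _ n(2)])
      (auto simp: act_mult Phi_act Phi_conj conj_op_t12 intro!: T_ext)
  show "kills M (yy t13 * yy t12 * dlt 1) \<longleftrightarrow> \<gamma> = 0"
    by (rule *[where f = "\<lambda>v. conj_op \<zeta> (Y_op \<zeta> \<gamma> \<alpha> 0 0) t13 (Y_op \<zeta> \<gamma> \<alpha> 0 0 (dlt_op 1 v))", OF _ _ _ _ n(1)])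
      (auto simp: act_mult Phi_act Phi_conj conj_op_t12 intro!: T_ext)
qed

text \<open>
  As for \<open>realizes_col_pattern\<close>, with the products in the opposite order.  The vector \<open>c\<^sub>4\<close> serves as a
  witness, since \<open>y\<^sub>1\<^sub>3\<close> maps it to a multiple of \<open>c\<^sub>8\<close> and \<open>x\<^sub>1\<^sub>3\<close> to a multiple of \<open>c\<^sub>1\<close>.
\<close>

lemma (in primitive_cube_root) realizes_row_pattern:
  assumes "realizes_row \<zeta> M \<alpha> \<beta> \<gamma>"
  shows "kills M (dlt 1 * xx t12 * yy t13) \<longleftrightarrow> \<alpha> = 0" "kills M (dlt 1 * xx t12 * xx t13) \<longleftrightarrow> \<beta> = 0"
    "kills M (dlt 1 * yy t12 * yy t13) \<longleftrightarrow> \<gamma> = 0"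
proof -
  obtain \<Phi> where r: "realizes \<zeta> M (X_op \<zeta> 0 0 (- \<beta>) \<alpha>) (Y_op \<zeta> 0 0 (- \<alpha>) \<gamma>) \<Phi>"
    using assms unfolding realizes_row_def by auto
  interpret realized M \<zeta> "X_op \<zeta> 0 0 (- \<beta>) \<alpha>" "Y_op \<zeta> 0 0 (- \<alpha>) \<gamma>" \<Phi>
    by (rule realizedI) (use r cube nontrivial in auto)
  have *: "kills M q \<longleftrightarrow> k = 0"
    if act: "\<And>v. v \<in> vecs T_basis \<Longrightarrow> act M q (\<Phi> v) = \<Phi> (f v)" and fv: "\<And>v. f v \<in> vecs T_basis"
      and z: "k = 0 \<Longrightarrow> \<forall>v. f v = (\<lambda>c. 0)" and n: "f (ket (Tau1 c123)) TT = l * k" "l \<noteq> 0" for q f k l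
  proof
    assume "kills M q"
    then have "act M q (\<Phi> (ket (Tau1 c123))) = \<zero>\<^bsub>M\<^esub>" unfolding kills_def by simp
    then have "f (ket (Tau1 c123)) = (\<lambda>c. 0)"
      using act[of "ket (Tau1 c123)"] Phi_eq_zero_iff[OF fv, of "ket (Tau1 c123)"] by simp
    then show "k = 0" using n by simp
  next
    assume "k = 0"
    then show "kills M q" unfolding kills_def using z act Phi_zero by (auto dest!: Phi_surj)
  qed
  have n: "\<zeta> \<noteq> 0" "1 + \<zeta> \<noteq> 0" using zeta_not by auto
  show "kills M (dlt 1 * xx t12 * yy t13) \<longleftrightarrow> \<alpha> = 0"
    by (rule *[where f = "\<lambda>v. dlt_op 1 (X_op \<zeta> 0 0 (- \<beta>) \<alpha> (conj_op \<zeta> (Y_op \<zeta> 0 0 (- \<alpha>) \<gamma>) t13 v))", OF _ _ _ _ n(1)])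
      (auto simp: act_mult Phi_act Phi_conj conj_op_t12 intro!: T_ext)
  show "kills M (dlt 1 * xx t12 * xx t13) \<longleftrightarrow> \<beta> = 0"
    by (rule *[where f = "\<lambda>v. dlt_op 1 (X_op \<zeta> 0 0 (- \<beta>) \<alpha> (conj_op \<zeta> (X_op \<zeta> 0 0 (- \<beta>) \<alpha>) t13 v))", OF _ _ _ _ n(2)])
      (auto simp: act_mult Phi_act Phi_conj conj_op_t12 algebra_simps intro!: T_ext)
  show "kills M (dlt 1 * yy t12 * yy t13) \<longleftrightarrow> \<gamma> = 0"
    by (rule *[where f = "\<lambda>v. dlt_op 1 (Y_op \<zeta> 0 0 (- \<alpha>) \<gamma> (conj_op \<zeta> (Y_op \<zeta> 0 0 (- \<alpha>) \<gamma>) t13 v))", OF _ _ _ _ n(1)])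
      (auto simp: act_mult Phi_act Phi_conj conj_op_t12 intro!: T_ext)
qed

lemma (in primitive_cube_root) realizes_col_mod_iso:
  assumes X: "realizes_col \<zeta> N \<alpha> \<beta> \<gamma>" and M: "left_module DD M"
  shows "mod_iso DD M N \<longleftrightarrow> realizes_col \<zeta> M \<alpha> \<beta> \<gamma>"
proof
  assume "mod_iso DD M N"
  then have "mod_iso DD N M" using M by (rule mod_iso_sym)
  then show "realizes_col \<zeta> M \<alpha> \<beta> \<gamma>"
    using X M cube nontrivial unfolding realizes_col_def by (elim exE, intro realizes_mod_iso) auto
next
  assume "realizes_col \<zeta> M \<alpha> \<beta> \<gamma>"
  then show "mod_iso DD M N"
    using X cube nontrivial unfolding realizes_col_def by (elim exE, intro realizes_iso) auto
qed

lemma (in primitive_cube_root) realizes_row_mod_iso: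
  assumes X: "realizes_row \<zeta> N \<alpha> \<beta> \<gamma>" and M: "left_module DD M"
  shows "mod_iso DD M N \<longleftrightarrow> realizes_row \<zeta> M \<alpha> \<beta> \<gamma>"
proof
  assume "mod_iso DD M N"
  then have "mod_iso DD N M" using M by (rule mod_iso_sym)
  then show "realizes_row \<zeta> M \<alpha> \<beta> \<gamma>"
    using X M cube nontrivial unfolding realizes_row_def by (elim exE, intro realizes_mod_iso) auto
next
  assume "realizes_row \<zeta> M \<alpha> \<beta> \<gamma>"
  then show "mod_iso DD M N"
    using X cube nontrivial unfolding realizes_row_def by (elim exE, intro realizes_iso) auto
qed

context extension_T
begin

lemma eps_by_sigmaI: "short_exact DD L_sigma (i, E, p) L_eps \<Longrightarrow> eps_by_sigma \<zeta> iT pT i E p"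
  by (intro eps_by_sigma.intro extension_T_axioms eps_by_sigma_axioms.intro)

lemma has_params_col:
  assumes "short_exact DD L_sigma (i, E, p) L_eps" "has_params i E p a b c d"
  shows "realizes_col \<zeta> E a b c" "d = a"
proof -
  interpret X: eps_by_sigma \<zeta> iT pT i E p by (rule eps_by_sigmaI) fact
  obtain \<Phi> where r: "realizes \<zeta> E (X_op \<zeta> a b 0 0) (Y_op \<zeta> c d 0 0) \<Phi>" by (rule X.has_params_realizes[OF assms(2)])
  then show "d = a" using column_cross_relation[OF r cube nontrivial] by simp
  then show "realizes_col \<zeta> E a b c" using r unfolding realizes_col_def by auto
qed

lemma scale_ext_params:
  assumes se: "short_exact DD L_sigma (i, E, p) L_eps" and inv: "has_params i E p a b c d"
  obtains i' E' p' where "scale_ext L_sigma (cls (scal k)) (i, E, p) = (i', E', p')"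
    "short_exact DD L_sigma (i', E', p') L_eps" "has_params i' E' p' (k * a) (k * b) (k * c) (k * d)"
proof -
  obtain i' E' p' h where h: "scale_ext L_sigma (cls (scal k)) (i, E, p) = (i', E', p')"
    "short_exact DD L_sigma (i', E', p') L_eps" "h \<in> mod_hom DD E E'"
    "\<And>x. x \<in> carrier E \<Longrightarrow> p' (h x) = p x" "\<And>u. u \<in> carrier L_sigma \<Longrightarrow> h (i u) = i' (cls (scal k) \<odot>\<^bsub>L_sigma\<^esub> u)"
    using scale_ext_exact[OF se cls_in_DD cls_scal_central] by metis
  have hi: "h (i (jT (low_high a b))) = i' (jT (low_high (k * a) (k * b)))" for a b
    using h(5)[of "jT (low_high a b)"] jT(1)[OF low_high_L10] jT_scal[of "low_high a b" k]
    by (simp add: act_def low_high_simps)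
  obtain t where t: "t \<in> carrier E" "p t = e0" "act E (dlt 1) t = t"
    "act E (xx t12) t = i (jT (low_high a b))" "act E (yy t12) t = i (jT (low_high c d))"
    using inv unfolding has_params_def by blast
  have "has_params i' E' p' (k * a) (k * b) (k * c) (k * d)"
    unfolding has_params_def
    by (rule bexI[of _ "h t"]) (simp_all add: t h(4) hi mod_hom_act[OF h(3), symmetric] mod_homD(1)[OF h(3)])
  then show ?thesis using that h by blast
qed

lemma baer_sum_params:
  assumes se: "short_exact DD L_sigma (i, E, p) L_eps" and inv: "has_params i E p a b c d"
    and se': "short_exact DD L_sigma (i', E', p') L_eps" and inv': "has_params i' E' p' a' b' c' d'"
  obtains j F q where "baer_sum L_sigma (i, E, p) (i', E', p') = (j, F, q)"
    "short_exact DD L_sigma (j, F, q) L_eps" "has_params j F q (a + a') (b + b') (c + c') (d + d')"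
proof -
  obtain j F q h where h: "baer_sum L_sigma (i, E, p) (i', E', p') = (j, F, q)" "short_exact DD L_sigma (j, F, q) L_eps"
    "\<And>x y. \<lbrakk>x \<in> carrier E; y \<in> carrier E'; p x = p' y\<rbrakk> \<Longrightarrow> h (x, y) \<in> carrier F \<and> q (h (x, y)) = p x"
    "\<And>r x y. \<lbrakk>r \<in> carrier DD; x \<in> carrier E; y \<in> carrier E'; p x = p' y\<rbrakk> \<Longrightarrow>
        r \<odot>\<^bsub>F\<^esub> h (x, y) = h (r \<odot>\<^bsub>E\<^esub> x, r \<odot>\<^bsub>E'\<^esub> y)"
    "\<And>a b. \<lbrakk>a \<in> carrier L_sigma; b \<in> carrier L_sigma\<rbrakk> \<Longrightarrow> h (i a, i' b) = j (a \<oplus>\<^bsub>L_sigma\<^esub> b)"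
    by (rule baer_sum_exact[OF se se'], rule that)
  obtain t where t: "t \<in> carrier E" "p t = e0" "act E (dlt 1) t = t"
    "act E (xx t12) t = i (jT (low_high a b))" "act E (yy t12) t = i (jT (low_high c d))"
    using inv unfolding has_params_def by blast
  obtain t' where t': "t' \<in> carrier E'" "p' t' = e0" "act E' (dlt 1) t' = t'"
    "act E' (xx t12) t' = i' (jT (low_high a' b'))" "act E' (yy t12) t' = i' (jT (low_high c' d'))"
    using inv' unfolding has_params_def by blast
  have ha: "act F r (h (t, t')) = h (act E r t, act E' r t')" for r
    unfolding act_def using h(4)[OF cls_in_DD t(1) t'(1)] t(2) t'(2) by simp
  have hj: "h (i (jT (low_high a b)), i' (jT (low_high a' b'))) = j (jT (low_high (a + a') (b + b')))" for a b a' b'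
    using h(5)[OF jT(1)[OF low_high_L10] jT(1)[OF low_high_L10], of a b a' b']
      jT_add[of "low_high a b" "low_high a' b'"] by (simp add: low_high_simps)
  have "has_params j F q (a + a') (b + b') (c + c') (d + d')"
    unfolding has_params_def
  proof (rule bexI[of _ "h (t, t')"], intro conjI)
    have "h (t, t') \<in> carrier F \<and> q (h (t, t')) = p t" by (rule h(3)[OF t(1) t'(1)]) (simp add: t(2) t'(2))
    then show "h (t, t') \<in> carrier F" "q (h (t, t')) = e0" by (simp_all add: t(2))
  qed (simp_all only: ha t(3-5) t'(3-5) hj)
  then show ?thesis using that h by blast
qed

lemma T01_params: "has_params iT (T01 \<zeta>) pT 1 0 0 1"
  unfolding has_params_def
proof (rule bexI[of _ "ket TT"], intro conjI)
  show "act (T01 \<zeta>) (xx t12) (ket TT) = iT (jT (low_high 1 0))" "act (T01 \<zeta>) (yy t12) (ket TT) = iT (jT (low_high 0 1))"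
    "act (T01 \<zeta>) (dlt 1) (ket TT) = ket TT"
    by (simp_all add: act_T01_generators jT) (rule T_ext; simp add: L10_vecs)+
qed (simp_all add: e0_def)

text \<open>
  A generator of group degree \<open>1\<close> is a nonzero multiple of \<open>t\<close>, so an operator killing it kills \<open>t\<close>.  If all
  parameters vanished, then \<open>t\<close> would span a submodule.
\<close>

lemma cyclic_col:
  assumes r: "realizes_col \<zeta> E \<alpha> \<beta> \<gamma>" and q: "q \<in> carrier E" "act E (dlt 1) q = q"
    and gen: "\<forall>P. \<zero>\<^bsub>E\<^esub> \<in> P \<and> (\<forall>u\<in>P. \<forall>v\<in>P. u \<oplus>\<^bsub>E\<^esub> v \<in> P) \<and> (\<forall>p. act E p q \<in> P) \<longrightarrow> carrier E \<subseteq> P"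
  shows "act E (xx t12) q = \<zero>\<^bsub>E\<^esub> \<Longrightarrow> \<alpha> = 0 \<and> \<beta> = 0" "act E (yy t12) q = \<zero>\<^bsub>E\<^esub> \<Longrightarrow> \<alpha> = 0 \<and> \<gamma> = 0"
    "\<alpha> \<noteq> 0 \<or> \<beta> \<noteq> 0 \<or> \<gamma> \<noteq> 0"
proof -
  have cyclic: "u \<in> P" if "u \<in> carrier E" "\<zero>\<^bsub>E\<^esub> \<in> P" "\<And>u v. \<lbrakk>u \<in> P; v \<in> P\<rbrakk> \<Longrightarrow> u \<oplus>\<^bsub>E\<^esub> v \<in> P"
    "\<And>p. act E p q \<in> P" for u P
    using gen[rule_format, of P] that by blast
  obtain \<Phi> where r: "realizes \<zeta> E (X_op \<zeta> \<alpha> \<beta> 0 0) (Y_op \<zeta> \<gamma> \<alpha> 0 0) \<Phi>" using r unfolding realizes_col_def by auto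
  interpret realized E \<zeta> "X_op \<zeta> \<alpha> \<beta> 0 0" "Y_op \<zeta> \<gamma> \<alpha> 0 0" \<Phi>
    by (rule realizedI) (use r cube nontrivial in auto)
  obtain v where v: "v \<in> vecs T_basis" "q = \<Phi> v" using Phi_surj[OF q(1)] by blast
  have "dlt_op 1 v = v" using q v by (intro Phi_inj) (auto simp: Phi_act)
  moreover have "dlt_op 1 v = (\<lambda>c. v TT * ket TT c)" by (intro T_ext op_vecs vecs_closed) simp_all
  ultimately have q': "q = \<Phi> (\<lambda>c. v TT * ket TT c)" using v by simp
  have k: "v TT \<noteq> 0"
  proof
    assume "v TT = 0"
    then have "q = \<zero>\<^bsub>E\<^esub>" using q' Phi_zero by simp
    then have "\<Phi> (ket TT) \<in> {\<zero>\<^bsub>E\<^esub>}" by (rule_tac cyclic) simp_all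
    then have "ket TT = (\<lambda>c. 0 :: 'k)" by (simp add: Phi_eq_zero_iff)
    from fun_cong[OF this, of TT] show False by simp
  qed
  have kv: "(\<lambda>c. v TT * ket TT c) \<in> vecs T_basis" by (intro vecs_closed) simp
  show "\<alpha> = 0 \<and> \<beta> = 0" if "act E (xx t12) q = \<zero>\<^bsub>E\<^esub>"
  proof -
    have "X_op \<zeta> \<alpha> \<beta> 0 0 (\<lambda>c. v TT * ket TT c) = (\<lambda>c. 0)"
      using that Phi_act(4)[OF kv] by (simp add: q' Phi_eq_zero_iff)
    from fun_cong[OF this, of "Low t12"] fun_cong[OF this, of "High t12"] k show ?thesis by simp
  qed
  show "\<alpha> = 0 \<and> \<gamma> = 0" if "act E (yy t12) q = \<zero>\<^bsub>E\<^esub>"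
  proof -
    have "Y_op \<zeta> \<gamma> \<alpha> 0 0 (\<lambda>c. v TT * ket TT c) = (\<lambda>c. 0)"
      using that Phi_act(5)[OF kv] by (simp add: q' Phi_eq_zero_iff)
    from fun_cong[OF this, of "Low t12"] fun_cong[OF this, of "High t12"] k show ?thesis by simp
  qed
  show "\<alpha> \<noteq> 0 \<or> \<beta> \<noteq> 0 \<or> \<gamma> \<noteq> 0"
  proof (rule ccontr)
    assume "\<not> ?thesis"
    then have z: "\<alpha> = 0" "\<beta> = 0" "\<gamma> = 0" by auto
    \<comment> \<open>The line through \<open>t\<close> would be a submodule and contain \<open>c\<^sub>8\<close>.\<close>
    let ?P = "range (\<lambda>m. \<Phi> (\<lambda>c. m * ket TT c))"
    have mv: "(\<lambda>c. m * ket TT c) \<in> vecs T_basis" for m :: 'k by (intro vecs_closed) simp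
    have ops: "G_op \<zeta> g (\<lambda>c. m * ket TT c) = (\<lambda>c. m * ket TT c)"
      "dlt_op h (\<lambda>c. m * ket TT c) = (\<lambda>c. (if h = 1 then m else 0) * ket TT c)"
      "X_op \<zeta> 0 0 0 0 (\<lambda>c. m * ket TT c) = (\<lambda>c. 0 * ket TT c)"
      "Y_op \<zeta> 0 0 0 0 (\<lambda>c. m * ket TT c) = (\<lambda>c. 0 * ket TT c)" for g h m
      by (intro T_ext G_op_vecs op_vecs mv; simp)+
    have add: "u \<oplus>\<^bsub>E\<^esub> v \<in> ?P" if "u \<in> ?P" "v \<in> ?P" for u v
      using that by (auto simp: Phi_add mv simp flip: distrib_right)
    have zP: "\<Phi> (\<lambda>c. 0) \<in> ?P" by (intro range_eqI[of _ _ 0]) simp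
    have "act E p q \<in> ?P" for p
    proof (rule act_preserves[OF _ _ add])
      show "act E (scal c) u \<in> ?P" if "u \<in> ?P" for c u
        using that by (auto simp: Phi_act mv simp flip: mult.assoc)
      show "act E (grp g) u \<in> ?P" "act E (dlt g) u \<in> ?P" if "u \<in> ?P" for g u
        using that by (auto simp: Phi_act mv ops)
      show "act E (xx t12) u \<in> ?P" "act E (yy t12) u \<in> ?P" if "u \<in> ?P" for u
        using that zP by (auto simp: Phi_act mv ops[unfolded z] z)
    qed (use mv q' in auto)
    moreover have "\<zero>\<^bsub>E\<^esub> \<in> ?P" using Phi_zero by (intro range_eqI[of _ _ 0]) simp
    ultimately have "\<Phi> (ket (High t12)) \<in> ?P" using add by (rule_tac cyclic) simp_all
    then obtain m where "\<Phi> (ket (High t12)) = \<Phi> (\<lambda>c. m * ket TT c)" by auto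
    then have "ket (High t12) = (\<lambda>c. m * ket TT c)" by (intro Phi_inj mv) auto
    from fun_cong[OF this, of "High t12"] show False by simp
  qed
qed

text \<open>
  The image of the highest weight vector generates the quotient and is killed by \<open>y\<^sub>1\<^sub>2\<close>.
\<close>

lemma verma_params:
  assumes M: "short_exact DD L_sigma (i, quot_module M_eps (socle DD M_eps), p) L_eps"
  shows "\<exists>m. m \<noteq> 0 \<and> has_params i (quot_module M_eps (socle DD M_eps)) p 0 m 0 0"
proof -
  interpret X: eps_by_sigma \<zeta> iT pT i "quot_module M_eps (socle DD M_eps)" p by (rule eps_by_sigmaI) fact
  interpret V: induced_quotient gens_ge0 "{1}" "eps_rep :: gen \<Rightarrow> S3 \<Rightarrow> S3 \<Rightarrow> 'k" "socle DD M_eps"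
    by (rule induced_quotient.intro) (auto simp: submodule_socle left_module_induced intro: eps_rep_stable)
  have g: "act V.quo (dlt 1) (V.gene 1) = act V.quo (scal 1) (V.gene 1)"
    "act V.quo (yy t12) (V.gene 1) = act V.quo (scal 0) (V.gene 1)"
    by (rule V.act_gene; auto simp: gens_ge0_def eps_rep_def)+
  obtain a b c d where inv: "has_params i V.quo p a b c d" using X.has_params_exists by blast
  note rc = has_params_col[OF M inv]
  have cyc: "\<forall>P. \<zero>\<^bsub>V.quo\<^esub> \<in> P \<and> (\<forall>u\<in>P. \<forall>v\<in>P. u \<oplus>\<^bsub>V.quo\<^esub> v \<in> P) \<and> (\<forall>p. act V.quo p (V.gene 1) \<in> P)
      \<longrightarrow> carrier V.quo \<subseteq> P"
  proof (intro allI impI subsetI, elim conjE)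
    fix P u
    assume "u \<in> carrier V.quo" "\<zero>\<^bsub>V.quo\<^esub> \<in> P" "\<forall>u\<in>P. \<forall>v\<in>P. u \<oplus>\<^bsub>V.quo\<^esub> v \<in> P" "\<forall>p. act V.quo p (V.gene 1) \<in> P"
    then show "u \<in> P" by (intro V.quo_span[of u P]) auto
  qed
  note cc = cyclic_col[OF rc(1) V.gene_carrier[OF singletonI] _ cyc]
  have d1: "act V.quo (dlt 1) (V.gene 1) = V.gene 1" and z: "act V.quo (yy t12) (V.gene 1) = \<zero>\<^bsub>V.quo\<^esub>"
    by (simp_all only: g X.E.act_scal_one X.E.act_scal_zero V.gene_carrier[OF singletonI])
  have ac: "a = 0" "c = 0" using cc(2)[OF d1 z] by simp_all
  moreover from this have "b \<noteq> 0" using cc(3)[OF d1] by simp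
  moreover have "has_params i V.quo p 0 b 0 0" using inv unfolding rc(2) ac .
  ultimately show ?thesis by blast
qed

text \<open>
  The image of the lowest weight vector generates the quotient and is killed by \<open>x\<^sub>1\<^sub>2\<close>.
\<close>

lemma coverma_params:
  assumes W: "short_exact DD L_sigma (i, quot_module W_eps (socle DD W_eps), p) L_eps"
  shows "\<exists>m. m \<noteq> 0 \<and> has_params i (quot_module W_eps (socle DD W_eps)) p 0 0 m 0"
proof -
  interpret X: eps_by_sigma \<zeta> iT pT i "quot_module W_eps (socle DD W_eps)" p by (rule eps_by_sigmaI) fact
  interpret V: induced_quotient gens_le0 "{1}" "eps_rep :: gen \<Rightarrow> S3 \<Rightarrow> S3 \<Rightarrow> 'k" "socle DD W_eps"
    by (rule induced_quotient.intro) (auto simp: submodule_socle left_module_induced intro: eps_rep_stable)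
  have g: "act V.quo (dlt 1) (V.gene 1) = act V.quo (scal 1) (V.gene 1)"
    "act V.quo (xx t12) (V.gene 1) = act V.quo (scal 0) (V.gene 1)"
    by (rule V.act_gene; auto simp: gens_le0_def eps_rep_def)+
  obtain a b c d where inv: "has_params i V.quo p a b c d" using X.has_params_exists by blast
  note rc = has_params_col[OF W inv]
  have cyc: "\<forall>P. \<zero>\<^bsub>V.quo\<^esub> \<in> P \<and> (\<forall>u\<in>P. \<forall>v\<in>P. u \<oplus>\<^bsub>V.quo\<^esub> v \<in> P) \<and> (\<forall>p. act V.quo p (V.gene 1) \<in> P)
      \<longrightarrow> carrier V.quo \<subseteq> P"
  proof (intro allI impI subsetI, elim conjE)
    fix P u
    assume "u \<in> carrier V.quo" "\<zero>\<^bsub>V.quo\<^esub> \<in> P" "\<forall>u\<in>P. \<forall>v\<in>P. u \<oplus>\<^bsub>V.quo\<^esub> v \<in> P" "\<forall>p. act V.quo p (V.gene 1) \<in> P"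
    then show "u \<in> P" by (intro V.quo_span[of u P]) auto
  qed
  note cc = cyclic_col[OF rc(1) V.gene_carrier[OF singletonI] _ cyc]
  have d1: "act V.quo (dlt 1) (V.gene 1) = V.gene 1" and z: "act V.quo (xx t12) (V.gene 1) = \<zero>\<^bsub>V.quo\<^esub>"
    by (simp_all only: g X.E.act_scal_one X.E.act_scal_zero V.gene_carrier[OF singletonI])
  have ab: "a = 0" "b = 0" using cc(1)[OF d1 z] by simp_all
  moreover from this have "c \<noteq> 0" using cc(3)[OF d1] by simp
  moreover have "has_params i V.quo p 0 0 c 0" using inv unfolding rc(2) ab .
  ultimately show ?thesis by blast
qed

lemma direct_sum_col: "realizes_col \<zeta> (dsum_module (L_sigma :: ('k free set, _) module) (L_eps :: ('k free set, _) module)) 0 0 0"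
proof -
  let ?S = "dsum_module (L_sigma :: ('k free set, _) module) (L_eps :: ('k free set, _) module)"
  have "short_exact DD L_sigma (\<lambda>u. (u, \<zero>\<^bsub>L_eps\<^esub>), ?S, snd) L_eps"
    by (rule short_exactI)
      (auto simp: mod_hom_def T_exactD(1,3) left_module_dsum Le.smult_zero_right)
  moreover have "has_params (\<lambda>u. (u, \<zero>\<^bsub>L_eps\<^esub>)) ?S snd 0 0 0 0"
    unfolding has_params_def
  proof (rule bexI[of _ "(\<zero>\<^bsub>L_sigma\<^esub>, e0)"], intro conjI)
    have a: "act ?S q (u, v) = (act L_sigma q u, act L_eps q v)" for q u v by (simp add: act_def)
    have l: "low_high 0 0 = (\<lambda>c. 0 :: 'k)" by (simp add: low_high_def)
    show "act ?S (dlt 1) (\<zero>\<^bsub>L_sigma\<^esub>, e0) = (\<zero>\<^bsub>L_sigma\<^esub>, e0)"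
      "act ?S (xx t12) (\<zero>\<^bsub>L_sigma\<^esub>, e0) = (jT (low_high 0 0), \<zero>\<^bsub>L_eps\<^esub>)"
      "act ?S (yy t12) (\<zero>\<^bsub>L_sigma\<^esub>, e0) = (jT (low_high 0 0), \<zero>\<^bsub>L_eps\<^esub>)"
      by (simp_all add: a e0_act l jT_zero)
  qed simp_all
  ultimately show ?thesis by (rule has_params_col(1))
qed

end

section \<open>Gradings\<close>

lemma finsum_additive:
  assumes "left_module R M" "finite A" "\<And>n. n \<in> A \<Longrightarrow> f n \<in> carrier M"
    and F: "F \<zero>\<^bsub>M\<^esub> = (0 :: 'c::comm_monoid_add)"
      "\<And>u v. \<lbrakk>u \<in> carrier M; v \<in> carrier M\<rbrakk> \<Longrightarrow> F (u \<oplus>\<^bsub>M\<^esub> v) = F u + F v"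
  shows "F (finsum M f A) = (\<Sum>n\<in>A. F (f n))"
proof -
  interpret left_module R M by fact
  from assms(2,3) show ?thesis
  proof (induct A)
    case (insert a A)
    then have fA: "f \<in> A \<rightarrow> carrier M" "f a \<in> carrier M" by auto
    then have "finsum M f (insert a A) = f a \<oplus>\<^bsub>M\<^esub> finsum M f A" using insert(1,2) by simp
    then show ?case using insert fA by (simp add: F)
  qed (simp add: F)
qed

lemma graded_moduleD:
  assumes "graded_module M Mg"
  shows "Mg n \<subseteq> carrier M" "\<zero>\<^bsub>M\<^esub> \<in> Mg n"
    "\<lbrakk>d \<in> DD_deg m; v \<in> Mg n\<rbrakk> \<Longrightarrow> d \<odot>\<^bsub>M\<^esub> v \<in> Mg (m + n)"
proof -
  have sg: "subgroup (Mg n) (add_monoid M)" for n using assms by (auto simp: graded_module_def)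
  show "Mg n \<subseteq> carrier M" "\<zero>\<^bsub>M\<^esub> \<in> Mg n" using subgroup.subset[OF sg] subgroup.one_closed[OF sg] by auto
  show "\<lbrakk>d \<in> DD_deg m; v \<in> Mg n\<rbrakk> \<Longrightarrow> d \<odot>\<^bsub>M\<^esub> v \<in> Mg (m + n)" using assms by (auto simp: graded_module_def)
qed

lemma graded_decomposition:
  assumes "graded_module M Mg" "v \<in> carrier M"
  obtains f where "\<And>n. f n \<in> Mg n" "finite {n. f n \<noteq> \<zero>\<^bsub>M\<^esub>}" "v = finsum M f {n. f n \<noteq> \<zero>\<^bsub>M\<^esub>}"
  using assms unfolding graded_module_def by blast

text \<open>
  The sum would have two different decompositions into homogeneous components: into \<open>u\<close> and \<open>v\<close>, and into a
  single component of degree \<open>q\<close>.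
\<close>

lemma graded_homogeneous_sum:
  assumes g: "graded_module M Mg" and u: "u \<in> Mg m" and v: "v \<in> Mg n" and mn: "m \<noteq> n"
    and w: "u \<oplus>\<^bsub>M\<^esub> v \<in> Mg q"
  shows "u \<noteq> \<zero>\<^bsub>M\<^esub> \<Longrightarrow> q = m" "v \<noteq> \<zero>\<^bsub>M\<^esub> \<Longrightarrow> q = n"
proof -
  interpret left_module DD M using g by (simp add: graded_module_def)
  note gm = graded_moduleD[OF g]
  have uc: "u \<in> carrier M" "v \<in> carrier M" using u v gm(1) by auto
  define f1 where "f1 = (\<lambda>j. if j = m then u else if j = n then v else \<zero>\<^bsub>M\<^esub>)"
  define f2 where "f2 = (\<lambda>j. if j = q then u \<oplus>\<^bsub>M\<^esub> v else \<zero>\<^bsub>M\<^esub>)"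
  have sum: "finsum M f {j. f j \<noteq> \<zero>\<^bsub>M\<^esub>} = finsum M f A"
    if "finite A" "{j. f j \<noteq> \<zero>\<^bsub>M\<^esub>} \<subseteq> A" "\<And>j. f j \<in> carrier M" for f and A :: "int set"
    using that by (intro M.add.finprod_mono_neutral_cong_left) auto
  have f1: "(\<forall>j. f1 j \<in> Mg j) \<and> finite {j. f1 j \<noteq> \<zero>\<^bsub>M\<^esub>} \<and> u \<oplus>\<^bsub>M\<^esub> v = finsum M f1 {j. f1 j \<noteq> \<zero>\<^bsub>M\<^esub>}"
  proof (intro conjI)
    have s: "{j. f1 j \<noteq> \<zero>\<^bsub>M\<^esub>} \<subseteq> {m, n}" by (auto simp: f1_def)
    then show "finite {j. f1 j \<noteq> \<zero>\<^bsub>M\<^esub>}" by (rule finite_subset) simp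
    have "finsum M f1 {m, n} = u \<oplus>\<^bsub>M\<^esub> v" using mn uc by (simp add: f1_def Pi_def)
    then show "u \<oplus>\<^bsub>M\<^esub> v = finsum M f1 {j. f1 j \<noteq> \<zero>\<^bsub>M\<^esub>}"
      using sum[OF _ s] uc by (simp add: f1_def)
  qed (use u v gm(2) in \<open>simp add: f1_def\<close>)
  have f2: "(\<forall>j. f2 j \<in> Mg j) \<and> finite {j. f2 j \<noteq> \<zero>\<^bsub>M\<^esub>} \<and> u \<oplus>\<^bsub>M\<^esub> v = finsum M f2 {j. f2 j \<noteq> \<zero>\<^bsub>M\<^esub>}"
  proof (intro conjI)
    have s: "{j. f2 j \<noteq> \<zero>\<^bsub>M\<^esub>} \<subseteq> {q}" by (auto simp: f2_def)
    then show "finite {j. f2 j \<noteq> \<zero>\<^bsub>M\<^esub>}" by (rule finite_subset) simp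
    have "finsum M f2 {q} = u \<oplus>\<^bsub>M\<^esub> v" using uc by (simp add: f2_def Pi_def)
    then show "u \<oplus>\<^bsub>M\<^esub> v = finsum M f2 {j. f2 j \<noteq> \<zero>\<^bsub>M\<^esub>}"
      using sum[OF _ s] uc by (simp add: f2_def)
  qed (use w gm(2) in \<open>simp add: f2_def\<close>)
  have "u \<oplus>\<^bsub>M\<^esub> v \<in> carrier M" using uc by simp
  then have "f1 = f2" using g f1 f2 unfolding graded_module_def by blast
  then have e: "f1 m = f2 m" "f1 n = f2 n" by simp_all
  show "u \<noteq> \<zero>\<^bsub>M\<^esub> \<Longrightarrow> q = m" "v \<noteq> \<zero>\<^bsub>M\<^esub> \<Longrightarrow> q = n"
    using e mn by (auto simp: f1_def f2_def split: if_splits)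
qed

lemma graded_act:
  assumes "graded_module M Mg" "v \<in> Mg n"
  shows "act M (scal k) v \<in> Mg n" "act M (dlt h) v \<in> Mg n" "act M (xx t12) v \<in> Mg (n - 1)" "act M (yy t12) v \<in> Mg (n + 1)"
  using graded_moduleD(3)[OF assms(1) DD_deg_closed(4) assms(2), of k]
    graded_moduleD(3)[OF assms(1) DD_deg_closed(5) assms(2), of "GDelta h"]
    graded_moduleD(3)[OF assms(1) DD_deg_closed(5) assms(2), of "GX t12"]
    graded_moduleD(3)[OF assms(1) DD_deg_closed(5) assms(2), of "GY t12"]
  by (simp_all add: act_def gen_degree_def add.commute)

context realized
begin

definition coords :: "'v \<Rightarrow> T_index \<Rightarrow> 'k" where
  "coords w = inv_into (vecs T_basis) \<Phi> w"

lemma coords: "w \<in> carrier M \<Longrightarrow> coords w \<in> vecs T_basis" "w \<in> carrier M \<Longrightarrow> \<Phi> (coords w) = w"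
  "v \<in> vecs T_basis \<Longrightarrow> coords (\<Phi> v) = v"
proof -
  have "coords (\<Phi> v) = v" if "v \<in> vecs T_basis" for v
    unfolding coords_def using bij_Phi that by (rule bij_betw_inv_into_left)
  then show "v \<in> vecs T_basis \<Longrightarrow> coords (\<Phi> v) = v"
    and "w \<in> carrier M \<Longrightarrow> coords w \<in> vecs T_basis" "w \<in> carrier M \<Longrightarrow> \<Phi> (coords w) = w"
    using Phi_surj[of w] by auto
qed

lemma coords_add: "\<lbrakk>u \<in> carrier M; v \<in> carrier M\<rbrakk> \<Longrightarrow> coords (u \<oplus>\<^bsub>M\<^esub> v) b = coords u b + coords v b"
  using Phi_add[of "coords u" "coords v"] coords(3)[of "\<lambda>c. coords u c + coords v c"] by (simp add: coords)

lemma coords_zero: "coords \<zero>\<^bsub>M\<^esub> b = 0"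
  using coords(3)[of "\<lambda>c. 0"] Phi_zero by simp

lemma coords_finsum:
  assumes "finite A" "\<And>n. n \<in> A \<Longrightarrow> f n \<in> carrier M"
  shows "coords (finsum M f A) b = (\<Sum>n\<in>A. coords (f n) b)"
  by (rule finsum_additive[OF left_module_axioms assms, where F = "\<lambda>w. coords w b"])
    (simp_all add: coords_zero coords_add)

text \<open>
  A coordinate of a vector is the sum of the coordinates of its homogeneous components; it is carried by a
  single component if it vanishes on the others.
\<close>

lemma graded_component_coords:
  assumes g: "graded_module M Mg" and v: "v \<in> vecs T_basis"
  shows "\<exists>f. (\<forall>n. f n \<in> Mg n) \<and> (\<forall>b m. (\<forall>n. n \<noteq> m \<longrightarrow> coords (f n) b = 0) \<longrightarrow> coords (f m) b = v b)"
proof -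
  obtain f where f: "\<And>n. f n \<in> Mg n" "finite {n. f n \<noteq> \<zero>\<^bsub>M\<^esub>}" "\<Phi> v = finsum M f {n. f n \<noteq> \<zero>\<^bsub>M\<^esub>}"
    using graded_decomposition[OF g Phi_carrier[OF v]] by blast
  have fc: "f n \<in> carrier M" for n using f(1) graded_moduleD(1)[OF g] by blast
  have sum: "v b = (\<Sum>n\<in>{n. f n \<noteq> \<zero>\<^bsub>M\<^esub>}. coords (f n) b)" for b
    using coords_finsum[where f = f and b = b, OF f(2) fc] coords(3)[OF v] by (simp flip: f(3))
  have one: "coords (f m) b = v b" if "\<And>n. n \<noteq> m \<Longrightarrow> coords (f n) b = 0" for b m
  proof -
    have "v b = (\<Sum>n\<in>{n. f n \<noteq> \<zero>\<^bsub>M\<^esub>}. if n = m then coords (f m) b else 0)"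
      unfolding sum by (rule sum.cong) (auto simp: that)
    also have "\<dots> = coords (f m) b" using f(2) by (auto simp: coords_zero)
    finally show ?thesis by simp
  qed
  show ?thesis using f(1) one by blast
qed

lemma Phi_finsum:
  assumes "finite A" "\<And>n. n \<in> A \<Longrightarrow> g n \<in> vecs T_basis"
  shows "finsum M (\<lambda>n. \<Phi> (g n)) A = \<Phi> (\<lambda>c. \<Sum>n\<in>A. g n c)"
  using assms
proof (induct A)
  case (insert a A)
  then have "(\<lambda>n. \<Phi> (g n)) \<in> A \<rightarrow> carrier M" "\<Phi> (g a) \<in> carrier M" by auto
  moreover have "(\<lambda>c. \<Sum>n\<in>A. g n c) \<in> vecs T_basis"
    using insert by (auto simp: vecs_def intro!: sum.neutral)
  ultimately show ?case using insert by (simp add: Phi_add)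
qed (simp add: Phi_zero)

text \<open>
  A degree \<open>\<tau>\<close> of \<open>t\<close> for which \<open>x\<^sub>1\<^sub>2\<close> and \<open>y\<^sub>1\<^sub>2\<close> are homogeneous makes the whole module graded.
\<close>

lemma realized_graded:
  assumes x: "\<And>n v. v \<in> T_homog \<tau> n \<Longrightarrow> xo v \<in> T_homog \<tau> (n - 1)"
    and y: "\<And>n v. v \<in> T_homog \<tau> n \<Longrightarrow> yo v \<in> T_homog \<tau> (n + 1)"
  shows "graded_module M (\<lambda>n. \<Phi> ` T_homog \<tau> n)"
proof -
  have hv: "v \<in> vecs T_basis" if "v \<in> T_homog \<tau> n" for v n using that by (simp add: T_homog_def)
  have zero: "\<zero>\<^bsub>M\<^esub> \<in> \<Phi> ` T_homog \<tau> n" for n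
    using T_homog_closed(5)[of \<tau> n] Phi_zero by (metis image_eqI)
  have add: "u \<oplus>\<^bsub>M\<^esub> v \<in> \<Phi> ` T_homog \<tau> n" if "u \<in> \<Phi> ` T_homog \<tau> n" "v \<in> \<Phi> ` T_homog \<tau> n" for u v n
    using that by (auto simp: Phi_add hv intro: T_homog_closed)
  have scal: "act M (scal k) v \<in> \<Phi> ` T_homog \<tau> n" if "v \<in> \<Phi> ` T_homog \<tau> n" for k v n
    using that by (auto simp: Phi_act hv intro: T_homog_closed)
  have carr: "\<Phi> ` T_homog \<tau> n \<subseteq> carrier M" for n using hv by auto
  have sub: "subgroup (\<Phi> ` T_homog \<tau> n) (add_monoid M)" for n
  proof (rule subgroup.intro)
    show "inv\<^bsub>add_monoid M\<^esub> w \<in> \<Phi> ` T_homog \<tau> n" if "w \<in> \<Phi> ` T_homog \<tau> n" for w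
    proof -
      have "w \<in> carrier M" using that carr by blast
      then have "act M (scal (- 1)) w = inv\<^bsub>add_monoid M\<^esub> w" by (simp add: scal_hom act_minus flip: a_inv_def)
      then show ?thesis using scal[OF that, of "- 1"] by simp
    qed
  qed (use carr zero add in auto)
  have hom: "d \<odot>\<^bsub>M\<^esub> v \<in> \<Phi> ` T_homog \<tau> (m + n)" if "d \<in> DD_deg m" "v \<in> \<Phi> ` T_homog \<tau> n" for d v m n
    by (rule act_homogeneous[where P = "\<lambda>n. \<Phi> ` T_homog \<tau> n", OF carr zero add scal _ _ _ _ that])
      (auto simp: Phi_act hv intro: T_homog_closed x y)
  have "\<exists>!f. (\<forall>n. f n \<in> \<Phi> ` T_homog \<tau> n) \<and> finite {n. f n \<noteq> \<zero>\<^bsub>M\<^esub>} \<and> w = finsum M f {n. f n \<noteq> \<zero>\<^bsub>M\<^esub>}"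
    if w: "w \<in> carrier M" for w
  proof -
    obtain v where v: "v \<in> vecs T_basis" "w = \<Phi> v" using Phi_surj[OF w] by blast
    define r where "r n = (\<lambda>b. if T_deg \<tau> b = n then v b else 0)" for n
    have r: "r n \<in> T_homog \<tau> n" for n using v by (auto simp: r_def T_homog_def vecs_def)
    have rz: "r n = (\<lambda>b. 0)" if "n \<notin> {0, - 1, - 2, \<tau>}" for n
    proof
      fix b show "r n b = 0" using that by (cases b) (auto simp: r_def)
    qed
    have s: "{n. \<Phi> (r n) \<noteq> \<zero>\<^bsub>M\<^esub>} \<subseteq> {0, - 1, - 2, \<tau>}" using rz Phi_zero by force
    then have fin: "finite {n. \<Phi> (r n) \<noteq> \<zero>\<^bsub>M\<^esub>}" by (rule finite_subset) simp
    show ?thesis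
    proof (rule ex1I[of _ "\<lambda>n. \<Phi> (r n)"], intro conjI allI)
      show "w = finsum M (\<lambda>n. \<Phi> (r n)) {n. \<Phi> (r n) \<noteq> \<zero>\<^bsub>M\<^esub>}"
      proof -
        have "(\<Sum>n\<in>{n. \<Phi> (r n) \<noteq> \<zero>\<^bsub>M\<^esub>}. r n b) = v b" for b
        proof -
          have "(\<Sum>n\<in>{n. \<Phi> (r n) \<noteq> \<zero>\<^bsub>M\<^esub>}. r n b) =
              (\<Sum>n\<in>{n. \<Phi> (r n) \<noteq> \<zero>\<^bsub>M\<^esub>}. if n = T_deg \<tau> b then v b else 0)"
            by (rule sum.cong) (auto simp: r_def)
          moreover have "v b = 0" if "\<Phi> (r (T_deg \<tau> b)) = \<zero>\<^bsub>M\<^esub>"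
          proof -
            have "r (T_deg \<tau> b) = (\<lambda>c. 0)" using that Phi_eq_zero_iff hv[OF r] by blast
            then have "r (T_deg \<tau> b) b = 0" by simp
            then show ?thesis by (simp add: r_def)
          qed
          ultimately show ?thesis using fin by auto
        qed
        then show ?thesis using Phi_finsum[OF fin, of r] hv[OF r] v by simp
      qed
      fix f assume f: "(\<forall>n. f n \<in> \<Phi> ` T_homog \<tau> n) \<and> finite {n. f n \<noteq> \<zero>\<^bsub>M\<^esub>} \<and> w = finsum M f {n. f n \<noteq> \<zero>\<^bsub>M\<^esub>}"
      have fc: "f n \<in> carrier M" for n using f carr by blast
      have fh: "coords (f n) \<in> T_homog \<tau> n" for n
      proof -
        obtain u where "u \<in> T_homog \<tau> n" "f n = \<Phi> u" using f by blast
        then show ?thesis by (simp add: coords hv)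
      qed
      have "coords (f n) b = r n b" for n b
      proof (cases "T_deg \<tau> b = n")
        case True
        have "v b = (\<Sum>j\<in>{j. f j \<noteq> \<zero>\<^bsub>M\<^esub>}. coords (f j) b)"
          using coords_finsum[of "{j. f j \<noteq> \<zero>\<^bsub>M\<^esub>}" f b] f fc coords(3)[OF v(1)] by (simp flip: v(2))
        also have "\<dots> = (\<Sum>j\<in>{j. f j \<noteq> \<zero>\<^bsub>M\<^esub>}. if j = n then coords (f n) b else 0)"
          using True fh by (intro sum.cong) (auto simp: T_homog_def)
        also have "\<dots> = coords (f n) b" using f by (auto simp: coords_zero)
        finally show ?thesis using True by (simp add: r_def)
      next
        case False
        then show ?thesis using fh[of n] by (auto simp: r_def T_homog_def)
      qed
      then have "coords (f n) = r n" for n by blast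
      then show "f = (\<lambda>n. \<Phi> (r n))" using coords(2)[OF fc] by (metis ext)
    qed (use r fin in auto)
  qed
  then show ?thesis
    unfolding graded_module_def using left_module_axioms sub hom by blast
qed

end

context extension_T
begin

text \<open>
  In a graded extension the lift \<open>t\<close> is homogeneous, and \<open>c\<^sub>1\<close>, \<open>c\<^sub>8\<close> have degrees \<open>l - 2\<close> and \<open>l\<close>.  If \<open>t\<close> has degree
  \<open>l'\<close>, then \<open>\<alpha> \<noteq> 0\<close> means \<open>l' - 1 = l - 2\<close>, while \<open>\<beta> \<noteq> 0\<close> means \<open>l' - 1 = l\<close> and \<open>\<gamma> \<noteq> 0\<close> means
  \<open>l' + 1 = l - 2\<close>.
\<close>

lemma graded_col_necessary:
  assumes "graded_extension L_sigma L_sigma_deg E L_eps (L_eps_deg :: int \<Rightarrow> (S3 \<Rightarrow> 'k free set) set set set)"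
  shows "\<exists>\<alpha> \<beta> \<gamma>. realizes_col \<zeta> E \<alpha> \<beta> \<gamma> \<and> (\<alpha> = 0 \<or> \<beta> = 0) \<and> (\<alpha> = 0 \<or> \<gamma> = 0) \<and> (\<beta> = 0 \<or> \<gamma> = 0)"
proof -
  obtain Eg l l' i p where g: "graded_module E Eg" and se: "short_exact DD L_sigma (i, E, p) L_eps"
    and di: "degree_preserving i (shift L_sigma_deg l) Eg" and dp: "degree_preserving p Eg (shift L_eps_deg l')"
    using assms unfolding graded_extension_def by blast
  interpret X: eps_by_sigma \<zeta> iT pT i E p by (rule eps_by_sigmaI) fact
  obtain a b c d where inv: "has_params i E p a b c d" using X.has_params_exists by blast
  note rc = has_params_col[OF se inv]
  obtain \<Phi> where r: "realizes \<zeta> E (X_op \<zeta> a b 0 0) (Y_op \<zeta> c a 0 0) \<Phi>"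
    "\<And>u. u \<in> carrier L_sigma \<Longrightarrow> \<Phi> (iT u) = i u"
    "\<And>v. v \<in> vecs T_basis \<Longrightarrow> p (\<Phi> v) = act L_eps (scal (v TT)) e0"
    by (rule X.has_params_realizes[OF inv[unfolded rc(2)]], rule that)
  interpret realized E \<zeta> "X_op \<zeta> a b 0 0" "Y_op \<zeta> c a 0 0" \<Phi>
    by (rule realizedI) (use r cube nontrivial in auto)
  note gm = graded_moduleD[OF g]
  have t: "\<Phi> (ket TT) \<in> Eg l'"
  proof -
    have tv: "ket TT \<in> vecs T_basis" by simp
    obtain f where f: "\<And>n. f n \<in> Eg n"
      "\<And>b m. \<forall>n. n \<noteq> m \<longrightarrow> coords (f n) b = 0 \<Longrightarrow> coords (f m) b = ket TT b"
      using graded_component_coords[OF g tv] by metis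
    have fc: "f n \<in> carrier E" for n using f(1) gm(1) by blast
    have "coords (f n) TT = 0" if "n \<noteq> l'" for n
    proof -
      have "p (f n) \<in> L_eps_deg (n - l')" using dp f(1)[of n] unfolding degree_preserving_def shift_def by blast
      then have "p (f n) = \<zero>\<^bsub>L_eps\<^esub>" using that by (simp add: L_eps_deg_eq)
      moreover have "p (f n) = act L_eps (scal (coords (f n) TT)) e0" using r(3)[OF coords(1)[OF fc]] by (simp add: coords(2)[OF fc])
      ultimately have "act L_eps (scal (coords (f n) TT)) e0 = act L_eps (scal 0) e0" by simp
      then show ?thesis by (simp only: L_eps_scal_eq_iff)
    qed
    then have tt: "coords (f l') TT = 1" using f(2)[of l' TT] by simp
    have "act E (dlt 1) (f l') = \<Phi> (dlt_op 1 (coords (f l')))"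
      using Phi_act(3)[OF coords(1)[OF fc], of 1 l'] by (simp add: coords(2)[OF fc])
    also have "dlt_op 1 (coords (f l')) = ket TT"
      by (rule T_ext[OF op_vecs(3) tv]) (simp_all add: tt)
    finally show ?thesis using graded_act(2)[OF g f(1)[of l'], of 1] by simp
  qed
  have low_high: "\<Phi> (ket (High t12)) \<in> Eg l" "\<Phi> (ket (Low t12)) \<in> Eg (l - 2)"
  proof -
    have "\<Phi> v \<in> Eg (n + l)" if v: "v \<in> L10" "v \<in> T_homog 0 n" for v n
    proof -
      have "\<Phi> v = i (jT v)" using r(2)[OF jT(1)[OF v(1)]] by (simp add: jT v)
      moreover have "jT v \<in> shift L_sigma_deg l (n + l)" using jT_deg[OF v] by (simp add: shift_def)
      ultimately show ?thesis using di unfolding degree_preserving_def by blast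
    qed
    from this[of "ket (High t12)" 0] this[of "ket (Low t12)" "- 2"]
    show "\<Phi> (ket (High t12)) \<in> Eg l" "\<Phi> (ket (Low t12)) \<in> Eg (l - 2)"
      by (auto simp: L10_def T_homog_def ket_def vecs_def)
  qed
  have comb: "k = 0 \<or> q = l - 2" "m = 0 \<or> q = l" if q: "\<Phi> (low_high k m) \<in> Eg q" for k m q
  proof -
    have kv: "(\<lambda>c. k * ket (Low t12) c) \<in> vecs T_basis" "(\<lambda>c. m * ket (High t12) c) \<in> vecs T_basis"
      by (intro vecs_closed; simp)+
    have 1: "\<Phi> (\<lambda>c. k * ket (Low t12) c) \<in> Eg (l - 2)" "\<Phi> (\<lambda>c. m * ket (High t12) c) \<in> Eg l"
      using graded_act(1)[OF g low_high(2), of k] graded_act(1)[OF g low_high(1), of m] by (simp_all add: Phi_act)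
    have 2: "\<Phi> (\<lambda>c. k * ket (Low t12) c) \<oplus>\<^bsub>E\<^esub> \<Phi> (\<lambda>c. m * ket (High t12) c) \<in> Eg q"
      using q kv by (simp add: Phi_add low_high_def)
    have 3: "k = 0" if "\<Phi> (\<lambda>c. k * ket (Low t12) c) = \<zero>\<^bsub>E\<^esub>"
      using fun_cong[OF iffD1[OF Phi_eq_zero_iff[OF kv(1)] that], of "Low t12"] by simp
    have 4: "m = 0" if "\<Phi> (\<lambda>c. m * ket (High t12) c) = \<zero>\<^bsub>E\<^esub>"
      using fun_cong[OF iffD1[OF Phi_eq_zero_iff[OF kv(2)] that], of "High t12"] by simp
    show "k = 0 \<or> q = l - 2" "m = 0 \<or> q = l"
      using graded_homogeneous_sum[OF g 1(1) 1(2) _ 2] 3 4 by auto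
  qed
  have xt: "X_op \<zeta> a b 0 0 (ket TT) = low_high a b" "Y_op \<zeta> c a 0 0 (ket TT) = low_high c a"
    by (rule T_ext; simp add: L10_vecs)+
  have "\<Phi> (low_high a b) \<in> Eg (l' - 1)" "\<Phi> (low_high c a) \<in> Eg (l' + 1)"
    using graded_act(3,4)[OF g t] by (simp_all add: Phi_act xt)
  from comb[OF this(1)] comb[OF this(2)] have "(a = 0 \<or> b = 0) \<and> (a = 0 \<or> c = 0) \<and> (b = 0 \<or> c = 0)" by auto
  then show ?thesis using rc by blast
qed

lemma graded_col_sufficient:
  assumes se: "short_exact DD L_sigma (i, E, p) L_eps" and inv: "has_params i E p a b c a"
    and one: "(a = 0 \<or> b = 0) \<and> (a = 0 \<or> c = 0) \<and> (b = 0 \<or> c = 0)"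
  shows "graded_extension L_sigma L_sigma_deg E L_eps (L_eps_deg :: int \<Rightarrow> (S3 \<Rightarrow> 'k free set) set set set)"
proof -
  interpret X: eps_by_sigma \<zeta> iT pT i E p by (rule eps_by_sigmaI) fact
  obtain \<Phi> where r: "realizes \<zeta> E (X_op \<zeta> a b 0 0) (Y_op \<zeta> c a 0 0) \<Phi>"
    "\<And>u. u \<in> carrier L_sigma \<Longrightarrow> \<Phi> (iT u) = i u"
    "\<And>v. v \<in> vecs T_basis \<Longrightarrow> p (\<Phi> v) = act L_eps (scal (v TT)) e0"
    by (rule X.has_params_realizes[OF inv], rule that)
  interpret realized E \<zeta> "X_op \<zeta> a b 0 0" "Y_op \<zeta> c a 0 0" \<Phi>
    by (rule realizedI) (use r cube nontrivial in auto)
  \<comment> \<open>The degree of \<open>t\<close>; any value would do if all parameters vanish.\<close>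
  define \<tau> :: int where "\<tau> = (if a \<noteq> 0 then - 1 else if b \<noteq> 0 then 1 else - 3)"
  have g: "graded_module E (\<lambda>n. \<Phi> ` T_homog \<tau> n)"
    by (rule realized_graded; rule X_op_homog Y_op_homog) (use one in \<open>auto simp: \<tau>_def\<close>)
  have di: "degree_preserving i (shift L_sigma_deg 0) (\<lambda>n. \<Phi> ` T_homog \<tau> n)"
    unfolding degree_preserving_def shift_def
  proof (intro allI subsetI, elim imageE)
    fix n w u assume u: "w = i u" "u \<in> L_sigma_deg (n - 0)"
    then show "w \<in> \<Phi> ` T_homog \<tau> n"
      using L_sigma_degD(1)[of u n] L_sigma_degD(2)[of u n \<tau>] r(2)[of u] by (intro image_eqI[of _ _ "iT u"]) auto
  qed
  have dp: "degree_preserving p (\<lambda>n. \<Phi> ` T_homog \<tau> n) (shift L_eps_deg \<tau>)"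
    unfolding degree_preserving_def shift_def
  proof (intro allI subsetI, elim imageE)
    fix n w u v assume u: "w = p u" "u = \<Phi> v" "v \<in> T_homog \<tau> n"
    then have w: "w = act L_eps (scal (v TT)) e0" using r(3)[of v] by (simp add: T_homog_vecs)
    have "v TT = 0" if "n \<noteq> \<tau>" using u(3) that unfolding T_homog_def by (auto dest: spec[of _ TT])
    then show "w \<in> L_eps_deg (n - \<tau>)" unfolding w L_eps_deg_eq by auto
  qed
  show ?thesis unfolding graded_extension_def using g se di dp by blast
qed

lemma sigma_by_epsI: "short_exact DD L_eps (i, E, p) L_sigma \<Longrightarrow> sigma_by_eps \<zeta> iT pT i E p"
  by (intro sigma_by_eps.intro extension_T_axioms sigma_by_eps_axioms.intro)

lemma row_exists:
  assumes "short_exact DD L_eps (i, E, p) L_sigma"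
  shows "\<exists>\<Phi> \<alpha> \<beta> \<gamma>. realizes \<zeta> E (X_op \<zeta> 0 0 (- \<beta>) \<alpha>) (Y_op \<zeta> 0 0 (- \<alpha>) \<gamma>) \<Phi> \<and>
    (\<forall>k. \<Phi> (\<lambda>e. k * ket TT e) = i (act L_eps (scal k) e0)) \<and> (\<forall>v\<in>vecs T_basis. p (\<Phi> v) = jT (drop_TT v))"
proof -
  interpret X: sigma_by_eps \<zeta> iT pT i E p by (rule sigma_by_epsI) fact
  obtain \<Phi> a b c d where r: "realizes \<zeta> E (X_op \<zeta> 0 0 a b) (Y_op \<zeta> 0 0 c d) \<Phi>"
    "\<And>k. \<Phi> (\<lambda>e. k * ket TT e) = i (act L_eps (scal k) e0)"
    "\<And>v. v \<in> vecs T_basis \<Longrightarrow> p (\<Phi> v) = jT (drop_TT v)"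
    by (rule X.row_realizes, rule that)
  have "c = - b" by (rule row_cross_relation[OF r(1) cube nontrivial])
  then have "realizes \<zeta> E (X_op \<zeta> 0 0 (- (- a)) b) (Y_op \<zeta> 0 0 (- b) d) \<Phi>" using r(1) by simp
  then show ?thesis using r(2,3) by blast
qed

text \<open>
  The argument of \<open>graded_col_necessary\<close> with sources and targets exchanged.
\<close>

lemma graded_row_necessary:
  assumes "graded_extension L_eps (L_eps_deg :: int \<Rightarrow> (S3 \<Rightarrow> 'k free set) set set set) E L_sigma L_sigma_deg"
  shows "\<exists>\<alpha> \<beta> \<gamma>. realizes_row \<zeta> E \<alpha> \<beta> \<gamma> \<and> (\<alpha> = 0 \<or> \<beta> = 0) \<and> (\<alpha> = 0 \<or> \<gamma> = 0) \<and> (\<beta> = 0 \<or> \<gamma> = 0)"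
proof -
  obtain Eg l l' i p where g: "graded_module E Eg" and se: "short_exact DD L_eps (i, E, p) L_sigma"
    and di: "degree_preserving i (shift L_eps_deg l) Eg" and dp: "degree_preserving p Eg (shift L_sigma_deg l')"
    using assms unfolding graded_extension_def by blast
  obtain \<Phi> \<alpha> \<beta> \<gamma> where r: "realizes \<zeta> E (X_op \<zeta> 0 0 (- \<beta>) \<alpha>) (Y_op \<zeta> 0 0 (- \<alpha>) \<gamma>) \<Phi>"
    "\<And>k. \<Phi> (\<lambda>e. k * ket TT e) = i (act L_eps (scal k) e0)"
    "\<And>v. v \<in> vecs T_basis \<Longrightarrow> p (\<Phi> v) = jT (drop_TT v)"
    using row_exists[OF se] by blast
  interpret realized E \<zeta> "X_op \<zeta> 0 0 (- \<beta>) \<alpha>" "Y_op \<zeta> 0 0 (- \<alpha>) \<gamma>" \<Phi>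
    by (rule realizedI) (use r cube nontrivial in auto)
  note gm = graded_moduleD[OF g]
  have top: "\<Phi> (ket TT) \<in> Eg l"
  proof -
    have "\<Phi> (ket TT) = i e0" using r(2)[of 1] by simp
    moreover have "e0 \<in> shift L_eps_deg l l" by (simp add: shift_def L_eps_deg_eq)
    ultimately show ?thesis using di unfolding degree_preserving_def by blast
  qed
  have low_high: "\<Phi> (ket b) \<in> Eg (T_deg 0 b + l')" if b: "b = Low t12 \<or> b = High t12" for b
  proof -
    have bv: "ket b \<in> vecs T_basis" using b by auto
    obtain f where f: "\<And>n. f n \<in> Eg n"
      "\<And>c m. \<forall>n. n \<noteq> m \<longrightarrow> coords (f n) c = 0 \<Longrightarrow> coords (f m) c = ket b c"
      using graded_component_coords[OF g bv] by metis
    have fc: "f n \<in> carrier E" for n using f(1) gm(1) by blast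
    have h: "drop_TT (coords (f n)) \<in> T_homog 0 (n - l')" for n
    proof -
      have "p (f n) \<in> L_sigma_deg (n - l')" using dp f(1)[of n] unfolding degree_preserving_def shift_def by blast
      moreover have "p (f n) = jT (drop_TT (coords (f n)))" using r(3)[OF coords(1)[OF fc]] by (simp add: coords(2)[OF fc])
      ultimately have "iT (jT (drop_TT (coords (f n)))) \<in> T_homog 0 (n - l')" using L_sigma_degD(2) by metis
      then show ?thesis using coords(1)[OF fc] by (simp add: jT)
    qed
    let ?m = "T_deg 0 b + l'"
    have z: "coords (f n) c = 0" if "c \<noteq> TT" "T_deg 0 c \<noteq> n - l'" for n c
      using h[of n] that unfolding T_homog_def by (auto dest: spec[of _ c])
    have m: "coords (f ?m) c = ket b c" if c: "c = Low t12 \<or> c = High t12" for c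
    proof (cases "T_deg 0 c = T_deg 0 b")
      case True
      then show ?thesis using c z by (intro f(2)) auto
    next
      case False
      then have "b \<noteq> c" by auto
      then show ?thesis using c False z[of c ?m] by auto
    qed
    have "act E (dlt t12) (f ?m) = \<Phi> (dlt_op t12 (coords (f ?m)))"
      using Phi_act(3)[OF coords(1)[OF fc], of t12 ?m] by (simp add: coords(2)[OF fc])
    also have "dlt_op t12 (coords (f ?m)) = ket b"
      using m[of "Low t12"] m[of "High t12"] b by (intro T_ext[OF op_vecs(3) bv]) (auto simp: ket_def)
    finally show ?thesis using graded_act(2)[OF g f(1)[of ?m], of t12] by simp
  qed
  have tv: "(\<lambda>e. k * ket TT e) \<in> vecs T_basis" for k :: 'k by (intro vecs_closed) simp
  have comb: "k = 0 \<or> q = l" if q: "\<Phi> (\<lambda>e. k * ket TT e) \<in> Eg q" for k q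
  proof -
    have "\<Phi> (\<lambda>e. k * ket TT e) \<in> Eg l" using graded_act(1)[OF g top, of k] by (simp add: Phi_act)
    moreover have "k = 0" if "\<Phi> (\<lambda>e. k * ket TT e) = \<zero>\<^bsub>E\<^esub>"
      using fun_cong[OF iffD1[OF Phi_eq_zero_iff[OF tv] that], of TT] by simp
    ultimately show ?thesis
      using graded_homogeneous_sum(1)[OF g _ gm(2), of "\<Phi> (\<lambda>e. k * ket TT e)" l "l + 1" q] q tv by auto
  qed
  have ops: "X_op \<zeta> 0 0 (- \<beta>) \<alpha> (ket (Low t12)) = (\<lambda>e. - \<beta> * ket TT e)"
    "X_op \<zeta> 0 0 (- \<beta>) \<alpha> (ket (High t12)) = (\<lambda>e. \<alpha> * ket TT e)"
    "Y_op \<zeta> 0 0 (- \<alpha>) \<gamma> (ket (High t12)) = (\<lambda>e. \<gamma> * ket TT e)"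
    by (intro T_ext op_vecs tv; simp)+
  have "\<Phi> (\<lambda>e. - \<beta> * ket TT e) \<in> Eg (l' - 3)" "\<Phi> (\<lambda>e. \<alpha> * ket TT e) \<in> Eg (l' - 1)" "\<Phi> (\<lambda>e. \<gamma> * ket TT e) \<in> Eg (l' + 1)"
    using graded_act(3)[OF g low_high[of "Low t12"]] graded_act(3)[OF g low_high[of "High t12"]]
      graded_act(4)[OF g low_high[of "High t12"]]
    unfolding Phi_act(4)[OF ket_vecs[THEN iffD2, OF T_basis_in(1)[THEN iffD2, OF transps_simps(1)]]]
      Phi_act(4,5)[OF ket_vecs[THEN iffD2, OF T_basis_in(2)[THEN iffD2, OF transps_simps(1)]]] ops
    by simp_all
  from comb[OF this(1)] comb[OF this(2)] comb[OF this(3)]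
  have "(\<alpha> = 0 \<or> \<beta> = 0) \<and> (\<alpha> = 0 \<or> \<gamma> = 0) \<and> (\<beta> = 0 \<or> \<gamma> = 0)" by auto
  then show ?thesis using r(1) unfolding realizes_row_def by blast
qed

lemma graded_row_sufficient:
  assumes se: "short_exact DD L_eps (i, E, p) L_sigma"
    and r: "realizes \<zeta> E (X_op \<zeta> 0 0 (- b) a) (Y_op \<zeta> 0 0 (- a) c) \<Phi>"
      "\<forall>k. \<Phi> (\<lambda>e. k * ket TT e) = i (act L_eps (scal k) e0)" "\<forall>v\<in>vecs T_basis. p (\<Phi> v) = jT (drop_TT v)"
    and one: "(a = 0 \<or> b = 0) \<and> (a = 0 \<or> c = 0) \<and> (b = 0 \<or> c = 0)"
  shows "graded_extension L_eps (L_eps_deg :: int \<Rightarrow> (S3 \<Rightarrow> 'k free set) set set set) E L_sigma L_sigma_deg"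
proof -
  interpret realized E \<zeta> "X_op \<zeta> 0 0 (- b) a" "Y_op \<zeta> 0 0 (- a) c" \<Phi>
    by (rule realizedI) (use r cube nontrivial in auto)
  \<comment> \<open>Compared with extensions of the other kind, the degrees forced by the last two parameters are exchanged.\<close>
  define \<tau> :: int where "\<tau> = (if a \<noteq> 0 then - 1 else if b \<noteq> 0 then - 3 else 1)"
  have g: "graded_module E (\<lambda>n. \<Phi> ` T_homog \<tau> n)"
    by (rule realized_graded; rule X_op_homog Y_op_homog) (use one in \<open>auto simp: \<tau>_def\<close>)
  have di: "degree_preserving i (shift L_eps_deg \<tau>) (\<lambda>n. \<Phi> ` T_homog \<tau> n)"
    unfolding degree_preserving_def shift_def
  proof (intro allI subsetI, elim imageE)
    fix n w u assume u: "w = i u" "u \<in> (L_eps_deg (n - \<tau>) :: (S3 \<Rightarrow> 'k free set) set set set)"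
    obtain k where k: "u = act L_eps (scal k) e0" "n = \<tau> \<or> k = 0"
    proof (cases "n = \<tau>")
      case True
      then show ?thesis using u that by (auto simp: L_eps_deg_eq L_eps_carrier)
    next
      case False
      then show ?thesis using u that[of 0] by (simp add: L_eps_deg_eq)
    qed
    have "(\<lambda>e. k * ket TT e) \<in> T_homog \<tau> n"
      using k(2) by (auto simp: T_homog_def vecs_def ket_def)
    then show "w \<in> \<Phi> ` T_homog \<tau> n" using r(2) k(1) u(1) by (metis image_eqI)
  qed
  have dp: "degree_preserving p (\<lambda>n. \<Phi> ` T_homog \<tau> n) (shift L_sigma_deg 0)"
    unfolding degree_preserving_def shift_def
  proof (intro allI subsetI, elim imageE)
    fix n w u v assume u: "w = p u" "u = \<Phi> v" "v \<in> T_homog \<tau> n"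
    have d: "drop_TT v \<in> T_homog \<tau> n"
      using u(3) drop_TT_vecs[OF T_homog_vecs[OF u(3)]] by (auto simp: T_homog_def drop_TT_def)
    have "w = jT (drop_TT v)" using u r(3) T_homog_vecs[OF u(3)] by simp
    then show "w \<in> L_sigma_deg (n - 0)" using jT_deg[OF drop_TT_L10[OF T_homog_vecs[OF u(3)]] d] by simp
  qed
  show ?thesis unfolding graded_extension_def using g se di dp by blast
qed

end

section \<open>The antipode\<close>

text \<open>
  The algebra \<open>D\<close> as a type.  The record \<open>DD\<close> is out of reach of the arithmetic of type classes, which
  does the computations with relations below.
\<close>

quotient_type (overloaded) 'k dd = "'k::field free" / "\<lambda>p q. p - q \<in> D_ideal" morphisms rep_dd dq
proof (rule equivpI)
  show "reflp (\<lambda>p q :: 'k free. p - q \<in> D_ideal)" by (simp add: reflp_def D_ideal_closed)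
  show "symp (\<lambda>p q :: 'k free. p - q \<in> D_ideal)"
    using D_ideal_closed(3) by (force simp: symp_def)
  show "transp (\<lambda>p q :: 'k free. p - q \<in> D_ideal)"
    unfolding transp_def cls_eq_iff[symmetric] by simp
qed

instantiation dd :: (field) "{ring, monoid_mult}"
begin

lift_definition zero_dd :: "'a dd" is 0 .
lift_definition one_dd :: "'a dd" is 1 .
lift_definition plus_dd :: "'a dd \<Rightarrow> 'a dd \<Rightarrow> 'a dd" is "(+)"
  unfolding cls_eq_iff[symmetric] by (rule cls_cong)
lift_definition times_dd :: "'a dd \<Rightarrow> 'a dd \<Rightarrow> 'a dd" is "(*)"
  unfolding cls_eq_iff[symmetric] by (rule cls_cong)
lift_definition minus_dd :: "'a dd \<Rightarrow> 'a dd \<Rightarrow> 'a dd" is "(-)"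
  unfolding cls_eq_iff[symmetric] by (rule cls_cong)
lift_definition uminus_dd :: "'a dd \<Rightarrow> 'a dd" is uminus
  unfolding cls_eq_iff[symmetric] by (rule cls_cong(3))

instance
  by standard (transfer; simp add: algebra_simps D_ideal_closed)+

end

lemma dq_eq_iff: "dq p = dq q \<longleftrightarrow> cls p = cls (q :: 'k::field free)"
  by (simp add: dd.abs_eq_iff cls_eq_iff)

lemma dq_hom: "dq (p + q) = dq p + dq (q :: 'k::field free)" "dq (p * q) = dq p * dq q"
  "dq (p - q) = dq p - dq q" "dq (- p) = - dq p" "dq (0 :: 'k free) = 0" "dq (1 :: 'k free) = 1"
  by (simp_all add: plus_dd.abs_eq times_dd.abs_eq minus_dd.abs_eq uminus_dd.abs_eq zero_dd.abs_eq one_dd.abs_eq)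

lemma dq_sum: "dq (sum f A) = (\<Sum>a\<in>A. dq (f a :: 'k::field free))"
  by (induct A rule: infinite_finite_induct) (simp_all add: dq_hom)

context
begin

private abbreviation "G g \<equiv> dq (grp g :: 'k::field free)"
private abbreviation "Dl g \<equiv> dq (dlt g :: 'k::field free)"
private abbreviation "K c \<equiv> dq (scal (c :: 'k::field))"
private abbreviation "sg g \<equiv> K (sgn3 g :: 'k::field)"

lemma dd_scal_simps: "K 1 = 1" "K 0 = 0" "K (- c) = - K c" "K (a * b) = K a * K b"
  by (simp_all add: scal_hom dq_hom)

lemma dd_scal_central: "p * K c = K c * (p :: 'k::field dd)" "p * (K c * q) = K c * (p * q)"
proof -
  show 1: "p * K c = K c * p"
  proof (induct p)
    fix r :: "'k free"
    show "dq r * K c = K c * dq r" by (simp only: dq_hom(2)[symmetric] scal_central)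
  qed
  have "p * (K c * q) = (p * K c) * q" by (simp only: mult.assoc)
  also have "\<dots> = K c * (p * q)" by (simp only: 1 mult.assoc)
  finally show "p * (K c * q) = K c * (p * q)" .
qed

lemma dd_sgn_mult: "sg (g * h) = sg g * sg h" "sg g * sg g = 1" "sg g * (sg g * p) = p"
proof -
  show "sg (g * h) = sg g * sg h" by (simp add: sgn3_mult dd_scal_simps)
  show 1: "sg g * sg g = 1" by (simp only: dd_scal_simps(4)[symmetric] sgn3_square dd_scal_simps(1))
  show "sg g * (sg g * p) = p" by (simp add: 1 flip: mult.assoc)
qed

lemma dd_sgn_simps: "a \<in> transps \<Longrightarrow> sg a = - 1" "sg (inverse a) = sg a"
  using S3_cases[of a] unfolding transps_def by (auto simp: dd_scal_simps)

lemma dd_grp_mult: "G g * G h = G (g * h)" "G g * (G h * p) = G (g * h) * p" "G 1 = 1"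
proof -
  show 1: "G g * G h = G (g * h)" by (simp add: dq_eq_iff cls_grp_mult flip: dq_hom)
  show "G g * (G h * p) = G (g * h) * p" by (simp add: 1 flip: mult.assoc)
  show "G 1 = 1" by (simp add: dq_eq_iff cls_grp_one flip: dq_hom)
qed

lemma dd_dlt_mult: "Dl g * Dl h = (if g = h then Dl g else 0)" "Dl g * (Dl h * p) = (if g = h then Dl g * p else 0)"
proof -
  have "Dl g * Dl h = dq (if g = h then dlt g else 0)" by (simp add: dq_eq_iff cls_dlt_mult flip: dq_hom)
  also have "\<dots> = (if g = h then Dl g else 0)" by (simp add: dq_hom)
  finally show 1: "Dl g * Dl h = (if g = h then Dl g else 0)" .
  show "Dl g * (Dl h * p) = (if g = h then Dl g * p else 0)" by (simp add: 1 flip: mult.assoc)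
qed

lemma dd_dlt_sum: "(\<Sum>g\<in>UNIV. Dl g) = 1"
  by (simp add: dq_eq_iff cls_dlt_sum flip: dq_sum dq_hom)

text \<open>
  The \<open>\<delta>\<^sub>k\<close> are orthogonal idempotents with sum \<open>1\<close>, so an identity in \<open>D\<close> may be checked after
  multiplication by each of them.
\<close>

lemma dd_eqI:
  assumes "\<And>k. Dl k * p = Dl k * q" shows "p = q"
proof -
  have "p = (\<Sum>k\<in>UNIV. Dl k) * p" by (simp add: dd_dlt_sum)
  also have "\<dots> = (\<Sum>k\<in>UNIV. Dl k) * q" by (simp add: sum_distrib_right assms)
  finally show ?thesis by (simp add: dd_dlt_sum)
qed

lemma dd_eqI_cases:
  assumes "Dl 1 * p = Dl 1 * q" "Dl t12 * p = Dl t12 * q" "Dl t13 * p = Dl t13 * q"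
    "Dl t23 * p = Dl t23 * q" "Dl c123 * p = Dl c123 * q" "Dl c132 * p = Dl c132 * q"
  shows "p = q"
proof (rule dd_eqI)
  show "Dl k * p = Dl k * q" for k using S3_cases[of k] assms by (elim disjE) simp_all
qed

lemma dd_grp_dlt: "G g * Dl h = Dl (conj3 g h) * G g"
  by (simp add: dq_eq_iff cls_grp_dlt flip: dq_hom)

lemma dd_dlt_grp: "Dl h * G g = G g * Dl (conj3 (inverse g) h)" "Dl h * (G g * p) = G g * (Dl (conj3 (inverse g) h) * p)"
proof -
  have "conj3 g (conj3 (inverse g) h) = h" by (simp flip: conj3_mult)
  then show 1: "Dl h * G g = G g * Dl (conj3 (inverse g) h)" by (simp only: dd_grp_dlt)
  show "Dl h * (G g * p) = G g * (Dl (conj3 (inverse g) h) * p)" by (simp add: 1 flip: mult.assoc)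
qed

lemma boson_dd:
  fixes z :: "S3 \<Rightarrow> 'k::field free"
  assumes z: "boson_relations z \<subseteq> D_relations"
  shows "s \<notin> transps \<Longrightarrow> dq (z s) = 0"
    "dq (z s) * dq (z s) = 0" "dq (z s) * (dq (z s) * p) = 0"
    "dq (z t12) * dq (z t13) + dq (z t23) * dq (z t12) + dq (z t13) * dq (z t23) = 0"
    "dq (z t13) * dq (z t12) + dq (z t12) * dq (z t23) + dq (z t23) * dq (z t13) = 0"
    "G g * dq (z s) = sg g * (dq (z (conj3 g s)) * G g)"
    "s \<in> transps \<Longrightarrow> Dl g * dq (z s) = dq (z s) * Dl (s * g)"
    "s \<in> transps \<Longrightarrow> Dl g * (dq (z s) * p) = dq (z s) * (Dl (s * g) * p)"
proof -
  note r = cls_boson[OF z]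
  show 0: "dq (z s) = 0" if "s \<notin> transps" for s using r(1)[OF that] by (simp add: dq_eq_iff flip: dq_hom)
  show sq: "dq (z s) * dq (z s) = 0"
    by (cases "s \<in> transps") (use r(2)[of s] in \<open>simp add: dq_eq_iff flip: dq_hom\<close>, simp add: 0)
  show "dq (z s) * (dq (z s) * p) = 0" by (simp add: sq flip: mult.assoc)
  show "dq (z t12) * dq (z t13) + dq (z t23) * dq (z t12) + dq (z t13) * dq (z t23) = 0"
    "dq (z t13) * dq (z t12) + dq (z t12) * dq (z t23) + dq (z t23) * dq (z t13) = 0"
    using r(3,4) by (simp_all add: dq_eq_iff flip: dq_hom)
  show "G g * dq (z s) = sg g * (dq (z (conj3 g s)) * G g)"
  proof (cases "s \<in> transps")
    case True
    then show ?thesis using r(5)[of s g] by (simp add: dq_eq_iff mult.assoc flip: dq_hom)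
  qed (simp add: 0)
  show d: "Dl g * dq (z s) = dq (z s) * Dl (s * g)" if "s \<in> transps"
    using r(6)[OF that, of g] by (simp add: dq_eq_iff flip: dq_hom)
  show "Dl g * (dq (z s) * p) = dq (z s) * (Dl (s * g) * p)" if "s \<in> transps"
    using d[OF that] by (simp flip: mult.assoc)
qed

lemma boson_dd_right:
  fixes z :: "S3 \<Rightarrow> 'k::field free"
  assumes z: "boson_relations z \<subseteq> D_relations"
  shows "dq (z s) * G g = sg g * (G g * dq (z (conj3 (inverse g) s)))"
    "dq (z s) * (G g * p) = sg g * (G g * (dq (z (conj3 (inverse g) s)) * p))"
proof -
  have "conj3 g (conj3 (inverse g) s) = s" by (simp flip: conj3_mult)
  then have "sg g * (G g * dq (z (conj3 (inverse g) s))) = sg g * (sg g * (dq (z s) * G g))"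
    using boson_dd(6)[OF z, of g "conj3 (inverse g) s"] by simp
  then show 1: "dq (z s) * G g = sg g * (G g * dq (z (conj3 (inverse g) s)))" by (simp add: dd_sgn_mult)
  have "dq (z s) * (G g * p) = (dq (z s) * G g) * p" by (simp add: mult.assoc)
  then show "dq (z s) * (G g * p) = sg g * (G g * (dq (z (conj3 (inverse g) s)) * p))"
    by (simp add: 1 mult.assoc)
qed

private abbreviation "x s \<equiv> dq (xx s :: 'k::field free)"
private abbreviation "y s \<equiv> dq (yy s :: 'k::field free)"

text \<open>
  Used as rewrite rules, these bring products to a normal form with the group elements on the left and the
  \<open>\<delta>\<^sub>g\<close> on the right.
\<close>

lemmas dd_x_rules = boson_dd(1,2,3,7,8)[OF boson_in_D(1)] boson_dd_right[OF boson_in_D(1)]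
lemmas dd_y_rules = boson_dd(1,2,3,7,8)[OF boson_in_D(2)] boson_dd_right[OF boson_in_D(2)]

lemma cross_dd:
  assumes "s \<in> transps" "r \<in> transps"
  shows "y s * x r = - (x r * y (r * s * r)) + (if s = r then 1 else 0) + G r * (Dl s - Dl (s * r))"
proof -
  have "y s * x r = dq (yy s * xx r)" by (simp add: dq_hom)
  also have "\<dots> = dq (- (xx r * yy (r * s * r)) + (if s = r then 1 else 0) + grp r * (dlt s - dlt (s * r)))"
    unfolding dq_eq_iff by (rule cls_cross[OF assms])
  finally show ?thesis by (cases "s = r") (simp_all add: dq_hom)
qed

text \<open>
  The antipode of \<open>y\<^sub>s\<close> up to sign.
\<close>

definition antipode_y :: "S3 \<Rightarrow> 'k::field dd" where
  "antipode_y s = (\<Sum>g\<in>UNIV. K (sgn3 g) * Dl (inverse g) * y (conj3 (inverse g) s))"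

text \<open>
  Orthogonality of the \<open>\<delta>\<^sub>g\<close> leaves the term for \<open>g = k\<^sup>-\<^sup>1\<close> only.
\<close>

lemma dlt_antipode_y: "Dl k * antipode_y s = sg k * (Dl k * y (conj3 k s))" "Dl k * (antipode_y s * p) = sg k * (Dl k * (y (conj3 k s) * p))"
proof -
  have "Dl k * antipode_y s = (\<Sum>g\<in>UNIV. if g = inverse k then sg k * (Dl k * y (conj3 k s)) else 0)"
    unfolding antipode_y_def sum_distrib_left
  proof (rule sum.cong)
    fix g
    have "inverse g = k \<longleftrightarrow> g = inverse k" by (metis perm.inverse_inverse)
    then show "Dl k * (K (sgn3 g) * Dl (inverse g) * y (conj3 (inverse g) s)) =
        (if g = inverse k then sg k * (Dl k * y (conj3 k s)) else 0)"
      by (auto simp: mult.assoc dd_scal_central(2) dd_dlt_mult dd_sgn_simps)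
  qed simp
  moreover have "finite (UNIV :: S3 set)" by (simp add: S3_UNIV)
  ultimately show 1: "Dl k * antipode_y s = sg k * (Dl k * y (conj3 k s))" by (simp add: sum.delta)
  have "Dl k * (antipode_y s * p) = (Dl k * antipode_y s) * p" by (simp add: mult.assoc)
  then show "Dl k * (antipode_y s * p) = sg k * (Dl k * (y (conj3 k s) * p))" by (simp add: 1 mult.assoc)
qed

text \<open>
  The antipode on the free algebra, with values in \<open>D\<close>.
\<close>

definition antipode_dd :: "'k::field free \<Rightarrow> 'k dd" where
  "antipode_dd p = dq (free_antipode p)"

lemma antipode_dd_add: "antipode_dd (p + q) = antipode_dd p + (antipode_dd q :: 'k::field dd)"
proof -
  have "free_antipode (p + q) = free_antipode p + free_antipode q"
    unfolding free_antipode_def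
    by (rule sum_keys_add) (simp_all add: scal_hom distrib_right)
  then show ?thesis by (simp add: antipode_dd_def dq_hom)
qed

lemma antipode_dd_single: "antipode_dd (Poly_Mapping.single w c) = K c * dq (prod_list (map gen_antipode (rev (letters w))))"
proof -
  have "free_antipode (Poly_Mapping.single w c) = scal c * prod_list (map gen_antipode (rev (letters w)))"
    by (simp add: free_antipode_def scal_hom)
  then show ?thesis by (simp add: antipode_dd_def dq_hom)
qed

lemma antipode_dd_mult: "antipode_dd (p * q) = antipode_dd q * (antipode_dd p :: 'k::field dd)"
proof (induct p rule: free_induct)
  case (single w c)
  show ?case
  proof (induct q rule: free_induct)
    case (single v d)
    then show ?case
      by (simp add: mult_single antipode_dd_single plus_word_def dd_scal_simps dq_hom mult.assoc dd_scal_central[of "dq (prod_list _)"])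
         (simp only: dd_scal_central(2)[of "K _"])
  qed (simp add: antipode_dd_add distrib_left distrib_right)
qed (simp add: antipode_dd_add distrib_left distrib_right)

lemma antipode_dd_simps: "antipode_dd 0 = (0 :: 'k::field dd)" "antipode_dd 1 = (1 :: 'k dd)" "antipode_dd (- p) = - (antipode_dd p :: 'k dd)" "antipode_dd (p - q) = antipode_dd p - (antipode_dd q :: 'k dd)"
  "antipode_dd (scal c) = K (c :: 'k)" "antipode_dd (grp g) = (G (inverse g) :: 'k dd)" "antipode_dd (dlt g) = (Dl (inverse g) :: 'k dd)"
  "antipode_dd (xx s) = - (G (inverse s) * x s :: 'k dd)" "antipode_dd (yy s) = - (antipode_y s :: 'k dd)"
proof -
  show 0: "antipode_dd 0 = (0 :: 'k dd)" by (simp add: antipode_dd_def free_antipode_def dq_hom)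
  have c: "antipode_dd (scal c) = K c" for c :: 'k
    by (simp add: scal_def antipode_dd_single zero_word_def dq_hom)
  show "antipode_dd (scal c) = K c" by (rule c)
  show "antipode_dd 1 = (1 :: 'k dd)" using c[of 1] by (simp add: scal_hom dq_hom)
  show m: "antipode_dd (- p) = - (antipode_dd p)" for p :: "'k free"
    using antipode_dd_add[of p "- p"] 0 by (simp add: minus_unique)
  show "antipode_dd (p - q) = antipode_dd p - (antipode_dd q :: 'k dd)" using antipode_dd_add[of p "- q"] by (simp add: m)
  have v: "antipode_dd (var a) = (dq (gen_antipode a) :: 'k dd)" for a
    by (simp add: var_def antipode_dd_single dd_scal_simps)
  show "antipode_dd (grp g) = (G (inverse g) :: 'k dd)" "antipode_dd (dlt g) = (Dl (inverse g) :: 'k dd)"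
    "antipode_dd (xx s) = - (G (inverse s) * x s :: 'k dd)" "antipode_dd (yy s) = - (antipode_y s :: 'k dd)"
    by (simp_all add: v gen_antipode_def dq_hom dq_sum antipode_y_def)
qed

lemma antipode_dd_sum: "antipode_dd (sum f A) = (\<Sum>a\<in>A. antipode_dd (f a))"
  by (induct A rule: infinite_finite_induct) (simp_all add: antipode_dd_add antipode_dd_simps)

lemma cross_dd_right:
  assumes "s \<in> transps" "r \<in> transps"
  shows "y s * (x r * p) = - (x r * (y (r * s * r) * p)) + (if s = r then p else 0) + G r * (Dl s * p - Dl (s * r) * p)"
proof -
  have "y s * (x r * p) = (y s * x r) * p" by (simp only: mult.assoc)
  also have "\<dots> = - (x r * (y (r * s * r) * p)) + (if s = r then p else 0) + G r * (Dl s * p - Dl (s * r) * p)"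
    unfolding cross_dd[OF assms] by (simp add: algebra_simps)
  finally show ?thesis .
qed

lemma antipode_dd_double: "p \<in> double_S3_relations \<Longrightarrow> antipode_dd p = (0 :: 'k::field dd)"
proof -
  have "Dl 1 + (Dl t12 + (Dl t13 + (Dl t23 + (Dl c123 + Dl c132)))) = (1 :: 'k dd)"
    using dd_dlt_sum by (simp only: S3_sum)
  then have 1: "antipode_dd ((\<Sum>g\<in>UNIV. dlt g) - 1) = (0 :: 'k dd)"
    by (simp add: antipode_dd_simps antipode_dd_add antipode_dd_sum S3_sum add_ac)
  have 2: "antipode_dd (dlt g * dlt h - (if g = h then dlt g else 0)) = (0 :: 'k dd)" for g h
  proof (cases "g = h")
    case False
    then have "inverse h \<noteq> inverse g" by (metis perm.inverse_inverse)
    with False show ?thesis by (simp add: antipode_dd_simps antipode_dd_mult dd_dlt_mult)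
  qed (simp add: antipode_dd_simps antipode_dd_mult dd_dlt_mult)
  have 3: "antipode_dd (grp g * dlt h - dlt (conj3 g h) * grp g) = (0 :: 'k dd)" for g h
    using S3_cases[of g] S3_cases[of h] by (elim disjE) (simp_all add: antipode_dd_simps antipode_dd_mult dd_dlt_grp)
  have 4: "antipode_dd (grp g * grp h - grp (g * h)) = (0 :: 'k dd)" for g h
    by (simp add: antipode_dd_simps antipode_dd_mult dd_grp_mult perm.inverse_distrib_swap)
  have 5: "antipode_dd (grp 1 - 1) = (0 :: 'k dd)" by (simp add: antipode_dd_simps dd_grp_mult)
  assume "p \<in> double_S3_relations"
  then show "antipode_dd p = 0" unfolding double_S3_relations_def using 1 2 3 4 5 by blast
qed

text \<open>
  The antipode of each quadratic relation is a group element times one of the two quadratic relations, up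
  to sign.
\<close>

lemma antipode_dd_xx: "p \<in> boson_relations xx \<Longrightarrow> antipode_dd p = (0 :: 'k::field dd)"
proof -
  note simps = antipode_dd_simps antipode_dd_mult antipode_dd_add dd_grp_mult dd_dlt_grp dd_x_rules dd_scal_simps mult.assoc
  have 1: "antipode_dd (xx s) = (0 :: 'k dd)" if "s \<notin> transps" for s using that by (simp add: simps)
  have 2: "antipode_dd (xx s * xx s) = (0 :: 'k dd)" if "s \<in> transps" for s
    using that unfolding transps_def by (elim insertE emptyE) (simp_all add: simps)
  have "antipode_dd (xx t12 * xx t13 + xx t23 * xx t12 + xx t13 * xx t23)
      = - (G c123 * (x t12 * x t13 + x t23 * x t12 + x t13 * x t23))"
    by (simp add: simps distrib_left)
  then have 3: "antipode_dd (xx t12 * xx t13 + xx t23 * xx t12 + xx t13 * xx t23) = (0 :: 'k dd)"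
    by (simp only: boson_dd(4)[OF boson_in_D(1)] mult_zero_right minus_zero)
  have "antipode_dd (xx t13 * xx t12 + xx t12 * xx t23 + xx t23 * xx t13)
      = - (G c132 * (x t13 * x t12 + x t12 * x t23 + x t23 * x t13))"
    by (simp add: simps distrib_left)
  then have 4: "antipode_dd (xx t13 * xx t12 + xx t12 * xx t23 + xx t23 * xx t13) = (0 :: 'k dd)"
    by (simp only: boson_dd(5)[OF boson_in_D(1)] mult_zero_right minus_zero)
  have 5: "antipode_dd (grp g * xx s - scal (sgn3 g) * xx (conj3 g s) * grp g) = (0 :: 'k dd)" if "s \<in> transps" for g s
    using that S3_cases[of g] unfolding transps_def by (elim disjE insertE emptyE) (simp_all add: simps)
  have 6: "antipode_dd (dlt g * xx s - xx s * dlt (s * g)) = (0 :: 'k dd)" if "s \<in> transps" for g s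
    using that S3_cases[of g] unfolding transps_def by (elim disjE insertE emptyE) (simp_all add: simps)
  assume "p \<in> boson_relations xx"
  then show "antipode_dd p = 0" unfolding boson_relations_def using 1 2 3 4 5 6 by blast
qed

text \<open>
  Multiplied by \<open>\<delta>\<^sub>k\<close>, the antipode of a quadratic relation becomes, up to sign, the conjugate by \<open>k\<close> of one of
  the two quadratic relations.
\<close>

lemma antipode_dd_yy: "p \<in> boson_relations yy \<Longrightarrow> antipode_dd p = (0 :: 'k::field dd)"
proof -
  note simps = antipode_dd_simps antipode_dd_mult antipode_dd_add dd_grp_mult dd_dlt_grp dd_dlt_mult dd_y_rules dlt_antipode_y dd_scal_simps mult.assoc distrib_left right_diff_distrib
  have 1: "antipode_dd (yy s) = (0 :: 'k dd)" if "s \<notin> transps" for s using that by (simp add: antipode_dd_simps antipode_y_def dd_y_rules)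
  have 2: "antipode_dd (yy s * yy s) = (0 :: 'k dd)" if "s \<in> transps" for s
    by (rule dd_eqI_cases; use that in \<open>unfold transps_def, (elim insertE emptyE; simp add: simps)\<close>)
  have neg: "a = - b - c" if "a + b + c = 0" for a b c :: "'k dd"
    using that by (simp add: algebra_simps eq_neg_iff_add_eq_0)
  note quad = boson_dd(4,5)[OF boson_in_D(2), THEN neg]
  have quad': "y t12 * (y t13 * p) = - (y t23 * (y t12 * p)) - y t13 * (y t23 * p)"
    "y t13 * (y t12 * p) = - (y t12 * (y t23 * p)) - y t23 * (y t13 * p)" for p :: "'k dd"
    using quad[THEN arg_cong[of _ _ "\<lambda>q. q * p"]] by (simp_all add: algebra_simps)
  have 3: "antipode_dd (yy t12 * yy t13 + yy t23 * yy t12 + yy t13 * yy t23) = (0 :: 'k dd)"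
    "antipode_dd (yy t13 * yy t12 + yy t12 * yy t23 + yy t23 * yy t13) = (0 :: 'k dd)"
    by (rule dd_eqI_cases; simp add: simps quad')+
  have 5: "antipode_dd (grp g * yy s - scal (sgn3 g) * yy (conj3 g s) * grp g) = (0 :: 'k dd)"
    "antipode_dd (dlt g * yy s - yy s * dlt (s * g)) = (0 :: 'k dd)" if "s \<in> transps" for g s
    by (rule dd_eqI_cases; use that S3_cases[of g] in \<open>unfold transps_def, (elim disjE insertE emptyE; simp add: simps)\<close>)+
  assume "p \<in> boson_relations yy"
  then show "antipode_dd p = 0" unfolding boson_relations_def using 1 2 3 5 by blast
qed

lemma antipode_dd_cross: "p \<in> cross_relations \<Longrightarrow> antipode_dd p = (0 :: 'k::field dd)"
proof -
  note simps = antipode_dd_simps antipode_dd_mult antipode_dd_add dd_grp_mult dd_dlt_grp dd_dlt_mult dd_x_rules dd_y_rules cross_dd cross_dd_right dlt_antipode_y dd_scal_simps mult.assoc distrib_left right_diff_distrib left_diff_distrib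
  have 1: "antipode_dd (yy s * xx r - (- (xx r * yy (r * s * r)) + (if s = r then 1 else 0)
        + grp r * (dlt s - dlt (s * r)))) = (0 :: 'k dd)" if "s \<in> transps" "r \<in> transps" for s r
    by (rule dd_eqI_cases; use that in \<open>unfold transps_def, (elim insertE emptyE; simp add: simps)\<close>)
  assume "p \<in> cross_relations"
  then show "antipode_dd p = 0" unfolding cross_relations_def using 1 by blast
qed

text \<open>
  An antihomomorphism that kills the relations kills the ideal; hence the antipode is well defined
  on \<open>D\<close>.
\<close>

lemma antipode_dd_ideal: "p \<in> D_ideal \<Longrightarrow> antipode_dd p = (0 :: 'k::field dd)"
proof -
  have "D_ideal \<subseteq> {p. antipode_dd p = (0 :: 'k dd)}"
  proof (rule D_ideal_least)
    show "D_relations \<subseteq> {p. antipode_dd p = (0 :: 'k dd)}"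
      unfolding D_relations_def using antipode_dd_double antipode_dd_xx antipode_dd_yy antipode_dd_cross by blast
  qed (simp_all add: antipode_dd_simps antipode_dd_mult)
  then show "p \<in> D_ideal \<Longrightarrow> antipode_dd p = 0" by blast
qed

lemma antipode_cls: "antipode (cls p) = cls (free_antipode (p :: 'k::field free))"
proof -
  have "cls (free_antipode q) = cls (free_antipode p)" if "q \<in> cls p" for q
  proof -
    have "antipode_dd (q - p) = 0" using that by (intro antipode_dd_ideal) (simp add: cls_def')
    then show ?thesis by (simp add: antipode_dd_simps) (simp add: antipode_dd_def dq_eq_iff)
  qed
  then show ?thesis using cls_self[of p] unfolding antipode_def by blast
qed

lemma cls_free_antipode_mult: "cls (free_antipode (p * q)) = cls (free_antipode q * free_antipode (p :: 'k::field free))"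
  using antipode_dd_mult[of p q] by (simp add: antipode_dd_def dq_eq_iff flip: dq_hom)

lemma cls_free_antipode_add: "cls (free_antipode (p + q)) = cls (free_antipode p + free_antipode (q :: 'k::field free))"
  using antipode_dd_add[of p q] by (simp add: antipode_dd_def dq_eq_iff flip: dq_hom)

lemma cls_free_antipode_generators:
  "cls (free_antipode 1) = (cls 1 :: 'k::field free set)"
  "cls (free_antipode (scal c)) = cls (scal (c :: 'k))"
  "cls (free_antipode (grp g)) = (cls (grp (inverse g)) :: 'k free set)"
  "cls (free_antipode (dlt g)) = (cls (dlt (inverse g)) :: 'k free set)"
  "cls (free_antipode (xx s)) = (cls (- (grp (inverse s) * xx s)) :: 'k free set)"
  "cls (free_antipode (yy s)) = (cls (- (\<Sum>g\<in>UNIV. scal (sgn3 g) * dlt (inverse g) * yy (conj3 (inverse g) s))) :: 'k free set)"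
proof -
  have "dq (\<Sum>g\<in>UNIV. scal (sgn3 g) * dlt (inverse g) * yy (conj3 (inverse g) s)) = (antipode_y s :: 'k dd)"
    by (simp add: antipode_y_def dq_sum dq_hom)
  then show "cls (free_antipode (yy s)) = (cls (- (\<Sum>g\<in>UNIV. scal (sgn3 g) * dlt (inverse g) * yy (conj3 (inverse g) s))) :: 'k free set)"
    using antipode_dd_simps(9)[where 'k = 'k, of s] by (simp only: antipode_dd_def dq_eq_iff[symmetric] dq_hom(4))
qed (use antipode_dd_simps(2,5-8)[where 'k = 'k] in \<open>simp_all add: antipode_dd_def dq_eq_iff flip: dq_hom\<close>)

end

section \<open>Dual modules\<close>

lemma dual_simps:
  "carrier (dual_module M) = {f. (\<forall>v. v \<notin> carrier M \<longrightarrow> f v = 0) \<and>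
        (\<forall>u\<in>carrier M. \<forall>v\<in>carrier M. f (u \<oplus>\<^bsub>M\<^esub> v) = f u + f v) \<and>
        (\<forall>c. \<forall>v\<in>carrier M. f (act M (scal c) v) = c * f v)}"
  "\<zero>\<^bsub>dual_module M\<^esub> = (\<lambda>v. 0)" "f \<oplus>\<^bsub>dual_module M\<^esub> f' = (\<lambda>v. f v + f' v)"
  "cls p \<odot>\<^bsub>dual_module M\<^esub> f = (\<lambda>v. if v \<in> carrier M then f (act M (free_antipode p) v) else 0)"
  by (simp_all add: dual_module_def act_def antipode_cls fun_eq_iff)

context D_module
begin

lemma dual_closed:
  assumes "f \<in> carrier (dual_module M)"
  shows "v \<notin> carrier M \<Longrightarrow> f v = 0" "\<lbrakk>u \<in> carrier M; v \<in> carrier M\<rbrakk> \<Longrightarrow> f (u \<oplus>\<^bsub>M\<^esub> v) = f u + f v"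
    "v \<in> carrier M \<Longrightarrow> f (act M (scal c) v) = c * f v"
  using assms by (simp_all add: dual_simps)

lemma dual_act_closed:
  assumes f: "f \<in> carrier (dual_module M)"
  shows "(\<lambda>v. if v \<in> carrier M then f (act M p v) else 0) \<in> carrier (dual_module M)"
proof -
  have "f (act M p (act M (scal c) v)) = c * f (act M p v)" if "v \<in> carrier M" for c v
    using that by (simp only: act_scal_commute[of v p c] dual_closed[OF f] act_closed)
  then show ?thesis by (simp add: dual_simps(1) dual_closed[OF f] act_add_right)
qed

text \<open>
  The two reversals of order, that of the antipode and that of passing to functionals, cancel.
\<close>

lemma left_module_dual: "left_module DD (dual_module M)"
proof (rule left_moduleI)
  show "ring (DD :: 'k free set ring)" by (rule ring_DD)
  show "\<exists>g\<in>carrier (dual_module M). g \<oplus>\<^bsub>dual_module M\<^esub> f = \<zero>\<^bsub>dual_module M\<^esub>"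
    if "f \<in> carrier (dual_module M)" for f
    using that by (intro bexI[of _ "\<lambda>v. - f v"]) (auto simp: dual_simps)
next
  fix a f assume "a \<in> carrier (DD :: 'k free set ring)" and f: "f \<in> carrier (dual_module M)"
  then obtain p where p: "a = cls p" by (auto elim: DD_carrierE)
  show "a \<odot>\<^bsub>dual_module M\<^esub> f \<in> carrier (dual_module M)"
    unfolding p dual_simps(4) by (rule dual_act_closed[OF f])
  fix g assume "g \<in> carrier (dual_module M)"
  show "a \<odot>\<^bsub>dual_module M\<^esub> (f \<oplus>\<^bsub>dual_module M\<^esub> g) = a \<odot>\<^bsub>dual_module M\<^esub> f \<oplus>\<^bsub>dual_module M\<^esub> a \<odot>\<^bsub>dual_module M\<^esub> g"
    by (auto simp: p dual_simps)
next
  fix a b f assume "a \<in> carrier (DD :: 'k free set ring)" "b \<in> carrier (DD :: 'k free set ring)" and f: "f \<in> carrier (dual_module M)"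
  then obtain p q where p: "a = cls p" "b = cls q" by (auto elim!: DD_carrierE)
  show "(a \<oplus>\<^bsub>DD\<^esub> b) \<odot>\<^bsub>dual_module M\<^esub> f = a \<odot>\<^bsub>dual_module M\<^esub> f \<oplus>\<^bsub>dual_module M\<^esub> b \<odot>\<^bsub>dual_module M\<^esub> f"
    using dual_closed(2)[OF f]
    by (auto simp: p DD_simps dual_simps act_cong[OF cls_free_antipode_add] act_add)
  show "(a \<otimes>\<^bsub>DD\<^esub> b) \<odot>\<^bsub>dual_module M\<^esub> f = a \<odot>\<^bsub>dual_module M\<^esub> (b \<odot>\<^bsub>dual_module M\<^esub> f)"
    by (auto simp: p DD_simps dual_simps act_cong[OF cls_free_antipode_mult] act_mult)
next
  show "\<one>\<^bsub>DD\<^esub> \<odot>\<^bsub>dual_module M\<^esub> f = f" if f: "f \<in> carrier (dual_module M)" for f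
    using dual_closed(1)[OF f] by (auto simp: DD_simps dual_simps act_cong[OF cls_free_antipode_generators(1)])
qed (auto simp: dual_simps algebra_simps)

end

section \<open>The dual of an extension of \<open>L(\<epsilon>)\<close> by \<open>L(\<sigma>,-)\<close>\<close>

text \<open>
  Up to scaling on each summand, the form is determined by invariance under the double of the group
  algebra and by reversal of degrees: the dual of a vector of group degree \<open>h\<close> has degree \<open>h\<^sup>-\<^sup>1\<close>, so \<open>c\<^sub>4\<close> pairs with
  \<open>c\<^sub>5\<close> and \<open>c\<^sub>6\<close> with \<open>c\<^sub>7\<close>; low vectors pair with high ones, so \<open>c\<^sub>1\<close> pairs with \<open>c\<^sub>8\<close>.  The
  coefficients make \<open>x\<^sub>1\<^sub>2\<close> and \<open>y\<^sub>1\<^sub>2\<close> adjoint to their antipodes.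
\<close>

definition dual_pairing :: "'k::field_char_0 \<Rightarrow> 'k T_vec \<Rightarrow> 'k T_vec \<Rightarrow> 'k" where
  "dual_pairing \<zeta> v w =
     v (High t12) * w (Low t12) + v (High t13) * w (Low t13) + v (High t23) * w (Low t23)
     - (v (Low t12) * w (High t12) + v (Low t13) * w (High t13) + v (Low t23) * w (High t23))
     + (\<zeta> - 1) * (v (Tau1 c123) * w (Tau1 c132) + v (Tau1 c132) * w (Tau1 c123))
     - (2 + \<zeta>) * (v (Tau2 c123) * w (Tau2 c132) + v (Tau2 c132) * w (Tau2 c123))
     + v TT * w TT"

lemma dual_pairing_linear:
  "dual_pairing \<zeta> (\<lambda>c. u c + v c) w = dual_pairing \<zeta> u w + dual_pairing \<zeta> v w" "dual_pairing \<zeta> (\<lambda>c. k * v c) w = k * dual_pairing \<zeta> v w"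
  "dual_pairing \<zeta> v (\<lambda>c. u c + w c) = dual_pairing \<zeta> v u + dual_pairing \<zeta> v w" "dual_pairing \<zeta> v (\<lambda>c. k * w c) = k * dual_pairing \<zeta> v w"
  by (simp_all add: dual_pairing_def algebra_simps)

context primitive_cube_root
begin

lemma dual_pairing_grp: "dual_pairing \<zeta> (G_op \<zeta> g v) w = dual_pairing \<zeta> v (G_op \<zeta> (inverse g) w)"
  using S3_cases[of g]
  by (elim disjE) (simp_all add: dual_pairing_def zeta_power zeta_cofactor algebra_simps zeta_square zeta_square')

lemma dual_pairing_dlt: "dual_pairing \<zeta> (dlt_op h v) w = dual_pairing \<zeta> v (dlt_op (inverse h) w)"
  using S3_cases[of h] by (elim disjE) (simp_all add: dual_pairing_def)

text \<open>
  The antipode of \<open>x\<^sub>1\<^sub>2\<close> is \<open>- (12) x\<^sub>1\<^sub>2\<close>.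
\<close>

lemma dual_pairing_xx:
  "dual_pairing \<zeta> (X_op \<zeta> 0 0 (- b) a v) w = dual_pairing \<zeta> v (\<lambda>c. - 1 * G_op \<zeta> t12 (X_op \<zeta> a b 0 0 w) c)"
  by (simp add: dual_pairing_def field_simps zeta_square zeta_square')

text \<open>
  The operator of the antipode of \<open>y\<^sub>1\<^sub>2\<close> if \<open>F\<close> is the action of \<open>y\<^sub>1\<^sub>2\<close>: the sum over the group, in the order
  \<open>1, (12), (13), (23), (123), (132)\<close>.
\<close>

definition antipode_yy :: "('k T_vec \<Rightarrow> 'k T_vec) \<Rightarrow> 'k T_vec \<Rightarrow> 'k T_vec" where
  "antipode_yy F w = (\<lambda>c. - 1 * (dlt_op 1 (F w) c + (- 1 * dlt_op t12 (F w) c +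
     (- 1 * dlt_op t13 (conj_op \<zeta> F t23 w) c + (- 1 * dlt_op t23 (conj_op \<zeta> F t13 w) c +
     (dlt_op c132 (conj_op \<zeta> F t13 w) c + dlt_op c123 (conj_op \<zeta> F t23 w) c))))))"

lemma dual_pairing_yy:
  "dual_pairing \<zeta> (Y_op \<zeta> 0 0 (- a) g v) w = dual_pairing \<zeta> v (antipode_yy (Y_op \<zeta> g a 0 0) w)"
  by (simp add: dual_pairing_def antipode_yy_def field_simps zeta_square zeta_square')

lemma dual_pairing_nondegenerate:
  assumes v: "v \<in> vecs T_basis" "v' \<in> vecs T_basis" and eq: "\<And>b. b \<in> T_basis \<Longrightarrow> dual_pairing \<zeta> v (ket b) = dual_pairing \<zeta> v' (ket b)"
  shows "v = v'"
proof -
  have "\<zeta> - 1 \<noteq> 0" "2 + \<zeta> \<noteq> 0" using zeta_not by (simp_all add: add_eq_0_iff)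
  then show ?thesis
    using eq[of "Low t12"] eq[of "Low t13"] eq[of "Low t23"] eq[of "High t12"] eq[of "High t13"] eq[of "High t23"]
      eq[of "Tau1 c123"] eq[of "Tau1 c132"] eq[of "Tau2 c123"] eq[of "Tau2 c132"] eq[of TT]
    by (intro T_ext v) (simp_all add: dual_pairing_def ket_def)
qed

lemma dual_pairing_represents:
  "\<exists>v\<in>vecs T_basis. \<forall>b\<in>T_basis. dual_pairing \<zeta> v (ket b) = h b"
proof -
  have nz: "\<zeta> - 1 \<noteq> 0" "2 + \<zeta> \<noteq> 0" using zeta_not by (simp_all add: add_eq_0_iff)
  define v where "v = (\<lambda>c. if c \<in> T_basis then (case c of Low s \<Rightarrow> - h (High s) | High s \<Rightarrow> h (Low s)
      | Tau1 s \<Rightarrow> h (Tau1 (inverse s)) / (\<zeta> - 1) | Tau2 s \<Rightarrow> - h (Tau2 (inverse s)) / (2 + \<zeta>) | TT \<Rightarrow> h TT) else 0)"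
  have "v \<in> vecs T_basis" by (simp add: v_def vecs_def)
  moreover have "dual_pairing \<zeta> v (ket b) = h b" if "b \<in> T_basis" for b
    using that nz unfolding T_basis_eq by (elim insertE emptyE) (simp_all add: dual_pairing_def ket_def v_def)
  ultimately show ?thesis by blast
qed

end

lemma (in realized) act_antipode:
  assumes w: "w \<in> vecs T_basis"
  shows "act M (free_antipode (scal k)) (\<Phi> w) = \<Phi> (\<lambda>c. k * w c)"
    "act M (free_antipode (grp g)) (\<Phi> w) = \<Phi> (G_op \<zeta> (inverse g) w)"
    "act M (free_antipode (dlt h)) (\<Phi> w) = \<Phi> (dlt_op (inverse h) w)"
    "act M (free_antipode (xx t12)) (\<Phi> w) = \<Phi> (\<lambda>c. - 1 * G_op \<zeta> t12 (xo w) c)"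
    "act M (free_antipode (yy t12)) (\<Phi> w) = \<Phi> (antipode_yy yo w)"
proof -
  have neg: "act M (- p) u = act M (scal (- 1)) (act M p u)" if "u \<in> carrier M" for p u
    using that by (simp add: scal_hom flip: act_mult)
  note s = act_cong[OF cls_free_antipode_generators(2)] act_cong[OF cls_free_antipode_generators(3)]
    act_cong[OF cls_free_antipode_generators(4)] act_cong[OF cls_free_antipode_generators(5)]
    act_cong[OF cls_free_antipode_generators(6)]
  show "act M (free_antipode (scal k)) (\<Phi> w) = \<Phi> (\<lambda>c. k * w c)"
    "act M (free_antipode (grp g)) (\<Phi> w) = \<Phi> (G_op \<zeta> (inverse g) w)"
    "act M (free_antipode (dlt h)) (\<Phi> w) = \<Phi> (dlt_op (inverse h) w)"
    using w by (simp_all add: s Phi_act)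
  show "act M (free_antipode (xx t12)) (\<Phi> w) = \<Phi> (\<lambda>c. - 1 * G_op \<zeta> t12 (xo w) c)"
    using w by (simp only: s neg Phi_carrier act_mult Phi_act op_vecs' G_op_vecs S3_inverse)
  note conj = Phi_conj(2)[OF w, of t13, simplified] Phi_conj(2)[OF w, of t23, simplified]
  show "act M (free_antipode (yy t12)) (\<Phi> w) = \<Phi> (antipode_yy yo w)"
    using w unfolding antipode_yy_def
    by (simp only: s neg S3_sum S3_inverse conj3_simps sgn3_simps act_mult act_add conj Phi_act Phi_add op_vecs op_vecs'
      Phi_carrier act_closed vecs_closed(3) vecs_closed scal_hom(2) act_one S3_inverse_one mult_1_left conj_op_vecs)
qed

text \<open>
  The nondegenerate form identifies the eleven-dimensional space with the functionals on \<open>M\<close>;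
  adjointness turns the action through the antipode into the stated operators.
\<close>

lemma dual_realizes_row:
  fixes \<zeta> :: "'k::field_char_0"
  assumes M: "realizes_col \<zeta> M \<alpha> \<beta> \<gamma>" and \<zeta>: "\<zeta> ^ 3 = 1" "\<zeta> \<noteq> 1"
  shows "realizes_row \<zeta> (dual_module M) \<alpha> \<beta> \<gamma>"
proof -
  obtain \<Phi> where \<Phi>: "realizes \<zeta> M (X_op \<zeta> \<alpha> \<beta> 0 0) (Y_op \<zeta> \<gamma> \<alpha> 0 0) \<Phi>"
    using M unfolding realizes_col_def by blast
  interpret realized M \<zeta> "X_op \<zeta> \<alpha> \<beta> 0 0" "Y_op \<zeta> \<gamma> \<alpha> 0 0" \<Phi>
    by (rule realizedI[OF \<Phi> \<zeta>]) simp_all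
  interpret dual: D_module "dual_module M" by (rule D_moduleI[OF left_module_dual])
  define \<Psi> where "\<Psi> v = (\<lambda>w. if w \<in> carrier M then dual_pairing \<zeta> v (coords w) else 0)" for v
  have \<Psi>: "\<Psi> v (\<Phi> w) = dual_pairing \<zeta> v w" if "w \<in> vecs T_basis" for v w
    using that by (simp add: \<Psi>_def coords)
  have ext: "f = f'" if "\<And>w. w \<notin> carrier M \<Longrightarrow> f w = f' w" "\<And>w. w \<in> vecs T_basis \<Longrightarrow> f (\<Phi> w) = f' (\<Phi> w)" for f f' :: "_ \<Rightarrow> 'k"
  proof
    show "f w = f' w" for w using that Phi_surj[of w] by (cases "w \<in> carrier M") auto
  qed
  have out: "w \<notin> carrier M \<Longrightarrow> \<Psi> v w = 0" for v w by (simp add: \<Psi>_def)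
  have carr: "\<Psi> v \<in> carrier (dual_module M)" for v
  proof -
    have "\<Psi> v (u \<oplus>\<^bsub>M\<^esub> w) = \<Psi> v u + \<Psi> v w" if "u \<in> carrier M" "w \<in> carrier M" for u w
      using that by (auto dest!: Phi_surj simp: Phi_add \<Psi> vecs_closed dual_pairing_linear)
    moreover have "\<Psi> v (act M (scal c) w) = c * \<Psi> v w" if "w \<in> carrier M" for c w
      using that by (auto dest!: Phi_surj simp: Phi_act \<Psi> vecs_closed(3) dual_pairing_linear)
    ultimately show ?thesis by (simp add: dual_simps out)
  qed
  have dact: "act (dual_module M) p (\<Psi> v) (\<Phi> w) = \<Psi> v (act M (free_antipode p) (\<Phi> w))" if "w \<in> vecs T_basis" for p v w
    using that by (simp add: act_def[of "dual_module M"] dual_simps)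
  have dout: "act (dual_module M) p (\<Psi> v) w = 0" if "w \<notin> carrier M" for p v w
    using that by (simp add: act_def[of "dual_module M"] dual_simps)
  have inj: "inj_on \<Psi> (vecs T_basis)"
  proof (rule inj_onI, rule dual_pairing_nondegenerate)
    fix u v :: "'k T_vec" and b assume "\<Psi> u = \<Psi> v" "b \<in> T_basis"
    then show "dual_pairing \<zeta> u (ket b) = dual_pairing \<zeta> v (ket b)" using \<Psi>[of "ket b"] by (metis ket_vecs)
  qed
  have "f \<in> \<Psi> ` vecs T_basis" if f: "f \<in> carrier (dual_module M)" for f
  proof -
    obtain v where v: "v \<in> vecs T_basis" "\<And>b. b \<in> T_basis \<Longrightarrow> dual_pairing \<zeta> v (ket b) = f (\<Phi> (ket b))"
      using dual_pairing_represents[of "\<lambda>b. f (\<Phi> (ket b))"] by blast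
    have "w \<in> {w \<in> vecs T_basis. f (\<Phi> w) = dual_pairing \<zeta> v w}" if w: "w \<in> vecs T_basis" for w
    proof (rule vecs_span[OF w finite_T_basis])
      have "f (act M (scal 0) (\<Phi> (\<lambda>b. 0))) = 0" by (subst dual_closed(3)[OF f]) (simp_all add: vecs_def)
      moreover have "dual_pairing \<zeta> v (\<lambda>b. 0) = 0" by (simp add: dual_pairing_def)
      ultimately show "(\<lambda>b. 0) \<in> {w \<in> vecs T_basis. f (\<Phi> w) = dual_pairing \<zeta> v w}" by (simp add: Phi_act)
    next
      fix u w assume "u \<in> {w \<in> vecs T_basis. f (\<Phi> w) = dual_pairing \<zeta> v w}" "w \<in> {w \<in> vecs T_basis. f (\<Phi> w) = dual_pairing \<zeta> v w}"
      then show "(\<lambda>b. u b + w b) \<in> {w \<in> vecs T_basis. f (\<Phi> w) = dual_pairing \<zeta> v w}"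
        using dual_closed(2)[OF f, of "\<Phi> u" "\<Phi> w"] by (simp add: vecs_closed dual_pairing_linear Phi_add)
    next
      fix k w assume "w \<in> {w \<in> vecs T_basis. f (\<Phi> w) = dual_pairing \<zeta> v w}"
      then show "(\<lambda>b. k * w b) \<in> {w \<in> vecs T_basis. f (\<Phi> w) = dual_pairing \<zeta> v w}"
        using dual_closed(3)[OF f, of "\<Phi> w" k] by (simp add: vecs_closed(3) dual_pairing_linear Phi_act)
    qed (simp add: v ket_vecs)
    then have "f = \<Psi> v" by (intro ext) (simp_all add: out dual_closed[OF f] \<Psi>)
    with v show ?thesis by blast
  qed
  with inj carr have bij: "bij_betw \<Psi> (vecs T_basis) (carrier (dual_module M))"
    by (auto simp: bij_betw_def)
  have add: "\<Psi> (\<lambda>c. u c + v c) = \<Psi> u \<oplus>\<^bsub>dual_module M\<^esub> \<Psi> v" for u v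
    by (rule ext) (simp_all add: out \<Psi> dual_simps dual_pairing_linear)
  have "realizes \<zeta> (dual_module M) (X_op \<zeta> 0 0 (- \<beta>) \<alpha>) (Y_op \<zeta> 0 0 (- \<alpha>) \<gamma>) \<Psi>"
    unfolding realizes_def
    by (intro conjI allI ballI left_module_dual bij add; rule ext)
      (simp_all add: out dout dact \<Psi> act_antipode dual_pairing_linear dual_pairing_grp dual_pairing_dlt dual_pairing_xx dual_pairing_yy antipode_yy_def vecs_closed(3) vecs_closed)
  then show ?thesis unfolding realizes_row_def by blast
qed

section \<open>The classification\<close>

context primitive_cube_root
begin

text \<open>
  The nonzero constants \<open>m\<close> and \<open>w\<close> are the parameters of the Verma and the co-Verma extension; rescaling \<open>t\<close>
  moves a single nonzero parameter to any prescribed nonzero value.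
\<close>

lemma col_single:
  assumes "m \<noteq> 0" "w \<noteq> 0"
  shows "(\<exists>\<alpha> \<beta> \<gamma>. realizes_col \<zeta> E \<alpha> \<beta> \<gamma> \<and> (\<alpha> = 0 \<or> \<beta> = 0) \<and> (\<alpha> = 0 \<or> \<gamma> = 0) \<and> (\<beta> = 0 \<or> \<gamma> = 0)) \<longleftrightarrow>
    realizes_col \<zeta> E 0 m 0 \<or> realizes_col \<zeta> E 0 0 w \<or> realizes_col \<zeta> E 1 0 0 \<or> realizes_col \<zeta> E 0 0 0"
    (is "?l \<longleftrightarrow> ?r")
proof
  assume ?l
  then obtain \<alpha> \<beta> \<gamma> where r: "realizes_col \<zeta> E \<alpha> \<beta> \<gamma>"
    and one: "\<alpha> = 0 \<or> \<beta> = 0" "\<alpha> = 0 \<or> \<gamma> = 0" "\<beta> = 0 \<or> \<gamma> = 0" by blast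
  consider "\<alpha> \<noteq> 0" "\<beta> = 0" "\<gamma> = 0" | "\<alpha> = 0" "\<beta> \<noteq> 0" "\<gamma> = 0" | "\<alpha> = 0" "\<beta> = 0" "\<gamma> \<noteq> 0" | "\<alpha> = 0" "\<beta> = 0" "\<gamma> = 0"
    using one by blast
  then show ?r
    by cases (use r assms realizes_col_scale[OF r, of "1 / \<alpha>"] realizes_col_scale[OF r, of "m / \<beta>"]
      realizes_col_scale[OF r, of "w / \<gamma>"] in \<open>simp_all\<close>)
qed (metis (no_types))

lemma row_single:
  assumes "m \<noteq> 0" "w \<noteq> 0"
  shows "(\<exists>\<alpha> \<beta> \<gamma>. realizes_row \<zeta> E \<alpha> \<beta> \<gamma> \<and> (\<alpha> = 0 \<or> \<beta> = 0) \<and> (\<alpha> = 0 \<or> \<gamma> = 0) \<and> (\<beta> = 0 \<or> \<gamma> = 0)) \<longleftrightarrow>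
    realizes_row \<zeta> E 0 m 0 \<or> realizes_row \<zeta> E 0 0 w \<or> realizes_row \<zeta> E 1 0 0 \<or> realizes_row \<zeta> E 0 0 0"
    (is "?l \<longleftrightarrow> ?r")
proof
  assume ?l
  then obtain \<alpha> \<beta> \<gamma> where r: "realizes_row \<zeta> E \<alpha> \<beta> \<gamma>"
    and one: "\<alpha> = 0 \<or> \<beta> = 0" "\<alpha> = 0 \<or> \<gamma> = 0" "\<beta> = 0 \<or> \<gamma> = 0" by blast
  consider "\<alpha> \<noteq> 0" "\<beta> = 0" "\<gamma> = 0" | "\<alpha> = 0" "\<beta> \<noteq> 0" "\<gamma> = 0" | "\<alpha> = 0" "\<beta> = 0" "\<gamma> \<noteq> 0" | "\<alpha> = 0" "\<beta> = 0" "\<gamma> = 0"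
    using one by blast
  then show ?r
    by cases (use r assms realizes_row_scale[OF r, of "1 / \<alpha>"] realizes_row_scale[OF r, of "m / \<beta>"]
      realizes_row_scale[OF r, of "w / \<gamma>"] in \<open>simp_all\<close>)
qed (metis (no_types))

end

context extension_T
begin

lemma lin_comb_ext_col:
  assumes M: "short_exact DD L_sigma (iM, EM, pM) L_eps" "has_params iM EM pM 0 m 0 0"
    and W: "short_exact DD L_sigma (iW, EW, pW) L_eps" "has_params iW EW pW 0 0 w 0"
  shows "realizes_col \<zeta> (middle (lin_comb_ext (iM, EM, pM) (iW, EW, pW) (iT, T01 \<zeta>, pT) s t u)) u (s * m) (t * w)"
proof -
  obtain i1 E1 p1 where 1: "scale_ext L_sigma (cls (scal s)) (iM, EM, pM) = (i1, E1, p1)"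
    "short_exact DD L_sigma (i1, E1, p1) L_eps" "has_params i1 E1 p1 (s * 0) (s * m) (s * 0) (s * 0)"
    by (rule scale_ext_params[OF M])
  obtain i2 E2 p2 where 2: "scale_ext L_sigma (cls (scal t)) (iW, EW, pW) = (i2, E2, p2)"
    "short_exact DD L_sigma (i2, E2, p2) L_eps" "has_params i2 E2 p2 (t * 0) (t * 0) (t * w) (t * 0)"
    by (rule scale_ext_params[OF W])
  obtain i3 E3 p3 where 3: "scale_ext L_sigma (cls (scal u)) (iT, T01 \<zeta>, pT) = (i3, E3, p3)"
    "short_exact DD L_sigma (i3, E3, p3) L_eps" "has_params i3 E3 p3 (u * 1) (u * 0) (u * 0) (u * 1)"
    by (rule scale_ext_params[OF T_exact T01_params])
  obtain i4 E4 p4 where 4: "baer_sum L_sigma (i1, E1, p1) (i2, E2, p2) = (i4, E4, p4)"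
    "short_exact DD L_sigma (i4, E4, p4) L_eps"
    "has_params i4 E4 p4 (s * 0 + t * 0) (s * m + t * 0) (s * 0 + t * w) (s * 0 + t * 0)"
    by (rule baer_sum_params[OF 1(2,3) 2(2,3)])
  obtain i5 E5 p5 where 5: "baer_sum L_sigma (i4, E4, p4) (i3, E3, p3) = (i5, E5, p5)"
    "short_exact DD L_sigma (i5, E5, p5) L_eps"
    "has_params i5 E5 p5 (s * 0 + t * 0 + u * 1) (s * m + t * 0 + u * 0) (s * 0 + t * w + u * 0) (s * 0 + t * 0 + u * 1)"
    by (rule baer_sum_params[OF 4(2,3) 3(2,3)])
  have "middle (lin_comb_ext (iM, EM, pM) (iW, EW, pW) (iT, T01 \<zeta>, pT) s t u) = E5"
    by (simp add: lin_comb_ext_def 1(1) 2(1) 3(1) 4(1) 5(1) middle_def)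
  then show ?thesis using has_params_col(1)[OF 5(2,3)] by simp
qed

text \<open>
  The extensions by \<open>T\<^sub>0\<^sub>,\<^sub>1\<close>, \<open>M(\<epsilon>)\<close> and \<open>W(\<epsilon>)\<close> have the parameters \<open>(1, 0, 0)\<close>, \<open>(0, m, 0)\<close> and \<open>(0, 0, w)\<close> with
  \<open>m\<close> and \<open>w\<close> nonzero.  A combination with coefficients \<open>s\<close>, \<open>t\<close>, \<open>u\<close> therefore has the
  parameters \<open>(u, s m, t w)\<close>, and everything follows by comparing parameters.
\<close>

theorem classification:
  fixes E :: "('k free set, 'e) module"
  assumes M: "short_exact DD L_sigma (iM, quot_module M_eps (socle DD M_eps), pM) L_eps"
    and W: "short_exact DD L_sigma (iW, quot_module W_eps (socle DD W_eps), pW) L_eps"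
  defines "\<xi>M \<equiv> (iM, quot_module M_eps (socle DD M_eps), pM)" and "\<xi>W \<equiv> (iW, quot_module W_eps (socle DD W_eps), pW)"
    and "\<xi>T \<equiv> (iT, T01 \<zeta>, pT)"
  shows "short_exact DD L_sigma (i, E, p) L_eps \<Longrightarrow> \<exists>s t u. iso_E \<xi>M \<xi>W \<xi>T s t u E"
    "short_exact DD L_sigma (i, E, p) L_eps \<Longrightarrow> graded_extension L_sigma L_sigma_deg E L_eps (L_eps_deg :: int \<Rightarrow> (S3 \<Rightarrow> 'k free set) set set set) \<longleftrightarrow>
       iso_E \<xi>M \<xi>W \<xi>T 1 0 0 E \<or> iso_E \<xi>M \<xi>W \<xi>T 0 1 0 E \<or> iso_E \<xi>M \<xi>W \<xi>T 0 0 1 E \<or> iso_E \<xi>M \<xi>W \<xi>T 0 0 0 E"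
    "short_exact DD L_eps (j, E, q) L_sigma \<Longrightarrow> \<exists>s t u. iso_E_dual \<xi>M \<xi>W \<xi>T s t u E"
    "short_exact DD L_eps (j, E, q) L_sigma \<Longrightarrow> graded_extension L_eps (L_eps_deg :: int \<Rightarrow> (S3 \<Rightarrow> 'k free set) set set set) E L_sigma L_sigma_deg \<longleftrightarrow>
       iso_E_dual \<xi>M \<xi>W \<xi>T 1 0 0 E \<or> iso_E_dual \<xi>M \<xi>W \<xi>T 0 1 0 E \<or> iso_E_dual \<xi>M \<xi>W \<xi>T 0 0 1 E \<or> iso_E \<xi>M \<xi>W \<xi>T 0 0 0 E"
proof -
  obtain m where m: "m \<noteq> 0" "has_params iM (quot_module M_eps (socle DD M_eps)) pM 0 m 0 0" using verma_params[OF M] by blast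
  obtain w where w: "w \<noteq> 0" "has_params iW (quot_module W_eps (socle DD W_eps)) pW 0 0 w 0" using coverma_params[OF W] by blast
  note col = lin_comb_ext_col[OF M m(2) W w(2), folded \<xi>M_def \<xi>W_def \<xi>T_def]
  have iso: "iso_E \<xi>M \<xi>W \<xi>T s t u E \<longleftrightarrow> realizes_col \<zeta> E u (s * m) (t * w)" if "left_module DD E" for s t u
    unfolding iso_E_def using realizes_col_mod_iso[OF direct_sum_col that] realizes_col_mod_iso[OF col that] by simp
  have dual: "iso_E_dual \<xi>M \<xi>W \<xi>T s t u E \<longleftrightarrow> realizes_row \<zeta> E u (s * m) (t * w)" if "left_module DD E" for s t u
    unfolding iso_E_dual_def
    using realizes_row_mod_iso[OF dual_realizes_row[OF direct_sum_col cube nontrivial] that]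
      realizes_row_mod_iso[OF dual_realizes_row[OF col cube nontrivial] that] by simp
  {
    assume se: "short_exact DD L_sigma (i, E, p) L_eps"
    have E: "left_module DD E" by (rule short_exactD[OF se])
    interpret eps_by_sigma \<zeta> iT pT i E p by (rule eps_by_sigmaI[OF se])
    obtain a b c d where inv: "has_params i E p a b c d" using has_params_exists by blast
    note ad = has_params_col[OF se inv]
    show "\<exists>s t u. iso_E \<xi>M \<xi>W \<xi>T s t u E"
      using ad(1) m(1) w(1) by (intro exI[of _ "b / m"] exI[of _ "c / w"] exI[of _ a]) (simp add: iso[OF E])
    have "graded_extension L_sigma L_sigma_deg E L_eps (L_eps_deg :: int \<Rightarrow> (S3 \<Rightarrow> 'k free set) set set set) \<longleftrightarrow>
      (\<exists>\<alpha> \<beta> \<gamma>. realizes_col \<zeta> E \<alpha> \<beta> \<gamma> \<and> (\<alpha> = 0 \<or> \<beta> = 0) \<and> (\<alpha> = 0 \<or> \<gamma> = 0) \<and> (\<beta> = 0 \<or> \<gamma> = 0))" (is "?g \<longleftrightarrow> ?r")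
    proof
      assume ?r
      then have "(a = 0 \<or> b = 0) \<and> (a = 0 \<or> c = 0) \<and> (b = 0 \<or> c = 0)"
        using realizes_col_pattern ad(1) by metis
      then show ?g using graded_col_sufficient[OF se] inv ad(2) by blast
    qed (rule graded_col_necessary)
    then show "graded_extension L_sigma L_sigma_deg E L_eps (L_eps_deg :: int \<Rightarrow> (S3 \<Rightarrow> 'k free set) set set set) \<longleftrightarrow>
       iso_E \<xi>M \<xi>W \<xi>T 1 0 0 E \<or> iso_E \<xi>M \<xi>W \<xi>T 0 1 0 E \<or> iso_E \<xi>M \<xi>W \<xi>T 0 0 1 E \<or> iso_E \<xi>M \<xi>W \<xi>T 0 0 0 E"
      by (simp add: iso[OF E] col_single[OF m(1) w(1)])
  }
  {
    assume se: "short_exact DD L_eps (j, E, q) L_sigma"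
    have E: "left_module DD E" by (rule short_exactD[OF se])
    interpret sigma_by_eps \<zeta> iT pT j E q by (rule sigma_by_epsI[OF se])
    obtain \<Phi> a b c where r: "realizes \<zeta> E (X_op \<zeta> 0 0 (- b) a) (Y_op \<zeta> 0 0 (- a) c) \<Phi>"
      "\<forall>k. \<Phi> (\<lambda>e. k * ket TT e) = j (act L_eps (scal k) e0)" "\<forall>v\<in>vecs T_basis. q (\<Phi> v) = jT (drop_TT v)"
      using row_exists[OF se] by blast
    have row: "realizes_row \<zeta> E a b c" using r(1) unfolding realizes_row_def by blast
    show "\<exists>s t u. iso_E_dual \<xi>M \<xi>W \<xi>T s t u E"
      using row m(1) w(1) by (intro exI[of _ "b / m"] exI[of _ "c / w"] exI[of _ a]) (simp add: dual[OF E])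
    have "graded_extension L_eps (L_eps_deg :: int \<Rightarrow> (S3 \<Rightarrow> 'k free set) set set set) E L_sigma L_sigma_deg \<longleftrightarrow>
      (\<exists>\<alpha> \<beta> \<gamma>. realizes_row \<zeta> E \<alpha> \<beta> \<gamma> \<and> (\<alpha> = 0 \<or> \<beta> = 0) \<and> (\<alpha> = 0 \<or> \<gamma> = 0) \<and> (\<beta> = 0 \<or> \<gamma> = 0))" (is "?g \<longleftrightarrow> ?r")
    proof
      assume ?r
      then have "(a = 0 \<or> b = 0) \<and> (a = 0 \<or> c = 0) \<and> (b = 0 \<or> c = 0)"
        using realizes_row_pattern row by metis
      then show ?g by (rule graded_row_sufficient[OF se r])
    qed (rule graded_row_necessary)
    then show "graded_extension L_eps (L_eps_deg :: int \<Rightarrow> (S3 \<Rightarrow> 'k free set) set set set) E L_sigma L_sigma_deg \<longleftrightarrow>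
       iso_E_dual \<xi>M \<xi>W \<xi>T 1 0 0 E \<or> iso_E_dual \<xi>M \<xi>W \<xi>T 0 1 0 E \<or> iso_E_dual \<xi>M \<xi>W \<xi>T 0 0 1 E \<or> iso_E \<xi>M \<xi>W \<xi>T 0 0 0 E"
      by (simp add: iso[OF E] dual[OF E] row_single[OF m(1) w(1)] realizes_row_col_zero)
  }
qed

end

theorem lemma3p6:
  fixes \<zeta> :: "'k::{alg_closed_field, field_char_0}"
    and E :: "('k free set, 'e) module"
  assumes zeta: "\<zeta> ^ 3 = 1" "\<zeta> \<noteq> 1"
    and \<xi>M: "\<xi>M = (iM, quot_module M_eps (socle DD M_eps), pM)"
            "short_exact DD L_sigma \<xi>M L_eps"
    and \<xi>W: "\<xi>W = (iW, quot_module W_eps (socle DD W_eps), pW)"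
            "short_exact DD L_sigma \<xi>W L_eps"
    and \<xi>T: "\<xi>T = (iT, T01 \<zeta>, pT)"
            "short_exact DD L_sigma \<xi>T L_eps"
  shows
    "((\<exists>i p. short_exact DD L_sigma (i, E, p) L_eps) \<longrightarrow>
        (\<exists>s t u. iso_E \<xi>M \<xi>W \<xi>T s t u E) \<and>
        (graded_extension L_sigma L_sigma_deg E L_eps L_eps_deg \<longleftrightarrow>
           iso_E \<xi>M \<xi>W \<xi>T 1 0 0 E \<or> iso_E \<xi>M \<xi>W \<xi>T 0 1 0 E \<or>
           iso_E \<xi>M \<xi>W \<xi>T 0 0 1 E \<or> iso_E \<xi>M \<xi>W \<xi>T 0 0 0 E))
     \<and>
     ((\<exists>i p. short_exact DD L_eps (i, E, p) L_sigma) \<longrightarrow>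
        (\<exists>s t u. iso_E_dual \<xi>M \<xi>W \<xi>T s t u E) \<and>
        (graded_extension L_eps L_eps_deg E L_sigma L_sigma_deg \<longleftrightarrow>
           iso_E_dual \<xi>M \<xi>W \<xi>T 1 0 0 E \<or> iso_E_dual \<xi>M \<xi>W \<xi>T 0 1 0 E \<or>
           iso_E_dual \<xi>M \<xi>W \<xi>T 0 0 1 E \<or> iso_E \<xi>M \<xi>W \<xi>T 0 0 0 E))"
proof -
  interpret extension_T \<zeta> iT pT
    using zeta \<xi>T by (simp add: extension_T_def primitive_cube_root_def extension_T_axioms_def)
  note c = classification[OF \<xi>M(2)[unfolded \<xi>M(1)] \<xi>W(2)[unfolded \<xi>W(1)], folded \<xi>M(1) \<xi>W(1) \<xi>T(1)]
  show ?thesis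
    by (intro conjI impI; elim exE; rule c; assumption)
qed

end
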